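(* Let $R$ be a commutative local ring in which $2$ is invertible, let $I$ be an ideal of $R$, let $R[X]$ be the polynomial ring in one variable over $R$ and $I[X]=I\cdot R[X]$ the extended ideal, and let $r\ge 2$. Then the group $SUm_r(R[X],I[X])/EUm_r(R[X],I[X])$ is abelian.
   Context: Let $B$ be a commutative ring with $1$ in which $2$ is invertible. For row vectors $v=(a_0,a_1,\dots,a_r)=(a_0,v_1)$ and $w=(b_0,b_1,\dots,b_r)=(b_0,w_1)$ in $B^{r+1}$, where $v_1=(a_1,\dots,a_r)$ and $w_1=(b_1,\dots,b_r)$, the Suslin matrix $S_r(v,w)\in M_{2^r}(B)$ is defined inductively by $S_0(v,w)=a_0$ and $$S_r(v,w)=\begin{pmatrix} a_0 I_{2^{r-1}} & S_{r-1}(v_1,w_1)\\ -S_{r-1}(w_1,v_1)^T & b_0 I_{2^{r-1}}\end{pmatrix}.$$ Put $\langle v,w\rangle=v\cdot w^T$. If $\langle v,w\rangle=1$ then $S_r(v,w)$ is invertible. $SUm_r(B)$ is the subgroup of $GL_{2^r}(B)$ generated by all $S_r(v,w)$ with $v,w\in B^{r+1}$, $\langle v,w\rangle=1$. $EUm_r(B)$ is the subgroup generated by those $S_r(v,w)$ with $\langle v,w\rangle=1$ and $v=e_1\varepsilon$ for some $\varepsilon\in E_{r+1}(B)$, where $e_1,\dots,e_{r+1}$ is the standard basis of $B^{r+1}$ and $E_{r+1}(B)$ is the group generated by elementary matrices. For $2\le i\le r+1$ and $x\in B$ put $E(e_i)(x)=S_r(e_1+xe_i,e_1)$ and $E(e_i^*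 )(x)=S_r(e_1,e_1+xe_i)$. For a square matrix $\alpha$, $\alpha^{top}$ (resp. $\alpha^{bot}$) is the matrix with the same entries as $\alpha$ on and above (resp. on and below) the diagonal and zeros elsewhere. For $r\ge 2$ it is known that the matrices $E(c)(x)^{top}$, $E(c)(x)^{bot}$ ($c=e_i$ or $e_i^*$, $2\le i\le r+1$, $x\in B$) lie in $EUm_r(B)$ and generate it; they are called the elementary generators. Relative groups: for an ideal $J$ of $B$, $SUm_r(B,J)$ is the subgroup of $SUm_r(B)$ of matrices congruent to the identity modulo $J$, and $EUm_r(B,J)$ is the normal closure in $EUm_r(B)$ of the set of elementary generators $E(c)(x)^{top}$, $E(c)(x)^{bot}$ with $x\in J$, i.e. the subgroup generated by all $\gamma g\gamma^{-1}$ with $\gamma\in EUm_r(B)$ and $g$ such a generator. $EUm_r(R[X],I[X])$ is understood to be normal in $SUm_r(R[X],I[X])$, so that the quotient is a group. *)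

theory Defs
  imports "HOL-Computational_Algebra.Polynomial" "HOL-Algebra.Ideal" "HOL-Algebra.Generated_Groups"
    "HOL-Algebra.Coset" "Jordan_Normal_Form.VS_Connect"
begin

text \<open>
  Commutative rings are types of class \<open>comm_ring_1\<close>; ideals are those of \<open>HOL-Algebra\<close>, taken in
  \<open>class_ring\<close>, the ring record whose carrier is the whole type. All indices start at 0, so the
  basis vector \<open>e_i\<close> of the mathematical text is \<open>unit_vec (r + 1) (i - 1)\<close>.
\<close>

definition local_ring :: "'a::comm_ring_1 itself \<Rightarrow> bool" where
  "local_ring _ \<longleftrightarrow> (\<exists>!M. maximalideal M (class_ring :: 'a ring))"

definition extended_ideal :: "'a::comm_ring_1 set \<Rightarrow> 'a poly set" where
  "extended_ideal I = Idl\<^bsub>class_ring\<^esub> ((\<lambda>a. [:a:]) ` I)"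

definition GL :: "nat \<Rightarrow> 'b::comm_ring_1 mat monoid" where
  "GL n = units_of (ring_mat TYPE('b) n ())"

definition elementary_group :: "nat \<Rightarrow> 'b::comm_ring_1 mat set" where
  "elementary_group n = generate (GL n) {addrow_mat n x i j | x i j. i < n \<and> j < n \<and> i \<noteq> j}"

text \<open>\<open>suslin r v w\<close> is meant for \<open>v\<close> and \<open>w\<close> of dimension \<open>r + 1\<close>;
  \<open>vec_last v r\<close> is then \<open>v\<close> without its first entry.\<close>

fun suslin :: "nat \<Rightarrow> 'b::comm_ring_1 vec \<Rightarrow> 'b vec \<Rightarrow> 'b mat" where
  "suslin 0 v w = mat 1 1 (\<lambda>_. v $ 0)"
| "suslin (Suc r) v w =
     (let v1 = vec_last v (Suc r); w1 = vec_last w (Suc r) in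
      four_block_mat
        (v $ 0 \<cdot>\<^sub>m 1\<^sub>m (2 ^ r))             (suslin r v1 w1)
        (- transpose_mat (suslin r w1 v1)) (w $ 0 \<cdot>\<^sub>m 1\<^sub>m (2 ^ r)))"

definition SUm :: "nat \<Rightarrow> 'b::comm_ring_1 mat set" where
  "SUm r = generate (GL (2 ^ r))
     {suslin r v w | v w. v \<in> carrier_vec (r + 1) \<and> w \<in> carrier_vec (r + 1) \<and> v \<bullet> w = 1}"

text \<open>Vectors are row vectors in the mathematical text, whence the transpose:
  \<open>transpose_mat \<epsilon> *\<^sub>v unit_vec (r + 1) 0\<close> is \<open>e_1 \<epsilon>\<close>.\<close>

definition EUm :: "nat \<Rightarrow> 'b::comm_ring_1 mat set" where
  "EUm r = generate (GL (2 ^ r))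
     {suslin r v w | v w. v \<in> carrier_vec (r + 1) \<and> w \<in> carrier_vec (r + 1) \<and> v \<bullet> w = 1 \<and>
        (\<exists>\<epsilon> \<in> elementary_group (r + 1). v = transpose_mat \<epsilon> *\<^sub>v unit_vec (r + 1) 0)}"

definition E_vec :: "nat \<Rightarrow> nat \<Rightarrow> 'b::comm_ring_1 \<Rightarrow> 'b mat" where
  "E_vec r i x =
     suslin r (unit_vec (r + 1) 0 + x \<cdot>\<^sub>v unit_vec (r + 1) i) (unit_vec (r + 1) 0)"

definition E_dual :: "nat \<Rightarrow> nat \<Rightarrow> 'b::comm_ring_1 \<Rightarrow> 'b mat" where
  "E_dual r i x =
     suslin r (unit_vec (r + 1) 0) (unit_vec (r + 1) 0 + x \<cdot>\<^sub>v unit_vec (r + 1) i)"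

definition mat_top :: "'b::zero mat \<Rightarrow> 'b mat" where
  "mat_top A = mat (dim_row A) (dim_col A) (\<lambda>(i, j). if i \<le> j then A $$ (i, j) else 0)"

definition mat_bot :: "'b::zero mat \<Rightarrow> 'b mat" where
  "mat_bot A = mat (dim_row A) (dim_col A) (\<lambda>(i, j). if j \<le> i then A $$ (i, j) else 0)"

definition elementary_generators :: "nat \<Rightarrow> 'b::comm_ring_1 set \<Rightarrow> 'b mat set" where
  "elementary_generators r J =
     (\<Union>i \<in> {1..r}. \<Union>x \<in> J.
        {mat_top (E_vec r i x), mat_bot (E_vec r i x),
         mat_top (E_dual r i x), mat_bot (E_dual r i x)})"

definition SUm_rel :: "nat \<Rightarrow> 'b::comm_ring_1 set \<Rightarrow> 'b mat set" where
  "SUm_rel r J =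
     {A \<in> SUm r. \<forall>i < 2 ^ r. \<forall>j < 2 ^ r. A $$ (i, j) - 1\<^sub>m (2 ^ r) $$ (i, j) \<in> J}"

definition EUm_rel :: "nat \<Rightarrow> 'b::comm_ring_1 set \<Rightarrow> 'b mat set" where
  "EUm_rel r J = generate (GL (2 ^ r))
     {\<gamma> * g * inv\<^bsub>GL (2 ^ r)\<^esub> \<gamma> | \<gamma> g. \<gamma> \<in> EUm r \<and> g \<in> elementary_generators r J}"

end

theory Submission
  imports Defs "HOL-Library.Function_Algebras"
begin

text \<open>
  The Suslin matrix of \<open>u = (v, w)\<close> is the off-diagonal half of a vector \<open>Cl r v w\<close> of the Clifford algebra
  of the hyperbolic quadratic form \<open>\<langle>v, w\<rangle>\<close> on \<open>B\<^sup>2\<^sup>r\<^sup>+\<^sup>2\<close>: \<open>S(u)\<close> is the first half-spin component of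
  \<open>u h\<^sub>0\<close> with \<open>h\<^sub>0 = e\<^sub>0 + f\<^sub>0\<close>. Since \<open>2\<close> is invertible, \<open>EUm\<close> and its relative version consist of the
  components of products of root elements \<open>1 + x z\<^sub>k z\<^sub>l\<close>, where \<open>z\<^sub>k, z\<^sub>l\<close> are orthogonal isotropic basis vectors,
  and of the normal closure of the root elements with parameter in the ideal.

  Let \<open>\<alpha>, \<beta>\<close> lift two elements of \<open>SUm(R[X], I[X])\<close>. Modulo \<open>I[X]\<close> they act on vectors by a scalar \<open>c\<close> with
  \<open>c\<^sup>2 = 1\<close>, which is constant in \<open>X\<close> because \<open>2\<close> is invertible; hence \<open>\<alpha>(tX)\<^sup>-\<^sup>1 \<alpha>((t + y)X)\<close> acts trivially modulo
  \<open>I[X]\<close>. If a vector \<open>u\<close> with \<open>\<langle>u, u\<rangle> = 1\<close> has an entry \<open>s\<close>, then \<open>u h\<^sub>0\<close> is elementary after inverting \<open>s\<close>, and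
  a dilation argument as in Quillen's local-global principle shows that \<open>\<alpha>(tX)\<^sup>-\<^sup>1 \<alpha>((t + y)X)\<close> commutes with
  \<open>u h\<^sub>0\<close> modulo the relative elementary group whenever \<open>y\<close> is a multiple of a high power of \<open>s\<close>. The parameters \<open>y\<close> that work
  for all \<open>t\<close> form an ideal, and the entries of \<open>u\<close> generate the unit ideal, so \<open>\<alpha>(0)\<^sup>-\<^sup>1 \<alpha>(X)\<close> commutes with every generator of
  \<open>\<beta>\<close>. Finally \<open>\<alpha>(0)\<close> is elementary because \<open>R\<close> is local, and elementary elements commute with \<open>\<beta>\<close> modulo
  the relative elementary group by a direct computation with \<open>c\<close>.
\<close>

subsection \<open>Root elements of a Clifford algebra\<close>

text \<open>The localisation at \<open>s\<close> is never formed: \<open>s\<close> may be a zero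
  divisor, so fractions are cleared and equalities hold after multiplication by a power of
  \<open>s\<close>, until a substitution in a polynomial variable removes that power. No relative
  commutator calculus is developed either. The double of the ring along an ideal J consists of the
  pairs (a, b) with a - b in J; over it a product of root elements is such a product in each
  component, and the quotient of the two components lies in the relative group. The absolute
  estimates, applied to pairs such as (g, 1), thus give the relative ones. This is why the
  coefficients are drawn from a subset \<open>D\<close> of a type: the double is a subring of the
  ring of pairs, not a type. The obstacle in the estimates is that 1 + x p q, with orthogonal
  isotropic vectors p and q, is not visibly a product of root elements. It becomes one after x is
  multiplied by suitable factors, and this costs powers of \<open>s\<close>. The condition r >= 2
  provides three hyperbolic planes, so that a plane orthogonal to any two given basis vectors is at
  hand for commutators.\<close>

locale scalar_algebra =
  fixes sm :: "'b::comm_ring_1 \<Rightarrow> 'c::ring_1 \<Rightarrow> 'c"  (infixr \<open>\<bullet>\<^sub>s\<close> 75)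
  assumes sm_add_right [simp]: "a \<bullet>\<^sub>s (x + y) = a \<bullet>\<^sub>s x + a \<bullet>\<^sub>s y"
    and sm_add_left [simp]: "(a + b) \<bullet>\<^sub>s x = a \<bullet>\<^sub>s x + b \<bullet>\<^sub>s x"
    and sm_sm [simp]: "a \<bullet>\<^sub>s b \<bullet>\<^sub>s x = (a * b) \<bullet>\<^sub>s x"
    and sm_one [simp]: "1 \<bullet>\<^sub>s x = x"
    and sm_mult_left [simp]: "(a \<bullet>\<^sub>s x) * y = a \<bullet>\<^sub>s (x * y)"
    and sm_mult_right [simp]: "x * (a \<bullet>\<^sub>s y) = a \<bullet>\<^sub>s (x * y)"
    and sm_faithful: "a \<bullet>\<^sub>s 1 = 0 \<Longrightarrow> a = 0"
begin

lemma sm_zero_left [simp]: "0 \<bullet>\<^sub>s x = 0"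
  using sm_add_left[of 0 0 x] by simp

lemma sm_zero_right [simp]: "a \<bullet>\<^sub>s 0 = 0"
  using sm_add_right[of a 0 0] by simp

lemma sm_minus_left [simp]: "(- a) \<bullet>\<^sub>s x = - (a \<bullet>\<^sub>s x)"
  using sm_add_left[of a "-a" x] by (simp add: eq_neg_iff_add_eq_0 add.commute)

lemma sm_minus_right [simp]: "a \<bullet>\<^sub>s (- x) = - (a \<bullet>\<^sub>s x)"
  using sm_add_right[of a x "-x"] by (simp add: eq_neg_iff_add_eq_0 add.commute)

lemma sm_diff_left [simp]: "(a - b) \<bullet>\<^sub>s x = a \<bullet>\<^sub>s x - b \<bullet>\<^sub>s x"
  using sm_add_left[of a "-b" x] by simp

lemma sm_diff_right [simp]: "a \<bullet>\<^sub>s (x - y) = a \<bullet>\<^sub>s x - a \<bullet>\<^sub>s y"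
  using sm_add_right[of a x "-y"] by simp

lemma sm_sum_left: "(\<Sum>i\<in>A. f i) \<bullet>\<^sub>s x = (\<Sum>i\<in>A. f i \<bullet>\<^sub>s x)"
  by (induction A rule: infinite_finite_induct) auto

lemma sm_sum_right: "a \<bullet>\<^sub>s (\<Sum>i\<in>A. f i) = (\<Sum>i\<in>A. a \<bullet>\<^sub>s f i)"
  by (induction A rule: infinite_finite_induct) auto

lemma sm_inj: "a \<bullet>\<^sub>s 1 = b \<bullet>\<^sub>s 1 \<Longrightarrow> a = b"
  using sm_faithful[of "a - b"] by simp

end

text \<open>The anticommutator. Between vectors of a Clifford algebra it is the polar form of the
  quadratic form, as a multiple of 1.\<close>

definition br :: "'c::ring \<Rightarrow> 'c \<Rightarrow> 'c" where
  "br x y = x * y + y * x"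

lemma br_simps [simp]:
  "br (x + y) w = br x w + br y w" "br w (x + y) = br w x + br w y"
  "br (x - y) w = br x w - br y w" "br w (x - y) = br w x - br w y"
  "br (- x) w = - br x w" "br w (- x) = - br w x" "br 0 w = 0" "br w 0 = 0"
  by (simp_all add: br_def algebra_simps)

lemma br_commute: "br x y = br y x"
  by (simp add: br_def add.commute)

lemma br_sum_left: "br (\<Sum>i\<in>A. f i) y = (\<Sum>i\<in>A. br (f i) y)"
  by (induction A rule: infinite_finite_induct) auto

lemma br_0_anti: "br x y = 0 \<Longrightarrow> x * y = - (y * x)"
  by (simp add: br_def eq_neg_iff_add_eq_0)

text \<open>Indices are pairs: \<open>(i, True)\<close> stands for \<open>e\<^sub>i\<close> and \<open>(i, False)\<close> for the dual vector \<open>f\<^sub>i\<close>.\<close>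

definition dual :: "nat \<times> bool \<Rightarrow> nat \<times> bool" where
  "dual k = (fst k, \<not> snd k)"

lemma dual_simps [simp]: "fst (dual k) = fst k" "dual (dual k) = k" "dual k \<noteq> k" "k \<noteq> dual k"
  "dual k = dual l \<longleftrightarrow> k = l" "dual (i, b) = (i, \<not> b)"
  by (auto simp: dual_def prod_eq_iff)

lemma fst_eq_dual: "fst k = fst l \<longleftrightarrow> l = k \<or> l = dual k"
  by (auto simp: dual_def prod_eq_iff)

text \<open>Only the relations of a hyperbolic basis are asked for, not that they present the
  algebra. The same results are then available for matrices and for pairs of matrices.\<close>

locale clifford = scalar_algebra sm
  for sm :: "'b::comm_ring_1 \<Rightarrow> 'c::ring_1 \<Rightarrow> 'c"  (infixr \<open>\<bullet>\<^sub>s\<close> 75) +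
  fixes D :: "'b set" and z :: "nat \<times> bool \<Rightarrow> 'c" and n :: nat
  assumes D_1 [simp]: "1 \<in> D"
    and D_add [simp]: "a \<in> D \<Longrightarrow> b \<in> D \<Longrightarrow> a + b \<in> D"
    and D_mult [simp]: "a \<in> D \<Longrightarrow> b \<in> D \<Longrightarrow> a * b \<in> D"
    and D_uminus [simp]: "a \<in> D \<Longrightarrow> - a \<in> D"
    and z_sq: "fst k < n \<Longrightarrow> z k * z k = 0"
    and z_br: "fst k < n \<Longrightarrow> fst l < n \<Longrightarrow> br (z k) (z l) = (if l = dual k then 1 else 0)"
    and n_ge_3: "n \<ge> 3"
begin

lemma D_0 [simp]: "0 \<in> D"
  using D_add[of 1 "-1"] D_uminus by simp

lemma D_diff [simp]: "a \<in> D \<Longrightarrow> b \<in> D \<Longrightarrow> a - b \<in> D"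
  using D_add[of a "-b"] D_uminus by simp

lemma D_sum [simp]: "(\<And>i. i \<in> A \<Longrightarrow> f i \<in> D) \<Longrightarrow> (\<Sum>i\<in>A. f i) \<in> D"
  by (induction A rule: infinite_finite_induct) auto

lemma D_power [simp]: "a \<in> D \<Longrightarrow> a ^ m \<in> D"
  by (induction m) auto

lemma br_sm [simp]: "br (a \<bullet>\<^sub>s x) y = a \<bullet>\<^sub>s br x y" "br x (a \<bullet>\<^sub>s y) = a \<bullet>\<^sub>s br x y"
  by (simp_all add: br_def)

definition K :: "(nat \<times> bool) set" where
  "K = {k. fst k < n}"

lemma K_eq: "K = {..<n} \<times> UNIV"
  by (auto simp: K_def)

lemma finite_K [simp]: "finite K"
  by (simp add: K_eq)

lemma dual_in_K [simp]: "dual k \<in> K \<longleftrightarrow> k \<in> K"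
  by (simp add: K_def)

lemma zz_K: "k \<in> K \<Longrightarrow> z k * z k = 0"
  by (simp add: K_def z_sq)

lemma br_K: "k \<in> K \<Longrightarrow> l \<in> K \<Longrightarrow> br (z k) (z l) = (if l = dual k then 1 else 0)"
  by (simp add: K_def z_br)

lemma z_anti: "k \<in> K \<Longrightarrow> l \<in> K \<Longrightarrow> l \<noteq> dual k \<Longrightarrow> z k * z l = - (z l * z k)"
  by (intro br_0_anti) (simp add: br_K)

lemma third_index: "\<exists>j. j \<in> K \<and> fst j \<noteq> i1 \<and> fst j \<noteq> i2"
proof -
  have "\<not> {..<n} \<subseteq> {i1, i2}"
  proof
    assume "{..<n} \<subseteq> {i1, i2}"
    hence "card {..<n} \<le> card {i1, i2}" by (intro card_mono) auto
    also have "\<dots> \<le> 2" by (cases "i1 = i2") auto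
    finally show False using n_ge_3 by simp
  qed
  then obtain i where "i < n" "i \<noteq> i1" "i \<noteq> i2" by auto
  thus ?thesis by (intro exI[of _ "(i, True)"]) (auto simp: K_def)
qed

definition vec :: "(nat \<times> bool \<Rightarrow> 'b) \<Rightarrow> 'c" where
  "vec a = (\<Sum>k\<in>K. a k \<bullet>\<^sub>s z k)"

definition Vec :: "'b set \<Rightarrow> 'c set" where
  "Vec P = {vec a | a. \<forall>k\<in>K. a k \<in> P}"

definition idl :: "'b set \<Rightarrow> bool" where
  "idl P \<longleftrightarrow> P \<subseteq> D \<and> 0 \<in> P \<and> (\<forall>a\<in>P. \<forall>b\<in>P. a + b \<in> P) \<and> (\<forall>a\<in>P. \<forall>d\<in>D. d * a \<in> P)"

lemma idl_D: "idl D"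
  by (auto simp: idl_def)

lemma idlD:
  assumes "idl P"
  shows "a \<in> P \<Longrightarrow> a \<in> D" "0 \<in> P" "a \<in> P \<Longrightarrow> b \<in> P \<Longrightarrow> a + b \<in> P"
    "a \<in> P \<Longrightarrow> d \<in> D \<Longrightarrow> d * a \<in> P" "a \<in> P \<Longrightarrow> d \<in> D \<Longrightarrow> a * d \<in> P" "a \<in> P \<Longrightarrow> - a \<in> P"
    "a \<in> P \<Longrightarrow> b \<in> P \<Longrightarrow> a - b \<in> P"
proof -
  show m: "- a \<in> P" if "a \<in> P" for a
    using assms that D_uminus[OF D_1] unfolding idl_def by (metis mult_minus1)
  show "a - b \<in> P" if "a \<in> P" "b \<in> P" using assms that m[of b] unfolding idl_def
    by (metis diff_conv_add_uminus)
qed (use assms in \<open>auto simp: idl_def mult.commute\<close>)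

lemma idl_sum: "idl P \<Longrightarrow> (\<And>i. i \<in> A \<Longrightarrow> f i \<in> P) \<Longrightarrow> (\<Sum>i\<in>A. f i) \<in> P"
  by (induction A rule: infinite_finite_induct) (auto simp: idlD)

lemma idl_principal: "s \<in> D \<Longrightarrow> idl ((*) s ` D)"
  unfolding idl_def
proof (intro conjI ballI; clarsimp)
  assume "s \<in> D"
  show "0 \<in> (*) s ` D" by (rule image_eqI[of _ _ 0]) auto
  fix a b assume "a \<in> D" "b \<in> D"
  thus "s * a + s * b \<in> (*) s ` D" by (intro image_eqI[of _ _ "a + b"]) (auto simp: distrib_left)
next
  fix a d assume "a \<in> D" "d \<in> D"
  thus "d * (s * a) \<in> (*) s ` D" by (intro image_eqI[of _ _ "d * a"]) (auto simp: ac_simps)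
qed

lemma vec_in_Vec: "(\<And>k. k \<in> K \<Longrightarrow> a k \<in> P) \<Longrightarrow> vec a \<in> Vec P"
  by (auto simp: Vec_def)

lemma vec_add: "vec a + vec b = vec (\<lambda>k. a k + b k)"
  and vec_sm: "c \<bullet>\<^sub>s vec a = vec (\<lambda>k. c * a k)"
  and vec_diff: "vec a - vec b = vec (\<lambda>k. a k - b k)"
  by (simp_all add: vec_def sum.distrib sm_sum_right sum_subtractf)

lemma z_eq_vec: "k \<in> K \<Longrightarrow> z k = vec (\<lambda>l. if l = k then 1 else 0)"
proof -
  assume k: "k \<in> K"
  have "vec (\<lambda>l. if l = k then 1 else 0) = (\<Sum>l\<in>K. if l = k then z l else 0)"
    unfolding vec_def by (intro sum.cong) auto
  thus ?thesis using k by simp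
qed

lemma Vec_z: "idl P \<Longrightarrow> 1 \<in> P \<Longrightarrow> k \<in> K \<Longrightarrow> z k \<in> Vec P"
  by (simp add: z_eq_vec vec_in_Vec idlD)

lemma z_in_Vec [simp]: "k \<in> K \<Longrightarrow> z k \<in> Vec D"
  by (rule Vec_z) (simp_all add: idl_D)

lemma Vec_add: "idl P \<Longrightarrow> u \<in> Vec P \<Longrightarrow> v \<in> Vec P \<Longrightarrow> u + v \<in> Vec P"
  unfolding Vec_def by (auto simp: vec_add) (metis idlD(3))

lemma Vec_diff: "idl P \<Longrightarrow> u \<in> Vec P \<Longrightarrow> v \<in> Vec P \<Longrightarrow> u - v \<in> Vec P"
  unfolding Vec_def by (auto simp: vec_diff) (metis idlD(7))

lemma Vec_sm: "idl P \<Longrightarrow> c \<in> D \<Longrightarrow> u \<in> Vec P \<Longrightarrow> c \<bullet>\<^sub>s u \<in> Vec P"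
  unfolding Vec_def by (auto simp: vec_sm) (metis idlD(4))

lemma Vec_sm': "idl P \<Longrightarrow> c \<in> P \<Longrightarrow> u \<in> Vec D \<Longrightarrow> c \<bullet>\<^sub>s u \<in> Vec P"
  unfolding Vec_def by (auto simp: vec_sm) (metis idlD(5))

lemma Vec_D_add [simp]: "u \<in> Vec D \<Longrightarrow> v \<in> Vec D \<Longrightarrow> u + v \<in> Vec D"
  by (rule Vec_add[OF idl_D])

lemma Vec_D_diff [simp]: "u \<in> Vec D \<Longrightarrow> v \<in> Vec D \<Longrightarrow> u - v \<in> Vec D"
  by (rule Vec_diff[OF idl_D])

lemma Vec_D_sm [simp]: "c \<in> D \<Longrightarrow> u \<in> Vec D \<Longrightarrow> c \<bullet>\<^sub>s u \<in> Vec D"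
  by (rule Vec_sm[OF idl_D])

lemma Vec_0: "idl P \<Longrightarrow> 0 \<in> Vec P"
  unfolding Vec_def by (auto simp: vec_def intro!: exI[of _ "\<lambda>_. 0"] idlD)

lemma Vec_sum: "idl P \<Longrightarrow> (\<And>i. i \<in> A \<Longrightarrow> f i \<in> Vec P) \<Longrightarrow> (\<Sum>i\<in>A. f i) \<in> Vec P"
  by (induction A rule: infinite_finite_induct) (auto simp: Vec_0 Vec_add)

definition form :: "(nat \<times> bool \<Rightarrow> 'b) \<Rightarrow> (nat \<times> bool \<Rightarrow> 'b) \<Rightarrow> 'b" where
  "form a b = (\<Sum>k\<in>K. a k * b (dual k))"

lemma br_vec_z: "k \<in> K \<Longrightarrow> br (vec a) (z k) = a (dual k) \<bullet>\<^sub>s 1"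
proof -
  assume k: "k \<in> K"
  have "br (vec a) (z k) = (\<Sum>l\<in>K. if l = dual k then a l \<bullet>\<^sub>s 1 else 0)"
    unfolding vec_def br_sum_left using k by (intro sum.cong) (auto simp: br_K)
  thus ?thesis using k by simp
qed

lemma br_z_vec: "k \<in> K \<Longrightarrow> br (z k) (vec a) = a (dual k) \<bullet>\<^sub>s 1"
  by (subst br_commute) (rule br_vec_z)

lemma br_vec_vec: "br (vec a) (vec b) = form a b \<bullet>\<^sub>s 1"
proof -
  have "br (vec a) (vec b) = (\<Sum>k\<in>K. a k \<bullet>\<^sub>s br (z k) (vec b))"
    by (subst vec_def) (simp add: br_sum_left)
  also have "\<dots> = form a b \<bullet>\<^sub>s 1"
    by (simp add: br_z_vec form_def sm_sum_left)
  finally show ?thesis .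
qed

lemma form_in_D: "(\<And>k. k \<in> K \<Longrightarrow> a k \<in> D) \<Longrightarrow> (\<And>k. k \<in> K \<Longrightarrow> b k \<in> D) \<Longrightarrow> form a b \<in> D"
  by (simp add: form_def)

lemma sum_K_split2:
  fixes f :: "nat \<times> bool \<Rightarrow> 'd::ab_group_add"
  assumes "k \<in> K"
  shows "(\<Sum>j\<in>K. f j) = f k + f (dual k) + (\<Sum>j\<in>K - {k, dual k}. f j)"
  using assms by (simp add: sum.remove[of K k] sum.remove[of "K - {k}" "dual k"] insert_Diff_if
      add.assoc flip: Diff_insert2)

text \<open>A monoid of words suffices, because the inverse of a root element is the root element
  with parameter - x. Factors are added on the left only, which keeps the inductions
  one-sided.\<close>

inductive_set E :: "'b set \<Rightarrow> 'c set" for P :: "'b set" where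
  one [simp]: "1 \<in> E P"
| step: "k \<in> K \<Longrightarrow> l \<in> K \<Longrightarrow> fst k \<noteq> fst l \<Longrightarrow> x \<in> P \<Longrightarrow> g \<in> E P \<Longrightarrow> (1 + x \<bullet>\<^sub>s (z k * z l)) * g \<in> E P"

lemma E_root: "k \<in> K \<Longrightarrow> l \<in> K \<Longrightarrow> fst k \<noteq> fst l \<Longrightarrow> x \<in> P \<Longrightarrow> 1 + x \<bullet>\<^sub>s (z k * z l) \<in> E P"
  using E.step[OF _ _ _ _ E.one] by simp

lemma E_mult: "g \<in> E P \<Longrightarrow> h \<in> E P \<Longrightarrow> g * h \<in> E P"
  by (induction g rule: E.induct) (auto simp: mult.assoc intro: E.step)

lemma E_mono: "P \<subseteq> Q \<Longrightarrow> E P \<subseteq> E Q"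
proof
  fix g assume "P \<subseteq> Q" "g \<in> E P"
  from this(2,1) show "g \<in> E Q" by (induction g rule: E.induct) (auto intro: E.step)
qed

lemma root_nilpotent:
  assumes "k \<in> K" "l \<in> K" "fst k \<noteq> fst l"
  shows "z k * z l * (z k * z l) = 0"
proof -
  have "z l * z k = - (z k * z l)" using assms by (intro z_anti) (auto simp: dual_def)
  hence "z k * z l * (z k * z l) = - (z k * z k * (z l * z l))"
    by (metis (no_types, lifting) mult.assoc mult_minus_left mult_minus_right)
  thus ?thesis using assms by (simp add: zz_K)
qed

lemma root_add:
  assumes "k \<in> K" "l \<in> K" "fst k \<noteq> fst l"
  shows "(1 + x \<bullet>\<^sub>s (z k * z l)) * (1 + y \<bullet>\<^sub>s (z k * z l)) = 1 + (x + y) \<bullet>\<^sub>s (z k * z l)"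
  using root_nilpotent[OF assms] by (simp add: distrib_left distrib_right)

text \<open>The commutator of 1 + p and 1 + (x / s) q is 1 + (x / s) (p q - q p); the identities are
  multiplied by s^2 so that no division occurs. The second one is the commutator in the opposite
  order.\<close>

lemma commutator_identity:
  fixes p q :: 'c
  assumes "p * p = 0" "q * q = 0" "p * q * p = 0" "q * p * q = 0"
  shows "(1 + p) * (s \<bullet>\<^sub>s 1 + x \<bullet>\<^sub>s q) * (1 - p) * (s \<bullet>\<^sub>s 1 - x \<bullet>\<^sub>s q)
     = (s * s) \<bullet>\<^sub>s 1 + (s * x) \<bullet>\<^sub>s (p * q - q * p)" (is ?A)
    "(s \<bullet>\<^sub>s 1 + x \<bullet>\<^sub>s q) * (1 + p) * (s \<bullet>\<^sub>s 1 - x \<bullet>\<^sub>s q) * (1 - p)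
     = (s * s) \<bullet>\<^sub>s 1 - (s * x) \<bullet>\<^sub>s (p * q - q * p)" (is ?B)
proof -
  have a: "p * (p * y) = 0" "q * (q * y) = 0" "p * (q * (p * y)) = 0" "q * (p * (q * y)) = 0"
    "p * (q * p) = 0" "q * (p * q) = 0" for y
    using assms by (metis mult.assoc mult_zero_left)+
  show ?A ?B by (simp_all add: algebra_simps a assms)
qed

end

text \<open>A commutator formula of Chevalley type: through a hyperbolic pair y, y' orthogonal to p
  and q, the element 1 + p q is the commutator of 1 + p y and 1 + y' q. The first four equations are
  the hypotheses of \<open>commutator_identity\<close> for p y and y' q.\<close>

lemma anticommuting_products:
  fixes p q y y' :: "'c::ring_1"
  assumes sq: "p * p = 0" "q * q = 0" "y * y = 0" "y' * y' = 0"
    and br: "br p q = 0" "br p y = 0" "br p y' = 0" "br q y = 0" "br q y' = 0" "br y y' = 1"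
  shows "p * y * (p * y) = 0" "y' * q * (y' * q) = 0" "p * y * (y' * q) * (p * y) = 0"
    "y' * q * (p * y) * (y' * q) = 0" "p * y * (y' * q) - y' * q * (p * y) = p * q"
proof -
  have a: "q * p = - (p * q)" "y * p = - (p * y)" "y' * p = - (p * y')" "y * q = - (q * y)"
    "y' * q = - (q * y')" "y' * y = 1 - y * y'"
    using br by (simp_all add: br_def eq_neg_iff_add_eq_0 eq_diff_eq add.commute)
  have b: "q * (p * w) = - (p * (q * w))" "y * (p * w) = - (p * (y * w))" "y' * (p * w) = - (p * (y' * w))"
    "y * (q * w) = - (q * (y * w))" "y' * (q * w) = - (q * (y' * w))" "y' * (y * w) = w - y * (y' * w)" for w
    by (simp_all add: a left_diff_distrib flip: mult.assoc)
  have c: "p * (p * w) = 0" "q * (q * w) = 0" "y * (y * w) = 0" "y' * (y' * w) = 0" for w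
    by (simp_all add: sq flip: mult.assoc)
  show "p * y * (p * y) = 0" "y' * q * (y' * q) = 0" "p * y * (y' * q) * (p * y) = 0"
    "y' * q * (p * y) * (y' * q) = 0" "p * y * (y' * q) - y' * q * (p * y) = p * q"
    by (simp_all add: mult.assoc a b c sq algebra_simps)
qed

section \<open>Transvections by isotropic vectors as products of root elements\<close>

context clifford
begin

text \<open>The mixed term u w u w' vanishes because \<open>u\<close> can be moved past
  \<open>w\<close> to meet the other \<open>u\<close>. For a fixed isotropic \<open>u\<close> the
  elements 1 + u w therefore multiply as the vectors \<open>w\<close> add.\<close>

lemma one_plus_mult_right:
  fixes u w w' :: 'c
  assumes "u * u = 0" "br u w = 0"
  shows "(1 + u * w) * (1 + u * w') = 1 + u * (w + w')"
proof -
  have "u * w * (u * w') = 0"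
    using br_0_anti[OF assms(2)] assms(1) by (metis mult.assoc mult_minus_left mult_minus_right mult_zero_left neg_0_equal_iff_equal)
  thus ?thesis by (simp add: distrib_left distrib_right)
qed

lemma one_plus_mult_left:
  fixes v w w' :: 'c
  assumes "v * v = 0" "br w' v = 0"
  shows "(1 + w * v) * (1 + w' * v) = 1 + (w + w') * v"
proof -
  have "w * v * (w' * v) = 0"
    using br_0_anti[OF assms(2)] assms(1) by (metis minus_mult_commute mult.assoc mult_zero_left mult_zero_right)
  thus ?thesis by (simp add: distrib_left distrib_right)
qed

lemma line_isotropic:
  assumes "k \<in> K" "l \<in> K" "fst k \<noteq> fst l"
  shows "(g \<bullet>\<^sub>s z l - d \<bullet>\<^sub>s z k) * (g \<bullet>\<^sub>s z l - d \<bullet>\<^sub>s z k) = 0"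
proof -
  have "z l * z k = - (z k * z l)" using assms by (intro z_anti) (auto simp: dual_def)
  thus ?thesis using assms by (simp add: algebra_simps zz_K)
qed

text \<open>The vanishing coordinates mean that \<open>vec y\<close> is orthogonal to z_k and to
  z_l. Each summand of \<open>vec y\<close> then anticommutes with the isotropic vector
  \<open>v\<close> and contributes one root element, or two if its index is outside both planes, and
  the contributions multiply additively.\<close>

lemma E_line:
  assumes P: "idl P" and kl: "k \<in> K" "l \<in> K" "fst k \<noteq> fst l" and gd: "g \<in> D" "d \<in> D" and c: "c \<in> P"
    and y: "\<And>j. j \<in> K \<Longrightarrow> y j \<in> D" "y (dual k) = 0" "y (dual l) = 0"
  defines "v \<equiv> g \<bullet>\<^sub>s z l - d \<bullet>\<^sub>s z k"
  shows "br (vec y) v = 0" "1 + c \<bullet>\<^sub>s (vec y * v) \<in> E P"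
proof -
  have vv: "v * v = 0" unfolding v_def by (rule line_isotropic[OF kl])
  have br: "br (z j) v = 0" if "j \<in> K" "j \<noteq> dual k" "j \<noteq> dual l" for j
    using that kl unfolding v_def by (auto simp: br_K)
  have single: "1 + x \<bullet>\<^sub>s (z j * v) \<in> E P" if j: "j \<in> K" "j \<noteq> dual k" "j \<noteq> dual l" and x: "x \<in> P" for j x
  proof -
    have xg: "x * g \<in> P" "- (x * d) \<in> P" using P x gd by (auto simp: idlD)
    consider "j = k" | "j = l" | "fst j \<noteq> fst k" "fst j \<noteq> fst l" using j fst_eq_dual[of j k] fst_eq_dual[of j l] by (metis dual_simps(2))
    thus ?thesis
    proof cases
      case 1
      have "1 + x \<bullet>\<^sub>s (z j * v) = 1 + (x * g) \<bullet>\<^sub>s (z k * z l)"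
        using 1 kl by (simp add: v_def right_diff_distrib zz_K)
      thus ?thesis using E_root[OF kl xg(1)] by simp
    next
      case 2
      have "1 + x \<bullet>\<^sub>s (z j * v) = 1 + (- (x * d)) \<bullet>\<^sub>s (z l * z k)"
        using 2 kl by (simp add: v_def right_diff_distrib zz_K)
      thus ?thesis using E_root[OF kl(2,1) kl(3)[symmetric] xg(2)] by simp
    next
      case 3
      have "1 + x \<bullet>\<^sub>s (z j * v) = 1 + z j * ((x * g) \<bullet>\<^sub>s z l + (- (x * d)) \<bullet>\<^sub>s z k)"
        by (simp add: v_def algebra_simps)
      also have "\<dots> = (1 + z j * ((x * g) \<bullet>\<^sub>s z l)) * (1 + z j * ((- (x * d)) \<bullet>\<^sub>s z k))"
        using j kl by (intro one_plus_mult_right[symmetric]) (auto simp: zz_K br_K)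
      also have "\<dots> = (1 + (x * g) \<bullet>\<^sub>s (z j * z l)) * (1 + (- (x * d)) \<bullet>\<^sub>s (z j * z k))"
        by (simp only: sm_mult_right)
      also have "\<dots> \<in> E P" using 3 j kl xg by (intro E_mult E_root) auto
      finally show ?thesis .
    qed
  qed
  have "br (\<Sum>j\<in>S. y j \<bullet>\<^sub>s z j) v = 0 \<and> 1 + c \<bullet>\<^sub>s ((\<Sum>j\<in>S. y j \<bullet>\<^sub>s z j) * v) \<in> E P" if "finite S" "S \<subseteq> K" for S
    using that
  proof (induction S rule: finite_induct)
    case empty
    show ?case by simp
  next
    case (insert j S)
    show ?case
    proof (cases "j = dual k \<or> j = dual l")
      case True
      thus ?thesis using insert y by auto
    next
      case False
      hence j: "j \<in> K" "j \<noteq> dual k" "j \<noteq> dual l" using insert by auto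
      let ?s = "\<Sum>j\<in>S. y j \<bullet>\<^sub>s z j"
      have IH: "br ?s v = 0" "1 + c \<bullet>\<^sub>s (?s * v) \<in> E P" using insert by auto
      have "1 + c \<bullet>\<^sub>s ((y j \<bullet>\<^sub>s z j + ?s) * v) = 1 + ((c * y j) \<bullet>\<^sub>s z j + c \<bullet>\<^sub>s ?s) * v"
        by (simp add: distrib_right)
      also have "\<dots> = (1 + (c * y j) \<bullet>\<^sub>s z j * v) * (1 + c \<bullet>\<^sub>s ?s * v)"
        by (rule one_plus_mult_left[symmetric]) (use vv IH in auto)
      also have "\<dots> \<in> E P"
        using single[OF j, of "c * y j"] IH y(1)[OF j(1)] P c by (intro E_mult) (auto simp: idlD)
      finally show ?thesis using insert IH br[OF j] by simp
    qed
  qed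
  from this[OF finite_K order_refl] show "br (vec y) v = 0" "1 + c \<bullet>\<^sub>s (vec y * v) \<in> E P"
    unfolding vec_def by auto
qed

text \<open>The part of \<open>vec a\<close> in the dual plane is dealt with by a commutator through a third
  hyperbolic plane; this is where \<open>n \<ge> 3\<close> enters.\<close>

lemma E_plane:
  assumes P: "idl P" and kl: "k \<in> K" "l \<in> K" "fst k \<noteq> fst l" and d: "d1 \<in> P" "d2 \<in> P"
    and a: "\<And>j. j \<in> K \<Longrightarrow> a j \<in> D"
  shows "1 + (d1 * d2) \<bullet>\<^sub>s (vec a * (a (dual k) \<bullet>\<^sub>s z l - a (dual l) \<bullet>\<^sub>s z k)) \<in> E P"
proof -
  define v where "v = a (dual k) \<bullet>\<^sub>s z l - a (dual l) \<bullet>\<^sub>s z k"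
  \<comment> \<open>The component of \<open>vec a\<close> in the span of the duals of z_k and z_l.
    The remaining part \<open>y\<close> is covered by \<open>E_line\<close>.\<close>
  define p where "p = a (dual k) \<bullet>\<^sub>s z (dual k) - (- a (dual l)) \<bullet>\<^sub>s z (dual l)"
  define y where "y = (\<lambda>j. if j = dual k \<or> j = dual l then 0 else a j)"
  have kl': "dual k \<noteq> dual l" "l \<noteq> dual k" "k \<noteq> dual l" "k \<noteq> l" using kl by (auto simp: dual_def)
  have vv: "v * v = 0" unfolding v_def by (rule line_isotropic[OF kl])
  have pp: "p * p = 0" unfolding p_def using kl by (intro line_isotropic) auto
  have pv: "br p v = 0" unfolding p_def v_def using kl kl' by (auto simp: br_K mult.commute)
  have split: "vec a = vec y + p"
  proof -
    have "vec a - vec y = (\<Sum>j\<in>K. if j = dual k \<or> j = dual l then a j \<bullet>\<^sub>s z j else 0)"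
      unfolding vec_def y_def sum_subtractf[symmetric] by (intro sum.cong) auto
    also have "\<dots> = (\<Sum>j\<in>{dual k, dual l}. a j \<bullet>\<^sub>s z j)"
      using kl by (intro sum.mono_neutral_cong_right) auto
    also have "\<dots> = p" using kl' by (simp add: p_def)
    finally show ?thesis by (simp add: algebra_simps)
  qed
  have yl: "br (vec y) v = 0" "1 + (d1 * d2) \<bullet>\<^sub>s (vec y * v) \<in> E P"
    unfolding v_def using P kl d a by (intro E_line; auto simp: y_def idlD)+
  obtain j where j: "j \<in> K" "fst j \<noteq> fst k" "fst j \<noteq> fst l" using third_index by blast
  have j': "j \<noteq> k" "j \<noteq> l" "j \<noteq> dual k" "j \<noteq> dual l" "dual j \<noteq> k" "dual j \<noteq> l" "k \<noteq> dual j" "l \<noteq> dual j"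
    using j by (auto simp: dual_def)
  have br0: "br p (z j) = 0" "br p (z (dual j)) = 0" "br v (z j) = 0" "br v (z (dual j)) = 0"
    "br (z j) (z (dual j)) = 1" "z j * z j = 0" "z (dual j) * z (dual j) = 0"
    using j j' kl by (auto simp: zz_K br_K p_def v_def)
  note ap = anticommuting_products[OF pp vv br0(6,7) pv br0(1-5)]
  \<comment> \<open>Both factors of the commutator need a parameter in \<open>P\<close> for the
    product to stay in \<open>E P\<close>; hence the product of two elements of \<open>P\<close> in
    the statement.\<close>
  have "1 + (d1 * d2) \<bullet>\<^sub>s (p * v) = (1 + d1 \<bullet>\<^sub>s (p * z j)) * (1 \<bullet>\<^sub>s 1 + d2 \<bullet>\<^sub>s (z (dual j) * v)) *
      (1 - d1 \<bullet>\<^sub>s (p * z j)) * (1 \<bullet>\<^sub>s 1 - d2 \<bullet>\<^sub>s (z (dual j) * v))"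
    by (subst commutator_identity(1)) (use ap in \<open>simp_all add: mult.commute flip: ap(5)\<close>)
  also have "\<dots> = (1 + d1 \<bullet>\<^sub>s (p * z j)) * (1 + d2 \<bullet>\<^sub>s (z (dual j) * v)) *
      (1 + (- d1) \<bullet>\<^sub>s (p * z j)) * (1 + (- d2) \<bullet>\<^sub>s (z (dual j) * v))"
    by simp
  also have "\<dots> \<in> E P"
  proof -
    have 1: "1 + c \<bullet>\<^sub>s (p * z j) \<in> E P" if c: "c \<in> P" for c
    proof -
      have "1 + c \<bullet>\<^sub>s (p * z j) = 1 + ((c * a (dual k)) \<bullet>\<^sub>s z (dual k) + (c * a (dual l)) \<bullet>\<^sub>s z (dual l)) * z j"
        by (simp add: p_def algebra_simps)
      also have "\<dots> = (1 + ((c * a (dual k)) \<bullet>\<^sub>s z (dual k)) * z j) * (1 + ((c * a (dual l)) \<bullet>\<^sub>s z (dual l)) * z j)"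
        using j j' kl by (intro one_plus_mult_left[symmetric]) (auto simp: zz_K br_K)
      also have "\<dots> \<in> E P" unfolding sm_mult_left
        using c P a j j' kl by (intro E_mult E_root) (auto simp: idlD)
      finally show ?thesis .
    qed
    have 2: "1 + c \<bullet>\<^sub>s (z (dual j) * v) \<in> E P" if c: "c \<in> P" for c
    proof -
      have "1 + c \<bullet>\<^sub>s (z (dual j) * v) = 1 + z (dual j) * ((c * a (dual k)) \<bullet>\<^sub>s z l + (- (c * a (dual l))) \<bullet>\<^sub>s z k)"
        by (simp add: v_def algebra_simps)
      also have "\<dots> = (1 + z (dual j) * ((c * a (dual k)) \<bullet>\<^sub>s z l)) * (1 + z (dual j) * ((- (c * a (dual l))) \<bullet>\<^sub>s z k))"
        using j j' kl by (intro one_plus_mult_right[symmetric]) (auto simp: zz_K br_K)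
      also have "\<dots> \<in> E P" unfolding sm_mult_right
        using c P a j j' kl by (intro E_mult E_root) (auto simp: idlD)
      finally show ?thesis .
    qed
    show ?thesis using P d by (intro E_mult 1 2) (auto simp: idlD)
  qed
  finally have pv_E: "1 + (d1 * d2) \<bullet>\<^sub>s (p * v) \<in> E P" .
  have "1 + (d1 * d2) \<bullet>\<^sub>s (vec a * v) = 1 + ((d1 * d2) \<bullet>\<^sub>s vec y + (d1 * d2) \<bullet>\<^sub>s p) * v"
    by (simp add: split distrib_right)
  also have "\<dots> = (1 + (d1 * d2) \<bullet>\<^sub>s vec y * v) * (1 + (d1 * d2) \<bullet>\<^sub>s p * v)"
    using vv pv by (intro one_plus_mult_left[symmetric]) auto
  also have "\<dots> \<in> E P" using yl(2) pv_E by (intro E_mult) simp_all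
  finally show ?thesis unfolding v_def .
qed

text \<open>Over \<open>w = 1\<close> the vectors orthogonal to \<open>u\<close> are combinations of Koszul relations
  \<open>\<langle>u, z\<^sub>k\<rangle> z\<^sub>l - \<langle>u, z\<^sub>l\<rangle> z\<^sub>k\<close>. Those with \<open>l = dual k\<close> are not isotropic, but every
  coordinate of \<open>u\<close> times such a relation is, up to a multiple of \<open>u\<close>, a combination of the others.\<close>

lemma transvection_in_E:
  assumes P: "idl P" and u: "u \<in> Vec D" "u * u = 0" and u': "u' \<in> Vec D" "br u u' = w \<bullet>\<^sub>s 1"
    and v: "v \<in> Vec D" "br u v = 0" and d: "d1 \<in> P" "d2 \<in> P"
  shows "1 + (d1 * d2 * w * w) \<bullet>\<^sub>s (u * v) \<in> E P"
proof -
  obtain a where a: "u = vec a" "\<And>k. k \<in> K \<Longrightarrow> a k \<in> D" using u by (auto simp: Vec_def)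
  obtain a' where a': "u' = vec a'" "\<And>k. k \<in> K \<Longrightarrow> a' k \<in> D" using u' by (auto simp: Vec_def)
  obtain b where b: "v = vec b" "\<And>k. k \<in> K \<Longrightarrow> b k \<in> D" using v by (auto simp: Vec_def)
  have faa: "form a a = 0" using u br_vec_vec[of a a] by (intro sm_faithful) (simp add: a br_def)
  have w: "w = form a a'" using u' br_vec_vec[of a a'] by (intro sm_inj) (simp add: a a')
  have fab: "form a b = 0" using v br_vec_vec[of a b] by (intro sm_faithful) (simp add: a b)
  have wD: "w \<in> D" using a a' by (simp add: w form_in_D)
  define \<kappa> where "\<kappa> = (\<lambda>k l. a (dual k) \<bullet>\<^sub>s z l - a (dual l) \<bullet>\<^sub>s z k)"
  define ok where "ok = (\<lambda>x. br u x = 0 \<and> 1 + u * x \<in> E P)"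
  have ok_add: "ok (x + y)" if "ok x" "ok y" for x y
    using that one_plus_mult_right[OF u(2), of x y] E_mult[of "1 + u * x" P "1 + u * y"]
    by (auto simp: ok_def)
  have ok_0: "ok 0" by (simp add: ok_def)
  have ok_sum: "ok (\<Sum>i\<in>A. f i)" if "\<And>i. i \<in> A \<Longrightarrow> ok (f i)" for A and f :: "nat \<times> bool \<Rightarrow> 'c"
    using that by (induction A rule: infinite_finite_induct) (auto simp: ok_add ok_0)
  have nondual: "ok ((d1 * d2 * c) \<bullet>\<^sub>s \<kappa> k l)" if "k \<in> K" "l \<in> K" "l \<noteq> dual k" "c \<in> D" for k l c
  proof (cases "l = k")
    case True
    thus ?thesis by (simp add: \<kappa>_def ok_def)
  next
    case False
    hence "fst k \<noteq> fst l" using that by (auto simp: fst_eq_dual)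
    hence "1 + (d1 * (d2 * c)) \<bullet>\<^sub>s (u * \<kappa> k l) \<in> E P" unfolding a \<kappa>_def
      using that P d a by (intro E_plane) (auto simp: idlD)
    moreover have "br u (\<kappa> k l) = 0" using that by (simp add: \<kappa>_def a br_vec_z mult.commute)
    ultimately show ?thesis by (simp add: ok_def mult.assoc)
  qed
  have dual1: "ok ((d1 * d2 * c * a k) \<bullet>\<^sub>s \<kappa> k (dual k))" if k: "k \<in> K" and c: "c \<in> D" for k c
  proof -
    have "(\<Sum>j\<in>K. a j * a (dual j)) = 0" using faa by (simp add: form_def)
    hence "(\<Sum>j\<in>K - {k, dual k}. a j * a (dual j)) = - (a k * a (dual k) + a k * a (dual k))"
      by (subst (asm) sum_K_split2[OF k]) (simp add: mult.commute add.commute eq_neg_iff_add_eq_0)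
    moreover have "(\<Sum>j\<in>K - {k, dual k}. a j \<bullet>\<^sub>s z j) = u - a k \<bullet>\<^sub>s z k - a (dual k) \<bullet>\<^sub>s z (dual k)"
      unfolding a vec_def by (subst sum_K_split2[OF k]) simp
    moreover have "(\<Sum>j\<in>K - {k, dual k}. a j \<bullet>\<^sub>s \<kappa> (dual k) j) =
        a k \<bullet>\<^sub>s (\<Sum>j\<in>K - {k, dual k}. a j \<bullet>\<^sub>s z j) - (\<Sum>j\<in>K - {k, dual k}. a j * a (dual j)) \<bullet>\<^sub>s z (dual k)"
      unfolding \<kappa>_def by (simp add: sum_subtractf sm_sum_left sm_sum_right mult.commute)
    ultimately have "(\<Sum>j\<in>K - {k, dual k}. a j \<bullet>\<^sub>s \<kappa> (dual k) j) =
        a k \<bullet>\<^sub>s (u - a k \<bullet>\<^sub>s z k - a (dual k) \<bullet>\<^sub>s z (dual k)) -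
        (- (a k * a (dual k) + a k * a (dual k))) \<bullet>\<^sub>s z (dual k)"
      by (simp only:)
    hence "(\<Sum>j\<in>K - {k, dual k}. a j \<bullet>\<^sub>s \<kappa> (dual k) j) =
        a k \<bullet>\<^sub>s u - (a k * a k) \<bullet>\<^sub>s z k - (a k * a (dual k)) \<bullet>\<^sub>s z (dual k) +
        ((a k * a (dual k)) \<bullet>\<^sub>s z (dual k) + (a k * a (dual k)) \<bullet>\<^sub>s z (dual k))"
      by (simp only: sm_minus_left sm_add_left sm_diff_right sm_sm diff_minus_eq_add)
    hence id: "a k \<bullet>\<^sub>s \<kappa> k (dual k) = (\<Sum>j\<in>K - {k, dual k}. a j \<bullet>\<^sub>s \<kappa> (dual k) j) - a k \<bullet>\<^sub>s u"
      by (simp only: \<kappa>_def sm_diff_right sm_sm dual_simps) simp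
    have "(d1 * d2 * c * a k) \<bullet>\<^sub>s \<kappa> k (dual k) = (d1 * d2 * c) \<bullet>\<^sub>s (a k \<bullet>\<^sub>s \<kappa> k (dual k))"
      by simp
    also have "\<dots> = (\<Sum>j\<in>K - {k, dual k}. (d1 * d2 * (c * a j)) \<bullet>\<^sub>s \<kappa> (dual k) j) + (- (d1 * d2 * c * a k)) \<bullet>\<^sub>s u"
      unfolding id by (simp add: sm_sum_right mult.assoc)
    also have "ok \<dots>"
    proof (intro ok_add ok_sum nondual)
      have "br u u = 0" using u by (simp add: br_def)
      thus "ok ((- (d1 * d2 * c * a k)) \<bullet>\<^sub>s u)" using u by (simp add: ok_def)
    qed (use k c a in auto)
    finally show ?thesis .
  qed
  \<comment> \<open>In w = sum of a_m a'_(dual m) the terms with m = k and m = dual k are handled by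
    \<open>dual1\<close>. The others use the Pluecker relation a_m \<kappa>(k, dual k) = a_(dual k)
    \<kappa>(dual m, dual k) - a_k \<kappa>(dual m, k), whose right-hand side contains no pair of
    dual indices.\<close>
  have dual2: "ok ((d1 * d2 * c * w) \<bullet>\<^sub>s \<kappa> k (dual k))" if k: "k \<in> K" and c: "c \<in> D" for k c
  proof -
    have "(d1 * d2 * c * w) \<bullet>\<^sub>s \<kappa> k (dual k) =
        (\<Sum>m\<in>K. (d1 * d2 * (c * a' (dual m)) * a m) \<bullet>\<^sub>s \<kappa> k (dual k))"
      unfolding w form_def by (simp add: sum_distrib_left sm_sum_left ac_simps del: sm_diff_right)
    also have "ok \<dots>"
    proof (rule ok_sum)
      fix m assume m: "m \<in> K"
      hence D: "c * a' (dual m) \<in> D" using a' c by simp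
      consider "m = k" | "m = dual k" | "m \<noteq> k" "m \<noteq> dual k" by blast
      thus "ok ((d1 * d2 * (c * a' (dual m)) * a m) \<bullet>\<^sub>s \<kappa> k (dual k))"
      proof cases
        case 1
        thus ?thesis using dual1[OF k D] by simp
      next
        case 2
        have "ok ((d1 * d2 * (- (c * a' (dual m))) * a (dual k)) \<bullet>\<^sub>s \<kappa> (dual k) k)"
          using dual1[of "dual k" "- (c * a' (dual m))"] k D by simp
        thus ?thesis using 2 by (simp add: \<kappa>_def)
      next
        case 3
        have "(d1 * d2 * (c * a' (dual m)) * a m) \<bullet>\<^sub>s \<kappa> k (dual k) =
            (d1 * d2 * (c * a' (dual m) * a (dual k))) \<bullet>\<^sub>s \<kappa> (dual m) (dual k) +
            (d1 * d2 * (- (c * a' (dual m) * a k))) \<bullet>\<^sub>s \<kappa> (dual m) k"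
          by (simp add: \<kappa>_def algebra_simps)
        also have "ok \<dots>"
          by (intro ok_add nondual) (use 3 k m D a in auto)
        finally show ?thesis .
      qed
    qed
    finally show ?thesis .
  qed
  \<comment> \<open>Expressing \<open>v\<close> by Koszul relations costs one factor
    \<open>w\<close>, and the relations with l = dual k cost a second one in \<open>dual2\<close>;
    this is the w * w of the statement.\<close>
  have "w \<bullet>\<^sub>s v = (\<Sum>k\<in>K. \<Sum>l\<in>K. (a' k * b l) \<bullet>\<^sub>s \<kappa> k l)"
  proof -
    have "(\<Sum>k\<in>K. \<Sum>l\<in>K. (a' k * b l) \<bullet>\<^sub>s \<kappa> k l) =
        (\<Sum>k\<in>K. \<Sum>l\<in>K. (a' k * a (dual k)) \<bullet>\<^sub>s (b l \<bullet>\<^sub>s z l)) - (\<Sum>k\<in>K. \<Sum>l\<in>K. (b l * a (dual l)) \<bullet>\<^sub>s (a' k \<bullet>\<^sub>s z k))"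
      by (simp add: \<kappa>_def sum_subtractf ac_simps)
    also have "\<dots> = form a' a \<bullet>\<^sub>s v - form b a \<bullet>\<^sub>s u'"
      unfolding form_def b a' vec_def by (subst sum.swap) (simp only: sm_sum_left sm_sum_right)
    also have "form a' a = w" using br_vec_vec[of a' a] br_vec_vec[of a a'] br_commute[of "vec a"]
      unfolding w by (metis sm_inj)
    also have "form b a = 0" using br_vec_vec[of a b] br_vec_vec[of b a] br_commute[of "vec a"] fab
      by (metis sm_inj)
    finally show ?thesis by simp
  qed
  hence "(d1 * d2 * w * w) \<bullet>\<^sub>s v = (d1 * d2 * w) \<bullet>\<^sub>s (\<Sum>k\<in>K. \<Sum>l\<in>K. (a' k * b l) \<bullet>\<^sub>s \<kappa> k l)"
    by (metis sm_sm)
  hence "(d1 * d2 * w * w) \<bullet>\<^sub>s v = (\<Sum>k\<in>K. \<Sum>l\<in>K. (d1 * d2 * w * (a' k * b l)) \<bullet>\<^sub>s \<kappa> k l)"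
    by (simp only: sm_sum_right sm_sm)
  also have "ok \<dots>"
  proof (intro ok_sum)
    fix k l assume kl: "k \<in> K" "l \<in> K"
    show "ok ((d1 * d2 * w * (a' k * b l)) \<bullet>\<^sub>s \<kappa> k l)"
    proof (cases "l = dual k")
      case True
      have "ok ((d1 * d2 * (a' k * b l) * w) \<bullet>\<^sub>s \<kappa> k (dual k))" using kl a' b by (intro dual2) auto
      thus ?thesis using True by (simp add: ac_simps)
    next
      case False
      have "ok ((d1 * d2 * (w * (a' k * b l))) \<bullet>\<^sub>s \<kappa> k l)" using kl a' b wD False by (intro nondual) auto
      thus ?thesis by (simp add: ac_simps)
    qed
  qed
  finally show ?thesis by (simp add: ok_def)
qed

end

text \<open>For vectors both anticommutators are scalars, so the commutator of a product of two
  vectors with a vector is again a vector: the action of the orthogonal Lie algebra.\<close>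

lemma commutator_with_product:
  fixes x y u :: "'c::ring"
  shows "x * y * u - u * (x * y) = x * br y u - br x u * y"
  by (simp add: br_def algebra_simps)

section \<open>Conjugation of root elements by root elements with a denominator\<close>

context clifford
begin

lemma one_plus_scaled_right:
  fixes u w w' :: 'c
  assumes "u * u = 0" "br u w = 0"
  shows "(1 + u * w) * (s \<bullet>\<^sub>s 1 + u * w') = s \<bullet>\<^sub>s 1 + u * (s \<bullet>\<^sub>s w + w')"
proof -
  have "u * w * (u * w') = 0"
    using br_0_anti[OF assms(2)] assms(1) by (metis mult.assoc mult_minus_left mult_minus_right mult_zero_left neg_0_equal_iff_equal)
  thus ?thesis by (simp add: distrib_left distrib_right)
qed

lemma one_plus_scaled_left:
  fixes v w w' :: 'c
  assumes "v * v = 0" "br w' v = 0"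
  shows "(1 + w * v) * (s \<bullet>\<^sub>s 1 + w' * v) = s \<bullet>\<^sub>s 1 + (s \<bullet>\<^sub>s w + w') * v"
proof -
  have "w * v * (w' * v) = 0"
    using br_0_anti[OF assms(2)] assms(1) by (metis minus_mult_commute mult.assoc mult_zero_left mult_zero_right)
  thus ?thesis by (simp add: distrib_left distrib_right)
qed

lemma Vec_br:
  assumes "u \<in> Vec D" "v \<in> Vec D"
  obtains c where "c \<in> D" "br u v = c \<bullet>\<^sub>s 1"
proof -
  obtain a b where "u = vec a" "v = vec b" "\<forall>k\<in>K. a k \<in> D" "\<forall>k\<in>K. b k \<in> D"
    using assms by (auto simp: Vec_def)
  thus ?thesis using that[of "form a b"] br_vec_vec[of a b] form_in_D[of a b] by auto
qed

text \<open>Moving z_k to the left past \<open>u\<close> costs only a scalar. One of the resulting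
  terms contains z_l z_l and the other z_k z_l z_k, and both vanish.\<close>

lemma root_sandwich:
  assumes kl: "k \<in> K" "l \<in> K" "fst k \<noteq> fst l" and u: "u \<in> Vec D"
  shows "z k * z l * u * (z k * z l) = 0"
proof -
  obtain c where c: "br u (z k) = c \<bullet>\<^sub>s 1" using Vec_br[OF u z_in_Vec[OF kl(1)]] by blast
  have lk: "z l * z k = - (z k * z l)" using kl by (intro z_anti) (auto simp: dual_def)
  have 1: "z k * z l * z k = 0" using lk zz_K[OF kl(1)] by (simp add: mult.assoc flip: mult.assoc[of "z k" "z k"])
  have 2: "z k * z l * z l = 0" using zz_K[OF kl(2)] by (simp add: mult.assoc)
  have "u * z k = c \<bullet>\<^sub>s 1 - z k * u" using c by (simp add: br_def eq_diff_eq)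
  hence "z k * z l * (u * z k) * z l = z k * z l * (c \<bullet>\<^sub>s 1 - z k * u) * z l" by simp
  also have "\<dots> = c \<bullet>\<^sub>s (z k * z l * z l) - z k * z l * z k * u * z l"
    by (simp add: algebra_simps)
  also have "\<dots> = 0" by (simp only: 1 2 sm_zero_right mult_zero_left diff_self)
  finally show ?thesis by (simp only: mult.assoc)
qed

text \<open>\<open>b\<close> times the conjugate of \<open>u\<close> by \<open>1 + (x / b) z\<^sub>k z\<^sub>l\<close>.\<close>

definition cnj :: "'b \<Rightarrow> 'b \<Rightarrow> 'c \<Rightarrow> 'c \<Rightarrow> 'c" where
  "cnj b x R u = b \<bullet>\<^sub>s u + x \<bullet>\<^sub>s (R * u - u * R)"

text \<open>Since R u R = 0 for vectors \<open>u\<close>, conjugation by 1 + (x / b) R has no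
  quadratic term on vectors. A single factor \<open>b\<close> therefore clears the denominator of
  the conjugate of a vector, and b^2 that of a product of two.\<close>

lemma cnj_product:
  assumes kl: "k \<in> K" "l \<in> K" "fst k \<noteq> fst l" and uv: "u \<in> Vec D" "v \<in> Vec D"
  defines "R \<equiv> z k * z l"
  shows "(b \<bullet>\<^sub>s 1 + x \<bullet>\<^sub>s R) * (u * v) * (b \<bullet>\<^sub>s 1 - x \<bullet>\<^sub>s R) = cnj b x R u * cnj b x R v"
    and "(b \<bullet>\<^sub>s 1 + x \<bullet>\<^sub>s R) * u * (b \<bullet>\<^sub>s 1 - x \<bullet>\<^sub>s R) = b \<bullet>\<^sub>s cnj b x R u"
    and "(b \<bullet>\<^sub>s 1 + x \<bullet>\<^sub>s R) * (b \<bullet>\<^sub>s 1 - x \<bullet>\<^sub>s R) = (b * b) \<bullet>\<^sub>s 1"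
    and "(b \<bullet>\<^sub>s 1 - x \<bullet>\<^sub>s R) * (b \<bullet>\<^sub>s 1 + x \<bullet>\<^sub>s R) = (b * b) \<bullet>\<^sub>s 1"
proof -
  have 0: "R * R = 0" "R * (u * R) = 0" "R * (v * R) = 0"
    using root_nilpotent[OF kl] root_sandwich[OF kl uv(1)] root_sandwich[OF kl uv(2)]
    by (simp_all add: R_def mult.assoc)
  have 1: "R * (R * w) = 0" "R * (u * (R * w)) = 0" "R * (v * (R * w)) = 0" for w
    using 0 by (metis mult.assoc mult_zero_left)+
  show "(b \<bullet>\<^sub>s 1 + x \<bullet>\<^sub>s R) * (u * v) * (b \<bullet>\<^sub>s 1 - x \<bullet>\<^sub>s R) = cnj b x R u * cnj b x R v"
    "(b \<bullet>\<^sub>s 1 + x \<bullet>\<^sub>s R) * u * (b \<bullet>\<^sub>s 1 - x \<bullet>\<^sub>s R) = b \<bullet>\<^sub>s cnj b x R u"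
    "(b \<bullet>\<^sub>s 1 + x \<bullet>\<^sub>s R) * (b \<bullet>\<^sub>s 1 - x \<bullet>\<^sub>s R) = (b * b) \<bullet>\<^sub>s 1"
    "(b \<bullet>\<^sub>s 1 - x \<bullet>\<^sub>s R) * (b \<bullet>\<^sub>s 1 + x \<bullet>\<^sub>s R) = (b * b) \<bullet>\<^sub>s 1"
    by (simp_all add: cnj_def algebra_simps 0 1)
qed

lemma commutator_root_Vec:
  assumes kl: "k \<in> K" "l \<in> K" and u: "u \<in> Vec D"
  shows "z k * z l * u - u * (z k * z l) \<in> Vec D"
proof -
  obtain c where c: "c \<in> D" "br (z k) u = c \<bullet>\<^sub>s 1" using Vec_br[OF z_in_Vec[OF kl(1)] u] by blast
  obtain d where d: "d \<in> D" "br (z l) u = d \<bullet>\<^sub>s 1" using Vec_br[OF z_in_Vec[OF kl(2)] u] by blast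
  have "z k * z l * u - u * (z k * z l) = d \<bullet>\<^sub>s z k - c \<bullet>\<^sub>s z l"
    by (simp add: commutator_with_product c d)
  thus ?thesis using c d kl by simp
qed

lemma cnj_Vec:
  assumes "k \<in> K" "l \<in> K" "u \<in> Vec D" "b \<in> D" "x \<in> D"
  shows "cnj b x (z k * z l) u \<in> Vec D"
  unfolding cnj_def using assms by (intro Vec_D_add Vec_D_sm commutator_root_Vec)

text \<open>The conjugate is a transvection by the cleared conjugates of z_k and z_l. The conjugates
  of z_k and its dual pair to b^2, and \<open>transvection_in_E\<close> needs the square b^4 of
  this; the remaining b^2 of b^6 is the factor in front of \<open>h\<close>.\<close>

lemma conj_root_by_root:
  assumes P: "idl P" and ij: "i \<in> K" "j \<in> K" "fst i \<noteq> fst j" and kl: "k \<in> K" "l \<in> K" "fst k \<noteq> fst l"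
    and D: "b \<in> D" "x \<in> D" and d: "d1 \<in> P" "d2 \<in> P"
  shows "\<exists>h\<in>E P. (b \<bullet>\<^sub>s 1 + x \<bullet>\<^sub>s (z i * z j)) * (1 + (b ^ 6 * (d1 * d2)) \<bullet>\<^sub>s (z k * z l)) *
     (b \<bullet>\<^sub>s 1 - x \<bullet>\<^sub>s (z i * z j)) = (b * b) \<bullet>\<^sub>s h"
proof -
  let ?X = "b \<bullet>\<^sub>s 1 + x \<bullet>\<^sub>s (z i * z j)" and ?Y = "b \<bullet>\<^sub>s 1 - x \<bullet>\<^sub>s (z i * z j)"
  let ?c = "cnj b x (z i * z j)"
  note cp = cnj_product[OF ij]
  have zz: "?c (z k) * ?c (z k) = 0" using cp(1)[of "z k" "z k" b x] kl by (simp add: zz_K)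
  have br_c: "br (?c u) (?c v) = (c * (b * b)) \<bullet>\<^sub>s 1" if "u \<in> Vec D" "v \<in> Vec D" "br u v = c \<bullet>\<^sub>s 1" for u v c
  proof -
    have "br (?c u) (?c v) = ?X * br u v * ?Y"
      using that(1,2) by (simp only: br_def cp(1)[symmetric] distrib_left distrib_right)
    also have "\<dots> = c \<bullet>\<^sub>s (?X * ?Y)" unfolding that by (simp only: sm_mult_left sm_mult_right mult_1_right)
    finally show ?thesis using cp(3)[of 0 0 b x] by (simp add: Vec_0 idl_D)
  qed
  have lk: "l \<noteq> dual k" using kl by (auto simp: dual_def)
  have "1 + (d1 * d2 * (b * b) * (b * b)) \<bullet>\<^sub>s (?c (z k) * ?c (z l)) \<in> E P" (is "?h \<in> _")
    using br_c[of "z k" "z (dual k)" 1] br_c[of "z k" "z l" 0] kl lk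
    by (intro transvection_in_E[OF P _ zz, of "?c (z (dual k))"]) (simp_all add: br_K D d cnj_Vec ij)
  moreover have "?X * (1 + (b ^ 6 * (d1 * d2)) \<bullet>\<^sub>s (z k * z l)) * ?Y = ?X * ?Y + (b ^ 6 * (d1 * d2)) \<bullet>\<^sub>s (?X * (z k * z l) * ?Y)"
    by (simp only: distrib_left distrib_right mult_1_right sm_mult_left sm_mult_right)
  moreover have "\<dots> = (b * b) \<bullet>\<^sub>s ?h"
  proof -
    have "b ^ 6 * (d1 * d2) = b * b * (d1 * d2 * (b * b) * (b * b))"
      by (simp add: numeral_eq_Suc ac_simps)
    thus ?thesis
      unfolding cp(1)[OF z_in_Vec[OF kl(1)] z_in_Vec[OF kl(2)]] cp(3)[OF Vec_0[OF idl_D] Vec_0[OF idl_D]]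
      by (simp only: sm_add_right sm_sm)
  qed
  ultimately show ?thesis by metis
qed

definition lev :: "'b \<Rightarrow> nat \<Rightarrow> 'b set" where
  "lev s m = (*) (s ^ m) ` D"

lemma idl_lev [simp]: "s \<in> D \<Longrightarrow> idl (lev s m)"
  by (simp add: lev_def idl_principal)

lemma levI: "s \<in> D \<Longrightarrow> d \<in> D \<Longrightarrow> m \<le> m' \<Longrightarrow> s ^ m' * d \<in> lev s m"
  unfolding lev_def
  by (rule image_eqI[of _ _ "s ^ (m' - m) * d"]) (simp_all flip: mult.assoc power_add)

lemma lev_self: "s \<in> D \<Longrightarrow> s ^ m * 1 \<in> lev s m" "s \<in> D \<Longrightarrow> d \<in> D \<Longrightarrow> s ^ m * d \<in> lev s m"
  by (rule levI; simp)+

lemma lev_mono: "s \<in> D \<Longrightarrow> m \<le> m' \<Longrightarrow> lev s m' \<subseteq> lev s m"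
  using levI[of s _ m m'] by (auto simp: lev_def[of s m'])

lemma lev_0 [simp]: "lev s 0 = D"
  by (auto simp: lev_def)

lemma E_lev_mono: "s \<in> D \<Longrightarrow> m \<le> m' \<Longrightarrow> g \<in> E (lev s m') \<Longrightarrow> g \<in> E (lev s m)"
  using E_mono[OF lev_mono] by blast

text \<open>The level is halved because \<open>conj_root_by_root\<close> wants the parameter as a
  product of two elements of the target ideal: s^(2m) d = s^m (s^m d).\<close>

lemma conj_by_root_integral:
  assumes s: "s \<in> D" "x \<in> D" and ij: "i \<in> K" "j \<in> K" "fst i \<noteq> fst j" and h: "h \<in> E (lev s (2 * m))"
  shows "(1 + x \<bullet>\<^sub>s (z i * z j)) * h * (1 - x \<bullet>\<^sub>s (z i * z j)) \<in> E (lev s m)"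
  using h
proof (induction h rule: E.induct)
  case one
  show ?case using cnj_product(3)[OF ij Vec_0[OF idl_D] Vec_0[OF idl_D], of 1 x] by simp
next
  case (step k l y g)
  let ?X = "1 + x \<bullet>\<^sub>s (z i * z j)" and ?Y = "1 - x \<bullet>\<^sub>s (z i * z j)"
  let ?t = "1 + y \<bullet>\<^sub>s (z k * z l)"
  have YX: "?Y * ?X = 1" using cnj_product(4)[OF ij Vec_0[OF idl_D] Vec_0[OF idl_D], of 1 x] by simp
  obtain d where d: "d \<in> D" "y = s ^ (2 * m) * d" using step by (auto simp: lev_def)
  have "y = s ^ m * 1 * (s ^ m * d)" by (simp only: d power_add mult_2 mult_2_right ac_simps mult_1_left mult_1_right)
  moreover have "s ^ m * 1 \<in> lev s m" "s ^ m * d \<in> lev s m" using lev_self[OF s(1)] d by blast+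
  ultimately obtain h where "h \<in> E (lev s m)" "?X * ?t * ?Y = h"
    using conj_root_by_root[OF idl_lev[OF s(1), of m] ij step(1-3) D_1 s(2), of "s ^ m * 1" "s ^ m * d"] by auto
  moreover have "?X * (?t * g) * ?Y = (?X * ?t * ?Y) * (?X * g * ?Y)"
  proof -
    have "(?X * ?t * ?Y) * (?X * g * ?Y) = ?X * ?t * (?Y * ?X) * g * ?Y" by (simp only: mult.assoc)
    thus ?thesis by (simp only: YX mult_1_right mult.assoc)
  qed
  ultimately show ?case using step.IH E_mult by auto
qed

text \<open>Six powers of \<open>s\<close> are the b^6 of \<open>conj_root_by_root\<close>, and the
  other 2m are split evenly as in the integral case. Each further factor of \<open>h\<close> puts a
  product Y X = s^2 between the conjugates; since it cannot be cancelled, the exponent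
  \<open>a\<close> grows with the length of the word.\<close>

lemma conj_by_root_fraction:
  assumes s: "s \<in> D" "x \<in> D" and ij: "i \<in> K" "j \<in> K" "fst i \<noteq> fst j" and h: "h \<in> E (lev s (2 * m + 6))"
  shows "\<exists>a. \<exists>h'\<in>E (lev s m). s ^ a \<bullet>\<^sub>s ((s \<bullet>\<^sub>s 1 + x \<bullet>\<^sub>s (z i * z j)) * h * (s \<bullet>\<^sub>s 1 - x \<bullet>\<^sub>s (z i * z j))) = s ^ (a + 2) \<bullet>\<^sub>s h'"
  using h
proof (induction h rule: E.induct)
  case one
  show ?case using cnj_product(3)[OF ij Vec_0[OF idl_D] Vec_0[OF idl_D], of s x]
    by (intro exI[of _ 0] bexI[of _ 1]) (simp_all add: power2_eq_square)
next
  case (step k l y g)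
  let ?X = "s \<bullet>\<^sub>s 1 + x \<bullet>\<^sub>s (z i * z j)" and ?Y = "s \<bullet>\<^sub>s 1 - x \<bullet>\<^sub>s (z i * z j)"
  let ?t = "1 + y \<bullet>\<^sub>s (z k * z l)"
  have YX: "?Y * ?X = (s * s) \<bullet>\<^sub>s 1" using cnj_product(4)[OF ij Vec_0[OF idl_D] Vec_0[OF idl_D], of s x] by simp
  obtain d where d: "d \<in> D" "y = s ^ (2 * m + 6) * d" using step by (auto simp: lev_def)
  have "y = s ^ 6 * (s ^ m * 1 * (s ^ m * d))" by (simp only: d power_add mult_2 mult_2_right ac_simps mult_1_left mult_1_right)
  moreover have "s ^ m * 1 \<in> lev s m" "s ^ m * d \<in> lev s m" using lev_self[OF s(1)] d by blast+
  ultimately obtain h where h: "h \<in> E (lev s m)" "?X * ?t * ?Y = (s * s) \<bullet>\<^sub>s h"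
    using conj_root_by_root[OF idl_lev[OF s(1), of m] ij step(1-3) s, of "s ^ m * 1" "s ^ m * d"] by auto
  obtain a h' where h': "h' \<in> E (lev s m)" "s ^ a \<bullet>\<^sub>s (?X * g * ?Y) = s ^ (a + 2) \<bullet>\<^sub>s h'" using step.IH by auto
  have "(s * s) \<bullet>\<^sub>s (?X * (?t * g) * ?Y) = (?X * ?t * ?Y) * (?X * g * ?Y)"
  proof -
    have "(?X * ?t * ?Y) * (?X * g * ?Y) = ?X * ?t * (?Y * ?X) * g * ?Y" by (simp only: mult.assoc)
    thus ?thesis by (simp only: YX sm_mult_left sm_mult_right mult_1_right mult.assoc)
  qed
  moreover have "s ^ (a + 2) \<bullet>\<^sub>s (?X * (?t * g) * ?Y) = s ^ a \<bullet>\<^sub>s (s * s) \<bullet>\<^sub>s (?X * (?t * g) * ?Y)"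
    by (simp only: sm_sm power_add power2_eq_square)
  ultimately have "s ^ (a + 2) \<bullet>\<^sub>s (?X * (?t * g) * ?Y) = ((s * s) \<bullet>\<^sub>s h) * (s ^ a \<bullet>\<^sub>s (?X * g * ?Y))"
    by (simp only: sm_mult_right h(2))
  also have "\<dots> = s ^ (a + 2 + 2) \<bullet>\<^sub>s (h * h')"
    by (simp only: h' sm_mult_left sm_mult_right sm_sm) (simp add: power_add power2_eq_square ac_simps)
  finally show ?case using h h' by (blast intro: E_mult)
qed

end

section \<open>Commutators with root elements that have a denominator\<close>

context clifford
begin

text \<open>The congruence modulo s^N is imposed on the action on vectors only. That is all the
  commutator estimate sees of \<open>g\<close>, since a root element is made of two vectors.\<close>

definition small :: "'b \<Rightarrow> nat \<Rightarrow> 'c \<Rightarrow> 'c \<Rightarrow> bool" where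
  "small s N g g' \<longleftrightarrow> g * g' = 1 \<and> g' * g = 1 \<and>
     (\<forall>k\<in>K. \<exists>a\<in>Vec D. g * z k * g' = z k + s ^ N \<bullet>\<^sub>s a)"

lemma small_mono:
  assumes "small s N g g'" "N' \<le> N" "s \<in> D"
  shows "small s N' g g'"
  unfolding small_def
proof (intro conjI ballI)
  fix k assume "k \<in> K"
  then obtain a where "a \<in> Vec D" "g * z k * g' = z k + s ^ N \<bullet>\<^sub>s a"
    using assms by (auto simp: small_def)
  moreover have "s ^ N = s ^ N' * s ^ (N - N')" using assms by (simp flip: power_add)
  ultimately show "\<exists>a\<in>Vec D. g * z k * g' = z k + s ^ N' \<bullet>\<^sub>s a"
    using assms by (intro bexI[of _ "s ^ (N - N') \<bullet>\<^sub>s a"]) auto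
qed (use assms in \<open>auto simp: small_def\<close>)

lemma anti_square:
  fixes x y w :: 'c
  assumes "br x y = 0" "y * y = 0"
  shows "w * y * (x * y) = 0" "y * x * (y * w) = 0"
proof -
  have "y * x = - (x * y)" by (rule br_0_anti) (use assms(1) br_commute in metis)
  hence "w * (y * x) * y = - (w * x * (y * y))" by (simp add: mult.assoc)
  thus "w * y * (x * y) = 0" by (simp add: assms(2) mult.assoc)
  have "x * y = - (y * x)" by (rule br_0_anti) (rule assms(1))
  hence "y * (x * y) * w = - (y * y * x * w)" by (simp add: mult.assoc)
  thus "y * x * (y * w) = 0" by (simp add: assms(2) mult.assoc)
qed

lemma one_plus_inverse:
  fixes w :: 'c
  assumes "w * w = 0"
  shows "(1 + t \<bullet>\<^sub>s w) * (1 + (- t) \<bullet>\<^sub>s w) = 1" "(1 + (- t) \<bullet>\<^sub>s w) * (1 + t \<bullet>\<^sub>s w) = 1"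
  using assms by (simp_all add: distrib_left distrib_right left_diff_distrib right_diff_distrib)

lemma conj_mult:
  fixes g g' x y :: "'c"
  assumes "g' * g = 1"
  shows "g * (x * y) * g' = (g * x * g') * (g * y * g')"
proof -
  have "(g * x * g') * (g * y * g') = g * x * (g' * g) * y * g'" by (simp only: mult.assoc)
  thus ?thesis by (simp only: assms mult_1_right mult.assoc)
qed

lemma conj_br:
  fixes g g' x y :: "'c"
  assumes "g' * g = 1"
  shows "br (g * x * g') (g * y * g') = g * br x y * g'"
  by (simp only: br_def conj_mult[OF assms, symmetric] distrib_left distrib_right)

text \<open>The key commutator estimate: \<open>g \<rho> g\<^sup>-\<^sup>1 \<rho>\<^sup>-\<^sup>1\<close> with \<open>\<rho> = 1 + (x / s) z\<^sub>k z\<^sub>l\<close> has integral parameters.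
  Writing \<open>p, q\<close> for the images of \<open>z\<^sub>k, z\<^sub>l\<close>, one splits off integral factors of \<open>1 + (x / s) p q\<close> until
  \<open>p\<close> and \<open>q\<close> lie in the span of \<open>z\<^sub>k, z\<^sub>l\<close> and their duals.\<close>

lemma small_commutator_root:
  assumes s: "s \<in> D" "x \<in> D" and kl: "k \<in> K" "l \<in> K" "fst k \<noteq> fst l"
    and g: "small s (8 * m + 13) g g'"
  shows "\<exists>a. \<exists>W\<in>E (lev s m). s ^ a \<bullet>\<^sub>s (g * (s \<bullet>\<^sub>s 1 + x \<bullet>\<^sub>s (z k * z l)) * g' * (s \<bullet>\<^sub>s 1 - x \<bullet>\<^sub>s (z k * z l)))
     = s ^ (a + 2) \<bullet>\<^sub>s W"
proof -
  \<comment> \<open>The level drops along 8m+13 -> 8m+12 = 2(4m+6) -> 4m+6 = 2(2m)+6 -> 2m -> m. One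
    power of \<open>s\<close> cancels the denominator of x / s, and the other drops come from
    \<open>conj_by_root_integral\<close>, \<open>conj_by_root_fraction\<close> and once more
    \<open>conj_by_root_integral\<close>.\<close>
  define t1 where "t1 = s ^ (8 * m + 12)"
  define t where "t = s * t1"
  have tD: "t1 \<in> D" "t \<in> D" using s by (auto simp: t1_def t_def)
  have t_eq: "s ^ (8 * m + 13) = t" by (simp add: t_def t1_def numeral_eq_Suc)
  have gg: "g * g' = 1" "g' * g = 1" using g by (auto simp: small_def)
  have kl': "dual k \<noteq> dual l" "l \<noteq> dual k" "k \<noteq> dual l" "k \<noteq> l" using kl by (auto simp: dual_def)
  have small_vec: "\<exists>a. (\<forall>j\<in>K. a j \<in> D) \<and> g * z i * g' = z i + t \<bullet>\<^sub>s vec a" if "i \<in> K" for i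
    using g that unfolding small_def t_eq Vec_def by blast
  obtain a where a: "\<And>j. j \<in> K \<Longrightarrow> a j \<in> D" "g * z k * g' = z k + t \<bullet>\<^sub>s vec a" using small_vec[OF kl(1)] by blast
  obtain b where b: "\<And>j. j \<in> K \<Longrightarrow> b j \<in> D" "g * z l * g' = z l + t \<bullet>\<^sub>s vec b" using small_vec[OF kl(2)] by blast
  obtain c where c: "\<And>j. j \<in> K \<Longrightarrow> c j \<in> D" "g * z (dual k) * g' = z (dual k) + t \<bullet>\<^sub>s vec c"
    using small_vec[of "dual k"] kl by auto
  have abc: "vec a \<in> Vec D" "vec b \<in> Vec D" "vec c \<in> Vec D" using a b c by (auto intro: vec_in_Vec)
  define p where "p = z k + t \<bullet>\<^sub>s vec a"
  define q where "q = z l + t \<bullet>\<^sub>s vec b"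
  define p' where "p' = z (dual k) + t \<bullet>\<^sub>s vec c"
  have pqV: "p \<in> Vec D" "q \<in> Vec D" "p' \<in> Vec D" using abc kl tD by (auto simp: p_def q_def p'_def)
  have pp: "p * p = 0" using conj_mult[OF gg(2), of "z k" "z k"] zz_K[OF kl(1)] by (simp add: p_def a)
  have pq: "br p q = 0" using conj_br[OF gg(2), of "z k" "z l"] kl kl' by (simp add: p_def q_def a b br_K)
  have pp': "br p p' = 1" using conj_br[OF gg(2), of "z k" "z (dual k)"] kl gg by (simp add: p_def p'_def a c br_K)
  define \<gamma> where "\<gamma> = 1 + t * a k"
  define \<delta> where "\<delta> = t * a (dual l)"
  have akD: "a k \<in> D" "a (dual l) \<in> D" "\<gamma> \<in> D" "\<delta> \<in> D" using a kl tD by (auto simp: \<gamma>_def \<delta>_def)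
  have pz: "br p (z (dual k)) = \<gamma> \<bullet>\<^sub>s 1" "br p (z l) = \<delta> \<bullet>\<^sub>s 1"
    using kl kl' by (simp_all add: p_def \<gamma>_def \<delta>_def br_vec_z br_K)
  obtain pb where pb: "pb \<in> D" "br p (vec b) = pb \<bullet>\<^sub>s 1" using Vec_br[OF pqV(1) abc(2)] by blast
  obtain pc where pc: "pc \<in> D" "br p (vec c) = pc \<bullet>\<^sub>s 1" using Vec_br[OF pqV(1) abc(3)] by blast
  have c1: "\<gamma> + t * pc = 1" using pp' by (intro sm_inj) (simp add: p'_def pz pc)
  have c0: "\<delta> + t * pb = 0" using pq by (intro sm_inj) (simp add: q_def pz pb)
  define m0 where "m0 = a k \<bullet>\<^sub>s z l - a (dual l) \<bullet>\<^sub>s z (dual k)"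
  \<comment> \<open>The combination of z_l and z_(dual k) that is orthogonal to \<open>p\<close>. It
    agrees with z_l modulo \<open>t\<close>.\<close>
  define v where "v = \<gamma> \<bullet>\<^sub>s z l - \<delta> \<bullet>\<^sub>s z (dual k)"
  have v_eq: "v = z l + t \<bullet>\<^sub>s m0" by (simp add: v_def m0_def \<gamma>_def \<delta>_def algebra_simps)
  \<comment> \<open>Chosen so that v + t r = (\<gamma> + t pc) q - (\<delta> + t pb) p'. The two
    coefficients are the pairings of \<open>p\<close> with \<open>p'\<close> and with
    \<open>q\<close>, that is 1 and 0, so the sum is \<open>q\<close>.\<close>
  define r where "r = (pc \<bullet>\<^sub>s z l - \<delta> \<bullet>\<^sub>s vec c) + (\<gamma> \<bullet>\<^sub>s vec b - pb \<bullet>\<^sub>s z (dual k)) + t \<bullet>\<^sub>s (pc \<bullet>\<^sub>s vec b - pb \<bullet>\<^sub>s vec c)"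
  have rV: "r \<in> Vec D" unfolding r_def using abc pb pc akD tD kl by (intro Vec_D_add Vec_D_diff Vec_D_sm) auto
  have pr: "br p r = 0" by (simp add: r_def pz pb pc ac_simps)
  have pv: "br p v = 0" by (simp add: v_def pz mult.commute)
  have q_eq: "q = v + t \<bullet>\<^sub>s r"
  proof -
    have "v + t \<bullet>\<^sub>s r = (\<gamma> + t * pc) \<bullet>\<^sub>s q - (\<delta> + t * pb) \<bullet>\<^sub>s p'"
      by (simp add: v_def r_def q_def p'_def algebra_simps)
    thus ?thesis by (simp add: c1 c0)
  qed
  have vv: "v * v = 0" unfolding v_def using kl kl' by (intro line_isotropic) auto
  have xt: "x * t1 = s ^ m * 1 * (s ^ m * (s ^ (6 * m + 12) * x))"
  proof -
    have "8 * m + 12 = m + (m + (6 * m + 12))" by simp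
    thus ?thesis unfolding t1_def by (simp only: power_add ac_simps mult_1_left)
  qed
  have xt_lev: "x * t1 \<in> lev s m" unfolding xt using s by (intro idlD(4)[OF idl_lev] lev_self) (auto simp: lev_def)
  have W1: "1 + (x * t1) \<bullet>\<^sub>s (p * r) \<in> E (lev s m)"
  proof -
    have "1 + (s ^ m * 1 * (s ^ m * (s ^ (6 * m + 12) * x)) * 1 * 1) \<bullet>\<^sub>s (p * r) \<in> E (lev s m)"
      using lev_self[OF s(1)] s
      by (intro transvection_in_E[OF idl_lev pqV(1) pp pqV(3) _ rV pr]) (auto simp: pp')
    thus ?thesis using xt by simp
  qed
  \<comment> \<open>The part of \<open>vec a\<close> orthogonal to z_l and z_(dual k), hence to
    \<open>v\<close>. Once it is split off, p0 lies in the span of z_k and z_(dual l), and a third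
    plane is orthogonal to both p0 and \<open>v\<close>.\<close>
  define y where "y = (\<lambda>j. if j = k \<or> j = dual l then 0 else a j)"
  have W2: "br (vec y) v = 0" "1 + (x * t1) \<bullet>\<^sub>s (vec y * v) \<in> E (lev s m)"
    unfolding v_def
    using E_line[where P = "lev s m" and k = "dual k" and l = l and g = \<gamma> and d = \<delta> and c = "x * t1" and y = y]
      kl akD a xt_lev s by (simp_all add: y_def)
  define n0 where "n0 = a k \<bullet>\<^sub>s z k + a (dual l) \<bullet>\<^sub>s z (dual l)"
  define p0 where "p0 = z k + t \<bullet>\<^sub>s n0"
  have a_split: "vec a = vec y + n0"
  proof -
    have "vec a - vec y = (\<Sum>j\<in>K. if j = k \<or> j = dual l then a j \<bullet>\<^sub>s z j else 0)"
      unfolding vec_def y_def sum_subtractf[symmetric] by (intro sum.cong) auto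
    also have "\<dots> = (\<Sum>j\<in>{k, dual l}. a j \<bullet>\<^sub>s z j)"
      using kl by (intro sum.mono_neutral_cong_right) auto
    also have "\<dots> = n0" using kl' by (simp add: n0_def)
    finally show ?thesis by (simp add: algebra_simps)
  qed
  have p_eq: "p = p0 + t \<bullet>\<^sub>s vec y" by (simp add: p_def p0_def a_split algebra_simps)
  have p0_alt: "p0 = \<gamma> \<bullet>\<^sub>s z k - (- \<delta>) \<bullet>\<^sub>s z (dual l)" by (simp add: p0_def n0_def \<gamma>_def \<delta>_def)
  have p0p0: "p0 * p0 = 0" unfolding p0_alt using kl kl' by (intro line_isotropic) auto
  have p0v: "br p0 v = 0" using kl kl' by (simp add: p0_alt v_def br_K mult.commute)
  have fac: "s \<bullet>\<^sub>s 1 + x \<bullet>\<^sub>s (p * q) = (1 + (x * t1) \<bullet>\<^sub>s (p * r)) * ((1 + (x * t1) \<bullet>\<^sub>s (vec y * v)) * (s \<bullet>\<^sub>s 1 + x \<bullet>\<^sub>s (p0 * v)))"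
  proof -
    have "(1 + (x * t1) \<bullet>\<^sub>s (vec y * v)) * (s \<bullet>\<^sub>s 1 + x \<bullet>\<^sub>s (p0 * v)) = (1 + ((x * t1) \<bullet>\<^sub>s vec y) * v) * (s \<bullet>\<^sub>s 1 + (x \<bullet>\<^sub>s p0) * v)"
      by simp
    also have "\<dots> = s \<bullet>\<^sub>s 1 + (s \<bullet>\<^sub>s ((x * t1) \<bullet>\<^sub>s vec y) + x \<bullet>\<^sub>s p0) * v"
      using vv p0v by (intro one_plus_scaled_left) auto
    also have "\<dots> = s \<bullet>\<^sub>s 1 + p * (x \<bullet>\<^sub>s v)"
      by (simp add: p_eq t_def algebra_simps)
    finally have 1: "(1 + (x * t1) \<bullet>\<^sub>s (vec y * v)) * (s \<bullet>\<^sub>s 1 + x \<bullet>\<^sub>s (p0 * v)) = s \<bullet>\<^sub>s 1 + p * (x \<bullet>\<^sub>s v)" .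
    have "(1 + (x * t1) \<bullet>\<^sub>s (p * r)) * (s \<bullet>\<^sub>s 1 + p * (x \<bullet>\<^sub>s v)) = (1 + p * ((x * t1) \<bullet>\<^sub>s r)) * (s \<bullet>\<^sub>s 1 + p * (x \<bullet>\<^sub>s v))"
      by simp
    also have "\<dots> = s \<bullet>\<^sub>s 1 + p * (s \<bullet>\<^sub>s ((x * t1) \<bullet>\<^sub>s r) + x \<bullet>\<^sub>s v)"
      using pp pr by (intro one_plus_scaled_right) auto
    also have "\<dots> = s \<bullet>\<^sub>s 1 + x \<bullet>\<^sub>s (p * q)"
      by (simp add: q_eq t_def algebra_simps)
    finally show ?thesis by (simp only: 1)
  qed
  obtain j where j: "j \<in> K" "fst j \<noteq> fst k" "fst j \<noteq> fst l" using third_index by blast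
  have j': "j \<noteq> k" "j \<noteq> l" "j \<noteq> dual k" "j \<noteq> dual l" "dual j \<noteq> k" "dual j \<noteq> l" "k \<noteq> dual j" "l \<noteq> dual j"
    using j by (auto simp: dual_def)
  have br0: "br p0 (z j) = 0" "br p0 (z (dual j)) = 0" "br v (z j) = 0" "br v (z (dual j)) = 0"
    "br (z j) (z (dual j)) = 1" "z j * z j = 0" "z (dual j) * z (dual j) = 0"
    using j j' kl by (auto simp: zz_K br_K p0_alt v_def)
  have br1: "br (z k) (z j) = 0" "br (z k) (z (dual j)) = 0" "br (z l) (z j) = 0" "br (z l) (z (dual j)) = 0"
    "br (z k) (z l) = 0"
    using j j' kl kl' by (auto simp: br_K)
  note ap0 = anticommuting_products[OF p0p0 vv br0(6,7) p0v br0(1-5)]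
  note ap1 = anticommuting_products[OF zz_K[OF kl(1)] zz_K[OF kl(2)] br0(6,7) br1(5,1-4) br0(5)]
  \<comment> \<open>The elements 1 + p0 z_j and s + x z_(dual j) v each split into a factor free of
    \<open>t\<close> (\<open>\<alpha>\<close>, \<open>B\<close>) and one whose parameter is t or x
    t1 (\<open>\<tau>\<close>, \<open>\<theta>\<close>). Only \<open>B\<close> carries the
    denominator.\<close>
  define \<alpha> where "\<alpha> = 1 + 1 \<bullet>\<^sub>s (z k * z j)"
  define \<alpha>' where "\<alpha>' = 1 - 1 \<bullet>\<^sub>s (z k * z j)"
  define \<tau> where "\<tau> = 1 + t \<bullet>\<^sub>s (n0 * z j)"
  define \<tau>' where "\<tau>' = 1 + (- t) \<bullet>\<^sub>s (n0 * z j)"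
  define \<theta> where "\<theta> = 1 + (x * t1) \<bullet>\<^sub>s (z (dual j) * m0)"
  define \<theta>' where "\<theta>' = 1 + (- (x * t1)) \<bullet>\<^sub>s (z (dual j) * m0)"
  define B where "B = s \<bullet>\<^sub>s 1 + x \<bullet>\<^sub>s (z (dual j) * z l)"
  define B' where "B' = s \<bullet>\<^sub>s 1 - x \<bullet>\<^sub>s (z (dual j) * z l)"
  have \<tau>_E: "1 + d \<bullet>\<^sub>s (n0 * z j) \<in> E (lev s M)" if d: "d \<in> lev s M" for d M
  proof -
    have dl: "d * a k \<in> lev s M" "d * a (dual l) \<in> lev s M" "- (d * a (dual l)) \<in> lev s M"
      using idlD(5,6)[OF idl_lev[OF s(1), of M]] d akD by blast+
    have "1 + d \<bullet>\<^sub>s (n0 * z j) = 1 + ((d * a k) \<bullet>\<^sub>s z k + (d * a (dual l)) \<bullet>\<^sub>s z (dual l)) * z j"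
      by (simp add: n0_def algebra_simps)
    also have "\<dots> = (1 + ((d * a k) \<bullet>\<^sub>s z k) * z j) * (1 + ((d * a (dual l)) \<bullet>\<^sub>s z (dual l)) * z j)"
      using j j' kl by (intro one_plus_mult_left[symmetric]) (auto simp: zz_K br_K)
    also have "\<dots> \<in> E (lev s M)" unfolding sm_mult_left
      using dl j j' kl by (intro E_mult E_root) auto
    finally show ?thesis .
  qed
  have \<theta>_E: "1 + d \<bullet>\<^sub>s (z (dual j) * m0) \<in> E (lev s M)" if d: "d \<in> lev s M" for d M
  proof -
    have dl: "d * a k \<in> lev s M" "d * a (dual l) \<in> lev s M" "- (d * a (dual l)) \<in> lev s M"
      using idlD(5,6)[OF idl_lev[OF s(1), of M]] d akD by blast+
    have "1 + d \<bullet>\<^sub>s (z (dual j) * m0) = 1 + z (dual j) * ((d * a k) \<bullet>\<^sub>s z l + (- (d * a (dual l))) \<bullet>\<^sub>s z (dual k))"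
      by (simp add: m0_def algebra_simps)
    also have "\<dots> = (1 + z (dual j) * ((d * a k) \<bullet>\<^sub>s z l)) * (1 + z (dual j) * ((- (d * a (dual l))) \<bullet>\<^sub>s z (dual k)))"
      using j j' kl by (intro one_plus_mult_right[symmetric]) (auto simp: zz_K br_K)
    also have "\<dots> \<in> E (lev s M)" unfolding sm_mult_right
      using dl j j' kl by (intro E_mult E_root) auto
    finally show ?thesis .
  qed
  have lev_t: "t \<in> lev s (2 * (4 * m + 6))" "- t \<in> lev s (2 * (4 * m + 6))"
    "x * t1 \<in> lev s (2 * (4 * m + 6))" "- (x * t1) \<in> lev s (2 * (4 * m + 6))"
    using levI[OF s(1), of s "2 * (4 * m + 6)" "8 * m + 12"] levI[OF s(1), of x "2 * (4 * m + 6)" "8 * m + 12"] s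
      idlD(6)[OF idl_lev[OF s(1), of "2 * (4 * m + 6)"]]
    by (auto simp: t_def t1_def mult.commute)
  have E8: "\<tau> \<in> E (lev s (2 * (4 * m + 6)))" "\<tau>' \<in> E (lev s (2 * (4 * m + 6)))"
    "\<theta> \<in> E (lev s (2 * (4 * m + 6)))" "\<theta>' \<in> E (lev s (2 * (4 * m + 6)))"
    unfolding \<tau>_def \<tau>'_def \<theta>_def \<theta>'_def by (intro \<tau>_E \<theta>_E lev_t)+
  have \<alpha>: "\<alpha>' * \<alpha> = 1" "\<alpha> * \<alpha>' = 1"
    using cnj_product(3,4)[OF kl(1) j(1) j(2)[symmetric] Vec_0[OF idl_D] Vec_0[OF idl_D], of 1 1]
    by (simp_all add: \<alpha>_def \<alpha>'_def)
  have nm: "br n0 (z j) = 0" "br m0 (z (dual j)) = 0" 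
  proof -
    have "br (z k) (z j) = 0" "br (z (dual l)) (z j) = 0" "br (z l) (z (dual j)) = 0" "br (z (dual k)) (z (dual j)) = 0"
      using j j' kl by (auto simp: br_K)
    thus "br n0 (z j) = 0" "br m0 (z (dual j)) = 0"
      unfolding n0_def m0_def by (simp_all only: br_simps br_sm sm_zero_right add_0_right diff_self)
  qed
  have nj: "n0 * z j * (n0 * z j) = 0" by (rule anti_square(1)[OF nm(1) br0(6)])
  have mj: "z (dual j) * m0 * (z (dual j) * m0) = 0" by (rule anti_square(2)[OF nm(2) br0(7)])
  have \<tau>: "\<tau> * \<tau>' = 1" "\<tau>' * \<tau> = 1" unfolding \<tau>_def \<tau>'_def by (rule one_plus_inverse[OF nj])+
  have \<theta>: "\<theta> * \<theta>' = 1" "\<theta>' * \<theta> = 1" unfolding \<theta>_def \<theta>'_def by (rule one_plus_inverse[OF mj])+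
  have zj_anti: "z k * z j * (n0 * z j) = 0" "n0 * z j * (z k * z j) = 0"
    "z (dual j) * z l * (z (dual j) * m0) = 0" "z (dual j) * m0 * (z (dual j) * z l) = 0"
    by (rule anti_square(1)[OF nm(1) br0(6)] anti_square(1)[OF br1(1) br0(6)]
        anti_square(2)[OF br1(4) br0(7)] anti_square(2)[OF nm(2) br0(7)])+
  have f1: "1 + p0 * z j = \<alpha> * \<tau>" "1 - p0 * z j = \<tau>' * \<alpha>'"
    by (simp_all add: p0_def \<alpha>_def \<alpha>'_def \<tau>_def \<tau>'_def algebra_simps zj_anti[unfolded mult.assoc])
  have f2: "s \<bullet>\<^sub>s 1 + x \<bullet>\<^sub>s (z (dual j) * v) = B * \<theta>" "s \<bullet>\<^sub>s 1 - x \<bullet>\<^sub>s (z (dual j) * v) = \<theta>' * B'"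
    by (simp_all add: v_eq B_def B'_def \<theta>_def \<theta>'_def t_def algebra_simps zj_anti[unfolded mult.assoc])
  have e1: "\<alpha> * \<tau> * (B * \<theta>) * (\<tau>' * \<alpha>') * (\<theta>' * B') = s \<bullet>\<^sub>s (s \<bullet>\<^sub>s 1 + x \<bullet>\<^sub>s (p0 * v))"
    using commutator_identity(1)[OF ap0(1-4), of s x] unfolding ap0(5) f1 f2 by simp
  have e2: "B * \<alpha> * B' * \<alpha>' = s \<bullet>\<^sub>s (s \<bullet>\<^sub>s 1 - x \<bullet>\<^sub>s (z k * z l))"
    using commutator_identity(2)[OF ap1(1-4), of s x] unfolding ap1(5) by (simp add: B_def B'_def \<alpha>_def \<alpha>'_def)
  have B'B: "B' * B = (s * s) \<bullet>\<^sub>s 1"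
    unfolding B_def B'_def using cnj_product(4)[of "dual j" l, OF _ kl(2) _ Vec_0[OF idl_D] Vec_0[OF idl_D]] j by auto
  \<comment> \<open>In the product of the commutators \<open>e1\<close> and \<open>e2\<close> the
    factors B' and B meet and leave s^2. What remains is \<alpha> \<tau> (B h B') \<alpha>', where
    \<open>h\<close> is integral and of high level.\<close>
  define h where "h = \<theta> * \<tau>' * (\<alpha>' * \<theta>' * \<alpha>)"
  have h1: "\<alpha>' * \<theta>' * \<alpha> \<in> E (lev s (4 * m + 6))"
    using conj_by_root_integral[OF s(1) D_uminus[OF D_1] kl(1) j(1) j(2)[symmetric] E8(4)] by (simp add: \<alpha>_def \<alpha>'_def)
  have "\<theta> * \<tau>' \<in> E (lev s (2 * (4 * m + 6)))" using E8 by (intro E_mult)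
  hence "\<theta> * \<tau>' \<in> E (lev s (4 * m + 6))" by (rule E_lev_mono[OF s(1), rotated]) simp
  from E_mult[OF this h1] have "h \<in> E (lev s (4 * m + 6))" by (simp only: h_def)
  hence h: "h \<in> E (lev s (2 * (2 * m) + 6))" by simp
  obtain a0 h' where h': "h' \<in> E (lev s (2 * m))" "s ^ a0 \<bullet>\<^sub>s (B * h * B') = s ^ (a0 + 2) \<bullet>\<^sub>s h'"
    using conj_by_root_fraction[OF s, of "dual j" l, OF _ _ _ h] j kl unfolding B_def B'_def by auto
  have \<alpha>_conj: "\<alpha> * w * \<alpha>' \<in> E (lev s m)" if "w \<in> E (lev s (2 * m))" for w
    using conj_by_root_integral[OF s(1) D_1 kl(1) j(1) j(2)[symmetric] that] by (simp add: \<alpha>_def \<alpha>'_def)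
  define W3 where "W3 = (\<alpha> * \<tau> * \<alpha>') * (\<alpha> * h' * \<alpha>')"
  have W3: "W3 \<in> E (lev s m)" unfolding W3_def
    using h' E8(1) E_lev_mono[OF s(1), of "2 * m" "2 * (4 * m + 6)"] by (intro E_mult \<alpha>_conj) auto
  have "(s * s) \<bullet>\<^sub>s ((s \<bullet>\<^sub>s 1 + x \<bullet>\<^sub>s (p0 * v)) * (s \<bullet>\<^sub>s 1 - x \<bullet>\<^sub>s (z k * z l))) =
      (s \<bullet>\<^sub>s (s \<bullet>\<^sub>s 1 + x \<bullet>\<^sub>s (p0 * v))) * (s \<bullet>\<^sub>s (s \<bullet>\<^sub>s 1 - x \<bullet>\<^sub>s (z k * z l)))"
    by (simp only: sm_mult_left sm_mult_right sm_sm)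
  also have "\<dots> = (\<alpha> * \<tau> * (B * \<theta>) * (\<tau>' * \<alpha>') * (\<theta>' * B')) * (B * \<alpha> * B' * \<alpha>')"
    by (simp only: e1 e2)
  also have "\<dots> = \<alpha> * \<tau> * B * \<theta> * \<tau>' * \<alpha>' * \<theta>' * (B' * B) * \<alpha> * B' * \<alpha>'"
    by (simp only: mult.assoc)
  also have "\<dots> = (s * s) \<bullet>\<^sub>s (\<alpha> * \<tau> * (B * h * B') * \<alpha>')"
    unfolding B'B h_def by (simp only: sm_mult_left sm_mult_right mult_1_right mult.assoc)
  finally have e3: "(s * s) \<bullet>\<^sub>s ((s \<bullet>\<^sub>s 1 + x \<bullet>\<^sub>s (p0 * v)) * (s \<bullet>\<^sub>s 1 - x \<bullet>\<^sub>s (z k * z l))) =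
      (s * s) \<bullet>\<^sub>s (\<alpha> * \<tau> * (B * h * B') * \<alpha>')" .
  have e4: "s ^ (a0 + 2) \<bullet>\<^sub>s ((s \<bullet>\<^sub>s 1 + x \<bullet>\<^sub>s (p0 * v)) * (s \<bullet>\<^sub>s 1 - x \<bullet>\<^sub>s (z k * z l))) = s ^ (a0 + 2 + 2) \<bullet>\<^sub>s W3"
  proof -
    have "s ^ (a0 + 2) \<bullet>\<^sub>s ((s \<bullet>\<^sub>s 1 + x \<bullet>\<^sub>s (p0 * v)) * (s \<bullet>\<^sub>s 1 - x \<bullet>\<^sub>s (z k * z l))) =
        s ^ a0 \<bullet>\<^sub>s (s * s) \<bullet>\<^sub>s ((s \<bullet>\<^sub>s 1 + x \<bullet>\<^sub>s (p0 * v)) * (s \<bullet>\<^sub>s 1 - x \<bullet>\<^sub>s (z k * z l)))"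
      by (simp only: sm_sm power_add power2_eq_square)
    also have "\<dots> = (s * s) \<bullet>\<^sub>s (\<alpha> * \<tau> * (s ^ a0 \<bullet>\<^sub>s (B * h * B')) * \<alpha>')"
      unfolding e3 by (simp only: sm_sm sm_mult_left sm_mult_right mult.commute)
    also have "\<dots> = s ^ (a0 + 2 + 2) \<bullet>\<^sub>s (\<alpha> * \<tau> * h' * \<alpha>')"
      unfolding h' by (simp only: sm_sm sm_mult_left sm_mult_right) (simp add: power_add power2_eq_square ac_simps)
    also have "\<alpha> * \<tau> * h' * \<alpha>' = W3"
    proof -
      have "W3 = \<alpha> * \<tau> * (\<alpha>' * \<alpha>) * h' * \<alpha>'" by (simp only: W3_def mult.assoc)
      thus ?thesis by (simp only: \<alpha> mult_1_right)
    qed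
    finally show ?thesis .
  qed
  let ?W1 = "1 + (x * t1) \<bullet>\<^sub>s (p * r)" and ?W2 = "1 + (x * t1) \<bullet>\<^sub>s (vec y * v)"
  have "g * (s \<bullet>\<^sub>s 1 + x \<bullet>\<^sub>s (z k * z l)) * g' = s \<bullet>\<^sub>s 1 + x \<bullet>\<^sub>s (p * q)"
    using conj_mult[OF gg(2), of "z k" "z l"] gg by (simp add: p_def q_def a b distrib_left distrib_right)
  hence "g * (s \<bullet>\<^sub>s 1 + x \<bullet>\<^sub>s (z k * z l)) * g' * (s \<bullet>\<^sub>s 1 - x \<bullet>\<^sub>s (z k * z l)) =
      ?W1 * ?W2 * ((s \<bullet>\<^sub>s 1 + x \<bullet>\<^sub>s (p0 * v)) * (s \<bullet>\<^sub>s 1 - x \<bullet>\<^sub>s (z k * z l)))"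
    unfolding fac by (simp only: mult.assoc)
  hence "s ^ (a0 + 2) \<bullet>\<^sub>s (g * (s \<bullet>\<^sub>s 1 + x \<bullet>\<^sub>s (z k * z l)) * g' * (s \<bullet>\<^sub>s 1 - x \<bullet>\<^sub>s (z k * z l))) =
      ?W1 * ?W2 * (s ^ (a0 + 2) \<bullet>\<^sub>s ((s \<bullet>\<^sub>s 1 + x \<bullet>\<^sub>s (p0 * v)) * (s \<bullet>\<^sub>s 1 - x \<bullet>\<^sub>s (z k * z l))))"
    by (simp only: sm_mult_right)
  also have "\<dots> = s ^ (a0 + 2 + 2) \<bullet>\<^sub>s (?W1 * ?W2 * W3)"
    unfolding e4 by (simp only: sm_mult_right)
  finally show ?thesis using W1 W2 W3 by (intro exI[of _ "a0 + 2"] bexI[of _ "?W1 * ?W2 * W3"] E_mult)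
qed

end

section \<open>Unit vectors as elementary elements after inverting a coordinate\<close>

context clifford
begin

text \<open>\<open>good s X Y a\<close>: here \<open>X / s ^ a\<close> and \<open>Y / s ^ a\<close> are mutually inverse, conjugation by \<open>X / s ^ a\<close> maps
  elementary products of high level in \<open>s\<close> to elementary products, and the commutator of \<open>X / s ^ a\<close>
  with an element of high level is an elementary product. Equations hold only up to powers of \<open>s\<close>,
  which may be a zero divisor.\<close>

definition good :: "'b \<Rightarrow> 'c \<Rightarrow> 'c \<Rightarrow> nat \<Rightarrow> bool" where
  "good s X Y a \<longleftrightarrow> X * Y = s ^ (2 * a) \<bullet>\<^sub>s 1 \<and> Y * X = s ^ (2 * a) \<bullet>\<^sub>s 1 \<and>
     (\<forall>m. \<exists>N. \<forall>h\<in>E (lev s N). \<exists>j. \<exists>h'\<in>E (lev s m). s ^ j \<bullet>\<^sub>s (X * h * Y) = s ^ (j + 2 * a) \<bullet>\<^sub>s h') \<and>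
     (\<forall>m. \<exists>N. \<forall>g g'. small s N g g' \<longrightarrow>
        (\<exists>j. \<exists>W\<in>E (lev s m). s ^ j \<bullet>\<^sub>s (g * X * g' * Y) = s ^ (j + 2 * a) \<bullet>\<^sub>s W))"

lemma good_root:
  assumes "s \<in> D" "x \<in> D" "k \<in> K" "l \<in> K" "fst k \<noteq> fst l"
  shows "good s (s \<bullet>\<^sub>s 1 + x \<bullet>\<^sub>s (z k * z l)) (s \<bullet>\<^sub>s 1 - x \<bullet>\<^sub>s (z k * z l)) 1"
  unfolding good_def
proof (intro conjI allI)
  fix m
  show "\<exists>N. \<forall>h\<in>E (lev s N). \<exists>j. \<exists>h'\<in>E (lev s m). s ^ j \<bullet>\<^sub>s ((s \<bullet>\<^sub>s 1 + x \<bullet>\<^sub>s (z k * z l)) * h *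
      (s \<bullet>\<^sub>s 1 - x \<bullet>\<^sub>s (z k * z l))) = s ^ (j + 2 * 1) \<bullet>\<^sub>s h'"
    by (rule exI[of _ "2 * m + 6"], rule ballI) (use conj_by_root_fraction[OF assms, of _ m] in simp)
  show "\<exists>N. \<forall>g g'. small s N g g' \<longrightarrow> (\<exists>j. \<exists>W\<in>E (lev s m). s ^ j \<bullet>\<^sub>s (g * (s \<bullet>\<^sub>s 1 + x \<bullet>\<^sub>s (z k * z l)) * g' *
      (s \<bullet>\<^sub>s 1 - x \<bullet>\<^sub>s (z k * z l))) = s ^ (j + 2 * 1) \<bullet>\<^sub>s W)"
    by (rule exI[of _ "8 * m + 13"], intro allI impI) (use small_commutator_root[OF assms, of m] in simp)
qed (use cnj_product(3,4)[OF assms(3-5) Vec_0[OF idl_D] Vec_0[OF idl_D], of s x] in \<open>simp_all add: power2_eq_square\<close>)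

text \<open>The commutator of \<open>g\<close> with X1 X2 is the commutator with X1 times the
  X1-conjugate of the commutator with X2. The conjugation clause of \<open>good\<close> for X1
  absorbs the second factor, so the two clauses have to be carried together.\<close>

lemma good_mult:
  assumes s: "s \<in> D" and 1: "good s X1 Y1 a1" and 2: "good s X2 Y2 a2"
  shows "good s (X1 * X2) (Y2 * Y1) (a1 + a2)"
  unfolding good_def
proof (intro conjI allI)
  have XY: "X1 * Y1 = s ^ (2 * a1) \<bullet>\<^sub>s 1" "Y1 * X1 = s ^ (2 * a1) \<bullet>\<^sub>s 1"
    "X2 * Y2 = s ^ (2 * a2) \<bullet>\<^sub>s 1" "Y2 * X2 = s ^ (2 * a2) \<bullet>\<^sub>s 1"
    using 1 2 by (auto simp: good_def)
  have "X1 * X2 * (Y2 * Y1) = X1 * (X2 * Y2) * Y1" "Y2 * Y1 * (X1 * X2) = Y2 * (Y1 * X1) * X2"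
    by (simp_all only: mult.assoc)
  thus "X1 * X2 * (Y2 * Y1) = s ^ (2 * (a1 + a2)) \<bullet>\<^sub>s 1" "Y2 * Y1 * (X1 * X2) = s ^ (2 * (a1 + a2)) \<bullet>\<^sub>s 1"
    by (simp_all add: XY power_add distrib_left mult.commute)
  fix m
  from 1 obtain N1 where N1: "\<And>h. h \<in> E (lev s N1) \<Longrightarrow>
      \<exists>j. \<exists>h'\<in>E (lev s m). s ^ j \<bullet>\<^sub>s (X1 * h * Y1) = s ^ (j + 2 * a1) \<bullet>\<^sub>s h'"
    unfolding good_def by blast
  from 2 obtain N2 where N2: "\<And>h. h \<in> E (lev s N2) \<Longrightarrow>
      \<exists>j. \<exists>h'\<in>E (lev s N1). s ^ j \<bullet>\<^sub>s (X2 * h * Y2) = s ^ (j + 2 * a2) \<bullet>\<^sub>s h'"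
    unfolding good_def by blast
  show "\<exists>N. \<forall>h\<in>E (lev s N). \<exists>j. \<exists>h'\<in>E (lev s m). s ^ j \<bullet>\<^sub>s (X1 * X2 * h * (Y2 * Y1)) = s ^ (j + 2 * (a1 + a2)) \<bullet>\<^sub>s h'"
  proof (rule exI[of _ N2], rule ballI)
    fix h assume "h \<in> E (lev s N2)"
    then obtain j2 h2 where 2: "h2 \<in> E (lev s N1)" "s ^ j2 \<bullet>\<^sub>s (X2 * h * Y2) = s ^ (j2 + 2 * a2) \<bullet>\<^sub>s h2"
      using N2 by blast
    then obtain j1 h1 where 1: "h1 \<in> E (lev s m)" "s ^ j1 \<bullet>\<^sub>s (X1 * h2 * Y1) = s ^ (j1 + 2 * a1) \<bullet>\<^sub>s h1"
      using N1 by blast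
    have "s ^ (j1 + j2) \<bullet>\<^sub>s (X1 * X2 * h * (Y2 * Y1)) = s ^ j1 \<bullet>\<^sub>s (X1 * (s ^ j2 \<bullet>\<^sub>s (X2 * h * Y2)) * Y1)"
      by (simp only: power_add sm_mult_left sm_mult_right sm_sm mult.assoc)
    also have "\<dots> = s ^ (j2 + 2 * a2) \<bullet>\<^sub>s s ^ j1 \<bullet>\<^sub>s (X1 * h2 * Y1)"
      unfolding 2 by (simp only: sm_mult_left sm_mult_right sm_sm mult.commute)
    also have "\<dots> = s ^ ((j1 + j2) + 2 * (a1 + a2)) \<bullet>\<^sub>s h1"
      unfolding 1 sm_sm by (simp add: power_add[symmetric] algebra_simps)
    finally show "\<exists>j. \<exists>h'\<in>E (lev s m). s ^ j \<bullet>\<^sub>s (X1 * X2 * h * (Y2 * Y1)) = s ^ (j + 2 * (a1 + a2)) \<bullet>\<^sub>s h'"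
      using 1 by blast
  qed
  from 1 obtain M1 where M1: "\<And>g g'. small s M1 g g' \<Longrightarrow>
      \<exists>j. \<exists>W\<in>E (lev s m). s ^ j \<bullet>\<^sub>s (g * X1 * g' * Y1) = s ^ (j + 2 * a1) \<bullet>\<^sub>s W"
    unfolding good_def by blast
  from 2 obtain M2 where M2: "\<And>g g'. small s M2 g g' \<Longrightarrow>
      \<exists>j. \<exists>W\<in>E (lev s N1). s ^ j \<bullet>\<^sub>s (g * X2 * g' * Y2) = s ^ (j + 2 * a2) \<bullet>\<^sub>s W"
    unfolding good_def by blast
  show "\<exists>N. \<forall>g g'. small s N g g' \<longrightarrow>
      (\<exists>j. \<exists>W\<in>E (lev s m). s ^ j \<bullet>\<^sub>s (g * (X1 * X2) * g' * (Y2 * Y1)) = s ^ (j + 2 * (a1 + a2)) \<bullet>\<^sub>s W)"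
  proof (rule exI[of _ "max M1 M2"], intro allI impI)
    fix g g' assume g: "small s (max M1 M2) g g'"
    obtain j1 W1 where 1: "W1 \<in> E (lev s m)" "s ^ j1 \<bullet>\<^sub>s (g * X1 * g' * Y1) = s ^ (j1 + 2 * a1) \<bullet>\<^sub>s W1"
      using M1[OF small_mono[OF g _ s]] by auto
    obtain j2 W2 where 2: "W2 \<in> E (lev s N1)" "s ^ j2 \<bullet>\<^sub>s (g * X2 * g' * Y2) = s ^ (j2 + 2 * a2) \<bullet>\<^sub>s W2"
      using M2[OF small_mono[OF g _ s]] by auto
    obtain j3 W3 where 3: "W3 \<in> E (lev s m)" "s ^ j3 \<bullet>\<^sub>s (X1 * W2 * Y1) = s ^ (j3 + 2 * a1) \<bullet>\<^sub>s W3"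
      using N1[OF 2(1)] by auto
    have gg: "g' * g = 1" using g by (simp add: small_def)
    have "s ^ j2 \<bullet>\<^sub>s (g * (X1 * X2) * g' * (Y2 * Y1)) = g * X1 * g' * (s ^ j2 \<bullet>\<^sub>s (g * X2 * g' * Y2)) * Y1"
    proof -
      have "g * X1 * g' * (g * X2 * g' * Y2) * Y1 = g * X1 * (g' * g) * X2 * g' * Y2 * Y1"
        by (simp only: mult.assoc)
      thus ?thesis by (simp only: gg sm_mult_left sm_mult_right mult_1_right mult.assoc)
    qed
    hence A: "s ^ j2 \<bullet>\<^sub>s (g * (X1 * X2) * g' * (Y2 * Y1)) = s ^ (j2 + 2 * a2) \<bullet>\<^sub>s (g * X1 * g' * W2 * Y1)"
      by (simp only: 2 sm_mult_left sm_mult_right)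
    have "s ^ (2 * a1) \<bullet>\<^sub>s (g * X1 * g' * W2 * Y1) = (g * X1 * g' * Y1) * (X1 * W2 * Y1)"
    proof -
      have "(g * X1 * g' * Y1) * (X1 * W2 * Y1) = g * X1 * g' * (Y1 * X1) * W2 * Y1"
        by (simp only: mult.assoc)
      thus ?thesis by (simp only: XY sm_mult_left sm_mult_right mult_1_right mult.assoc)
    qed
    hence "s ^ j1 \<bullet>\<^sub>s s ^ j3 \<bullet>\<^sub>s s ^ (2 * a1) \<bullet>\<^sub>s (g * X1 * g' * W2 * Y1) =
        (s ^ j1 \<bullet>\<^sub>s (g * X1 * g' * Y1)) * (s ^ j3 \<bullet>\<^sub>s (X1 * W2 * Y1))"
      by (simp only: sm_mult_left sm_mult_right) (simp only: sm_sm ac_simps)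
    hence B: "s ^ j1 \<bullet>\<^sub>s s ^ j3 \<bullet>\<^sub>s s ^ (2 * a1) \<bullet>\<^sub>s (g * X1 * g' * W2 * Y1) =
        s ^ (j1 + 2 * a1) \<bullet>\<^sub>s s ^ (j3 + 2 * a1) \<bullet>\<^sub>s (W1 * W3)"
      by (simp only: 1 3 sm_mult_left sm_mult_right) (simp only: sm_sm ac_simps)
    have "s ^ (j1 + j3 + 2 * a1 + j2) \<bullet>\<^sub>s (g * (X1 * X2) * g' * (Y2 * Y1)) =
        s ^ j1 \<bullet>\<^sub>s s ^ j3 \<bullet>\<^sub>s s ^ (2 * a1) \<bullet>\<^sub>s (s ^ j2 \<bullet>\<^sub>s (g * (X1 * X2) * g' * (Y2 * Y1)))"
      by (simp only: sm_sm power_add mult.assoc)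
    also have "\<dots> = s ^ (j2 + 2 * a2) \<bullet>\<^sub>s (s ^ j1 \<bullet>\<^sub>s s ^ j3 \<bullet>\<^sub>s s ^ (2 * a1) \<bullet>\<^sub>s (g * X1 * g' * W2 * Y1))"
      unfolding A by (simp only: sm_sm ac_simps)
    also have "\<dots> = s ^ ((j1 + j3 + 2 * a1 + j2) + 2 * (a1 + a2)) \<bullet>\<^sub>s (W1 * W3)"
      unfolding B unfolding sm_sm power_add[symmetric] by (rule arg_cong[of _ _ "\<lambda>e. s ^ e \<bullet>\<^sub>s (W1 * W3)"]) simp
    finally show "\<exists>j. \<exists>W\<in>E (lev s m). s ^ j \<bullet>\<^sub>s (g * (X1 * X2) * g' * (Y2 * Y1)) = s ^ (j + 2 * (a1 + a2)) \<bullet>\<^sub>s W"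
      using 1 3 by (blast intro: E_mult)
  qed
qed

text \<open>Here \<open>\<sigma>\<close> and \<open>\<sigma>'\<close> have no denominators
  themselves; \<open>good\<close> is asked of their multiples by s^a, which is how they are viewed
  over the localisation.\<close>

definition fracE :: "'b \<Rightarrow> 'c \<Rightarrow> 'c \<Rightarrow> bool" where
  "fracE s \<sigma> \<sigma>' \<longleftrightarrow> (\<exists>a. good s (s ^ a \<bullet>\<^sub>s \<sigma>) (s ^ a \<bullet>\<^sub>s \<sigma>') a)"

lemma fracE_mult:
  assumes "s \<in> D" "fracE s \<sigma>1 \<sigma>1'" "fracE s \<sigma>2 \<sigma>2'"
  shows "fracE s (\<sigma>1 * \<sigma>2) (\<sigma>2' * \<sigma>1')"
proof -
  obtain a1 where 1: "good s (s ^ a1 \<bullet>\<^sub>s \<sigma>1) (s ^ a1 \<bullet>\<^sub>s \<sigma>1') a1" using assms by (auto simp: fracE_def)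
  obtain a2 where 2: "good s (s ^ a2 \<bullet>\<^sub>s \<sigma>2) (s ^ a2 \<bullet>\<^sub>s \<sigma>2') a2" using assms by (auto simp: fracE_def)
  show ?thesis unfolding fracE_def
    using good_mult[OF assms(1) 1 2] by (intro exI[of _ "a1 + a2"]) (simp add: power_add mult.commute)
qed

lemma fracE_E:
  assumes s: "s \<in> D" and g: "g \<in> E D"
  shows "\<exists>g'. g * g' = 1 \<and> g' * g = 1 \<and> fracE s g g'"
  using g
proof (induction g rule: E.induct)
  case one
  have "good s (s ^ 0 \<bullet>\<^sub>s 1) (s ^ 0 \<bullet>\<^sub>s 1) 0"
    unfolding good_def
  proof (intro conjI allI)
    fix m
    show "\<exists>N. \<forall>h\<in>E (lev s N). \<exists>j. \<exists>h'\<in>E (lev s m). s ^ j \<bullet>\<^sub>s (s ^ 0 \<bullet>\<^sub>s 1 * h * s ^ 0 \<bullet>\<^sub>s 1) = s ^ (j + 2 * 0) \<bullet>\<^sub>s h'"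
      by (rule exI[of _ m]) auto
    show "\<exists>N. \<forall>g g'. small s N g g' \<longrightarrow> (\<exists>j. \<exists>W\<in>E (lev s m). s ^ j \<bullet>\<^sub>s (g * s ^ 0 \<bullet>\<^sub>s 1 * g' * s ^ 0 \<bullet>\<^sub>s 1) = s ^ (j + 2 * 0) \<bullet>\<^sub>s W)"
      by (auto simp: small_def intro: E.one)
  qed simp_all
  hence "fracE s 1 1" unfolding fracE_def by blast
  thus ?case by (intro exI[of _ 1]) simp
next
  case (step k l x g)
  then obtain g' where g': "g * g' = 1" "g' * g = 1" "fracE s g g'" by auto
  let ?r = "1 + x \<bullet>\<^sub>s (z k * z l)" and ?r' = "1 - x \<bullet>\<^sub>s (z k * z l)"
  have rr: "?r * ?r' = 1" "?r' * ?r = 1"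
    using cnj_product(3,4)[OF step(1-3) Vec_0[OF idl_D] Vec_0[OF idl_D], of 1 x] by simp_all
  \<comment> \<open>A root element without denominator is read as the fraction (s + s x z_k z_l) /
    s.\<close>
  have "good s (s ^ 1 \<bullet>\<^sub>s ?r) (s ^ 1 \<bullet>\<^sub>s ?r') 1"
    using good_root[OF s, of "s * x" k l] step s by simp
  hence "fracE s ?r ?r'" unfolding fracE_def by blast
  from fracE_mult[OF s this g'(3)] have "fracE s (?r * g) (g' * ?r')" .
  moreover have "?r * g * (g' * ?r') = ?r * (g * g') * ?r'" "g' * ?r' * (?r * g) = g' * (?r' * ?r) * g"
    by (simp_all only: mult.assoc)
  ultimately show ?case using rr g' by (intro exI[of _ "g' * ?r'"]) simp
qed

definition h0 :: 'c where
  "h0 = z (0, True) + z (0, False)"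

lemma K0 [simp]: "(0, b) \<in> K"
  using n_ge_3 by (simp add: K_def)

lemma h0_Vec [simp]: "h0 \<in> Vec D"
  by (simp add: h0_def)

lemma h0_h0: "h0 * h0 = 1"
  using br_K[of "(0, True)" "(0, False)"] by (simp add: h0_def br_def algebra_simps zz_K dual_def)

definition swp :: "nat \<times> bool \<Rightarrow> nat \<times> bool" where
  "swp k = (if fst k = 0 then dual k else k)"

lemma fst_swp [simp]: "fst (swp k) = fst k" and swp_K [simp]: "swp k \<in> K \<longleftrightarrow> k \<in> K"
  by (auto simp: swp_def)

text \<open>Conjugation by a unit vector is minus the reflection in it: here it exchanges e_0 and
  f_0 and negates all other basis vectors.\<close>

lemma h0_conj:
  assumes "k \<in> K"
  shows "h0 * z k * h0 = (if fst k = 0 then 1 else -1) \<bullet>\<^sub>s z (swp k)"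
proof -
  have "h0 * z k * h0 = br h0 (z k) * h0 - z k * (h0 * h0)"
    by (simp add: br_def algebra_simps)
  hence *: "h0 * z k * h0 = br h0 (z k) * h0 - z k" by (simp add: h0_h0)
  show ?thesis
  proof (cases "fst k = 0")
    case True
    then obtain b where "k = (0, b)" by (cases k) auto
    thus ?thesis unfolding * by (cases b) (simp_all add: h0_def br_K swp_def)
  next
    case False
    hence "br h0 (z k) = 0" using assms by (auto simp: h0_def br_K dual_def)
    thus ?thesis unfolding * using False by (simp add: swp_def)
  qed
qed

lemma E_h0:
  assumes "g \<in> E P" and P: "\<And>x. x \<in> P \<Longrightarrow> - x \<in> P"
  shows "h0 * g * h0 \<in> E P"
  using assms(1)
proof (induction g rule: E.induct)
  case one
  show ?case by (simp add: h0_h0)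
next
  case (step k l x g)
  define c where "c = (if fst k = 0 then 1 else -1) * (if fst l = 0 then 1 else - 1 :: 'b)"
  have "h0 * (1 + x \<bullet>\<^sub>s (z k * z l)) * h0 = h0 * h0 + x \<bullet>\<^sub>s (h0 * (z k * z l) * h0)"
    by (simp add: distrib_left distrib_right)
  also have "\<dots> = 1 + (x * c) \<bullet>\<^sub>s (z (swp k) * z (swp l))"
    unfolding conj_mult[OF h0_h0] h0_conj[OF step(1)] h0_conj[OF step(2)] h0_h0
    by (simp add: c_def)
  also have "\<dots> \<in> E P" using step P by (intro E_root) (auto simp: c_def)
  finally have "h0 * (1 + x \<bullet>\<^sub>s (z k * z l)) * h0 \<in> E P" .
  moreover have "h0 * ((1 + x \<bullet>\<^sub>s (z k * z l)) * g) * h0 = (h0 * (1 + x \<bullet>\<^sub>s (z k * z l)) * h0) * (h0 * g * h0)"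
    by (rule conj_mult[OF h0_h0])
  ultimately show ?case using step by (auto intro: E_mult)
qed

lemma E_isotropic:
  assumes P: "idl P" and l: "l \<in> K" and c: "c \<in> P" and y: "\<And>j. j \<in> K \<Longrightarrow> y j \<in> D" "\<And>j. j \<in> K \<Longrightarrow> fst j = fst l \<Longrightarrow> y j = 0"
  shows "1 + c \<bullet>\<^sub>s (vec y * z l) \<in> E P"
proof -
  have "1 + c \<bullet>\<^sub>s ((\<Sum>j\<in>S. y j \<bullet>\<^sub>s z j) * z l) \<in> E P \<and> br (\<Sum>j\<in>S. y j \<bullet>\<^sub>s z j) (z l) = 0" if "finite S" "S \<subseteq> K" for S
    using that
  proof (induction S rule: finite_induct)
    case empty
    show ?case by simp
  next
    case (insert j S)
    let ?s = "\<Sum>j\<in>S. y j \<bullet>\<^sub>s z j"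
    have IH: "1 + c \<bullet>\<^sub>s (?s * z l) \<in> E P" "br ?s (z l) = 0" and j: "j \<in> K" using insert by auto
    show ?case
    proof (cases "fst j = fst l")
      case True
      thus ?thesis using insert y(2)[of j] by simp
    next
      case False
      have "1 + c \<bullet>\<^sub>s ((y j \<bullet>\<^sub>s z j + ?s) * z l) = 1 + ((c * y j) \<bullet>\<^sub>s z j + c \<bullet>\<^sub>s ?s) * z l"
        by (simp add: distrib_right)
      also have "\<dots> = (1 + ((c * y j) \<bullet>\<^sub>s z j) * z l) * (1 + (c \<bullet>\<^sub>s ?s) * z l)"
        using l IH by (intro one_plus_mult_left[symmetric]) (auto simp: zz_K)
      also have "\<dots> \<in> E P" unfolding sm_mult_left
        using l j False c y(1)[OF j] P IH by (intro E_mult E_root) (auto simp: idlD)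
      moreover have "l \<noteq> dual j" using False by auto
      ultimately show ?thesis using insert IH l j by (simp add: br_K)
    qed
  qed
  from this[OF finite_K order_refl] show ?thesis by (simp add: vec_def)
qed

text \<open>Let y be the part of \<open>u\<close> outside plane 0. As the e_0-coordinate is 1, u * u
  = 1 determines the f_0-coordinate, and \<open>u\<close> is the conjugate of h_0 by the elementary
  element 1 + y f_0. Hence u h_0 is a product of this element and an h_0-conjugate of its
  inverse.\<close>

lemma normalised_unit_vector:
  assumes u: "u \<in> Vec D" "u * u = 1" and a: "br u (z (0, False)) = 1"
  shows "u * h0 \<in> E D"
proof -
  let ?e = "z (0, True)" and ?f = "z (0, False)"
  obtain b where b: "u = vec b" "\<And>k. k \<in> K \<Longrightarrow> b k \<in> D" using u by (auto simp: Vec_def)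
  define c where "c = b (0, False)"
  define y where "y = vec (\<lambda>k. if fst k = 0 then 0 else b k)"
  have b0: "b (0, True) = 1" using a b br_vec_z[of "(0, False)" b] by (intro sm_inj) (simp add: dual_def)
  have u_eq: "u = ?e + c \<bullet>\<^sub>s ?f + y"
  proof -
    have "u - y = (\<Sum>k\<in>K. if fst k = 0 then b k \<bullet>\<^sub>s z k else 0)"
      unfolding b y_def vec_def sum_subtractf[symmetric] by (intro sum.cong) auto
    also have "\<dots> = (\<Sum>k\<in>{(0, True), (0, False)}. b k \<bullet>\<^sub>s z k)"
      by (intro sum.mono_neutral_cong_right) auto
    also have "\<dots> = ?e + c \<bullet>\<^sub>s ?f" by (simp add: c_def b0)
    finally show ?thesis by (simp add: algebra_simps)
  qed
  have bry: "br y ?e = 0" "br y ?f = 0" by (simp_all add: y_def br_vec_z dual_def)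
  have anti: "?e * y = - (y * ?e)" "?f * y = - (y * ?f)" "?f * ?e = 1 - ?e * ?f"
    using bry br_K[of "(0, True)" "(0, False)"] by (simp_all add: br_def eq_neg_iff_add_eq_0 eq_diff_eq add.commute dual_def)
  have anti': "?e * (y * w) = - (y * (?e * w))" "?f * (y * w) = - (y * (?f * w))" "?f * (?e * w) = w - ?e * (?f * w)" for w
    by (simp_all add: anti left_diff_distrib flip: mult.assoc)
  have sq: "?e * ?e = 0" "?f * ?f = 0" "?e * (?e * w) = 0" "?f * (?f * w) = 0" for w
    by (simp_all add: zz_K flip: mult.assoc)
  have "c \<bullet>\<^sub>s 1 + y * y = 1"
    using u(2) unfolding u_eq by (simp add: algebra_simps anti sq)
  hence yy: "y * y = (1 - c) \<bullet>\<^sub>s 1" by (simp add: algebra_simps)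
  have yy': "y * (y * w) = (1 - c) \<bullet>\<^sub>s w" for w
    by (simp only: yy sm_mult_left mult_1_left flip: mult.assoc)
  have "(1 + y * ?f) * h0 * (1 - y * ?f) = u"
    by (simp add: h0_def u_eq algebra_simps anti anti' sq yy yy')
  moreover have "1 + d \<bullet>\<^sub>s (y * ?f) \<in> E D" if "d \<in> D" for d
    unfolding y_def using b that by (intro E_isotropic idl_D) auto
  from this[of 1] this[of "-1"] have "1 + y * ?f \<in> E D" "1 - y * ?f \<in> E D" by simp_all
  moreover have "(1 + y * ?f) * h0 * (1 - y * ?f) * h0 = (1 + y * ?f) * (h0 * (1 - y * ?f) * h0)"
    by (simp only: mult.assoc)
  ultimately show ?thesis using E_h0[of "1 - y * ?f" D] by (auto intro: E_mult)
qed

text \<open>The coordinate of \<open>u\<close> at z_j is \<open>s\<close>. After inverting it, two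
  root conjugations relate \<open>u\<close> to a unit vector with e_0-coordinate 1, to which
  \<open>normalised_unit_vector\<close> applies. The index \<open>j\<close> lies outside plane 0
  because these root elements involve both z_(dual j) and e_0 or f_0.\<close>

lemma fracE_unit_vector:
  assumes u: "u \<in> Vec D" "u * u = 1" and j: "j \<in> K" "fst j \<noteq> 0" and s: "br u (z (dual j)) = s \<bullet>\<^sub>s 1"
  shows "s \<in> D" "fracE s (u * h0) (h0 * u)"
proof -
  let ?e = "z (0, True)" and ?f = "z (0, False)" and ?z = "z (dual j)"
  obtain b where b: "u = vec b" "\<And>k. k \<in> K \<Longrightarrow> b k \<in> D" using u by (auto simp: Vec_def)
  define a where "a = b (0, True)"
  define c where "c = b (0, False)"
  have sb: "s = b j" using s br_vec_z[of "dual j" b] j by (intro sm_inj) (simp add: b)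
  thus sD: "s \<in> D" using b j by simp
  have br: "br u ?f = a \<bullet>\<^sub>s 1" "br u ?e = c \<bullet>\<^sub>s 1" by (simp_all add: a_def c_def b br_vec_z dual_def)
  have acD: "a \<in> D" "c \<in> D" using b by (simp_all add: a_def c_def)
  define x where "x = 1 - a"
  have xD: "x \<in> D" "x * c \<in> D" "-x \<in> D" "- (x * c) \<in> D" using acD by (simp_all add: x_def)
  \<comment> \<open>The coordinates (a, c) of \<open>u\<close> at (e_0, f_0) become (1, a c). Their
    product, and with it the norm, is unchanged.\<close>
  define u3 where "u3 = u + x \<bullet>\<^sub>s ?e - (x * c) \<bullet>\<^sub>s ?f"
  have u3V: "u3 \<in> Vec D" using u xD by (simp add: u3_def)
  have jd: "dual j \<noteq> (0, b)" "(0, b) \<noteq> dual j" "j \<noteq> (0, b)" "(0, b) \<noteq> j" for b using j by (auto simp: dual_def)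
  have br0: "br ?e ?e = 0" "br ?f ?f = 0" "br ?e ?f = 1" "br ?f ?e = 1" "br ?e ?z = 0" "br ?z ?e = 0" "br ?f ?z = 0" "br ?z ?f = 0" "br ?z ?z = 0"
    using j jd by (auto simp: br_K)
  have u3u3: "u3 * u3 = 1"
  proof -
    have "u3 * u3 = u * u + x \<bullet>\<^sub>s br u ?e - (x * c) \<bullet>\<^sub>s br u ?f + (x * x) \<bullet>\<^sub>s (?e * ?e) - (x * (x * c)) \<bullet>\<^sub>s br ?e ?f + ((x * c) * (x * c)) \<bullet>\<^sub>s (?f * ?f)"
      by (simp add: u3_def br_def algebra_simps)
    also have "\<dots> = (1 + x * c - x * c * a - x * (x * c)) \<bullet>\<^sub>s 1" by (simp add: u br br0 zz_K)
    also have "1 + x * c - x * c * a - x * (x * c) = 1" by (simp add: x_def algebra_simps)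
    finally show ?thesis by simp
  qed
  have "br u3 ?f = 1" by (simp add: u3_def br br0 x_def algebra_simps)
  hence u3E: "u3 * h0 \<in> E D" using normalised_unit_vector[OF u3V u3u3] by simp
  let ?P = "s \<bullet>\<^sub>s 1 + x \<bullet>\<^sub>s (?e * ?z)" and ?Q = "s \<bullet>\<^sub>s 1 - x \<bullet>\<^sub>s (?e * ?z)"
  let ?P' = "s \<bullet>\<^sub>s 1 + (x * c) \<bullet>\<^sub>s (?z * ?f)" and ?Q' = "s \<bullet>\<^sub>s 1 - (x * c) \<bullet>\<^sub>s (?z * ?f)"
  define m where "m = s \<bullet>\<^sub>s u + (s * x) \<bullet>\<^sub>s ?e - (x * c) \<bullet>\<^sub>s ?z"
  have mV: "m \<in> Vec D" using u xD sD j by (simp add: m_def)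
  have brc: "br ?f u = a \<bullet>\<^sub>s 1" "br ?e u = c \<bullet>\<^sub>s 1" "br ?z u = s \<bullet>\<^sub>s 1" using br s by (simp_all add: br_commute)
  have "?Q' * u3 * ?P' = s \<bullet>\<^sub>s cnj s (- (x * c)) (?z * ?f) u3"
    using cnj_product(2)[of "dual j" "(0, False)" u3 0 s "- (x * c)", OF _ _ _ u3V Vec_0[OF idl_D]] j by simp
  also have "cnj s (- (x * c)) (?z * ?f) u3 = m"
    unfolding cnj_def commutator_with_product by (simp add: u3_def brc br0 m_def x_def algebra_simps)
  finally have c1: "?Q' * u3 * ?P' = s \<bullet>\<^sub>s m" .
  have "?Q * m * ?P = s \<bullet>\<^sub>s cnj s (- x) (?e * ?z) m"
    using cnj_product(2)[of "(0, True)" "dual j" m 0 s "- x", OF _ _ _ mV Vec_0[OF idl_D]] j by simp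
  also have "cnj s (- x) (?e * ?z) m = (s * s) \<bullet>\<^sub>s u"
    unfolding cnj_def commutator_with_product by (simp add: m_def brc br0 algebra_simps)
  finally have c2: "?Q * m * ?P = s \<bullet>\<^sub>s (s * s) \<bullet>\<^sub>s u" .
  have c3: "s ^ 4 \<bullet>\<^sub>s u = ?Q * ?Q' * u3 * ?P' * ?P"
  proof -
    have "?Q * ?Q' * u3 * ?P' * ?P = ?Q * (?Q' * u3 * ?P') * ?P" by (simp only: mult.assoc)
    also have "\<dots> = s \<bullet>\<^sub>s s \<bullet>\<^sub>s (s * s) \<bullet>\<^sub>s u" unfolding c1 by (simp only: sm_mult_left sm_mult_right c2)
    finally show ?thesis by (simp add: numeral_eq_Suc mult.assoc)
  qed
  have gQ: "good s ?Q ?P 1" "good s ?Q' ?P' 1"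
    using good_root[OF sD xD(3), of "(0, True)" "dual j"] good_root[OF sD xD(4), of "dual j" "(0, False)"] j by simp_all
  have "h0 * (?e * ?z) * h0 = - (?f * ?z)" "h0 * (?z * ?f) * h0 = - (?z * ?e)"
    unfolding conj_mult[OF h0_h0] using j by (simp_all add: h0_conj swp_def)
  hence hP: "h0 * ?P * h0 = s \<bullet>\<^sub>s 1 - x \<bullet>\<^sub>s (?f * ?z)" "h0 * ?Q * h0 = s \<bullet>\<^sub>s 1 + x \<bullet>\<^sub>s (?f * ?z)"
    "h0 * ?P' * h0 = s \<bullet>\<^sub>s 1 - (x * c) \<bullet>\<^sub>s (?z * ?e)" "h0 * ?Q' * h0 = s \<bullet>\<^sub>s 1 + (x * c) \<bullet>\<^sub>s (?z * ?e)"
    by (simp_all add: distrib_left distrib_right left_diff_distrib right_diff_distrib h0_h0)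
  have gP: "good s (h0 * ?P * h0) (h0 * ?Q * h0) 1" "good s (h0 * ?P' * h0) (h0 * ?Q' * h0) 1"
    unfolding hP using good_root[OF sD xD(3), of "(0, False)" "dual j"] good_root[OF sD xD(4), of "dual j" "(0, True)"] j by simp_all
  obtain g' a0 where g': "g' * (u3 * h0) = 1" "good s (s ^ a0 \<bullet>\<^sub>s (u3 * h0)) (s ^ a0 \<bullet>\<^sub>s g') a0"
    using fracE_E[OF sD u3E] unfolding fracE_def by blast
  have "g' = g' * (u3 * (h0 * h0) * u3)" by (simp add: h0_h0 u3u3)
  also have "\<dots> = g' * (u3 * h0) * (h0 * u3)" by (simp only: mult.assoc)
  finally have g'_eq: "g' = h0 * u3" using g' by simp
  \<comment> \<open>Inserting h_0 h_0 = 1 between the factors on the right turns Q Q' u3 P' P h_0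
    into a product of good elements. The four root factors account for s^4.\<close>
  have "good s (?Q * (?Q' * ((s ^ a0 \<bullet>\<^sub>s (u3 * h0)) * ((h0 * ?P' * h0) * (h0 * ?P * h0)))))
      (((((h0 * ?Q * h0) * (h0 * ?Q' * h0)) * (s ^ a0 \<bullet>\<^sub>s g')) * ?P') * ?P) (1 + (1 + (a0 + (1 + 1))))"
    using g' gP gQ sD by (intro good_mult)
  also have "?Q * (?Q' * ((s ^ a0 \<bullet>\<^sub>s (u3 * h0)) * ((h0 * ?P' * h0) * (h0 * ?P * h0)))) = s ^ (a0 + 4) \<bullet>\<^sub>s (u * h0)"
  proof -
    have "?Q * (?Q' * ((s ^ a0 \<bullet>\<^sub>s (u3 * h0)) * ((h0 * ?P' * h0) * (h0 * ?P * h0)))) =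
        s ^ a0 \<bullet>\<^sub>s (?Q * ?Q' * u3 * (h0 * h0) * ?P' * (h0 * h0) * ?P * h0)"
      by (simp only: sm_mult_left sm_mult_right mult.assoc)
    also have "\<dots> = s ^ a0 \<bullet>\<^sub>s ((s ^ 4 \<bullet>\<^sub>s u) * h0)" unfolding c3 by (simp only: h0_h0 mult_1_right)
    finally show ?thesis by (simp add: power_add)
  qed
  also have "(((((h0 * ?Q * h0) * (h0 * ?Q' * h0)) * (s ^ a0 \<bullet>\<^sub>s g')) * ?P') * ?P) = s ^ (a0 + 4) \<bullet>\<^sub>s (h0 * u)"
  proof -
    have "(((((h0 * ?Q * h0) * (h0 * ?Q' * h0)) * (s ^ a0 \<bullet>\<^sub>s g')) * ?P') * ?P) =
        s ^ a0 \<bullet>\<^sub>s (h0 * (?Q * (h0 * h0) * ?Q' * (h0 * h0) * u3 * ?P' * ?P))"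
      unfolding g'_eq by (simp only: sm_mult_left sm_mult_right mult.assoc)
    also have "\<dots> = s ^ a0 \<bullet>\<^sub>s (h0 * (s ^ 4 \<bullet>\<^sub>s u))" unfolding c3 by (simp only: h0_h0 mult_1_right)
    finally show ?thesis by (simp add: power_add)
  qed
  also have "1 + (1 + (a0 + (1 + 1))) = a0 + 4" by simp
  finally show "fracE s (u * h0) (h0 * u)" unfolding fracE_def by blast
qed

lemma fracE_commutator:
  assumes "fracE s \<sigma> \<sigma>'"
  shows "\<exists>N. \<forall>g g'. small s N g g' \<longrightarrow> (\<exists>j. \<exists>W\<in>E D. s ^ j \<bullet>\<^sub>s (g * \<sigma> * g' * \<sigma>') = s ^ j \<bullet>\<^sub>s W)"
proof -
  obtain a where a: "good s (s ^ a \<bullet>\<^sub>s \<sigma>) (s ^ a \<bullet>\<^sub>s \<sigma>') a" using assms by (auto simp: fracE_def)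
  then obtain N where N: "\<And>g g'. small s N g g' \<Longrightarrow> \<exists>j. \<exists>W\<in>E (lev s 0).
      s ^ j \<bullet>\<^sub>s (g * (s ^ a \<bullet>\<^sub>s \<sigma>) * g' * (s ^ a \<bullet>\<^sub>s \<sigma>')) = s ^ (j + 2 * a) \<bullet>\<^sub>s W"
    unfolding good_def by blast
  show ?thesis
  proof (rule exI[of _ N], intro allI impI)
    fix g g' assume "small s N g g'"
    then obtain j W where W: "W \<in> E D" "s ^ j \<bullet>\<^sub>s (g * (s ^ a \<bullet>\<^sub>s \<sigma>) * g' * (s ^ a \<bullet>\<^sub>s \<sigma>')) = s ^ (j + 2 * a) \<bullet>\<^sub>s W"
      using N by fastforce
    have "s ^ j * (s ^ a * s ^ a) = s ^ (j + 2 * a)" by (simp add: mult_2 flip: power_add)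
    with W(2) have "s ^ (j + 2 * a) \<bullet>\<^sub>s (g * \<sigma> * g' * \<sigma>') = s ^ (j + 2 * a) \<bullet>\<^sub>s W"
      by (simp only: sm_mult_left sm_mult_right sm_sm)
    thus "\<exists>j. \<exists>W\<in>E D. s ^ j \<bullet>\<^sub>s (g * \<sigma> * g' * \<sigma>') = s ^ j \<bullet>\<^sub>s W" using W by blast
  qed
qed

end

section \<open>The relative elementary group and the Clifford group\<close>

context clifford
begin

inductive_set Erel :: "'b set \<Rightarrow> 'c set" for J :: "'b set" where
  one: "1 \<in> Erel J"
| step: "\<gamma> \<in> E D \<Longrightarrow> \<gamma>' \<in> E D \<Longrightarrow> \<gamma> * \<gamma>' = 1 \<Longrightarrow> \<gamma>' * \<gamma> = 1 \<Longrightarrow> k \<in> K \<Longrightarrow> l \<in> K \<Longrightarrow> fst k \<noteq> fst l \<Longrightarrow> x \<in> J \<Longrightarrow>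
    h \<in> Erel J \<Longrightarrow> \<gamma> * (1 + x \<bullet>\<^sub>s (z k * z l)) * \<gamma>' * h \<in> Erel J"

lemma Erel_root: "k \<in> K \<Longrightarrow> l \<in> K \<Longrightarrow> fst k \<noteq> fst l \<Longrightarrow> x \<in> J \<Longrightarrow> 1 + x \<bullet>\<^sub>s (z k * z l) \<in> Erel J"
  using Erel.step[OF E.one E.one _ _ _ _ _ _ Erel.one] by simp

lemma Erel_mult: "g \<in> Erel J \<Longrightarrow> h \<in> Erel J \<Longrightarrow> g * h \<in> Erel J"
  by (induction g rule: Erel.induct) (auto simp: mult.assoc intro: Erel.step[simplified mult.assoc])

lemma Erel_conj_E:
  assumes "h \<in> Erel J" "g \<in> E D" "g' \<in> E D" "g * g' = 1" "g' * g = 1"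
  shows "g * h * g' \<in> Erel J"
  using assms(1)
proof (induction h rule: Erel.induct)
  case one
  show ?case using assms by (simp add: Erel.one)
next
  case (step \<gamma> \<gamma>' k l x h)
  let ?r = "1 + x \<bullet>\<^sub>s (z k * z l)"
  have "g * \<gamma> * (\<gamma>' * g') = g * (\<gamma> * \<gamma>') * g'" "\<gamma>' * g' * (g * \<gamma>) = \<gamma>' * (g' * g) * \<gamma>" by (simp_all only: mult.assoc)
  hence "(g * \<gamma>) * ?r * (\<gamma>' * g') * (g * h * g') \<in> Erel J"
    using step assms by (intro Erel.step) (auto intro: E_mult)
  moreover have "(g * \<gamma>) * ?r * (\<gamma>' * g') * (g * h * g') = g * \<gamma> * ?r * \<gamma>' * (g' * g) * h * g'"
    by (simp only: mult.assoc)
  ultimately show ?case using assms by (simp add: mult.assoc)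
qed

lemma Erel_inverse:
  assumes "h \<in> Erel J" and J: "\<And>x. x \<in> J \<Longrightarrow> - x \<in> J"
  shows "\<exists>h'\<in>Erel J. h * h' = 1 \<and> h' * h = 1"
  using assms(1)
proof (induction h rule: Erel.induct)
  case one
  show ?case using Erel.one by (intro bexI[of _ 1]) auto
next
  case (step \<gamma> \<gamma>' k l x h)
  then obtain h' where h': "h' \<in> Erel J" "h * h' = 1" "h' * h = 1" by auto
  let ?r = "1 + x \<bullet>\<^sub>s (z k * z l)" and ?r' = "1 + (- x) \<bullet>\<^sub>s (z k * z l)"
  have rr: "?r * ?r' = 1" "?r' * ?r = 1" by (rule one_plus_inverse[OF root_nilpotent]; use step in simp)+
  have "\<gamma> * ?r' * \<gamma>' * 1 \<in> Erel J" using step J by (intro Erel.step Erel.one) auto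
  hence "h' * (\<gamma> * ?r' * \<gamma>') \<in> Erel J" using Erel_mult[OF h'(1)] by simp
  moreover have "\<gamma> * ?r * \<gamma>' * h * (h' * (\<gamma> * ?r' * \<gamma>')) = \<gamma> * ?r * \<gamma>' * (h * h') * \<gamma> * ?r' * \<gamma>'"
    "h' * (\<gamma> * ?r' * \<gamma>') * (\<gamma> * ?r * \<gamma>' * h) = h' * (\<gamma> * ?r' * (\<gamma>' * \<gamma>) * ?r * \<gamma>') * h"
    by (simp_all only: mult.assoc)
  moreover have "\<gamma> * ?r * \<gamma>' * \<gamma> * ?r' * \<gamma>' = \<gamma> * (?r * (\<gamma>' * \<gamma>) * ?r') * \<gamma>'"
    by (simp only: mult.assoc)
  moreover have "\<gamma> * ?r' * 1 * ?r * \<gamma>' = \<gamma> * (?r' * ?r) * \<gamma>'" by (simp only: mult_1_right mult.assoc)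
  ultimately show ?case using h' rr step(3,4) by (intro bexI[of _ "h' * (\<gamma> * ?r' * \<gamma>')"]) simp_all
qed

text \<open>The Clifford group over \<open>D\<close>: units which, together with their inverses,
  conjugate vectors to vectors.\<close>

definition orth :: "'c \<Rightarrow> 'c \<Rightarrow> bool" where
  "orth g g' \<longleftrightarrow> g * g' = 1 \<and> g' * g = 1 \<and> (\<forall>k\<in>K. g * z k * g' \<in> Vec D) \<and> (\<forall>k\<in>K. g' * z k * g \<in> Vec D)"

lemma conj_Vec:
  assumes "\<And>k. k \<in> K \<Longrightarrow> g * z k * g' \<in> Vec D" "idl P" "u \<in> Vec P"
  shows "g * u * g' \<in> Vec P"
proof -
  obtain a where a: "u = vec a" "\<And>k. k \<in> K \<Longrightarrow> a k \<in> P" using assms by (auto simp: Vec_def)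
  have "g * u * g' = (\<Sum>k\<in>K. a k \<bullet>\<^sub>s (g * z k * g'))"
    by (simp add: a vec_def sum_distrib_left sum_distrib_right)
  also have "\<dots> \<in> Vec P" using assms a by (intro Vec_sum Vec_sm') auto
  finally show ?thesis .
qed

lemma orth_unique:
  assumes "orth g g'" "g * h = 1"
  shows "h = g'"
proof -
  have "h = g' * g * h" using assms by (simp add: orth_def)
  thus ?thesis using assms by (simp add: mult.assoc)
qed

lemma orth_sym: "orth g g' \<Longrightarrow> orth g' g"
  by (auto simp: orth_def)

lemma orth_mult:
  assumes "orth g g'" "orth h h'"
  shows "orth (g * h) (h' * g')"
proof -
  have "g * h * (h' * g') = g * (h * h') * g'" "h' * g' * (g * h) = h' * (g' * g) * h" by (simp_all only: mult.assoc)
  moreover have "g * h * z k * (h' * g') = g * (h * z k * h') * g'" "h' * g' * z k * (g * h) = h' * (g' * z k * g) * h" for k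
    by (simp_all only: mult.assoc)
  ultimately show ?thesis using assms conj_Vec[OF _ idl_D, of g g'] conj_Vec[OF _ idl_D, of h' h] by (simp add: orth_def)
qed

lemma orth_E:
  assumes "g \<in> E D"
  shows "\<exists>g'\<in>E D. orth g g'"
  using assms
proof (induction g rule: E.induct)
  case one
  show ?case by (intro bexI[of _ 1]) (auto simp: orth_def)
next
  case (step k l x g)
  then obtain g' where g': "g' \<in> E D" "orth g g'" by auto
  let ?r = "1 + x \<bullet>\<^sub>s (z k * z l)" and ?r' = "1 + (- x) \<bullet>\<^sub>s (z k * z l)"
  have 1: "(1 + y \<bullet>\<^sub>s (z k * z l)) * z j * (1 + (- y) \<bullet>\<^sub>s (z k * z l)) \<in> Vec D" if "j \<in> K" "y \<in> D" for y j
    using cnj_product(2)[OF step(1-3) z_in_Vec[OF that(1)] z_in_Vec[OF that(1)], of 1 y]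
      cnj_Vec[OF step(1,2) z_in_Vec[OF that(1)] D_1 that(2)] by simp
  have "orth ?r ?r'" unfolding orth_def
    using one_plus_inverse[OF root_nilpotent[OF step(1-3)]] 1[of _ x] 1[of _ "-x"] step by auto
  hence "orth (?r * g) (g' * ?r')" using g' by (intro orth_mult)
  moreover have "g' * ?r' \<in> E D" using g' step by (intro E_mult E_root) auto
  ultimately show ?case by blast
qed

subsection \<open>Relative statements via the double of the ring along an ideal\<close>

definition pair_sm :: "(bool \<Rightarrow> 'b) \<Rightarrow> (bool \<Rightarrow> 'c) \<Rightarrow> (bool \<Rightarrow> 'c)" where
  "pair_sm a X = (\<lambda>i. a i \<bullet>\<^sub>s X i)"

text \<open>The fibre product of \<open>D\<close> with itself over D / J. Pairs are functions on
  \<open>bool\<close>, so that the ring operations are the pointwise ones.\<close>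

definition pair_D :: "'b set \<Rightarrow> (bool \<Rightarrow> 'b) set" where
  "pair_D J = {d. d True \<in> D \<and> d False \<in> D \<and> d True - d False \<in> J}"

definition pair_z :: "nat \<times> bool \<Rightarrow> bool \<Rightarrow> 'c" where
  "pair_z k = (\<lambda>_. z k)"

definition pair :: "'x \<Rightarrow> 'x \<Rightarrow> bool \<Rightarrow> 'x" where
  "pair x y = (\<lambda>i. if i then x else y)"

lemma pair_apply [simp]: "pair x y True = x" "pair x y False = y"
  by (simp_all add: pair_def)

lemma pair_mult [simp]: "pair x y * pair x' y' = pair (x * x' :: 'y::times) (y * y')"
  and pair_add [simp]: "pair u v + pair u' v' = pair (u + u' :: 'w::plus) (v + v')"
  by (auto simp: pair_def fun_eq_iff)

lemma pair_eq_iff: "X = Y \<longleftrightarrow> X True = Y True \<and> X False = Y False"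
  by (auto simp: fun_eq_iff all_bool_eq)

lemma pair_1: "pair 1 1 = 1" and pair_0: "pair 0 0 = 0"
  by (auto simp: pair_eq_iff)

lemma pair_sm_pair: "pair_sm (pair a b) (pair x y) = pair (a \<bullet>\<^sub>s x) (b \<bullet>\<^sub>s y)"
  by (auto simp: pair_eq_iff pair_sm_def)

lemma pair_z_eq: "pair_z k = pair (z k) (z k)"
  by (auto simp: pair_eq_iff pair_z_def)

lemma pair_br: "br (pair x y) (pair x' y') = pair (br x x') (br y y' :: 'y::ring)"
  by (simp add: br_def)

lemma pair_clifford:
  assumes J: "idl J"
  shows "clifford pair_sm (pair_D J) pair_z n"
proof
  fix a b :: "bool \<Rightarrow> 'b" and k l
  show "pair_sm a 1 = 0 \<Longrightarrow> a = 0" by (auto simp: pair_sm_def fun_eq_iff intro: sm_faithful)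
  show "1 \<in> pair_D J" using J by (simp add: pair_D_def idlD)
  show "a + b \<in> pair_D J" if "a \<in> pair_D J" "b \<in> pair_D J"
    using that idlD(3)[OF J, of "a True - a False" "b True - b False"] by (simp add: pair_D_def algebra_simps)
  show "a * b \<in> pair_D J" if "a \<in> pair_D J" "b \<in> pair_D J"
  proof -
    have "(a True - a False) * b True + a False * (b True - b False) \<in> J"
      using that J by (intro idlD(3,4,5)[OF J]) (auto simp: pair_D_def)
    thus ?thesis using that by (simp add: pair_D_def algebra_simps)
  qed
  show "- a \<in> pair_D J" if "a \<in> pair_D J"
    using that idlD(6)[OF J, of "a True - a False"] by (simp add: pair_D_def)
  show "pair_z k * pair_z k = 0" if "fst k < n" using that z_sq[of k] by (simp add: pair_z_def fun_eq_iff)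
  show "br (pair_z k) (pair_z l) = (if l = dual k then 1 else 0)" if "fst k < n" "fst l < n"
    using that z_br[of k l] by (auto simp: pair_z_eq pair_br pair_1 pair_0)
  show "3 \<le> n" by (rule n_ge_3)
qed (auto simp: pair_sm_def fun_eq_iff)

context
  fixes J :: "'b set"
  assumes J: "idl J"
begin

interpretation P: clifford pair_sm "pair_D J" pair_z n
  by (rule pair_clifford[OF J])

lemma pair_vec: "P.vec a = pair (vec (\<lambda>k. a k True)) (vec (\<lambda>k. a k False))"
proof
  fix i :: bool
  have *: "(\<Sum>k\<in>A. f k) i = (\<Sum>k\<in>A. f k i)" for A :: "(nat \<times> bool) set" and f :: "nat \<times> bool \<Rightarrow> bool \<Rightarrow> 'c"
    by (induction A rule: infinite_finite_induct) auto
  show "P.vec a i = pair (vec (\<lambda>k. a k True)) (vec (\<lambda>k. a k False)) i"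
    unfolding P.vec_def vec_def * by (cases i) (simp_all only: pair_sm_def pair_z_def pair_apply)
qed

lemma pair_Vec:
  assumes "u \<in> Vec D" "w \<in> Vec J"
  shows "pair (u + w) u \<in> P.Vec (pair_D J)"
proof -
  obtain a b where ab: "u = vec a" "\<forall>k\<in>K. a k \<in> D" "w = vec b" "\<forall>k\<in>K. b k \<in> J" using assms by (auto simp: Vec_def)
  have "pair (u + w) u = P.vec (\<lambda>k. pair (a k + b k) (a k))"
    unfolding pair_vec ab vec_add by simp
  moreover have "\<forall>k\<in>P.K. pair (a k + b k) (a k) \<in> pair_D J"
    using ab(2,4) by (simp add: pair_D_def idlD(1)[OF J])
  ultimately show ?thesis unfolding P.Vec_def by blast
qed

text \<open>Write x, y for the components of a parameter: 1 + x R = (1 + (x - y) R) (1 + y R), where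
  x - y lies in \<open>J\<close>. The first factor is a relative root element, and the second
  conjugates what has been collected before. If the second component of \<open>W\<close> is 1, the
  first is in the relative group.\<close>

lemma Erel_of_pair:
  assumes "W \<in> P.E (pair_D J)"
  shows "W False \<in> E D \<and> (\<exists>V\<in>Erel J. W True = V * W False)"
  using assms
proof (induction W rule: P.E.induct)
  case one
  show ?case using Erel.one by (auto intro!: bexI[of _ 1])
next
  case (step k l x W)
  then obtain V where V: "V \<in> Erel J" "W True = V * W False" "W False \<in> E D" by auto
  have kl: "k \<in> K" "l \<in> K" "fst k \<noteq> fst l" using step by auto
  have x: "x True \<in> D" "x False \<in> D" "x True - x False \<in> J" using step by (auto simp: pair_D_def)
  define R where "R = z k * z l"
  have app: "(1 + pair_sm x (pair_z k * pair_z l)) i = 1 + x i \<bullet>\<^sub>s R" for i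
    by (simp add: pair_sm_def pair_z_def R_def)
  note inv = one_plus_inverse[OF root_nilpotent[OF kl], folded R_def, of "x False"]
  have r: "1 + y \<bullet>\<^sub>s R \<in> E D" if "y \<in> D" for y using E_root[OF kl that] by (simp add: R_def)
  have "(1 + (x True - x False) \<bullet>\<^sub>s R) * ((1 + x False \<bullet>\<^sub>s R) * V * (1 + (- x False) \<bullet>\<^sub>s R)) \<in> Erel J" (is "?V \<in> _")
    using Erel_root[OF kl x(3)] Erel_conj_E[OF V(1) r[OF x(2)] r inv] x by (auto simp: R_def intro: Erel_mult)
  moreover have "?V * ((1 + x False \<bullet>\<^sub>s R) * W False) = (1 + (x True - x False) \<bullet>\<^sub>s R) * (1 + x False \<bullet>\<^sub>s R) * V *
      ((1 + (- x False) \<bullet>\<^sub>s R) * (1 + x False \<bullet>\<^sub>s R)) * W False"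
    by (simp only: mult.assoc)
  moreover have "\<dots> = (1 + x True \<bullet>\<^sub>s R) * W True"
    unfolding inv R_def root_add[OF kl] V by (simp add: mult.assoc)
  ultimately have "\<exists>V\<in>Erel J. (1 + x True \<bullet>\<^sub>s R) * W True = V * ((1 + x False \<bullet>\<^sub>s R) * W False)" by metis
  thus ?case using E_mult[OF r[OF x(2)] V(3)] by (simp only: times_fun_apply app simp_thms)
qed

text \<open>This is \<open>transvection_in_E\<close> over the double for the vectors (u, u) and (v,
  0): the second component of the transvection is 1.\<close>

lemma Erel_transvection:
  assumes "u \<in> Vec D" "u * u = 0" "u' \<in> Vec D" "br u u' = 1" "v \<in> Vec J" "br u v = 0"
  shows "1 + u * v \<in> Erel J"
proof -
  have "1 + pair_sm (1 * 1 * 1 * 1) (pair (u + 0) u * pair (0 + v) 0) \<in> P.E (pair_D J)"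
    using assms
    by (intro P.transvection_in_E[OF P.idl_D _ _ _ _ _ _ P.D_1 P.D_1, of _ "pair (u' + 0) u'"] pair_Vec)
       (auto simp: pair_0 pair_br pair_1 Vec_0 J idl_D P.sm_one)
  hence "1 + pair (u * v) 0 \<in> P.E (pair_D J)" by (simp add: P.sm_one)
  from Erel_of_pair[OF this] show ?thesis by auto
qed

text \<open>Conjugation by \<open>g\<close> preserves anticommutators, so the result is a
  transvection by an isotropic vector that has a partner of pairing 1. This makes the relative group
  normal in the whole Clifford group and not only in \<open>E D\<close>.\<close>

lemma Erel_conj_root:
  assumes "orth g g'" "k \<in> K" "l \<in> K" "fst k \<noteq> fst l" "x \<in> J"
  shows "g * (1 + x \<bullet>\<^sub>s (z k * z l)) * g' \<in> Erel J"
proof -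
  have gg: "g' * g = 1" "g * g' = 1" and gz: "\<And>k. k \<in> K \<Longrightarrow> g * z k * g' \<in> Vec D" using assms by (auto simp: orth_def)
  have "g * (1 + x \<bullet>\<^sub>s (z k * z l)) * g' = 1 + g * z k * g' * (x \<bullet>\<^sub>s (g * z l * g'))"
    using conj_mult[OF gg(1), of "z k" "z l"] gg(2) by (simp add: distrib_left distrib_right)
  also have "\<dots> \<in> Erel J"
  proof (rule Erel_transvection[of _ "g * z (dual k) * g'"])
    show "g * z k * g' * (g * z k * g') = 0" using conj_mult[OF gg(1), of "z k" "z k"] assms by (simp add: zz_K)
    show "br (g * z k * g') (g * z (dual k) * g') = 1" using assms gg by (simp add: conj_br br_K)
    have "l \<noteq> dual k" using assms by auto
    thus "br (g * z k * g') (x \<bullet>\<^sub>s (g * z l * g')) = 0" using assms gg by (simp add: conj_br br_K)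
    show "x \<bullet>\<^sub>s (g * z l * g') \<in> Vec J" using gz assms J by (intro Vec_sm') auto
  qed (use gz assms in auto)
  finally show ?thesis .
qed

lemma Erel_normal:
  assumes "orth g g'" "h \<in> Erel J"
  shows "g * h * g' \<in> Erel J"
  using assms(2)
proof (induction h rule: Erel.induct)
  case one
  show ?case using assms by (simp add: orth_def Erel.one)
next
  case (step \<gamma> \<gamma>' k l x h)
  obtain \<gamma>2 where \<gamma>2: "orth \<gamma> \<gamma>2" using orth_E[OF step(1)] by blast
  hence "\<gamma>' = \<gamma>2" by (rule orth_unique) (rule step(3))
  hence "orth (g * \<gamma>) (\<gamma>' * g')" using orth_mult[OF assms(1) \<gamma>2] by simp
  hence 1: "g * \<gamma> * (1 + x \<bullet>\<^sub>s (z k * z l)) * (\<gamma>' * g') \<in> Erel J" using step by (intro Erel_conj_root) auto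
  have "g * (\<gamma> * (1 + x \<bullet>\<^sub>s (z k * z l)) * \<gamma>' * h) * g' = (g * \<gamma> * (1 + x \<bullet>\<^sub>s (z k * z l)) * (\<gamma>' * g')) * (g * h * g')"
  proof -
    have "(g * \<gamma> * (1 + x \<bullet>\<^sub>s (z k * z l)) * (\<gamma>' * g')) * (g * h * g') = g * \<gamma> * (1 + x \<bullet>\<^sub>s (z k * z l)) * \<gamma>' * (g' * g) * h * g'"
      by (simp only: mult.assoc)
    moreover have "g' * g = 1" using assms(1) by (simp add: orth_def)
    ultimately show ?thesis by (simp only: mult_1_right mult.assoc)
  qed
  thus ?case using Erel_mult[OF 1 step.IH] by simp
qed

text \<open>In the half-spin representation an element that is trivial modulo \<open>J\<close> acts on vectors modulo \<open>J\<close> by a scalar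
  \<open>c\<close> with \<open>c\<^sup>2 = 1\<close>, not necessarily trivially.\<close>

lemma Erel_commutator_root:
  assumes g: "orth g g'" and c: "c \<in> D" "c * c - 1 \<in> J" "\<And>k. k \<in> K \<Longrightarrow> g * z k * g' - c \<bullet>\<^sub>s z k \<in> Vec J"
    and kl: "k \<in> K" "l \<in> K" "fst k \<noteq> fst l" and x: "x \<in> D"
  shows "g * (1 + x \<bullet>\<^sub>s (z k * z l)) * g' * (1 + (- x) \<bullet>\<^sub>s (z k * z l)) \<in> Erel J"
proof -
  define w where "w = (\<lambda>k. g * z k * g' - c \<bullet>\<^sub>s z k)"
  have gg: "g' * g = 1" "g * g' = 1" using g by (auto simp: orth_def)
  have gz: "g * z k * g' = c \<bullet>\<^sub>s z k + w k" for k by (simp add: w_def)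
  have wJ: "w k \<in> Vec J" if "k \<in> K" for k using c that by (simp add: w_def)
  let ?p = "\<lambda>k. c \<bullet>\<^sub>s z k + w k"
  have lk: "l \<noteq> dual k" using kl by auto
  have p: "?p k * ?p k = 0" "br (?p k) (?p (dual k)) = 1" "br (?p k) (?p l) = 0" "?p k * ?p l = g * (z k * z l) * g'"
    unfolding gz[symmetric] conj_mult[OF gg(1), symmetric] conj_br[OF gg(1)] using kl lk gg by (simp_all add: zz_K br_K)
  have ccD: "c * c - 1 + 1 \<in> D" using c by simp
  \<comment> \<open>The pairing of the conjugate of z_k with that of its dual is 1 in the first
    component, whereas c z_k and c z_(dual k) pair to c^2 in the second.\<close>
  define q where "q = pair 1 (c * c)"
  have q_D: "q \<in> pair_D J" using c idlD(6)[OF J c(2)] by (simp add: q_def pair_D_def)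
  have "1 + pair_sm (1 * 1 * q * q) (pair (?p k) (c \<bullet>\<^sub>s z k) * pair (x \<bullet>\<^sub>s c \<bullet>\<^sub>s z l + x \<bullet>\<^sub>s w l) (x \<bullet>\<^sub>s c \<bullet>\<^sub>s z l)) \<in> P.E (pair_D J)"
  proof (rule P.transvection_in_E[OF P.idl_D _ _ _ _ _ _ P.D_1 P.D_1, of _ "pair (?p (dual k)) (c \<bullet>\<^sub>s z (dual k))"])
    show "pair (?p k) (c \<bullet>\<^sub>s z k) \<in> P.Vec (pair_D J)" "pair (?p (dual k)) (c \<bullet>\<^sub>s z (dual k)) \<in> P.Vec (pair_D J)"
      "pair (x \<bullet>\<^sub>s c \<bullet>\<^sub>s z l + x \<bullet>\<^sub>s w l) (x \<bullet>\<^sub>s c \<bullet>\<^sub>s z l) \<in> P.Vec (pair_D J)"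
      using kl c x wJ J by (intro pair_Vec Vec_D_sm Vec_sm z_in_Vec; simp)+
    show "pair (?p k) (c \<bullet>\<^sub>s z k) * pair (?p k) (c \<bullet>\<^sub>s z k) = 0"
      using p(1) kl by (simp only: pair_mult pair_0[symmetric]) (simp add: zz_K)
    show "br (pair (?p k) (c \<bullet>\<^sub>s z k)) (pair (?p (dual k)) (c \<bullet>\<^sub>s z (dual k))) = pair_sm q 1"
      unfolding pair_br p(2) using kl by (simp add: pair_eq_iff pair_sm_def q_def br_K)
    have "br (?p k) (x \<bullet>\<^sub>s ?p l) = 0" using p(3) by (simp only: br_sm sm_zero_right)
    thus "br (pair (?p k) (c \<bullet>\<^sub>s z k)) (pair (x \<bullet>\<^sub>s c \<bullet>\<^sub>s z l + x \<bullet>\<^sub>s w l) (x \<bullet>\<^sub>s c \<bullet>\<^sub>s z l)) = 0"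
      unfolding pair_br sm_add_right using kl lk by (simp only: pair_0[symmetric]) (simp add: br_K)
  qed
  from Erel_of_pair[OF this] obtain V where V: "V \<in> Erel J" and
    "1 + (1 * 1 * q * q) True \<bullet>\<^sub>s (?p k * (x \<bullet>\<^sub>s c \<bullet>\<^sub>s z l + x \<bullet>\<^sub>s w l)) =
      V * (1 + (1 * 1 * q * q) False \<bullet>\<^sub>s (c \<bullet>\<^sub>s z k * x \<bullet>\<^sub>s c \<bullet>\<^sub>s z l))"
    by (auto simp: pair_sm_def)
  moreover have "1 + (1 * 1 * q * q) True \<bullet>\<^sub>s (?p k * (x \<bullet>\<^sub>s c \<bullet>\<^sub>s z l + x \<bullet>\<^sub>s w l)) = g * (1 + x \<bullet>\<^sub>s (z k * z l)) * g'"
  proof -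
    have "1 + (1 * 1 * q * q) True \<bullet>\<^sub>s (?p k * (x \<bullet>\<^sub>s c \<bullet>\<^sub>s z l + x \<bullet>\<^sub>s w l)) = 1 + x \<bullet>\<^sub>s (?p k * ?p l)"
      by (simp add: q_def algebra_simps)
    also have "\<dots> = g * (1 + x \<bullet>\<^sub>s (z k * z l)) * g'"
      unfolding p(4) using gg by (simp add: distrib_left distrib_right)
    finally show ?thesis .
  qed
  \<comment> \<open>The exponent 6 of c: four from the square of the pairing c^2, two from the
    vectors c z_k and c z_l. As c^6 - 1 is a multiple of c^2 - 1, the parameters d x and x agree
    modulo \<open>J\<close>.\<close>
  moreover define d where "d = c * c * (c * c) * (c * c)"
  have "1 + (1 * 1 * q * q) False \<bullet>\<^sub>s (c \<bullet>\<^sub>s z k * x \<bullet>\<^sub>s c \<bullet>\<^sub>s z l) = 1 + (d * x) \<bullet>\<^sub>s (z k * z l)"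
    by (simp add: q_def d_def ac_simps)
  ultimately have "g * (1 + x \<bullet>\<^sub>s (z k * z l)) * g' = V * (1 + (d * x) \<bullet>\<^sub>s (z k * z l))"
    by (simp only:)
  hence "g * (1 + x \<bullet>\<^sub>s (z k * z l)) * g' * (1 + (- x) \<bullet>\<^sub>s (z k * z l)) =
      V * ((1 + (d * x) \<bullet>\<^sub>s (z k * z l)) * (1 + (- x) \<bullet>\<^sub>s (z k * z l)))"
    by (simp only: mult.assoc)
  also have "\<dots> = V * (1 + (d * x + - x) \<bullet>\<^sub>s (z k * z l))" by (simp only: root_add[OF kl])
  also have "\<dots> \<in> Erel J"
  proof (intro Erel_mult V Erel_root kl)
    have "((c * c - 1) * (c * c * (c * c) + c * c + 1)) * x \<in> J" using c x by (intro idlD(5)[OF J]) auto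
    also have "((c * c - 1) * (c * c * (c * c) + c * c + 1)) * x = d * x + - x" by (simp add: d_def algebra_simps)
    finally show "d * x + - x \<in> J" .
  qed
  finally show ?thesis .
qed

definition comm_rel :: "'c \<Rightarrow> 'c \<Rightarrow> 'c \<Rightarrow> 'c \<Rightarrow> bool" where
  "comm_rel g g' h h' \<longleftrightarrow> g * h * g' * h' \<in> Erel J"

text \<open>[g, h1 h2] = [g, h1] times the h1-conjugate of [g, h2]; the conjugate stays in the
  relative group by \<open>Erel_normal\<close>.\<close>

lemma comm_rel_mult_right:
  assumes "orth h1 h1'" "comm_rel g g' h1 h1'" "comm_rel g g' h2 h2'" "orth g g'"
  shows "comm_rel g g' (h1 * h2) (h2' * h1')"
proof -
  have inv: "h1' * h1 = 1" "g' * g = 1" using assms by (auto simp: orth_def)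
  have "(g * h1 * g' * h1') * (h1 * (g * h2 * g' * h2') * h1') = g * h1 * (g' * (h1' * h1) * g) * h2 * g' * h2' * h1'"
    by (simp only: mult.assoc)
  hence "g * (h1 * h2) * g' * (h2' * h1') = (g * h1 * g' * h1') * (h1 * (g * h2 * g' * h2') * h1')"
    by (simp only: inv mult_1_right mult.assoc)
  thus ?thesis using assms unfolding comm_rel_def by (auto intro: Erel_mult Erel_normal)
qed

lemma comm_rel_mult_left:
  assumes "orth g1 g1'" "comm_rel g1 g1' h h'" "comm_rel g2 g2' h h'" "orth h h'"
  shows "comm_rel (g1 * g2) (g2' * g1') h h'"
proof -
  have inv: "g1' * g1 = 1" "h' * h = 1" using assms by (auto simp: orth_def)
  have "(g1 * (g2 * h * g2' * h') * g1') * (g1 * h * g1' * h') = g1 * g2 * h * g2' * (h' * (g1' * g1) * h) * g1' * h'"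
    by (simp only: mult.assoc)
  hence "(g1 * g2) * h * (g2' * g1') * h' = (g1 * (g2 * h * g2' * h') * g1') * (g1 * h * g1' * h')"
    by (simp only: inv mult_1_right mult.assoc)
  thus ?thesis using assms unfolding comm_rel_def by (auto intro: Erel_mult Erel_normal)
qed

lemma Erel_commutator_E:
  assumes g: "orth g g'" and c: "c \<in> D" "c * c - 1 \<in> J" "\<And>k. k \<in> K \<Longrightarrow> g * z k * g' - c \<bullet>\<^sub>s z k \<in> Vec J"
    and h: "h \<in> E D" "orth h h'"
  shows "comm_rel g g' h h'"
proof -
  have "\<exists>h'. orth h h' \<and> comm_rel g g' h h'"
    using h(1)
  proof (induction h rule: E.induct)
    case one
    show ?case using g Erel.one by (intro exI[of _ 1]) (auto simp: orth_def comm_rel_def)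
  next
    case (step k l x h)
    then obtain h' where h': "orth h h'" "comm_rel g g' h h'" by auto
    let ?r = "1 + x \<bullet>\<^sub>s (z k * z l)" and ?r' = "1 + (- x) \<bullet>\<^sub>s (z k * z l)"
    have "\<exists>r'. orth ?r r'" using orth_E[OF E_root[OF step(1-4)]] by blast
    hence "orth ?r ?r'"
      using orth_unique[OF _ one_plus_inverse(1)[OF root_nilpotent[OF step(1-3)], of x]] by auto
    moreover have "comm_rel g g' ?r ?r'" unfolding comm_rel_def using g c step by (intro Erel_commutator_root)
    ultimately show ?case using h' g by (blast intro: orth_mult comm_rel_mult_right)
  qed
  then obtain h2 where "orth h h2" "comm_rel g g' h h2" by blast
  moreover have "h2 = h'" using h(2) orth_unique[of h h' h2] \<open>orth h h2\<close> by (simp add: orth_def)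
  ultimately show ?thesis by simp
qed

text \<open>Over the double the elements (g, 1) and (u, u) satisfy the hypotheses of
  \<open>fracE_commutator\<close>, since (a, 0) is a vector over the double when \<open>a\<close>
  has its coordinates in \<open>J\<close>. The second component of the commutator is 1, so
  \<open>Erel_of_pair\<close> leaves a relative element, up to a power of \<open>s\<close>.\<close>

lemma relative_commutator_unit_vector:
  assumes u: "u \<in> Vec D" "u * u = 1" and j: "j \<in> K" "fst j \<noteq> 0" and s: "br u (z (dual j)) = s \<bullet>\<^sub>s 1"
  shows "\<exists>N. \<forall>g g'. g * g' = 1 \<and> g' * g = 1 \<and> (\<forall>k\<in>K. \<exists>a\<in>Vec J. g * z k * g' = z k + s ^ N \<bullet>\<^sub>s a) \<longrightarrow>
     (\<exists>j. \<exists>V\<in>Erel J. s ^ j \<bullet>\<^sub>s (g * (u * h0) * g' * (h0 * u)) = s ^ j \<bullet>\<^sub>s V)"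
proof -
  have pj: "j \<in> P.K" using j by simp
  have ph: "P.h0 = pair h0 h0" by (simp add: P.h0_def h0_def pair_z_eq)
  have pu: "pair u u \<in> P.Vec (pair_D J)" using pair_Vec[OF u(1) Vec_0[OF J]] by simp
  have "P.fracE (pair s s) (pair u u * P.h0) (P.h0 * pair u u)"
    by (rule P.fracE_unit_vector(2)[OF pu _ pj j(2)])
       (use u s in \<open>simp_all add: pair_1 pair_z_eq pair_br pair_sm_pair flip: pair_1\<close>)
  from P.fracE_commutator[OF this] obtain N where N: "\<And>g g'. P.small (pair s s) N g g' \<Longrightarrow>
      \<exists>j. \<exists>W\<in>P.E (pair_D J). pair_sm (pair s s ^ j) (g * (pair u u * P.h0) * g' * (P.h0 * pair u u)) = pair_sm (pair s s ^ j) W"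
    by blast
  have pow: "(pair s s ^ m) i = s ^ m" for m i by (induction m) (auto simp: pair_def)
  show ?thesis
  proof (rule exI[of _ N], intro allI impI)
    fix g g' assume g: "g * g' = 1 \<and> g' * g = 1 \<and> (\<forall>k\<in>K. \<exists>a\<in>Vec J. g * z k * g' = z k + s ^ N \<bullet>\<^sub>s a)"
    have "P.small (pair s s) N (pair g 1) (pair g' 1)"
      unfolding P.small_def
    proof (intro conjI ballI)
      fix k assume "k \<in> K"
      then obtain a where a: "a \<in> Vec J" "g * z k * g' = z k + s ^ N \<bullet>\<^sub>s a" using g by blast
      have "pair (0 + a) 0 \<in> P.Vec (pair_D J)" using a by (intro pair_Vec Vec_0 idl_D)
      moreover have "pair g 1 * pair_z k * pair g' 1 = pair_z k + pair_sm (pair s s ^ N) (pair (0 + a) 0)"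
        using a by (simp add: pair_eq_iff pair_sm_def pow pair_z_eq)
      ultimately show "\<exists>a\<in>P.Vec (pair_D J). pair g 1 * pair_z k * pair g' 1 = pair_z k + pair_sm (pair s s ^ N) a" by blast
    qed (use g in \<open>simp_all add: pair_1\<close>)
    then obtain i W where W: "W \<in> P.E (pair_D J)"
      "pair_sm (pair s s ^ i) (pair g 1 * (pair u u * P.h0) * pair g' 1 * (P.h0 * pair u u)) = pair_sm (pair s s ^ i) W"
      using N by blast
    from fun_cong[OF W(2), of True] fun_cong[OF W(2), of False]
    have W': "s ^ i \<bullet>\<^sub>s (g * (u * h0) * g' * (h0 * u)) = s ^ i \<bullet>\<^sub>s W True" "s ^ i \<bullet>\<^sub>s (u * h0 * (h0 * u)) = s ^ i \<bullet>\<^sub>s W False"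
      by (simp_all add: pair_sm_def pow ph)
    have "u * h0 * (h0 * u) = u * (h0 * h0) * u" by (simp only: mult.assoc)
    hence "u * h0 * (h0 * u) = 1" using u by (simp add: h0_h0)
    with W' have F: "s ^ i \<bullet>\<^sub>s W False = s ^ i \<bullet>\<^sub>s 1" by simp
    obtain V where V: "V \<in> Erel J" "W True = V * W False" using Erel_of_pair[OF W(1)] by blast
    have "s ^ i \<bullet>\<^sub>s W True = V * (s ^ i \<bullet>\<^sub>s W False)" unfolding V by (simp only: sm_mult_right)
    hence "s ^ i \<bullet>\<^sub>s W True = s ^ i \<bullet>\<^sub>s V" unfolding F by simp
    thus "\<exists>j. \<exists>V\<in>Erel J. s ^ j \<bullet>\<^sub>s (g * (u * h0) * g' * (h0 * u)) = s ^ j \<bullet>\<^sub>s V" using W' V(1) by metis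
  qed
qed

end

end

subsection \<open>Row-finite infinite matrices\<close>

text \<open>They provide one ring type for matrices of all sizes: a square matrix of size \<open>N\<close> is repeated along the diagonal.\<close>

typedef (overloaded) 'b rfm = "{f :: nat \<Rightarrow> nat \<Rightarrow> 'b::comm_ring_1. \<forall>i. finite {j. f i j \<noteq> 0}}"
  morphisms ent Rfm
  by (rule exI[of _ "\<lambda>_ _. 0"]) simp

setup_lifting type_definition_rfm

lemma row_finite: "finite {j. ent A i j \<noteq> 0}"
  using ent[of A] by auto

lemma rfm_eqI: "(\<And>i j. ent A i j = ent B i j) \<Longrightarrow> A = B"
  by (metis ent_inject ext)

instantiation rfm :: (comm_ring_1) ring_1
begin

lift_definition zero_rfm :: "'a rfm" is "\<lambda>_ _. 0" by simp

lift_definition one_rfm :: "'a rfm" is "\<lambda>i j. if i = j then 1 else 0" by simp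

lift_definition plus_rfm :: "'a rfm \<Rightarrow> 'a rfm \<Rightarrow> 'a rfm" is "\<lambda>f g i j. f i j + g i j"
proof -
  fix f g :: "nat \<Rightarrow> nat \<Rightarrow> 'a" and i
  assume "\<And>i. finite {j. f i j \<noteq> 0}" "\<And>i. finite {j. g i j \<noteq> 0}"
  moreover have "{j. f i j + g i j \<noteq> 0} \<subseteq> {j. f i j \<noteq> 0} \<union> {j. g i j \<noteq> 0}" by auto
  ultimately show "finite {j. f i j + g i j \<noteq> 0}" by (meson finite_Un finite_subset)
qed

lift_definition uminus_rfm :: "'a rfm \<Rightarrow> 'a rfm" is "\<lambda>f i j. - f i j" by simp

definition minus_rfm :: "'a rfm \<Rightarrow> 'a rfm \<Rightarrow> 'a rfm" where
  "minus_rfm A B = A + (- B)"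

lift_definition times_rfm :: "'a rfm \<Rightarrow> 'a rfm \<Rightarrow> 'a rfm" is "\<lambda>f g i k. \<Sum>j | f i j \<noteq> 0. f i j * g j k"
proof -
  fix f g :: "nat \<Rightarrow> nat \<Rightarrow> 'a" and i
  assume f: "\<And>i. finite {j. f i j \<noteq> 0}" and g: "\<And>i. finite {j. g i j \<noteq> 0}"
  have "{k. (\<Sum>j | f i j \<noteq> 0. f i j * g j k) \<noteq> 0} \<subseteq> (\<Union>j\<in>{j. f i j \<noteq> 0}. {k. g j k \<noteq> 0})"
    by (auto elim!: sum.not_neutral_contains_not_neutral)
  moreover have "finite (\<Union>j\<in>{j. f i j \<noteq> 0}. {k. g j k \<noteq> 0})" using f g by blast
  ultimately show "finite {k. (\<Sum>j | f i j \<noteq> 0. f i j * g j k) \<noteq> 0}" by (rule finite_subset)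
qed

lemma ent_0 [simp]: "ent 0 i j = 0" and ent_1: "ent 1 i j = (if i = j then 1 else 0)"
  and ent_add [simp]: "ent (A + B) i j = ent A i j + ent B i j"
  and ent_uminus [simp]: "ent (- A) i j = - ent A i j"
  by (transfer, simp)+

lemma ent_mult_over:
  assumes "finite S" "{j. ent A i j \<noteq> 0} \<subseteq> S"
  shows "ent (A * B) i k = (\<Sum>j\<in>S. ent A i j * ent B j k)"
proof -
  have "ent (A * B) i k = (\<Sum>j | ent A i j \<noteq> 0. ent A i j * ent B j k)" by transfer simp
  also have "\<dots> = (\<Sum>j\<in>S. ent A i j * ent B j k)"
    using assms by (intro sum.mono_neutral_left) auto
  finally show ?thesis .
qed

instance
proof
  fix A B C :: "'a rfm"
  show "A * B * C = A * (B * C)"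
  proof (rule rfm_eqI)
    fix i l
    define S where "S = {j. ent A i j \<noteq> 0}"
    define T where "T = (\<Union>j\<in>S. {k. ent B j k \<noteq> 0})"
    have fin: "finite S" "finite T" by (simp_all add: S_def T_def row_finite)
    have AB: "ent (A * B) i k = (\<Sum>j\<in>S. ent A i j * ent B j k)" for k
      by (rule ent_mult_over) (auto simp: fin S_def row_finite)
    have "{k. ent (A * B) i k \<noteq> 0} \<subseteq> T"
      unfolding AB T_def by (auto elim!: sum.not_neutral_contains_not_neutral)
    hence "ent (A * B * C) i l = (\<Sum>k\<in>T. (\<Sum>j\<in>S. ent A i j * ent B j k) * ent C k l)"
      using fin by (simp add: ent_mult_over[of T] AB)
    also have "\<dots> = (\<Sum>j\<in>S. ent A i j * (\<Sum>k\<in>T. ent B j k * ent C k l))"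
      unfolding sum_distrib_left sum_distrib_right by (subst sum.swap) (simp add: mult.assoc)
    also have "\<dots> = (\<Sum>j\<in>S. ent A i j * ent (B * C) j l)"
    proof (rule sum.cong[OF refl])
      fix j assume "j \<in> S"
      hence "ent (B * C) j l = (\<Sum>k\<in>T. ent B j k * ent C k l)"
        by (intro ent_mult_over[OF fin(2)]) (auto simp: T_def)
      thus "ent A i j * (\<Sum>k\<in>T. ent B j k * ent C k l) = ent A i j * ent (B * C) j l" by simp
    qed
    also have "\<dots> = ent (A * (B * C)) i l"
      by (rule ent_mult_over[symmetric]) (auto simp: fin S_def row_finite)
    finally show "ent (A * B * C) i l = ent (A * (B * C)) i l" .
  qed
  show "1 * A = A"
    by (rule rfm_eqI, subst ent_mult_over[of "{i}" for i]) (auto simp: ent_1)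
  show "A * 1 = A"
  proof (rule rfm_eqI)
    fix i k
    have "ent (A * 1) i k = (\<Sum>j\<in>insert k {j. ent A i j \<noteq> 0}. ent A i j * ent 1 j k)"
      by (rule ent_mult_over) (auto simp: row_finite)
    also have "\<dots> = (\<Sum>j\<in>insert k {j. ent A i j \<noteq> 0}. if j = k then ent A i j else 0)"
      by (rule sum.cong) (auto simp: ent_1)
    finally show "ent (A * 1) i k = ent A i k" by (simp add: row_finite)
  qed
  show "(A + B) * C = A * C + B * C"
  proof (rule rfm_eqI)
    fix i k
    let ?S = "{j. ent A i j \<noteq> 0} \<union> {j. ent B i j \<noteq> 0}"
    have "finite ?S" by (simp add: row_finite)
    moreover have "{j. ent (A + B) i j \<noteq> 0} \<subseteq> ?S" by auto
    ultimately show "ent ((A + B) * C) i k = ent (A * C + B * C) i k"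
      by (simp add: ent_mult_over[of ?S] sum.distrib distrib_right)
  qed
  show "A * (B + C) = A * B + A * C"
    by (rule rfm_eqI) (simp add: ent_mult_over[OF row_finite order_refl] sum.distrib distrib_left)
  show "(0::'a rfm) \<noteq> 1"
  proof
    assume "(0::'a rfm) = 1"
    hence "ent (0::'a rfm) 0 0 = ent 1 0 0" by simp
    thus False by (simp add: ent_1)
  qed
qed (auto simp: minus_rfm_def intro!: rfm_eqI)

end

lemma ent_diff [simp]: "ent (A - B) i j = ent A i j - ent B i j"
  by (simp only: minus_rfm_def ent_add ent_uminus) simp

lift_definition smr :: "'b::comm_ring_1 \<Rightarrow> 'b rfm \<Rightarrow> 'b rfm" is "\<lambda>a f i j. a * f i j"
proof -
  fix a :: 'b and f :: "nat \<Rightarrow> nat \<Rightarrow> 'b" and i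
  assume "\<And>i. finite {j. f i j \<noteq> 0}"
  thus "finite {j. a * f i j \<noteq> 0}" by (rule_tac finite_subset[of _ "{j. f i j \<noteq> 0}"]) auto
qed

lemma ent_smr [simp]: "ent (smr a A) i j = a * ent A i j"
  by transfer simp

interpretation rfm: scalar_algebra smr
proof
  fix a b :: "'b::comm_ring_1" and A B :: "'b rfm"
  show "smr a (A + B) = smr a A + smr a B" "smr (a + b) A = smr a A + smr b A" "smr a (smr b A) = smr (a * b) A"
    "smr 1 A = A"
    by (auto intro!: rfm_eqI simp: algebra_simps)
  show "smr a A * B = smr a (A * B)"
  proof (rule rfm_eqI)
    fix i k
    have "{j. ent (smr a A) i j \<noteq> 0} \<subseteq> {j. ent A i j \<noteq> 0}" by auto
    from ent_mult_over[OF row_finite this] show "ent (smr a A * B) i k = ent (smr a (A * B)) i k"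
      by (simp add: ent_mult_over[OF row_finite order_refl] sum_distrib_left mult.assoc)
  qed
  show "A * smr a B = smr a (A * B)"
    by (rule rfm_eqI) (simp add: ent_mult_over[OF row_finite order_refl] sum_distrib_left mult.left_commute)
  show "a = 0" if "smr a 1 = 0"
  proof -
    have "ent (smr a 1) 0 0 = 0" using that by simp
    thus ?thesis by (simp add: ent_1)
  qed
qed

text \<open>The case distinction makes the definition total; it is vacuous for additive maps.\<close>

lift_definition map_rfm :: "('b::comm_ring_1 \<Rightarrow> 'd::comm_ring_1) \<Rightarrow> 'b rfm \<Rightarrow> 'd rfm" is
  "\<lambda>\<phi> f i j. if f i j = 0 then 0 else \<phi> (f i j)"
proof -
  fix \<phi> :: "'b \<Rightarrow> 'd" and f :: "nat \<Rightarrow> nat \<Rightarrow> 'b" and i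
  assume "\<And>i. finite {j. f i j \<noteq> 0}"
  thus "finite {j. (if f i j = 0 then 0 else \<phi> (f i j)) \<noteq> 0}" by (rule_tac finite_subset[of _ "{j. f i j \<noteq> 0}"]) auto
qed

context comm_ring_hom
begin

lemma ent_map_rfm [simp]: "ent (map_rfm hom A) i j = hom (ent A i j)"
  by (simp add: map_rfm.rep_eq)

lemma map_rfm_0 [simp]: "map_rfm hom 0 = 0" and map_rfm_1 [simp]: "map_rfm hom 1 = 1"
  and map_rfm_add [simp]: "map_rfm hom (A + B) = map_rfm hom A + map_rfm hom B"
  and map_rfm_uminus [simp]: "map_rfm hom (- A) = - map_rfm hom A"
  and map_rfm_diff [simp]: "map_rfm hom (A - B) = map_rfm hom A - map_rfm hom B"
  and map_rfm_smr [simp]: "map_rfm hom (smr a A) = smr (hom a) (map_rfm hom A)"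
  by (auto intro!: rfm_eqI simp: hom_distribs ent_1)

lemma map_rfm_mult [simp]: "map_rfm hom (A * B) = map_rfm hom A * map_rfm hom B"
proof (rule rfm_eqI)
  fix i k
  have "{j. ent (map_rfm hom A) i j \<noteq> 0} \<subseteq> {j. ent A i j \<noteq> 0}" by auto
  from ent_mult_over[OF row_finite this]
  have "ent (map_rfm hom A * map_rfm hom B) i k = (\<Sum>j | ent A i j \<noteq> 0. hom (ent A i j) * hom (ent B j k))"
    by (simp only: ent_map_rfm)
  moreover have "ent (map_rfm hom (A * B)) i k = (\<Sum>j | ent A i j \<noteq> 0. hom (ent A i j) * hom (ent B j k))"
    by (simp add: ent_mult_over[OF row_finite order_refl] hom_distribs)
  ultimately show "ent (map_rfm hom (A * B)) i k = ent (map_rfm hom A * map_rfm hom B) i k" by simp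
qed

lemma map_rfm_sum: "map_rfm hom (\<Sum>i\<in>S. f i) = (\<Sum>i\<in>S. map_rfm hom (f i))"
  by (induction S rule: infinite_finite_induct) auto

end

text \<open>Repeating the block, instead of filling up with zeros, makes the embedding unital; rows
  remain finite because each meets a single block.\<close>

lift_definition iota :: "nat \<Rightarrow> 'b::comm_ring_1 mat \<Rightarrow> 'b rfm" is
  "\<lambda>N M i j. if 0 < N \<and> i div N = j div N then M $$ (i mod N, j mod N) else 0"
proof -
  fix N :: nat and M :: "'b mat" and i
  show "finite {j. (if 0 < N \<and> i div N = j div N then M $$ (i mod N, j mod N) else 0) \<noteq> 0}"
  proof (cases "N = 0")
    case False
    have "j < Suc (i div N) * N" if "i div N = j div N" for j
      using False that by (metis div_less_iff_less_mult lessI neq0_conv)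
    hence "{j. (if 0 < N \<and> i div N = j div N then M $$ (i mod N, j mod N) else 0) \<noteq> 0} \<subseteq> {..<Suc (i div N) * N}"
      unfolding subset_iff mem_Collect_eq lessThan_iff by (metis (full_types))
    thus ?thesis by (rule finite_subset) (rule finite_lessThan)
  qed simp
qed

lemma ent_iota: "0 < N \<Longrightarrow> ent (iota N M) i j = (if i div N = j div N then M $$ (i mod N, j mod N) else 0)"
  by (simp only: iota.rep_eq simp_thms)

lemma iota_mult:
  assumes N: "0 < N" and A: "A \<in> carrier_mat N N" and B: "B \<in> carrier_mat N N"
  shows "iota N (A * B) = iota N A * iota N B"
proof (rule rfm_eqI)
  fix i k
  define b where "b = i div N"
  let ?S = "(\<lambda>t. b * N + t) ` {..<N}"
  have "{j. ent (iota N A) i j \<noteq> 0} \<subseteq> ?S"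
  proof
    fix j assume "j \<in> {j. ent (iota N A) i j \<noteq> 0}"
    hence "j div N = b" using N by (auto simp: ent_iota b_def split: if_splits)
    hence "j = b * N + j mod N" by (metis div_mult_mod_eq)
    thus "j \<in> ?S" using N by (metis imageI lessThan_iff mod_less_divisor)
  qed
  hence "ent (iota N A * iota N B) i k = (\<Sum>j\<in>?S. ent (iota N A) i j * ent (iota N B) j k)"
    by (intro ent_mult_over) auto
  also have "\<dots> = (\<Sum>t<N. ent (iota N A) i (b * N + t) * ent (iota N B) (b * N + t) k)"
    by (subst sum.reindex) (auto simp: inj_on_def)
  also have "\<dots> = (\<Sum>t<N. if b = k div N then A $$ (i mod N, t) * B $$ (t, k mod N) else 0)"
    using N by (intro sum.cong) (auto simp: ent_iota b_def)
  also have "\<dots> = ent (iota N (A * B)) i k"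
    using N A B by (auto simp: ent_iota b_def scalar_prod_def atLeast0LessThan)
  finally show "ent (iota N (A * B)) i k = ent (iota N A * iota N B) i k" ..
qed

lemma iota_1: "0 < N \<Longrightarrow> iota N (1\<^sub>m N) = 1"
proof (rule rfm_eqI)
  fix i j assume "0 < N"
  moreover have "i = j \<longleftrightarrow> i div N = j div N \<and> i mod N = j mod N" by (metis div_mult_mod_eq)
  ultimately show "ent (iota N (1\<^sub>m N)) i j = ent 1 i j" by (auto simp: ent_iota ent_1)
qed

lemma iota_add: "0 < N \<Longrightarrow> A \<in> carrier_mat N N \<Longrightarrow> B \<in> carrier_mat N N \<Longrightarrow> iota N (A + B) = iota N A + iota N B"
  by (rule rfm_eqI) (auto simp: ent_iota)

lemma iota_smult: "0 < N \<Longrightarrow> A \<in> carrier_mat N N \<Longrightarrow> iota N (a \<cdot>\<^sub>m A) = smr a (iota N A)"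
  by (rule rfm_eqI) (auto simp: ent_iota)

lemma iota_inj:
  assumes "0 < N" "A \<in> carrier_mat N N" "B \<in> carrier_mat N N" "iota N A = iota N B"
  shows "A = B"
proof (rule eq_matI)
  fix i j assume "i < dim_row B" "j < dim_col B"
  hence ij: "i < N" "j < N" using assms by auto
  have "ent (iota N A) i j = ent (iota N B) i j" using assms by simp
  thus "A $$ (i, j) = B $$ (i, j)" unfolding ent_iota[OF assms(1)] using ij by simp
qed (use assms in auto)

lemma (in comm_ring_hom) map_rfm_iota:
  "0 < N \<Longrightarrow> A \<in> carrier_mat N N \<Longrightarrow> map_rfm hom (iota N A) = iota N (map_mat hom A)"
  by (rule rfm_eqI) (auto simp: ent_iota)

subsection \<open>Suslin matrices and the Clifford algebra\<close>

abbreviation sbar :: "nat \<Rightarrow> 'b::comm_ring_1 vec \<Rightarrow> 'b vec \<Rightarrow> 'b mat" where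
  "sbar r v w \<equiv> transpose_mat (suslin r w v)"

lemma two_power_Suc: "(2::nat) ^ Suc r = 2 ^ r + 2 ^ r"
  by simp

lemma suslin_carrier [simp]: "suslin r v w \<in> carrier_mat (2 ^ r) (2 ^ r)"
proof (induction r arbitrary: v w)
  case (Suc r)
  show ?case unfolding suslin.simps Let_def two_power_Suc by (intro four_block_carrier_mat) auto
qed simp

lemma suslin_dim [simp]: "dim_row (suslin r v w) = 2 ^ r" "dim_col (suslin r v w) = 2 ^ r"
  by (rule carrier_matD[OF suslin_carrier])+

lemma vec_last_Suc: "v \<in> carrier_vec (Suc n) \<Longrightarrow> vec_last v n = vec n (\<lambda>i. v $ Suc i)"
  unfolding vec_last_def by (intro eq_vecI) auto

lemma vec_last_add:
  "v \<in> carrier_vec (Suc n) \<Longrightarrow> w \<in> carrier_vec (Suc n) \<Longrightarrow> vec_last (v + w) n = vec_last v n + vec_last w n"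
  by (intro eq_vecI) (auto simp: vec_last_Suc)

lemma vec_last_smult: "v \<in> carrier_vec (Suc n) \<Longrightarrow> vec_last (a \<cdot>\<^sub>v v) n = a \<cdot>\<^sub>v vec_last v n"
  by (intro eq_vecI) (auto simp: vec_last_Suc)

lemma scalar_prod_Suc:
  "v \<in> carrier_vec (Suc n) \<Longrightarrow> w \<in> carrier_vec (Suc n) \<Longrightarrow> v \<bullet> w = v $ 0 * w $ 0 + vec_last v n \<bullet> vec_last w n"
  by (simp add: scalar_prod_def vec_last_Suc sum.atLeast0_lessThan_Suc_shift del: sum.op_ivl_Suc)

lemma suslin_add:
  assumes "v \<in> carrier_vec (r + 1)" "v' \<in> carrier_vec (r + 1)" "w \<in> carrier_vec (r + 1)" "w' \<in> carrier_vec (r + 1)"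
  shows "suslin r (v + v') (w + w') = suslin r v w + suslin r v' w'"
  using assms
proof (induction r arbitrary: v v' w w')
  case 0
  thus ?case by (auto intro!: eq_matI)
next
  case (Suc r)
  have IH: "suslin r (vec_last (v + v') (Suc r)) (vec_last (w + w') (Suc r)) =
      suslin r (vec_last v (Suc r)) (vec_last w (Suc r)) + suslin r (vec_last v' (Suc r)) (vec_last w' (Suc r))"
    "suslin r (vec_last (w + w') (Suc r)) (vec_last (v + v') (Suc r)) =
      suslin r (vec_last w (Suc r)) (vec_last v (Suc r)) + suslin r (vec_last w' (Suc r)) (vec_last v' (Suc r))"
    using Suc.prems by (simp_all add: vec_last_add Suc.IH)
  show ?case unfolding suslin.simps Let_def IH using Suc.prems
    by (intro eq_matI) (auto simp: distrib_right)
qed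

lemma suslin_smult:
  assumes "v \<in> carrier_vec (r + 1)" "w \<in> carrier_vec (r + 1)"
  shows "suslin r (a \<cdot>\<^sub>v v) (a \<cdot>\<^sub>v w) = a \<cdot>\<^sub>m suslin r v w"
  using assms
proof (induction r arbitrary: v w)
  case 0
  thus ?case by (auto intro!: eq_matI)
next
  case (Suc r)
  have IH: "suslin r (vec_last (a \<cdot>\<^sub>v v) (Suc r)) (vec_last (a \<cdot>\<^sub>v w) (Suc r)) = a \<cdot>\<^sub>m suslin r (vec_last v (Suc r)) (vec_last w (Suc r))"
    "suslin r (vec_last (a \<cdot>\<^sub>v w) (Suc r)) (vec_last (a \<cdot>\<^sub>v v) (Suc r)) = a \<cdot>\<^sub>m suslin r (vec_last w (Suc r)) (vec_last v (Suc r))"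
    using Suc.prems by (simp_all add: vec_last_smult Suc.IH)
  show ?case unfolding suslin.simps Let_def IH using Suc.prems
    by (intro eq_matI) (auto simp: mult.assoc)
qed

lemma suslin_zero: "suslin r (0\<^sub>v (r + 1)) (0\<^sub>v (r + 1)) = (0\<^sub>m (2 ^ r) (2 ^ r) :: 'b::comm_ring_1 mat)"
proof -
  have "(0::'b) \<cdot>\<^sub>v 0\<^sub>v (r + 1) = 0\<^sub>v (r + 1)" by auto
  moreover have "(0::'b) \<cdot>\<^sub>m suslin r v w = 0\<^sub>m (2 ^ r) (2 ^ r)" for v w by (intro eq_matI) auto
  ultimately show ?thesis using suslin_smult[of "0\<^sub>v (r + 1)" r "0\<^sub>v (r + 1)" "0::'b"] by simp
qed

text \<open>Suslin's identity. In the block product the off-diagonal blocks cancel because the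
  diagonal blocks of the factors are scalar, and the induction hypothesis supplies the
  diagonal.\<close>

lemma suslin_sbar:
  assumes "v \<in> carrier_vec (r + 1)" "w \<in> carrier_vec (r + 1)"
  shows "suslin r v w * sbar r v w = (v \<bullet> w) \<cdot>\<^sub>m 1\<^sub>m (2 ^ r) \<and> sbar r v w * suslin r v w = (v \<bullet> w) \<cdot>\<^sub>m 1\<^sub>m (2 ^ r)"
  using assms
proof (induction r arbitrary: v w)
  case 0
  thus ?case by (auto intro!: eq_matI simp: scalar_prod_def mult.commute)
next
  case (Suc r)
  define A where "A = suslin r (vec_last v (Suc r)) (vec_last w (Suc r))"
  define B where "B = suslin r (vec_last w (Suc r)) (vec_last v (Suc r))"
  define N :: nat where "N = 2 ^ r"
  have AB: "A \<in> carrier_mat N N" "B \<in> carrier_mat N N" by (simp_all add: A_def B_def N_def)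
  hence ABt: "A\<^sup>T \<in> carrier_mat N N" "B\<^sup>T \<in> carrier_mat N N" by auto
  let ?q = "vec_last v (Suc r) \<bullet> vec_last w (Suc r)" and ?I = "1\<^sub>m N :: 'a mat"
  have IH: "A * B\<^sup>T = ?q \<cdot>\<^sub>m ?I" "B\<^sup>T * A = ?q \<cdot>\<^sub>m ?I"
    using Suc.IH[of "vec_last v (Suc r)" "vec_last w (Suc r)"] by (simp_all add: A_def B_def N_def)
  let ?a = "v $ 0" and ?b = "w $ 0"
  have c: "?a \<cdot>\<^sub>m ?I \<in> carrier_mat N N" "?b \<cdot>\<^sub>m ?I \<in> carrier_mat N N" by auto
  have S: "suslin (Suc r) v w = four_block_mat (?a \<cdot>\<^sub>m ?I) A (- B\<^sup>T) (?b \<cdot>\<^sub>m ?I)"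
    by (simp add: A_def B_def N_def Let_def)
  have S': "sbar (Suc r) v w = four_block_mat (?b \<cdot>\<^sub>m ?I) (- A) (B\<^sup>T) (?a \<cdot>\<^sub>m ?I)"
  proof -
    have "sbar (Suc r) v w = (four_block_mat (?b \<cdot>\<^sub>m ?I) B (- A\<^sup>T) (?a \<cdot>\<^sub>m ?I))\<^sup>T"
      by (simp add: A_def B_def N_def Let_def)
    also have "\<dots> = four_block_mat (?b \<cdot>\<^sub>m ?I)\<^sup>T (- A\<^sup>T)\<^sup>T B\<^sup>T (?a \<cdot>\<^sub>m ?I)\<^sup>T"
      using AB by (intro transpose_four_block_mat) auto
    also have "(- A\<^sup>T)\<^sup>T = - A" using AB by (intro eq_matI) auto
    finally have "sbar (Suc r) v w = four_block_mat (?b \<cdot>\<^sub>m ?I)\<^sup>T (- A) B\<^sup>T (?a \<cdot>\<^sub>m ?I)\<^sup>T" .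
    moreover have "(x \<cdot>\<^sub>m ?I)\<^sup>T = x \<cdot>\<^sub>m ?I" for x by (intro eq_matI) auto
    ultimately show ?thesis by simp
  qed
  have q: "v \<bullet> w = ?a * ?b + ?q" using Suc.prems by (intro scalar_prod_Suc) auto
  have I: "(v \<bullet> w) \<cdot>\<^sub>m 1\<^sub>m (2 ^ Suc r) = four_block_mat ((?a * ?b + ?q) \<cdot>\<^sub>m ?I) (0\<^sub>m N N) (0\<^sub>m N N) ((?a * ?b + ?q) \<cdot>\<^sub>m ?I)"
    unfolding q by (intro eq_matI) (auto simp: N_def)
  have sI: "(x \<cdot>\<^sub>m ?I) * M = x \<cdot>\<^sub>m M" "M * (x \<cdot>\<^sub>m ?I) = x \<cdot>\<^sub>m M" if "M \<in> carrier_mat N N" for x and M :: "'a mat"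
    using that by auto
  have um: "(- A) * M = - (A * M)" "M * (- A) = - (M * A)" if "A \<in> carrier_mat N N" "M \<in> carrier_mat N N" for A M :: "'a mat"
    using that by (auto simp: uminus_mult_left_mat uminus_mult_right_mat)
  have 1: "suslin (Suc r) v w * sbar (Suc r) v w = (v \<bullet> w) \<cdot>\<^sub>m 1\<^sub>m (2 ^ Suc r)"
    unfolding S S' I using AB ABt
    by (subst mult_four_block_mat[of _ N N _ N _ N _ _ N _ N];
        (simp add: sI um IH)?) (auto intro!: eq_matI cong_four_block_mat simp: algebra_simps)
  have 2: "sbar (Suc r) v w * suslin (Suc r) v w = (v \<bullet> w) \<cdot>\<^sub>m 1\<^sub>m (2 ^ Suc r)"
    unfolding S S' I using AB ABt
    by (subst mult_four_block_mat[of _ N N _ N _ N _ _ N _ N];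
        (simp add: sI um IH)?) (auto intro!: eq_matI cong_four_block_mat simp: algebra_simps)
  from 1 2 show ?case ..
qed

lemma suslin_unit: "suslin r (unit_vec (r + 1) 0) (unit_vec (r + 1) 0) = (1\<^sub>m (2 ^ r) :: 'b::comm_ring_1 mat)"
proof (cases r)
  case 0
  thus ?thesis by (auto intro!: eq_matI)
next
  case (Suc m)
  have "vec_last (unit_vec (r + 1) 0) (Suc m) = (0\<^sub>v (m + 1) :: 'b vec)"
    using Suc by (intro eq_vecI) (auto simp: vec_last_Suc)
  thus ?thesis using Suc suslin_zero[of m, where 'b = 'b] by (simp add: Let_def) (auto intro!: eq_matI)
qed

text \<open>By \<open>suslin_sbar\<close> this matrix squares to the scalar v . w, which is the
  defining relation of the Clifford algebra. Vectors exchange the two half-spin summands, so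
  products of two vectors are block diagonal.\<close>

definition Cmat :: "nat \<Rightarrow> 'b::comm_ring_1 vec \<Rightarrow> 'b vec \<Rightarrow> 'b mat" where
  "Cmat r v w = four_block_mat (0\<^sub>m (2 ^ r) (2 ^ r)) (suslin r v w) (sbar r v w) (0\<^sub>m (2 ^ r) (2 ^ r))"

lemma Cmat_carrier [simp]: "Cmat r v w \<in> carrier_mat (2 * 2 ^ r) (2 * 2 ^ r)"
  unfolding Cmat_def mult_2 by (intro four_block_carrier_mat) auto

definition bdiag :: "nat \<Rightarrow> 'b::comm_ring_1 mat \<Rightarrow> 'b mat \<Rightarrow> 'b mat" where
  "bdiag r g h = four_block_mat g (0\<^sub>m (2 ^ r) (2 ^ r)) (0\<^sub>m (2 ^ r) (2 ^ r)) h"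

lemma bdiag_carrier [simp]:
  "g \<in> carrier_mat (2 ^ r) (2 ^ r) \<Longrightarrow> h \<in> carrier_mat (2 ^ r) (2 ^ r) \<Longrightarrow> bdiag r g h \<in> carrier_mat (2 * 2 ^ r) (2 * 2 ^ r)"
  unfolding bdiag_def mult_2 by (intro four_block_carrier_mat) auto

lemma Cmat_mult: "Cmat r v w * Cmat r v' w' = bdiag r (suslin r v w * sbar r v' w') (sbar r v w * suslin r v' w')"
  unfolding Cmat_def bdiag_def
  by (subst mult_four_block_mat[of _ "2 ^ r" "2 ^ r" _ "2 ^ r" _ "2 ^ r" _ _ "2 ^ r" _ "2 ^ r"]) (auto intro!: cong_four_block_mat)

lemma bdiag_mult:
  assumes "g \<in> carrier_mat (2 ^ r) (2 ^ r)" "h \<in> carrier_mat (2 ^ r) (2 ^ r)"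
    "g' \<in> carrier_mat (2 ^ r) (2 ^ r)" "h' \<in> carrier_mat (2 ^ r) (2 ^ r)"
  shows "bdiag r g h * bdiag r g' h' = bdiag r (g * g') (h * h')"
  unfolding bdiag_def using assms
  by (subst mult_four_block_mat[of _ "2 ^ r" "2 ^ r" _ "2 ^ r" _ "2 ^ r" _ _ "2 ^ r" _ "2 ^ r"]) (auto intro!: cong_four_block_mat)

lemma bdiag_eq_iff:
  assumes "g \<in> carrier_mat (2 ^ r) (2 ^ r)" "h \<in> carrier_mat (2 ^ r) (2 ^ r)"
    "g' \<in> carrier_mat (2 ^ r) (2 ^ r)" "h' \<in> carrier_mat (2 ^ r) (2 ^ r)" "bdiag r g h = bdiag r g' h'"
  shows "g = g'"
proof (rule eq_matI)
  fix i j assume "i < dim_row g'" "j < dim_col g'"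
  hence ij: "i < 2 ^ r" "j < 2 ^ r" using assms by auto
  have "bdiag r g h $$ (i, j) = bdiag r g' h' $$ (i, j)" using assms(5) by simp
  thus "g $$ (i, j) = g' $$ (i, j)" using ij assms(1-4) by (simp add: bdiag_def)
qed (use assms in auto)

definition Cl :: "nat \<Rightarrow> 'b::comm_ring_1 vec \<Rightarrow> 'b vec \<Rightarrow> 'b rfm" where
  "Cl r v w = iota (2 * 2 ^ r) (Cmat r v w)"

text \<open>\<open>lft r g W\<close>: the matrix \<open>g\<close> is the half-spin component of the even element \<open>W\<close>.\<close>

definition lft :: "nat \<Rightarrow> 'b::comm_ring_1 mat \<Rightarrow> 'b rfm \<Rightarrow> bool" where
  "lft r g W \<longleftrightarrow> g \<in> carrier_mat (2 ^ r) (2 ^ r) \<and> (\<exists>h\<in>carrier_mat (2 ^ r) (2 ^ r). W = iota (2 * 2 ^ r) (bdiag r g h))"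

lemma lft_carrier: "lft r g W \<Longrightarrow> g \<in> carrier_mat (2 ^ r) (2 ^ r)"
  by (simp add: lft_def)

lemma lft_mult: "lft r g W \<Longrightarrow> lft r g' W' \<Longrightarrow> lft r (g * g') (W * W')"
  unfolding lft_def
proof (elim conjE bexE, intro conjI)
  fix h h' assume *: "g \<in> carrier_mat (2 ^ r) (2 ^ r)" "g' \<in> carrier_mat (2 ^ r) (2 ^ r)"
    "h \<in> carrier_mat (2 ^ r) (2 ^ r)" "W = iota (2 * 2 ^ r) (bdiag r g h)"
    "h' \<in> carrier_mat (2 ^ r) (2 ^ r)" "W' = iota (2 * 2 ^ r) (bdiag r g' h')"
  have pos: "0 < 2 * (2::nat) ^ r" by simp
  from iota_mult[OF pos bdiag_carrier[OF *(1,3)] bdiag_carrier[OF *(2,5)]]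
  have "W * W' = iota (2 * 2 ^ r) (bdiag r (g * g') (h * h'))"
    by (simp only: bdiag_mult[OF *(1,3,2,5)] *(4,6))
  moreover have "h * h' \<in> carrier_mat (2 ^ r) (2 ^ r)" using *(3,5) by (rule mult_carrier_mat)
  ultimately show "\<exists>h\<in>carrier_mat (2 ^ r) (2 ^ r). W * W' = iota (2 * 2 ^ r) (bdiag r (g * g') h)" by (rule bexI)
qed (rule mult_carrier_mat)

lemma lft_1: "lft r (1\<^sub>m (2 ^ r) :: 'b::comm_ring_1 mat) 1"
proof -
  have "bdiag r (1\<^sub>m (2 ^ r)) (1\<^sub>m (2 ^ r)) = (1\<^sub>m (2 * 2 ^ r) :: 'b mat)"
    unfolding bdiag_def four_block_one_mat by (simp only: mult_2)
  moreover have "iota (2 * 2 ^ r) (1\<^sub>m (2 * 2 ^ r)) = (1 :: 'b rfm)" by (rule iota_1) simp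
  ultimately have "(1 :: 'b rfm) = iota (2 * 2 ^ r) (bdiag r (1\<^sub>m (2 ^ r)) (1\<^sub>m (2 ^ r)))" by (simp only:)
  thus ?thesis unfolding lft_def by (auto intro: bexI[of _ "1\<^sub>m (2 ^ r)"])
qed

lemma lft_unique:
  assumes "lft r g W" "lft r g' W"
  shows "g = g'"
proof -
  obtain h h' where h: "h \<in> carrier_mat (2 ^ r) (2 ^ r)" "h' \<in> carrier_mat (2 ^ r) (2 ^ r)"
    "W = iota (2 * 2 ^ r) (bdiag r g h)" "W = iota (2 * 2 ^ r) (bdiag r g' h')"
    using assms by (auto simp: lft_def)
  note g = lft_carrier[OF assms(1)] lft_carrier[OF assms(2)]
  have "iota (2 * 2 ^ r) (bdiag r g h) = iota (2 * 2 ^ r) (bdiag r g' h')" using h(3,4) by (rule subst)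
  hence "bdiag r g h = bdiag r g' h'"
    by (rule iota_inj[rotated 3]) (use g h(1,2) in \<open>auto intro: bdiag_carrier\<close>)
  thus ?thesis by (rule bdiag_eq_iff[OF g(1) h(1) g(2) h(2)])
qed

lemma lft_Cl: "lft r (suslin r v w * sbar r v' w') (Cl r v w * Cl r v' w')"
  unfolding lft_def Cl_def
  by (auto simp: Cmat_mult simp flip: iota_mult
      intro!: bexI[of _ "sbar r v w * suslin r v' w'"])

lemma Cl_add:
  assumes "v \<in> carrier_vec (r + 1)" "v' \<in> carrier_vec (r + 1)" "w \<in> carrier_vec (r + 1)" "w' \<in> carrier_vec (r + 1)"
  shows "Cl r (v + v') (w + w') = Cl r v w + Cl r v' w'"
proof -
  have "Cmat r (v + v') (w + w') = Cmat r v w + Cmat r v' w'"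
    unfolding Cmat_def suslin_add[OF assms] suslin_add[OF assms(3,4,1,2)] by (intro eq_matI) auto
  thus ?thesis unfolding Cl_def by (simp add: iota_add)
qed

lemma Cl_smult:
  assumes "v \<in> carrier_vec (r + 1)" "w \<in> carrier_vec (r + 1)"
  shows "Cl r (a \<cdot>\<^sub>v v) (a \<cdot>\<^sub>v w) = smr a (Cl r v w)"
proof -
  have "Cmat r (a \<cdot>\<^sub>v v) (a \<cdot>\<^sub>v w) = a \<cdot>\<^sub>m Cmat r v w"
    unfolding Cmat_def suslin_smult[OF assms] suslin_smult[OF assms(2,1)] by (intro eq_matI) auto
  thus ?thesis unfolding Cl_def by (simp add: iota_smult)
qed

lemma Cl_zero: "Cl r (0\<^sub>v (r + 1)) (0\<^sub>v (r + 1)) = (0 :: 'b::comm_ring_1 rfm)"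
proof -
  have "(0::'b) \<cdot>\<^sub>v 0\<^sub>v (r + 1) = 0\<^sub>v (r + 1)" by auto
  thus ?thesis using Cl_smult[of "0\<^sub>v (r + 1)" r "0\<^sub>v (r + 1)" "0::'b"] by simp
qed

lemma Cl_square:
  assumes "v \<in> carrier_vec (r + 1)" "w \<in> carrier_vec (r + 1)"
  shows "Cl r v w * Cl r v w = smr (v \<bullet> w) 1"
proof -
  have "Cmat r v w * Cmat r v w = (v \<bullet> w) \<cdot>\<^sub>m 1\<^sub>m (2 * 2 ^ r)"
    unfolding Cmat_mult using suslin_sbar[OF assms] by (auto simp: bdiag_def intro!: eq_matI)
  hence "Cl r v w * Cl r v w = iota (2 * 2 ^ r) ((v \<bullet> w) \<cdot>\<^sub>m 1\<^sub>m (2 * 2 ^ r))"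
    unfolding Cl_def by (simp flip: iota_mult)
  also have "\<dots> = smr (v \<bullet> w) 1" by (simp add: iota_smult iota_1)
  finally show ?thesis .
qed

lemma Cl_br:
  assumes c: "v \<in> carrier_vec (r + 1)" "v' \<in> carrier_vec (r + 1)" "w \<in> carrier_vec (r + 1)" "w' \<in> carrier_vec (r + 1)"
  shows "br (Cl r v w) (Cl r v' w') = smr (v \<bullet> w' + v' \<bullet> w) 1"
proof -
  have "br (Cl r v w) (Cl r v' w') = Cl r (v + v') (w + w') * Cl r (v + v') (w + w') - Cl r v w * Cl r v w - Cl r v' w' * Cl r v' w'"
    by (simp add: Cl_add[OF c] br_def algebra_simps)
  also have "\<dots> = smr ((v + v') \<bullet> (w + w') - v \<bullet> w - v' \<bullet> w') 1"
    using c by (simp add: Cl_square)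
  also have "(v + v') \<bullet> (w + w') - v \<bullet> w - v' \<bullet> w' = v \<bullet> w' + v' \<bullet> w"
    using c by (simp add: scalar_prod_add_distrib[of _ "r + 1"] add_scalar_prod_distrib[of _ "r + 1"])
  finally show ?thesis .
qed

definition zc :: "nat \<Rightarrow> nat \<times> bool \<Rightarrow> 'b::comm_ring_1 rfm" where
  "zc r k = (if snd k then Cl r (unit_vec (r + 1) (fst k)) (0\<^sub>v (r + 1)) else Cl r (0\<^sub>v (r + 1)) (unit_vec (r + 1) (fst k)))"

lemma zc_clifford:
  assumes "r \<ge> 2"
  shows "clifford smr (UNIV :: 'b::comm_ring_1 set) (zc r) (r + 1)"
proof
  fix k l :: "nat \<times> bool"
  show "zc r k * zc r k = (0 :: 'b rfm)" if "fst k < r + 1"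
    using that by (auto simp: zc_def Cl_square)
  show "br (zc r k) (zc r l) = (if l = dual k then 1 else 0 :: 'b rfm)" if "fst k < r + 1" "fst l < r + 1"
    using that by (auto simp: zc_def Cl_br dual_def prod_eq_iff)
  show "3 \<le> r + 1" using assms by simp
qed auto

lemma Cl_eq_sum:
  fixes v w :: "'b::comm_ring_1 vec"
  assumes c: "v \<in> carrier_vec (r + 1)" "w \<in> carrier_vec (r + 1)"
  shows "Cl r v w = (\<Sum>i<r + 1. smr (v $ i) (zc r (i, True)) + smr (w $ i) (zc r (i, False)))"
proof -
  \<comment> \<open>Truncation to the first m coordinates, so that one coordinate of
    \<open>v\<close> and one of \<open>w\<close> are added at a time.\<close>
  define tr where "tr = (\<lambda>m (v :: 'b vec). vec (r + 1) (\<lambda>i. if i < m then v $ i else 0))"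
  have "m \<le> r + 1 \<Longrightarrow> Cl r (tr m v) (tr m w) = (\<Sum>i<m. smr (v $ i) (zc r (i, True)) + smr (w $ i) (zc r (i, False)))" for m
  proof (induction m)
    case 0
    have "tr 0 u = 0\<^sub>v (r + 1)" for u by (auto simp: tr_def)
    thus ?case using Cl_zero[of r, where 'b = 'b] by simp
  next
    case (Suc m)
    have tr_carrier: "tr m u \<in> carrier_vec (r + 1)" for u by (simp add: tr_def)
    have tr: "tr (Suc m) u = tr m u + u $ m \<cdot>\<^sub>v unit_vec (r + 1) m" for u
      using Suc.prems by (intro eq_vecI) (auto simp: tr_def less_Suc_eq unit_vec_def)
    have "Cl r (v $ m \<cdot>\<^sub>v unit_vec (r + 1) m) (w $ m \<cdot>\<^sub>v unit_vec (r + 1) m) =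
        Cl r (v $ m \<cdot>\<^sub>v unit_vec (r + 1) m + v $ m \<cdot>\<^sub>v 0\<^sub>v (r + 1) ) (w $ m \<cdot>\<^sub>v 0\<^sub>v (r + 1) + w $ m \<cdot>\<^sub>v unit_vec (r + 1) m)"
      by (intro arg_cong2[of _ _ _ _ "Cl r"]) auto
    also have "\<dots> = Cl r (v $ m \<cdot>\<^sub>v unit_vec (r + 1) m) (v $ m \<cdot>\<^sub>v 0\<^sub>v (r + 1)) + Cl r (w $ m \<cdot>\<^sub>v 0\<^sub>v (r + 1)) (w $ m \<cdot>\<^sub>v unit_vec (r + 1) m)"
      by (subst Cl_add[symmetric]) (auto intro!: arg_cong2[of _ _ _ _ "Cl r"])
    also have "\<dots> = smr (v $ m) (zc r (m, True)) + smr (w $ m) (zc r (m, False))"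
      by (subst (1 2) Cl_smult) (auto simp: zc_def)
    finally show ?case unfolding tr using Suc tr_carrier by (subst Cl_add) auto
  qed
  from this[of "r + 1"] have "Cl r (tr (r + 1) v) (tr (r + 1) w) = (\<Sum>i<r + 1. smr (v $ i) (zc r (i, True)) + smr (w $ i) (zc r (i, False)))"
    by simp
  moreover have "tr (r + 1) u = u" if "u \<in> carrier_vec (r + 1)" for u
    using that by (intro eq_vecI) (auto simp: tr_def)
  ultimately show ?thesis using c by simp
qed

lemma clifford_vec_eq:
  fixes a :: "nat \<times> bool \<Rightarrow> 'b::comm_ring_1"
  assumes r: "r \<ge> 2"
  shows "clifford.vec smr (zc r) (r + 1) a = Cl r (vec (r + 1) (\<lambda>i. a (i, True))) (vec (r + 1) (\<lambda>i. a (i, False)))"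
proof -
  interpret clifford smr "UNIV :: 'b set" "zc r" "r + 1" by (rule zc_clifford[OF r])
  have "(\<Sum>k\<in>K. smr (a k) (zc r k)) = (\<Sum>i<r + 1. \<Sum>b\<in>UNIV. smr (a (i, b)) (zc r (i, b)))"
    unfolding K_eq by (simp only: sum.cartesian_product) (simp add: case_prod_beta)
  thus ?thesis unfolding vec_def by (simp add: Cl_eq_sum UNIV_bool add.commute)
qed

lemma (in comm_ring_hom) map_suslin:
  assumes "v \<in> carrier_vec (r + 1)" "w \<in> carrier_vec (r + 1)"
  shows "map_mat hom (suslin r v w) = suslin r (map_vec hom v) (map_vec hom w)"
  using assms
proof (induction r arbitrary: v w)
  case 0
  thus ?case by (auto intro!: eq_matI)
next
  case (Suc r)
  have l: "vec_last (map_vec hom u) (Suc r) = map_vec hom (vec_last u (Suc r))" if "u \<in> carrier_vec (Suc r + 1)" for u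
    using that by (intro eq_vecI) (auto simp: vec_last_Suc)
  have IH: "suslin r (map_vec hom (vec_last v (Suc r))) (map_vec hom (vec_last w (Suc r))) = map_mat hom (suslin r (vec_last v (Suc r)) (vec_last w (Suc r)))"
    "suslin r (map_vec hom (vec_last w (Suc r))) (map_vec hom (vec_last v (Suc r))) = map_mat hom (suslin r (vec_last w (Suc r)) (vec_last v (Suc r)))"
    by (simp_all add: Suc.IH)
  show ?case unfolding suslin.simps Let_def l[OF Suc.prems(1)] l[OF Suc.prems(2)] IH using Suc.prems
    by (intro eq_matI) (auto simp: hom_distribs)
qed

lemma (in comm_ring_hom) map_Cl:
  assumes "v \<in> carrier_vec (r + 1)" "w \<in> carrier_vec (r + 1)"
  shows "map_rfm hom (Cl r v w) = Cl r (map_vec hom v) (map_vec hom w)"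
proof -
  have "map_mat hom (Cmat r v w) = Cmat r (map_vec hom v) (map_vec hom w)"
    unfolding Cmat_def map_suslin[OF assms, symmetric] map_suslin[OF assms(2,1), symmetric] by (intro eq_matI) auto
  thus ?thesis unfolding Cl_def by (simp add: map_rfm_iota)
qed

lemma (in comm_ring_hom) map_zc: "map_rfm hom (zc r k) = zc r k"
proof -
  have "map_vec hom (0\<^sub>v (r + 1)) = 0\<^sub>v (r + 1)" "map_vec hom (unit_vec (r + 1) i) = unit_vec (r + 1) i" for i
    by (intro eq_vecI; auto simp: unit_vec_def)+
  thus ?thesis by (simp add: zc_def map_Cl)
qed

subsection \<open>Base change and the homotopy argument\<close>

locale suslin_rank =
  fixes r :: nat
  assumes r_ge_2: "r \<ge> 2"
begin

interpretation cl: clifford smr UNIV "zc r" "Suc r"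
  using zc_clifford[OF r_ge_2] by simp

lemma map_rfm_E:
  assumes "comm_ring_hom \<phi>" "g \<in> cl.E UNIV"
  shows "map_rfm \<phi> g \<in> cl.E UNIV"
proof -
  interpret comm_ring_hom \<phi> by fact
  show ?thesis using assms(2)
  proof (induction g rule: cl.E.induct)
    case (step k l x g)
    thus ?case by (simp add: map_zc cl.E.step)
  qed (simp add: cl.E.one)
qed

lemma map_rfm_Erel:
  assumes "comm_ring_hom \<phi>" "\<phi> ` J \<subseteq> J'" "g \<in> cl.Erel J"
  shows "map_rfm \<phi> g \<in> cl.Erel J'"
proof -
  interpret comm_ring_hom \<phi> by fact
  show ?thesis using assms(3)
  proof (induction g rule: cl.Erel.induct)
    case (step \<gamma> \<gamma>' k l x h)
    have "map_rfm \<phi> \<gamma> * (1 + smr (\<phi> x) (zc r k * zc r l)) * map_rfm \<phi> \<gamma>' * map_rfm \<phi> h \<in> cl.Erel J'"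
      using step assms(1,2) map_rfm_E[OF assms(1)] by (intro cl.Erel.step) (auto simp flip: map_rfm_mult)
    thus ?case by (simp add: map_zc)
  qed (simp add: cl.Erel.one)
qed

lemma map_rfm_vec:
  assumes "comm_ring_hom \<phi>"
  shows "map_rfm \<phi> (cl.vec a) = cl.vec (\<lambda>k. \<phi> (a k))"
proof -
  interpret comm_ring_hom \<phi> by fact
  show ?thesis by (simp add: cl.vec_def map_rfm_sum map_zc)
qed

lemma map_rfm_Vec:
  assumes "comm_ring_hom \<phi>" "\<phi> ` P \<subseteq> P'" "u \<in> cl.Vec P"
  shows "map_rfm \<phi> u \<in> cl.Vec P'"
proof -
  obtain a where "u = cl.vec a" "\<forall>k\<in>cl.K. a k \<in> P" using assms(3) by (auto simp: cl.Vec_def)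
  thus ?thesis using assms(2) by (auto simp: map_rfm_vec[OF assms(1)] intro!: cl.vec_in_Vec)
qed

lemma map_rfm_h0:
  assumes "comm_ring_hom \<phi>"
  shows "map_rfm \<phi> cl.h0 = cl.h0"
proof -
  interpret comm_ring_hom \<phi> by fact
  show ?thesis by (simp add: cl.h0_def map_zc)
qed

definition poly_ideal :: "'b::comm_ring_1 set \<Rightarrow> 'b poly set" where
  "poly_ideal J = {p. \<forall>i. coeff p i \<in> J}"

lemma idl_poly_ideal: "cl.idl J \<Longrightarrow> cl.idl (poly_ideal J)"
  unfolding cl.idl_def[of "poly_ideal J"]
  by (auto simp: poly_ideal_def coeff_mult cl.idlD intro!: cl.idl_sum)

lemma comm_ring_hom_poly: "comm_ring_hom (\<lambda>p. poly p x)"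
  by unfold_locales auto

lemma comm_ring_hom_const: "comm_ring_hom (\<lambda>a. [:a:])"
  by unfold_locales (auto simp: one_pCons)

lemma comm_ring_hom_pcompose: "comm_ring_hom (\<lambda>p. pcompose p q)"
  by unfold_locales (auto simp: pcompose_add pcompose_mult pcompose_1)

lemma comm_ring_hom_comp: "comm_ring_hom f \<Longrightarrow> comm_ring_hom g \<Longrightarrow> comm_ring_hom (\<lambda>x. f (g x))"
proof -
  assume "comm_ring_hom f" "comm_ring_hom g"
  then interpret f: comm_ring_hom f + g: comm_ring_hom g .
  show "comm_ring_hom (\<lambda>x. f (g x))" by unfold_locales (auto simp: f.hom_add g.hom_add f.hom_mult g.hom_mult)
qed

lemma map_rfm_comp:
  assumes "comm_ring_hom f" "comm_ring_hom g"
  shows "map_rfm f (map_rfm g A) = map_rfm (\<lambda>x. f (g x)) A"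
proof -
  interpret f: comm_ring_hom f by fact
  interpret g: comm_ring_hom g by fact
  interpret fg: comm_ring_hom "\<lambda>x. f (g x)" by (rule comm_ring_hom_comp[OF assms])
  show ?thesis by (rule rfm_eqI) simp
qed

lemma poly_in_ideal: "cl.idl J \<Longrightarrow> p \<in> poly_ideal J \<Longrightarrow> poly p x \<in> J"
  by (simp add: poly_altdef poly_ideal_def cl.idl_sum cl.idlD)

lemma pcompose_in_ideal:
  assumes J: "cl.idl J" and p: "p \<in> poly_ideal J"
  shows "pcompose p q \<in> poly_ideal J"
  using p
proof (induction p)
  case 0
  thus ?case by simp
next
  case (pCons a p)
  note I = cl.idlD[OF idl_poly_ideal[OF J]]
  have c: "coeff (pCons a p) i \<in> J" for i using pCons.prems by (simp add: poly_ideal_def)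
  have "p \<in> poly_ideal J" unfolding poly_ideal_def using c[of "Suc i" for i] by simp
  moreover have "[:a:] \<in> poly_ideal J" unfolding poly_ideal_def
    using c[of 0] cl.idlD(2)[OF J] by (auto simp: coeff_pCons split: nat.splits)
  ultimately show ?case using pCons.IH by (simp add: pcompose_pCons I)
qed

text \<open>Every term of positive degree acquires a factor s^j, which kills its coefficient; the
  constant term is zero by the second assumption.\<close>

lemma poly_eval_torsion:
  fixes p :: "'b::comm_ring_1 poly"
  assumes "[:s:] ^ j * p = 0" "poly p 0 = 0"
  shows "poly p (s ^ j * y) = 0"
proof -
  have "coeff ([:s:] ^ j * p) i = s ^ j * coeff p i" for i
  proof -
    have "[:s:] ^ j = [:s ^ j:]" by (rule poly_const_pow)
    thus ?thesis by simp
  qed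
  hence c: "s ^ j * coeff p i = 0" for i using assms(1) by simp
  have "coeff p i * (s ^ j * y) ^ i = 0" for i
  proof (cases i)
    case 0
    thus ?thesis using assms(2) by (simp add: poly_0_coeff_0)
  next
    case (Suc m)
    have "coeff p i * (s ^ j * y) ^ i = (s ^ j * coeff p i) * (y * (s ^ j * y) ^ m)"
      by (simp add: Suc ac_simps)
    thus ?thesis by (simp add: c)
  qed
  thus ?thesis by (simp add: poly_altdef)
qed

text \<open>Equality up to a power of \<open>s\<close> over \<open>B[Y]\<close> becomes equality after the substitution \<open>Y \<mapsto> s\<^sup>M Y\<close>,
  since both sides agree at \<open>Y = 0\<close>.\<close>

lemma dilation:
  fixes \<delta> \<delta>' :: "'b::comm_ring_1 poly rfm"
  assumes J: "cl.idl J"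
    and u: "u \<in> cl.Vec UNIV" "u * u = 1" and j: "j \<in> cl.K" "fst j \<noteq> 0" and s: "br u (zc r (dual j)) = smr s 1"
    and inv: "\<delta> * \<delta>' = 1" "\<delta>' * \<delta> = 1" and \<delta>0: "map_rfm (\<lambda>p. poly p 0) \<delta> = 1"
    and \<delta>: "\<And>k. k \<in> cl.K \<Longrightarrow> \<exists>a\<in>cl.Vec (poly_ideal J). \<delta> * zc r k * \<delta>' = zc r k + smr [:0, 1:] a"
  shows "\<exists>M. \<forall>y. map_rfm (\<lambda>p. poly p (s ^ M * y)) \<delta> * (u * cl.h0) * map_rfm (\<lambda>p. poly p (s ^ M * y)) \<delta>' * (cl.h0 * u) \<in> cl.Erel J"
proof -
  let ?c = "\<lambda>a::'b. [:a:]" and ?ev = "\<lambda>x p. poly p (x::'b)"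
  interpret c: comm_ring_hom ?c by (rule comm_ring_hom_const)
  interpret ev: comm_ring_hom "?ev x" for x by (rule comm_ring_hom_poly)
  note JX = idl_poly_ideal[OF J]
  define U where "U = map_rfm ?c u"
  have U: "U \<in> cl.Vec UNIV" "U * U = 1" unfolding U_def
    using map_rfm_Vec[OF comm_ring_hom_const _ u(1), of UNIV] u(2) by (simp_all flip: c.map_rfm_mult)
  have Us: "br U (zc r (dual j)) = smr [:s:] 1"
  proof -
    have "br U (zc r (dual j)) = map_rfm ?c (br u (zc r (dual j)))" by (simp add: br_def U_def c.map_zc)
    thus ?thesis by (simp add: s)
  qed
  obtain N where N: "\<And>g g'. g * g' = 1 \<and> g' * g = 1 \<and>
      (\<forall>k\<in>cl.K. \<exists>a\<in>cl.Vec (poly_ideal J). g * zc r k * g' = zc r k + smr ([:s:] ^ N) a) \<Longrightarrow>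
      \<exists>j. \<exists>V\<in>cl.Erel (poly_ideal J). smr ([:s:] ^ j) (g * (U * cl.h0) * g' * (cl.h0 * U)) = smr ([:s:] ^ j) V"
    using cl.relative_commutator_unit_vector[OF JX U j Us] by blast
  \<comment> \<open>Conjugation by \<delta> moves the basis vectors by multiples of Y. Replacing Y
    by s^N Y makes these multiples of s^N, as the commutator estimate requires.\<close>
  let ?\<phi> = "\<lambda>p. pcompose p [:0, s ^ N:]"
  interpret \<phi>: comm_ring_hom ?\<phi> by (rule comm_ring_hom_pcompose)
  define g where "g = map_rfm ?\<phi> \<delta>"
  define g' where "g' = map_rfm ?\<phi> \<delta>'"
  have gg: "g * g' = 1" "g' * g = 1" using inv by (simp_all add: g_def g'_def flip: \<phi>.map_rfm_mult)
  have pow: "[:s:] ^ m = [:s ^ m:]" for m by (rule poly_const_pow)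
  have "\<exists>a\<in>cl.Vec (poly_ideal J). g * zc r k * g' = zc r k + smr ([:s:] ^ N) a" if k: "k \<in> cl.K" for k
  proof -
    obtain a where a: "a \<in> cl.Vec (poly_ideal J)" "\<delta> * zc r k * \<delta>' = zc r k + smr [:0, 1:] a" using \<delta>[OF k] by blast
    have "g * zc r k * g' = map_rfm ?\<phi> (\<delta> * zc r k * \<delta>')" by (simp add: g_def g'_def \<phi>.map_zc)
    also have "\<dots> = zc r k + smr ([:s:] ^ N) (smr [:0, 1:] (map_rfm ?\<phi> a))"
      by (simp add: a \<phi>.map_zc pow pcompose_pCons)
    finally have *: "g * zc r k * g' = zc r k + smr ([:s:] ^ N) (smr [:0, 1:] (map_rfm ?\<phi> a))" .
    have "map_rfm ?\<phi> a \<in> cl.Vec (poly_ideal J)"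
      by (rule map_rfm_Vec[OF comm_ring_hom_pcompose _ a(1)]) (use pcompose_in_ideal[OF J] in auto)
    from cl.Vec_sm[OF JX UNIV_I this] * show ?thesis by blast
  qed
  then obtain i V where V: "V \<in> cl.Erel (poly_ideal J)"
    "smr ([:s:] ^ i) (g * (U * cl.h0) * g' * (cl.h0 * U)) = smr ([:s:] ^ i) V"
    using N[of g g'] gg by blast
  define X where "X = g * (U * cl.h0) * g' * (cl.h0 * U)"
  have ev_U: "map_rfm (?ev x) U = u" for x
    unfolding U_def map_rfm_comp[OF comm_ring_hom_poly comm_ring_hom_const] by (rule rfm_eqI) (simp add: map_rfm.rep_eq)
  have ev_g: "map_rfm (?ev x) g = map_rfm (?ev (s ^ N * x)) \<delta>" "map_rfm (?ev x) g' = map_rfm (?ev (s ^ N * x)) \<delta>'" for x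
    unfolding g_def g'_def map_rfm_comp[OF comm_ring_hom_poly comm_ring_hom_pcompose] by (simp_all add: poly_pcompose mult.commute)
  have ev_X: "map_rfm (?ev x) X = map_rfm (?ev (s ^ N * x)) \<delta> * (u * cl.h0) * map_rfm (?ev (s ^ N * x)) \<delta>' * (cl.h0 * u)" for x
    unfolding X_def by (simp add: ev_U ev_g map_rfm_h0[OF comm_ring_hom_poly])
  have "map_rfm (?ev 0) \<delta> * map_rfm (?ev 0) \<delta>' = 1" using inv by (simp flip: ev.map_rfm_mult)
  hence \<delta>'0: "map_rfm (?ev 0) \<delta>' = 1" by (simp add: \<delta>0)
  have X0: "map_rfm (?ev 0) X = 1"
  proof -
    have "map_rfm (?ev 0) X = u * (cl.h0 * cl.h0) * u" unfolding ev_X by (simp add: \<delta>0 \<delta>'0 mult.assoc)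
    thus ?thesis by (simp add: cl.h0_h0 u)
  qed
  let ?c0 = "\<lambda>p::'b poly. [:poly p 0:]"
  have c0: "comm_ring_hom ?c0" by (rule comm_ring_hom_comp[OF comm_ring_hom_const comm_ring_hom_poly])
  interpret c0: comm_ring_hom ?c0 by fact
  \<comment> \<open>\<open>V\<close> is known only up to torsion by powers of \<open>s\<close> and
    need not be 1 at Y = 0. Its value V0 there satisfies s^i V0 = s^i, so dividing \<open>V\<close>
    by V0 keeps the equation and makes both sides agree at Y = 0.\<close>
  define V0 where "V0 = map_rfm ?c0 V"
  have "?c0 ` poly_ideal J \<subseteq> poly_ideal J"
    using poly_in_ideal[OF J] cl.idlD(2)[OF J] by (auto simp: poly_ideal_def coeff_pCons split: nat.splits)
  hence V0: "V0 \<in> cl.Erel (poly_ideal J)" unfolding V0_def by (rule map_rfm_Erel[OF c0 _ V(1)])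
  then obtain V0' where V0': "V0' \<in> cl.Erel (poly_ideal J)" "V0 * V0' = 1"
    using cl.Erel_inverse[OF V0] cl.idlD(6)[OF JX] by blast
  have X_c0: "map_rfm ?c0 X = 1"
    using X0 map_rfm_comp[OF comm_ring_hom_const comm_ring_hom_poly[of 0], of X] by simp
  have "smr ([:s:] ^ i) V0 = map_rfm ?c0 (smr ([:s:] ^ i) V)" by (simp add: V0_def pow)
  also have "\<dots> = smr ([:s:] ^ i) 1" unfolding V(2)[symmetric] X_def[symmetric] by (simp add: X_c0 pow)
  finally have "smr ([:s:] ^ i) V0 * V0' = smr ([:s:] ^ i) 1 * V0'" by simp
  hence sV0: "smr ([:s:] ^ i) V0' = smr ([:s:] ^ i) 1" by (simp add: V0')
  have "smr ([:s:] ^ i) (V * V0') = V * smr ([:s:] ^ i) V0'" by simp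
  also have "\<dots> = smr ([:s:] ^ i) X" unfolding sV0 using V(2) by (simp add: X_def)
  finally have T: "smr ([:s:] ^ i) (X - V * V0') = 0" by simp
  have ev0: "map_rfm (?ev 0) (X - V * V0') = 0"
  proof -
    have "map_rfm (?ev 0) V0 = map_rfm (?ev 0) V"
      unfolding V0_def map_rfm_comp[OF comm_ring_hom_poly c0] by (rule arg_cong[of _ _ "\<lambda>f. map_rfm f V"]) auto
    hence "map_rfm (?ev 0) (V * V0') = map_rfm (?ev 0) (V0 * V0')" by simp
    thus ?thesis by (simp add: X0 V0')
  qed
  have eq: "map_rfm (?ev (s ^ i * y)) X = map_rfm (?ev (s ^ i * y)) (V * V0')" for y
  proof -
    have "poly (ent (X - V * V0') a b) (s ^ i * y) = 0" for a b
    proof (rule poly_eval_torsion)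
      show "[:s:] ^ i * ent (X - V * V0') a b = 0"
        using arg_cong[OF T, of "\<lambda>A. ent A a b"] by (simp only: ent_smr ent_0)
      show "poly (ent (X - V * V0') a b) 0 = 0"
        using arg_cong[OF ev0, of "\<lambda>A. ent A a b"] by (simp only: ev.ent_map_rfm ent_0)
    qed
    hence "map_rfm (?ev (s ^ i * y)) (X - V * V0') = 0" by (intro rfm_eqI) (simp only: ev.ent_map_rfm ent_0)
    thus ?thesis by simp
  qed
  have ideal_ev: "?ev x ` poly_ideal J \<subseteq> J" for x using poly_in_ideal[OF J] by auto
  show ?thesis
  proof (intro exI[of _ "N + i"] allI)
    fix y
    have "map_rfm (?ev (s ^ i * y)) (V * V0') \<in> cl.Erel J"
      by (rule map_rfm_Erel[OF comm_ring_hom_poly ideal_ev]) (rule cl.Erel_mult[OF V(1) V0'(1)])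
    hence "map_rfm (?ev (s ^ i * y)) X \<in> cl.Erel J" by (simp only: eq)
    thus "map_rfm (?ev (s ^ (N + i) * y)) \<delta> * (u * cl.h0) * map_rfm (?ev (s ^ (N + i) * y)) \<delta>' * (cl.h0 * u) \<in> cl.Erel J"
      unfolding ev_X by (simp add: power_add mult.assoc)
  qed
qed

end

section \<open>Substitution in polynomials and the homotopy obtained by scaling the variable\<close>

context suslin_rank
begin

interpretation cl: clifford smr UNIV "zc r" "Suc r"
  using zc_clifford[OF r_ge_2] by simp

definition subst :: "('a::comm_ring_1 \<Rightarrow> 'b::comm_ring_1) \<Rightarrow> 'b \<Rightarrow> 'a poly \<Rightarrow> 'b" where
  "subst c w p = poly (map_poly c p) w"

lemma subst_pCons: "comm_ring_hom c \<Longrightarrow> subst c w (pCons a p) = c a + w * subst c w p"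
proof -
  assume "comm_ring_hom c"
  then interpret comm_ring_hom c .
  have "map_poly c (pCons a p) = pCons (c a) (map_poly c p)"
    by (rule map_poly_pCons) simp
  thus ?thesis by (simp add: subst_def)
qed

lemma comm_ring_hom_subst:
  assumes "comm_ring_hom c"
  shows "comm_ring_hom (subst c w)"
proof -
  interpret c: comm_ring_hom c by fact
  have co: "coeff (map_poly c p) i = c (coeff p i)" for p i by (simp add: coeff_map_poly)
  interpret m: comm_ring_hom "map_poly c"
    by unfold_locales (auto simp: poly_eq_iff co coeff_mult c.hom_add c.hom_mult c.hom_sum)
  show ?thesis unfolding subst_def by (rule comm_ring_hom_comp[OF comm_ring_hom_poly m.comm_ring_hom_axioms])
qed

lemma hom_subst:
  assumes "comm_ring_hom \<phi>" "comm_ring_hom c"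
  shows "\<phi> (subst c w p) = subst (\<lambda>a. \<phi> (c a)) (\<phi> w) p"
proof -
  interpret \<phi>: comm_ring_hom \<phi> by fact
  interpret c: comm_ring_hom c by fact
  have \<phi>c: "comm_ring_hom (\<lambda>a. \<phi> (c a))" by (rule comm_ring_hom_comp[OF assms])
  show ?thesis
    by (induction p) (simp_all add: subst_pCons assms \<phi>c \<phi>.hom_add \<phi>.hom_mult, simp add: subst_def)
qed

lemma subst_in_ideal:
  assumes c: "comm_ring_hom c" "c ` I \<subseteq> J" and J: "cl.idl J" and p: "\<And>i. coeff p i \<in> I"
  shows "subst c w p \<in> J"
  using p
proof (induction p)
  case 0
  show ?case using cl.idlD(2)[OF J] by (simp add: subst_def)
next
  case (pCons a p)
  have "a \<in> I" "\<And>i. coeff p i \<in> I" using pCons.prems[of 0] pCons.prems[of "Suc i" for i] by simp_all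
  thus ?case using pCons.IH c J by (auto simp: subst_pCons cl.idlD)
qed

lemma subst_difference_ideal:
  assumes c: "comm_ring_hom c" "c ` I \<subseteq> J" and J: "cl.idl J" and p: "\<And>i. coeff p i \<in> I"
  shows "\<exists>q\<in>J. subst c (w + y) p - subst c w p = y * q"
  using p
proof (induction p)
  case 0
  show ?case using cl.idlD(2)[OF J] by (intro bexI[of _ 0]) (auto simp: subst_def)
next
  case (pCons a p)
  have p: "\<And>i. coeff p i \<in> I" using pCons.prems[of "Suc i" for i] by simp
  obtain q where q: "q \<in> J" "subst c (w + y) p - subst c w p = y * q" using pCons.IH p by blast
  have "subst c (w + y) (pCons a p) - subst c w (pCons a p) = w * (subst c (w + y) p - subst c w p) + y * subst c (w + y) p"
    by (simp add: subst_pCons c algebra_simps)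
  also have "\<dots> = y * (w * q + subst c (w + y) p)" unfolding q by (simp add: algebra_simps)
  finally show ?case using q subst_in_ideal[OF c J p] J by (blast intro: cl.idlD)
qed

text \<open>The constant coefficient cancels in the difference, so it may be arbitrary; the
  polynomial formed by the other coefficients is covered by
  \<open>subst_difference_ideal\<close>.\<close>

lemma subst_difference:
  assumes c: "comm_ring_hom c" "c ` I \<subseteq> J" and J: "cl.idl J" and p: "\<And>i. i \<noteq> 0 \<Longrightarrow> coeff p i \<in> I"
  shows "\<exists>q\<in>J. subst c (w + y * x) p - subst c w p = y * q"
proof (cases p)
  case (pCons a p')
  have p': "\<And>i. coeff p' i \<in> I" using p[of "Suc i" for i] pCons by simp
  obtain q where q: "q \<in> J" "subst c (w + y * x) p' - subst c w p' = y * x * q"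
    using subst_difference_ideal[OF c J p'] by blast
  have "subst c (w + y * x) p - subst c w p = w * (subst c (w + y * x) p' - subst c w p') + y * (x * subst c (w + y * x) p')"
    by (simp add: pCons subst_pCons c algebra_simps)
  also have "\<dots> = y * (w * (x * q) + x * subst c (w + y * x) p')" unfolding q by (simp add: algebra_simps)
  finally show ?thesis using q subst_in_ideal[OF c J p'] J by (blast intro: cl.idlD)
qed

lemma subst_const: "subst (\<lambda>a. [:a:]) w p = pcompose p w"
  by (simp add: subst_def pcompose_altdef)

definition scale_var :: "'a::comm_ring_1 poly \<Rightarrow> 'a poly rfm \<Rightarrow> 'a poly rfm" where
  "scale_var t = map_rfm (\<lambda>p. pcompose p ([:0, 1:] * t))"

text \<open>The action on vectors is constant in X modulo \<open>I\<close>, without having to be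
  trivial there. This is enough for quotients of \<alpha> at two scalings of X to act trivially
  modulo I[X].\<close>

definition tame :: "'a::comm_ring_1 set \<Rightarrow> 'a poly rfm \<Rightarrow> 'a poly rfm \<Rightarrow> bool" where
  "tame I \<alpha> \<alpha>' \<longleftrightarrow> cl.orth \<alpha> \<alpha>' \<and>
     (\<forall>k\<in>cl.K. \<exists>f. \<alpha> * zc r k * \<alpha>' = cl.vec f \<and> (\<forall>l\<in>cl.K. \<forall>i. i \<noteq> 0 \<longrightarrow> coeff (f l) i \<in> I))"

text \<open>The path \<open>\<tau> \<mapsto> \<alpha>(\<tau>X)\<close> varies only modulo \<open>J\<close> up to conjugation; \<open>s\<close>-close parameters
  give elements commuting with \<open>u h\<^sub>0\<close> modulo the relative elementary group. Uniformity in \<open>\<tau>\<close> is obtained by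
  working over \<open>R[X][T][Y]\<close>.\<close>

lemma local_homotopy:
  fixes \<alpha> \<alpha>' :: "'a::comm_ring_1 poly rfm"
  assumes I: "cl.idl I" and \<alpha>: "tame I \<alpha> \<alpha>'"
    and u: "u \<in> cl.Vec UNIV" "u * u = 1" and j: "j \<in> cl.K" "fst j \<noteq> 0" and s: "br u (zc r (dual j)) = smr s 1"
  shows "\<exists>M. \<forall>\<tau> y. cl.comm_rel (poly_ideal I) (scale_var \<tau> \<alpha>' * scale_var (\<tau> + s ^ M * y) \<alpha>)
     (scale_var (\<tau> + s ^ M * y) \<alpha>' * scale_var \<tau> \<alpha>) (u * cl.h0) (cl.h0 * u)"
proof -
  define J0 where "J0 = poly_ideal (poly_ideal I)"
  have J: "cl.idl (poly_ideal I)" "cl.idl J0" "cl.idl (poly_ideal J0)"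
    unfolding J0_def by (intro idl_poly_ideal I)+
  let ?c = "\<lambda>a::'a. [:[:[:a:]:]:]"
  have c: "comm_ring_hom ?c"
    by (rule comm_ring_hom_comp[OF comm_ring_hom_const comm_ring_hom_comp[OF comm_ring_hom_const comm_ring_hom_const]])
  have cI: "?c ` I \<subseteq> poly_ideal J0"
    using cl.idlD(2)[OF I] by (auto simp: J0_def poly_ideal_def coeff_pCons split: nat.splits)
  \<comment> \<open>In R[X][T][Y] the outermost variable is Y, so \<open>w\<close> is T X and
    \<open>w'\<close> is (T + Y) X.\<close>
  define X :: "'a poly poly poly" where "X = [:[:[:0, 1:]:]:]"
  define w where "w = X * [:[:0, 1:]:]"
  define w' where "w' = w + [:0, 1:] * X"
  interpret p: comm_ring_hom "subst ?c w" by (rule comm_ring_hom_subst[OF c])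
  interpret p': comm_ring_hom "subst ?c w'" by (rule comm_ring_hom_subst[OF c])
  have orth: "\<alpha> * \<alpha>' = 1" "\<alpha>' * \<alpha> = 1" "\<And>k. k \<in> cl.K \<Longrightarrow> \<alpha>' * zc r k * \<alpha> \<in> cl.Vec UNIV"
    using \<alpha> by (auto simp: tame_def cl.orth_def)
  let ?p = "map_rfm (subst ?c w)" and ?p' = "map_rfm (subst ?c w')"
  have inv: "?p \<alpha> * ?p \<alpha>' = 1" "?p \<alpha>' * ?p \<alpha> = 1" "?p' \<alpha> * ?p' \<alpha>' = 1" "?p' \<alpha>' * ?p' \<alpha> = 1"
    by (simp_all add: orth flip: p.map_rfm_mult p'.map_rfm_mult)
  define \<delta> where "\<delta> = ?p \<alpha>' * ?p' \<alpha>"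
  define \<delta>' where "\<delta>' = ?p' \<alpha>' * ?p \<alpha>"
  have "\<delta> * \<delta>' = ?p \<alpha>' * (?p' \<alpha> * ?p' \<alpha>') * ?p \<alpha>" "\<delta>' * \<delta> = ?p' \<alpha>' * (?p \<alpha> * ?p \<alpha>') * ?p' \<alpha>"
    by (simp_all only: \<delta>_def \<delta>'_def mult.assoc)
  hence \<delta>inv: "\<delta> * \<delta>' = 1" "\<delta>' * \<delta> = 1" by (simp_all add: inv)
  have \<delta>0: "map_rfm (\<lambda>p. poly p 0) \<delta> = 1"
  proof -
    interpret ev: comm_ring_hom "\<lambda>p. poly p (0 :: 'a poly poly)" by (rule comm_ring_hom_poly)
    have e: "map_rfm (\<lambda>p. poly p 0) (?p' A) = map_rfm (\<lambda>p. poly p 0) (?p A)" for A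
      unfolding map_rfm_comp[OF comm_ring_hom_poly p.comm_ring_hom_axioms] map_rfm_comp[OF comm_ring_hom_poly p'.comm_ring_hom_axioms]
      by (simp add: hom_subst[OF comm_ring_hom_poly c] w'_def)
    have "map_rfm (\<lambda>p. poly p 0) \<delta> = map_rfm (\<lambda>p. poly p 0) (?p \<alpha>' * ?p \<alpha>)"
      by (simp only: \<delta>_def ev.map_rfm_mult e)
    thus ?thesis by (simp add: inv)
  qed
  have \<delta>z: "\<exists>a\<in>cl.Vec (poly_ideal J0). \<delta> * zc r k * \<delta>' = zc r k + smr [:0, 1:] a" if k: "k \<in> cl.K" for k
  proof -
    obtain f where f: "\<alpha> * zc r k * \<alpha>' = cl.vec f" "\<And>l i. l \<in> cl.K \<Longrightarrow> i \<noteq> 0 \<Longrightarrow> coeff (f l) i \<in> I"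
      using \<alpha> k by (auto simp: tame_def)
    have "\<forall>l\<in>cl.K. \<exists>q\<in>poly_ideal J0. subst ?c w' (f l) - subst ?c w (f l) = [:0, 1:] * q"
      unfolding w'_def using f(2) by (intro ballI subst_difference[OF c cI J(3)]) auto
    then obtain q where q: "\<And>l. l \<in> cl.K \<Longrightarrow> q l \<in> poly_ideal J0"
      "\<And>l. l \<in> cl.K \<Longrightarrow> subst ?c w' (f l) - subst ?c w (f l) = [:0, 1:] * q l" by metis
    have "cl.vec (\<lambda>l. subst ?c w' (f l)) - cl.vec (\<lambda>l. subst ?c w (f l)) = smr [:0, 1:] (cl.vec q)"
      unfolding cl.vec_diff cl.vec_sm unfolding cl.vec_def by (intro sum.cong) (auto simp: q)
    hence "?p' (\<alpha> * zc r k * \<alpha>') = ?p (\<alpha> * zc r k * \<alpha>') + smr [:0, 1:] (cl.vec q)"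
      unfolding f map_rfm_vec[OF p.comm_ring_hom_axioms] map_rfm_vec[OF p'.comm_ring_hom_axioms] by (simp add: algebra_simps)
    hence e: "?p' \<alpha> * zc r k * ?p' \<alpha>' = ?p \<alpha> * zc r k * ?p \<alpha>' + smr [:0, 1:] (cl.vec q)"
      by (simp add: p.map_zc p'.map_zc)
    have "\<delta> * zc r k * \<delta>' = ?p \<alpha>' * (?p' \<alpha> * zc r k * ?p' \<alpha>') * ?p \<alpha>" by (simp only: \<delta>_def \<delta>'_def mult.assoc)
    also have "\<dots> = (?p \<alpha>' * ?p \<alpha>) * zc r k * (?p \<alpha>' * ?p \<alpha>) + smr [:0, 1:] (?p \<alpha>' * cl.vec q * ?p \<alpha>)"
      unfolding e by (simp add: distrib_left distrib_right mult.assoc)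
    also have "\<dots> = zc r k + smr [:0, 1:] (?p \<alpha>' * cl.vec q * ?p \<alpha>)" by (simp add: inv)
    finally have *: "\<delta> * zc r k * \<delta>' = zc r k + smr [:0, 1:] (?p \<alpha>' * cl.vec q * ?p \<alpha>)" .
    have "?p \<alpha>' * zc r l * ?p \<alpha> \<in> cl.Vec UNIV" if "l \<in> cl.K" for l
      using map_rfm_Vec[OF p.comm_ring_hom_axioms _ orth(3)[OF that], of UNIV] by (simp add: p.map_zc)
    hence "?p \<alpha>' * cl.vec q * ?p \<alpha> \<in> cl.Vec (poly_ideal J0)"
      by (rule cl.conj_Vec[OF _ J(3)]) (auto intro: cl.vec_in_Vec q)
    thus ?thesis using * by blast
  qed
  let ?k = "\<lambda>p::'a poly. [:p:]"
  interpret k: comm_ring_hom ?k by (rule comm_ring_hom_const)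
  define ub where "ub = map_rfm ?k u"
  have ub: "ub \<in> cl.Vec UNIV" "ub * ub = 1" unfolding ub_def
    using map_rfm_Vec[OF comm_ring_hom_const _ u(1), of UNIV] u(2) by (simp_all flip: k.map_rfm_mult)
  have ubs: "br ub (zc r (dual j)) = smr [:s:] 1"
  proof -
    have "br ub (zc r (dual j)) = map_rfm ?k (br u (zc r (dual j)))" by (simp add: br_def ub_def k.map_zc)
    thus ?thesis by (simp add: s)
  qed
  obtain M where M: "\<And>y. map_rfm (\<lambda>p. poly p ([:s:] ^ M * y)) \<delta> * (ub * cl.h0) *
      map_rfm (\<lambda>p. poly p ([:s:] ^ M * y)) \<delta>' * (cl.h0 * ub) \<in> cl.Erel J0"
    using dilation[OF J(2) ub j ubs \<delta>inv \<delta>0 \<delta>z] by blast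
  show ?thesis
  proof (intro exI[of _ M] allI)
    fix \<tau> y :: "'a poly"
    \<comment> \<open>First Y becomes s^M y, then T becomes \<tau>. Both values are inserted after
      \<open>M\<close> has been found, so \<open>M\<close> does not depend on them.\<close>
    let ?v = "\<lambda>p. poly p ([:s:] ^ M * [:y:])" and ?t = "\<lambda>q. poly q \<tau>"
    interpret v: comm_ring_hom ?v by (rule comm_ring_hom_poly)
    interpret t: comm_ring_hom ?t by (rule comm_ring_hom_poly)
    have "?t ` J0 \<subseteq> poly_ideal I" unfolding J0_def using poly_in_ideal[OF J(1)] by auto
    from map_rfm_Erel[OF comm_ring_hom_poly this M[of "[:y:]"]]
    have base: "map_rfm ?t (map_rfm ?v \<delta>) * (map_rfm ?t ub * cl.h0) * map_rfm ?t (map_rfm ?v \<delta>') * (cl.h0 * map_rfm ?t ub)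
        \<in> cl.Erel (poly_ideal I)"
      by (simp add: map_rfm_h0[OF comm_ring_hom_poly])
    have ubu: "map_rfm ?t ub = u"
      unfolding ub_def map_rfm_comp[OF comm_ring_hom_poly comm_ring_hom_const] by (rule rfm_eqI) (simp add: map_rfm.rep_eq)
    have cmp: "map_rfm ?t (map_rfm ?v (map_rfm (subst ?c x) A)) = map_rfm (subst (\<lambda>a. [:a:]) (?t (?v x))) A" for x and A :: "'a poly rfm"
    proof -
      have "map_rfm ?t (map_rfm ?v (map_rfm (subst ?c x) A)) = map_rfm (\<lambda>f. ?t (?v (subst ?c x f))) A"
        by (simp only: map_rfm_comp[OF comm_ring_hom_poly comm_ring_hom_subst[OF c]]
            map_rfm_comp[OF comm_ring_hom_poly comm_ring_hom_comp[OF comm_ring_hom_poly comm_ring_hom_subst[OF c]]])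
      also have "(\<lambda>f. ?t (?v (subst ?c x f))) = subst (\<lambda>a. [:a:]) (?t (?v x))"
        by (rule ext) (simp add: hom_subst[OF comm_ring_hom_poly c] hom_subst[OF comm_ring_hom_poly comm_ring_hom_comp[OF comm_ring_hom_const comm_ring_hom_const]])
      finally show ?thesis .
    qed
    have tv: "?t (?v w) = [:0, 1:] * \<tau>" "?t (?v w') = [:0, 1:] * (\<tau> + s ^ M * y)"
      by (simp_all add: w'_def w_def X_def poly_const_pow algebra_simps)
    show "cl.comm_rel (poly_ideal I) (scale_var \<tau> \<alpha>' * scale_var (\<tau> + s ^ M * y) \<alpha>)
      (scale_var (\<tau> + s ^ M * y) \<alpha>' * scale_var \<tau> \<alpha>) (u * cl.h0) (cl.h0 * u)"
      using base unfolding cl.comm_rel_def[OF J(1)]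
      by (simp only: \<delta>_def \<delta>'_def scale_var_def v.map_rfm_mult t.map_rfm_mult ubu cmp tv subst_const[abs_def])
  qed
qed

end

lemma power_add_in_ideal:
  fixes x y :: "'a::comm_ring_1"
  assumes K: "\<And>a b. a \<in> K \<Longrightarrow> b \<in> K \<Longrightarrow> a + b \<in> K" "\<And>a c. a \<in> K \<Longrightarrow> c * a \<in> K"
    and x: "x ^ m \<in> K" and y: "y ^ n \<in> K"
  shows "(x + y) ^ (m + n) \<in> K"
proof -
  have 0: "0 \<in> K" using K(2)[OF x, of 0] by simp
  have sum: "finite A \<Longrightarrow> (\<And>i. i \<in> A \<Longrightarrow> f i \<in> K) \<Longrightarrow> sum f A \<in> K" for f :: "nat \<Rightarrow> 'a" and A
    by (induction A rule: finite_induct) (auto simp: 0 K)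
  have "of_nat ((m + n) choose i) * x ^ i * y ^ (m + n - i) \<in> K" if "i \<le> m + n" for i
  proof (cases "m \<le> i")
    case True
    hence "x ^ i = x ^ (i - m) * x ^ m" by (simp flip: power_add)
    hence "of_nat ((m + n) choose i) * x ^ i * y ^ (m + n - i) = (of_nat ((m + n) choose i) * x ^ (i - m) * y ^ (m + n - i)) * x ^ m"
      by (simp add: ac_simps)
    thus ?thesis using K(2)[OF x] by simp
  next
    case False
    hence "y ^ (m + n - i) = y ^ (m - i) * y ^ n" by (simp flip: power_add)
    hence "of_nat ((m + n) choose i) * x ^ i * y ^ (m + n - i) = (of_nat ((m + n) choose i) * x ^ i * y ^ (m - i)) * y ^ n"
      by (simp add: ac_simps)
    thus ?thesis using K(2)[OF y] by simp
  qed
  thus ?thesis unfolding binomial_ring by (intro sum) auto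
qed

section \<open>The local-global step, and unit vectors with an invertible entry\<close>

context suslin_rank
begin

interpretation cl: clifford smr UNIV "zc r" "Suc r"
  using zc_clifford[OF r_ge_2] by simp

lemma index_in_K [simp]: "(i, b) \<in> cl.K \<longleftrightarrow> i \<le> r"
  by (auto simp: cl.K_def)

lemma Cl_in_Vec_ideal:
  assumes "v \<in> carrier_vec (r + 1)" "w \<in> carrier_vec (r + 1)" "\<And>i. i \<le> r \<Longrightarrow> v $ i \<in> J \<and> w $ i \<in> J"
  shows "Cl r v w \<in> cl.Vec J"
proof -
  have "cl.vec (\<lambda>k. if snd k then v $ fst k else w $ fst k) = Cl r (vec (r + 1) (($) v)) (vec (r + 1) (($) w))"
    using clifford_vec_eq[OF r_ge_2, of "\<lambda>k. if snd k then v $ fst k else w $ fst k"] by simp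
  moreover have "vec (r + 1) (($) v) = v" "vec (r + 1) (($) w) = w" using assms by auto
  ultimately have "Cl r v w = cl.vec (\<lambda>k. if snd k then v $ fst k else w $ fst k)" by simp
  thus ?thesis using assms(3) by (auto simp: cl.K_def intro!: cl.vec_in_Vec)
qed

lemma Cl_in_Vec:
  assumes "v \<in> carrier_vec (r + 1)" "w \<in> carrier_vec (r + 1)"
  shows "Cl r v w \<in> cl.Vec UNIV"
  using Cl_in_Vec_ideal[OF assms, of UNIV] by simp

lemma br_Cl_zc:
  assumes "v \<in> carrier_vec (r + 1)" "w \<in> carrier_vec (r + 1)" "i \<le> r"
  shows "br (Cl r v w) (zc r (i, b)) = smr (if b then w $ i else v $ i) 1"
  using assms by (simp add: zc_def Cl_br)

definition unit_pair :: "'b::comm_ring_1 vec \<Rightarrow> 'b vec \<Rightarrow> bool" where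
  "unit_pair v w \<longleftrightarrow> v \<in> carrier_vec (r + 1) \<and> w \<in> carrier_vec (r + 1) \<and> v \<bullet> w = 1"

lemma unit_pair_Cl: "unit_pair v w \<Longrightarrow> Cl r v w * Cl r v w = 1"
  by (simp add: unit_pair_def Cl_square)

lemma orth_unit_vector:
  assumes "u \<in> cl.Vec UNIV" "u * u = 1"
  shows "cl.orth u u"
  unfolding cl.orth_def
proof (intro conjI ballI)
  fix k assume k: "k \<in> cl.K"
  obtain c where c: "br u (zc r k) = smr c 1" using cl.Vec_br[OF assms(1) cl.z_in_Vec[OF k]] by blast
  have "u * zc r k * u = br u (zc r k) * u - zc r k * (u * u)" by (simp add: br_def algebra_simps)
  also have "\<dots> = smr c u - zc r k" by (simp add: c assms)
  finally have "u * zc r k * u = smr c u - zc r k" .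
  thus "u * zc r k * u \<in> cl.Vec UNIV" "u * zc r k * u \<in> cl.Vec UNIV" using assms k by auto
qed (use assms in auto)

lemma orth_h0: "cl.orth cl.h0 cl.h0"
  by (rule orth_unit_vector) (simp_all add: cl.h0_h0)

lemma orth_map:
  assumes "comm_ring_hom \<phi>" "cl.orth g g'"
  shows "cl.orth (map_rfm \<phi> g) (map_rfm \<phi> g')"
proof -
  interpret comm_ring_hom \<phi> by fact
  have "map_rfm \<phi> (a * zc r k * b) = map_rfm \<phi> a * zc r k * map_rfm \<phi> b" for a b k by (simp add: map_zc)
  thus ?thesis using assms(2) map_rfm_Vec[OF assms(1), of UNIV UNIV]
    unfolding cl.orth_def by (simp flip: map_rfm_mult) (metis subset_UNIV)
qed

text \<open>Replacing \<open>u\<close> by its conjugate \<open>u1\<close> changes u h_0 only by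
  elementary factors on both sides. The explicit formula for \<open>u1\<close> shows which
  coordinates move, so a coordinate can be adjusted before \<open>u\<close> is treated.\<close>

lemma conj_unit_vector:
  fixes u :: "'b::comm_ring_1 rfm" and x :: 'b
  assumes u: "u \<in> cl.Vec UNIV" "u * u = 1" and kl: "k \<in> cl.K" "l \<in> cl.K" "fst k \<noteq> fst l"
  defines "\<rho> \<equiv> 1 + smr x (zc r k * zc r l)" and "\<rho>' \<equiv> 1 + smr (- x) (zc r k * zc r l)"
  defines "u1 \<equiv> \<rho> * u * \<rho>'"
  shows "u1 \<in> cl.Vec UNIV" "u1 * u1 = 1" "u * cl.h0 = \<rho>' * (u1 * cl.h0) * (cl.h0 * \<rho> * cl.h0)"
    "u1 = u + smr x (zc r k * br (zc r l) u - br (zc r k) u * zc r l)"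
    "cl.orth \<rho> \<rho>'" "\<rho> \<in> cl.E UNIV" "\<rho>' \<in> cl.E UNIV"
proof -
  have inv: "\<rho> * \<rho>' = 1" "\<rho>' * \<rho> = 1"
    unfolding \<rho>_def \<rho>'_def by (rule cl.one_plus_inverse[OF cl.root_nilpotent[OF kl]])+
  show E: "\<rho> \<in> cl.E UNIV" "\<rho>' \<in> cl.E UNIV" unfolding \<rho>_def \<rho>'_def by (intro cl.E_root kl UNIV_I)+
  obtain g where g: "cl.orth \<rho> g" using cl.orth_E[OF E(1)] by blast
  have "\<rho>' = g" by (rule cl.orth_unique[OF g inv(1)])
  thus orth: "cl.orth \<rho> \<rho>'" using g by simp
  show "u1 \<in> cl.Vec UNIV" unfolding u1_def by (rule cl.conj_Vec[OF _ cl.idl_D u(1)]) (use orth in \<open>auto simp: cl.orth_def\<close>)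
  have "u1 * u1 = \<rho> * (u * u) * \<rho>'" unfolding u1_def by (rule cl.conj_mult[OF inv(2), symmetric])
  thus "u1 * u1 = 1" by (simp add: u inv)
  have "\<rho>' * (u1 * cl.h0) * (cl.h0 * \<rho> * cl.h0) = (\<rho>' * \<rho>) * u * \<rho>' * (cl.h0 * cl.h0) * \<rho> * cl.h0"
    by (simp only: u1_def mult.assoc)
  also have "\<dots> = u * (\<rho>' * \<rho>) * cl.h0" by (simp only: inv cl.h0_h0 mult_1_left mult_1_right mult.assoc)
  finally show "u * cl.h0 = \<rho>' * (u1 * cl.h0) * (cl.h0 * \<rho> * cl.h0)" by (simp only: inv mult_1_right)
  have "u1 = cl.cnj 1 x (zc r k * zc r l) u"
    using cl.cnj_product(2)[OF kl u(1) u(1), of 1 x] by (simp add: u1_def \<rho>_def \<rho>'_def)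
  thus "u1 = u + smr x (zc r k * br (zc r l) u - br (zc r k) u * zc r l)"
    by (simp add: cl.cnj_def commutator_with_product)
qed

lemma scale_var_1: "scale_var 1 A = A"
  by (rule rfm_eqI) (simp add: scale_var_def map_rfm.rep_eq)

lemma scale_var_hom: "comm_ring_hom (\<lambda>p::'a::comm_ring_1 poly. pcompose p ([:0, 1:] * t))"
  by (rule comm_ring_hom_pcompose)

lemma scale_var_mult: "scale_var t (A * B) = scale_var t A * scale_var t B"
  using comm_ring_hom.map_rfm_mult[OF scale_var_hom] by (simp only: scale_var_def)

lemma tame_orth:
  assumes "tame I \<alpha> \<alpha>'"
  shows "cl.orth (scale_var t \<alpha>) (scale_var t \<alpha>')" "cl.orth (scale_var t \<alpha>') (scale_var t \<alpha>)"
  using orth_map[OF scale_var_hom] assms cl.orth_sym unfolding tame_def scale_var_def by blast+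

text \<open>Modulo \<open>I\<close> the coordinates of the conjugates of z_k by \<alpha>(\<tau> X)
  and by \<alpha>(\<tau>2 X) both reduce to the same constants, so the quotient acts trivially even
  where \<alpha> does not.\<close>

lemma tame_difference:
  assumes I: "cl.idl I" and \<alpha>: "tame I \<alpha> \<alpha>'" and k: "k \<in> cl.K"
  shows "(scale_var \<tau> \<alpha>' * scale_var \<tau>2 \<alpha>) * zc r k * (scale_var \<tau>2 \<alpha>' * scale_var \<tau> \<alpha>) - zc r k \<in> cl.Vec (poly_ideal I)"
proof -
  note J = idl_poly_ideal[OF I]
  obtain f where f: "\<alpha> * zc r k * \<alpha>' = cl.vec f" "\<And>l i. l \<in> cl.K \<Longrightarrow> i \<noteq> 0 \<Longrightarrow> coeff (f l) i \<in> I"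
    using \<alpha> k by (auto simp: tame_def)
  have sv: "scale_var t \<alpha> * zc r k * scale_var t \<alpha>' = cl.vec (\<lambda>l. pcompose (f l) ([:0, 1:] * t))" for t
  proof -
    have "scale_var t (\<alpha> * zc r k * \<alpha>') = scale_var t \<alpha> * zc r k * scale_var t \<alpha>'"
    proof -
      have "scale_var t (zc r k) = zc r k" unfolding scale_var_def by (rule comm_ring_hom.map_zc[OF scale_var_hom])
      thus ?thesis by (simp only: scale_var_mult)
    qed
    thus ?thesis unfolding f scale_var_def map_rfm_vec[OF scale_var_hom] ..
  qed
  have const: "pcompose (f l) q - [:coeff (f l) 0:] \<in> poly_ideal I" if "l \<in> cl.K" for l q
  proof -
    have "f l - [:coeff (f l) 0:] \<in> poly_ideal I"
      using f(2)[OF that] cl.idlD(2)[OF I] by (auto simp: poly_ideal_def coeff_pCons split: nat.splits)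
    from pcompose_in_ideal[OF I this, of q] show ?thesis by (simp add: pcompose_diff)
  qed
  define d where "d = (\<lambda>l. pcompose (f l) ([:0, 1:] * \<tau>2) - pcompose (f l) ([:0, 1:] * \<tau>))"
  have dI: "d l \<in> poly_ideal I" if "l \<in> cl.K" for l
  proof -
    have e: "d l = (pcompose (f l) ([:0, 1:] * \<tau>2) - [:coeff (f l) 0:]) - (pcompose (f l) ([:0, 1:] * \<tau>) - [:coeff (f l) 0:])"
      by (simp add: d_def)
    show ?thesis unfolding e by (intro cl.idlD(7)[OF J] const that)
  qed
  have o: "cl.orth (scale_var \<tau> \<alpha>') (scale_var \<tau> \<alpha>)" by (rule tame_orth[OF \<alpha>])
  have e: "scale_var \<tau>2 \<alpha> * zc r k * scale_var \<tau>2 \<alpha>' = scale_var \<tau> \<alpha> * zc r k * scale_var \<tau> \<alpha>' + cl.vec d"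
    unfolding sv cl.vec_add by (simp add: d_def)
  have "(scale_var \<tau> \<alpha>' * scale_var \<tau>2 \<alpha>) * zc r k * (scale_var \<tau>2 \<alpha>' * scale_var \<tau> \<alpha>) =
      scale_var \<tau> \<alpha>' * (scale_var \<tau>2 \<alpha> * zc r k * scale_var \<tau>2 \<alpha>') * scale_var \<tau> \<alpha>"
    by (simp only: mult.assoc)
  also have "\<dots> = (scale_var \<tau> \<alpha>' * scale_var \<tau> \<alpha>) * zc r k * (scale_var \<tau> \<alpha>' * scale_var \<tau> \<alpha>) + scale_var \<tau> \<alpha>' * cl.vec d * scale_var \<tau> \<alpha>"
    unfolding e by (simp only: distrib_left distrib_right mult.assoc)
  also have "scale_var \<tau> \<alpha>' * scale_var \<tau> \<alpha> = 1" using o by (simp add: cl.orth_def)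
  finally have "(scale_var \<tau> \<alpha>' * scale_var \<tau>2 \<alpha>) * zc r k * (scale_var \<tau>2 \<alpha>' * scale_var \<tau> \<alpha>) - zc r k = scale_var \<tau> \<alpha>' * cl.vec d * scale_var \<tau> \<alpha>"
    by simp
  also have "\<dots> \<in> cl.Vec (poly_ideal I)"
    using o by (intro cl.conj_Vec[OF _ J] cl.vec_in_Vec dI) (auto simp: cl.orth_def)
  finally show ?thesis .
qed

text \<open>\<open>local_homotopy\<close> gives powers of v_j only for j different from 0. To reach
  v_0, \<open>u\<close> is conjugated by a root element so that its coordinate at index 1 becomes
  v_1 + v_0. The radical of \<open>S\<close> then contains every v_j, hence 1, and the parameter may
  run from 0 to 1.\<close>

lemma homotopy_commutes:
  fixes \<alpha> \<alpha>' :: "'a::comm_ring_1 poly rfm"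
  assumes I: "cl.idl I" and \<alpha>: "tame I \<alpha> \<alpha>'" and vw: "unit_pair v w"
  shows "cl.comm_rel (poly_ideal I) (scale_var 0 \<alpha>' * \<alpha>) (\<alpha>' * scale_var 0 \<alpha>) (Cl r v w * cl.h0) (cl.h0 * Cl r v w)"
proof -
  note J = idl_poly_ideal[OF I]
  have c: "v \<in> carrier_vec (r + 1)" "w \<in> carrier_vec (r + 1)" "v \<bullet> w = 1" using vw by (auto simp: unit_pair_def)
  define u where "u = Cl r v w"
  have u: "u \<in> cl.Vec UNIV" "u * u = 1" unfolding u_def using Cl_in_Vec[OF c(1,2)] unit_pair_Cl[OF vw] by auto
  define g where "g = (\<lambda>\<tau> \<tau>2. scale_var \<tau> \<alpha>' * scale_var \<tau>2 \<alpha>)"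
  define close where "close = (\<lambda>u \<tau> \<tau>2. cl.comm_rel (poly_ideal I) (g \<tau> \<tau>2) (g \<tau>2 \<tau>) (u * cl.h0) (cl.h0 * u))"
  have orth_g: "cl.orth (g \<tau> \<tau>2) (g \<tau>2 \<tau>)" for \<tau> \<tau>2 unfolding g_def by (intro cl.orth_mult tame_orth[OF \<alpha>])
  have g_trans: "g \<tau> \<tau>2 * g \<tau>2 \<tau>3 = g \<tau> \<tau>3" for \<tau> \<tau>2 \<tau>3
  proof -
    have "g \<tau> \<tau>2 * g \<tau>2 \<tau>3 = scale_var \<tau> \<alpha>' * (scale_var \<tau>2 \<alpha> * scale_var \<tau>2 \<alpha>') * scale_var \<tau>3 \<alpha>"
      by (simp only: g_def mult.assoc)
    moreover have "scale_var \<tau>2 \<alpha> * scale_var \<tau>2 \<alpha>' = 1" using tame_orth(1)[OF \<alpha>] by (auto simp: cl.orth_def)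
    ultimately show ?thesis by (simp add: g_def)
  qed
  have orth_u: "cl.orth (u * cl.h0) (cl.h0 * u)" if "u \<in> cl.Vec UNIV" "u * u = 1" for u :: "'a poly rfm"
    by (intro cl.orth_mult orth_unit_vector that orth_h0)
  have trans: "close u \<tau> \<tau>3" if "close u \<tau> \<tau>2" "close u \<tau>2 \<tau>3" for \<tau> \<tau>2 \<tau>3
    using cl.comm_rel_mult_left[OF J orth_g that[unfolded close_def] orth_u[OF u]] by (simp add: close_def g_trans)
  define S where "S = {s. \<forall>\<tau> y. close u \<tau> (\<tau> + s * y)}"
  have S_add: "a + b \<in> S" if "a \<in> S" "b \<in> S" for a b
    unfolding S_def
  proof (clarify)
    fix \<tau> y
    have "close u \<tau> (\<tau> + a * y)" "close u (\<tau> + a * y) (\<tau> + a * y + b * y)" using that by (auto simp: S_def)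
    from trans[OF this] show "close u \<tau> (\<tau> + (a + b) * y)" by (simp add: algebra_simps)
  qed
  have S_mult: "b * a \<in> S" if "a \<in> S" for a b
    unfolding S_def
  proof (clarify)
    fix \<tau> y
    have "close u \<tau> (\<tau> + a * (b * y))" using that by (auto simp: S_def)
    thus "close u \<tau> (\<tau> + b * a * y)" by (simp add: ac_simps)
  qed
  have nonzero: "\<exists>M. \<forall>\<tau> y. close u1 \<tau> (\<tau> + s ^ M * y)"
    if "u1 \<in> cl.Vec UNIV" "u1 * u1 = 1" "j \<le> r" "j \<noteq> 0" "br u1 (zc r (j, False)) = smr s 1" for u1 j s
    using local_homotopy[OF I \<alpha> that(1,2), of "(j, True)" s] that(3-5) by (simp add: close_def g_def)
  have pos: "\<exists>M. (v $ j) ^ M \<in> S" if "j \<le> r" "j \<noteq> 0" for j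
    using nonzero[OF u that, of "v $ j"] br_Cl_zc[OF c(1,2) that(1), of False] by (simp add: u_def S_def)
  have sum01: "\<exists>M. (v $ 1 + v $ 0) ^ M \<in> S"
  proof -
    have kl: "(1, True) \<in> cl.K" "(0, False) \<in> cl.K" "fst (1::nat, True) \<noteq> fst (0::nat, False)" using r_ge_2 by auto
    define \<rho> :: "'a poly rfm" where "\<rho> = 1 + smr 1 (zc r (1, True) * zc r (0, False))"
    define \<rho>' :: "'a poly rfm" where "\<rho>' = 1 + smr (- 1) (zc r (1, True) * zc r (0, False))"
    define u1 where "u1 = \<rho> * u * \<rho>'"
    note cu = conj_unit_vector[OF u kl, of 1, folded \<rho>_def \<rho>'_def, folded u1_def]
    have "br u1 (zc r (1, False)) = smr (v $ 1 + v $ 0) 1"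
    proof -
      have "br (zc r (0, False)) u = smr (v $ 0) 1" "br (zc r (1, True)) u = smr (w $ 1) 1" "br u (zc r (1, False)) = smr (v $ 1) 1"
        using br_Cl_zc[OF c(1,2), of 0 False] br_Cl_zc[OF c(1,2), of 1 True] br_Cl_zc[OF c(1,2), of 1 False] r_ge_2
        by (simp_all add: u_def br_commute)
      moreover have "br (zc r (1, True)) (zc r (1, False)) = (1 :: 'a poly rfm)" "br (zc r (0, False)) (zc r (1, False)) = (0 :: 'a poly rfm)"
        using r_ge_2 by (simp_all add: cl.br_K)
      ultimately show ?thesis unfolding cu(4) by (simp del: One_nat_def)
    qed
    then obtain M where M: "\<And>\<tau> y. close u1 \<tau> (\<tau> + (v $ 1 + v $ 0) ^ M * y)"
      using nonzero[OF cu(1,2), of 1 "v $ 1 + v $ 0"] r_ge_2 by auto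
    have "close u \<tau> \<tau>2" if u1: "close u1 \<tau> \<tau>2" for \<tau> \<tau>2
    proof -
      \<comment> \<open>The scalar of \<open>Erel_commutator_E\<close> is 1 here, because the
        elements \<open>g \<tau> \<tau>2\<close> act trivially modulo the ideal.\<close>
      have comm_E: "cl.comm_rel (poly_ideal I) (g \<tau> \<tau>2) (g \<tau>2 \<tau>) h h'" if "h \<in> cl.E UNIV" "cl.orth h h'" for h h'
        using tame_difference[OF I \<alpha>] cl.idlD(2)[OF J] that
        by (intro cl.Erel_commutator_E[OF J orth_g, of 1]) (auto simp: g_def)
      have hE: "cl.h0 * \<rho> * cl.h0 \<in> cl.E UNIV" using cu(6) by (rule cl.E_h0) auto
      have oh: "cl.orth (cl.h0 * \<rho> * cl.h0) (cl.h0 * (\<rho>' * cl.h0))" by (intro cl.orth_mult orth_h0 cu(5))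
      note o' = cl.orth_sym[OF cu(5)]
      note c1 = cl.comm_rel_mult_right[OF J o' comm_E[OF cu(7) o'] u1[unfolded close_def] orth_g]
      note c2 = cl.comm_rel_mult_right[OF J cl.orth_mult[OF o' orth_u[OF cu(1,2)]] c1 comm_E[OF hE oh] orth_g]
      have "cl.h0 * (\<rho>' * cl.h0) * (cl.h0 * u1 * \<rho>) = cl.h0 * u"
      proof -
        have inv: "\<rho>' * \<rho> = 1" using cu(5) by (simp add: cl.orth_def)
        have "cl.h0 * (\<rho>' * cl.h0) * (cl.h0 * u1 * \<rho>) = cl.h0 * \<rho>' * (cl.h0 * cl.h0) * \<rho> * u * \<rho>' * \<rho>"
          by (simp only: u1_def mult.assoc)
        also have "\<dots> = cl.h0 * (\<rho>' * \<rho>) * u * (\<rho>' * \<rho>)" by (simp only: cl.h0_h0 mult_1_right mult.assoc)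
        finally show ?thesis by (simp only: inv mult_1_right)
      qed
      with c2 show ?thesis unfolding close_def cu(3)[symmetric] by simp
    qed
    hence "close u \<tau> (\<tau> + (v $ 1 + v $ 0) ^ M * y)" for \<tau> y by (metis M)
    hence "(v $ 1 + v $ 0) ^ M \<in> S" unfolding S_def by blast
    thus ?thesis by blast
  qed
  define rad where "rad = {x. \<exists>M. x ^ M \<in> S}"
  have rad_add: "a + b \<in> rad" if "a \<in> rad" "b \<in> rad" for a b
    using that power_add_in_ideal[OF S_add S_mult, of a _ b] unfolding rad_def by blast
  have rad_mult: "a * b \<in> rad" if "a \<in> rad" for a b
  proof -
    from that obtain M where "a ^ M \<in> S" by (auto simp: rad_def)
    from S_mult[OF this, of "b ^ M"] have "(a * b) ^ M \<in> S" by (simp add: power_mult_distrib mult.commute)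
    thus ?thesis by (auto simp: rad_def)
  qed
  have v1: "v $ j \<in> rad" if "j \<le> r" "j \<noteq> 0" for j using pos[OF that] by (auto simp: rad_def)
  have "v $ 1 + v $ 0 \<in> rad" using sum01 by (simp add: rad_def)
  moreover have "v $ 1 * (- 1) \<in> rad" using v1[of 1] r_ge_2 by (intro rad_mult) auto
  ultimately have "(v $ 1 + v $ 0) + v $ 1 * (- 1) \<in> rad" by (rule rad_add)
  hence v0: "v $ 0 \<in> rad" by simp
  have rad0: "0 \<in> rad" using rad_mult[OF v0, of 0] by simp
  have "(\<Sum>i\<in>A. v $ i * w $ i) \<in> rad" if "finite A" "A \<subseteq> {0..<r + 1}" for A
    using that
  proof (induction A rule: finite_induct)
    case (insert i A)
    have "v $ i \<in> rad" using v0 v1[of i] insert by (cases "i = 0") auto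
    thus ?case using insert by (auto intro: rad_add rad_mult)
  qed (simp add: rad0)
  from this[of "{0..<r + 1}"] have "1 \<in> rad" using c by (simp add: scalar_prod_def)
  hence "1 \<in> S" by (auto simp: rad_def)
  hence "close u 0 (0 + 1 * 1)" unfolding S_def by blast
  thus ?thesis by (simp add: close_def g_def scale_var_1 u_def)
qed

text \<open>Here the root element that makes the e_0-coordinate 1 needs no denominator, as the
  inverse \<open>t\<close> of \<open>s\<close> is available: a + (1 - a) t s = 1.\<close>

lemma unit_coefficient_E:
  fixes u :: "'b::comm_ring_1 rfm"
  assumes u: "u \<in> cl.Vec UNIV" "u * u = 1" and j: "j \<le> r" "j \<noteq> 0" and s: "br u (zc r (j, False)) = smr s 1" "s * t = 1"
  shows "u * cl.h0 \<in> cl.E UNIV"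
proof -
  obtain a where a: "br u (zc r (0, False)) = smr a 1"
    using cl.Vec_br[OF u(1) cl.z_in_Vec[OF cl.K0]] by blast
  obtain c where c: "br u (zc r (0, True)) = smr c 1"
    using cl.Vec_br[OF u(1) cl.z_in_Vec[OF cl.K0]] by blast
  have kl: "(0, True) \<in> cl.K" "(j, False) \<in> cl.K" "fst (0::nat, True) \<noteq> fst (j, False)" using j by auto
  define x where "x = (1 - a) * t"
  note cu = conj_unit_vector[OF u kl, of x]
  let ?u1 = "(1 + smr x (zc r (0, True) * zc r (j, False))) * u * (1 + smr (- x) (zc r (0, True) * zc r (j, False)))"
  have z: "br (zc r (0, True)) (zc r (0, False)) = (1 :: 'b rfm)" "br (zc r (j, False)) (zc r (0, False)) = (0 :: 'b rfm)"
    using j by (simp_all add: cl.br_K)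
  have "a + x * s = 1" using s(2) by (simp add: x_def mult.assoc mult.commute[of t])
  moreover have "br ?u1 (zc r (0, False)) = smr (a + x * s) 1"
    unfolding cu(4) using s(1) c by (simp add: a br_commute[of _ u] z)
  ultimately have "?u1 * cl.h0 \<in> cl.E UNIV" using cl.normalised_unit_vector[OF cu(1,2)] by simp
  from cl.E_mult[OF cl.E_mult[OF cu(7) this] cl.E_h0[OF cu(6)]] show ?thesis unfolding cu(3) by simp
qed

lemma unit_entry_E:
  fixes v w :: "'b::comm_ring_1 vec"
  assumes vw: "unit_pair v w" and j: "j \<le> r" and s: "v $ j * t = 1"
  shows "Cl r v w * cl.h0 \<in> cl.E UNIV"
proof -
  have c: "v \<in> carrier_vec (r + 1)" "w \<in> carrier_vec (r + 1)" using vw by (auto simp: unit_pair_def)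
  note u = Cl_in_Vec[OF c] unit_pair_Cl[OF vw]
  show ?thesis
  proof (cases "j = 0")
    case False
    thus ?thesis using unit_coefficient_E[OF u j False _ s] br_Cl_zc[OF c j, of False] by simp
  next
    case True
    have kl: "(1, True) \<in> cl.K" "(0, False) \<in> cl.K" "fst (1::nat, True) \<noteq> fst (0::nat, False)" using r_ge_2 by auto
    \<comment> \<open>A unit at index 0 need not be 1, and no scaling is at hand to make it so. It
      is used to turn the coordinate at index 1 into 1, after which
      \<open>unit_coefficient_E\<close> applies.\<close>
    define x where "x = (1 - v $ 1) * t"
    note cu = conj_unit_vector[OF u kl, of x]
    let ?u1 = "(1 + smr x (zc r (1, True) * zc r (0, False))) * Cl r v w * (1 + smr (- x) (zc r (1, True) * zc r (0, False)))"
    have b: "br (Cl r v w) (zc r (0, False)) = smr (v $ 0) 1" "br (Cl r v w) (zc r (1, True)) = smr (w $ 1) 1" "br (Cl r v w) (zc r (1, False)) = smr (v $ 1) 1"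
      using br_Cl_zc[OF c, of 0 False] br_Cl_zc[OF c, of 1 True] br_Cl_zc[OF c, of 1 False] r_ge_2 by simp_all
    have z: "br (zc r (1, True)) (zc r (1, False)) = (1 :: 'b rfm)" "br (zc r (0, False)) (zc r (1, False)) = (0 :: 'b rfm)"
      using r_ge_2 by (simp_all add: cl.br_K)
    have "v $ 1 + x * v $ 0 = 1" using s True by (simp add: x_def mult.assoc mult.commute[of t])
    moreover have "br ?u1 (zc r (1, False)) = smr (v $ 1 + x * v $ 0) 1"
      unfolding cu(4) by (simp add: b br_commute[of _ "Cl r v w"] z del: One_nat_def)
    ultimately have "?u1 * cl.h0 \<in> cl.E UNIV"
      using unit_coefficient_E[OF cu(1,2), of 1 1 1] r_ge_2 by simp
    from cl.E_mult[OF cl.E_mult[OF cu(7) this] cl.E_h0[OF cu(6)]] show ?thesis unfolding cu(3) by simp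
  qed
qed

end

subsection \<open>Ideals and local rings\<close>

definition is_ideal :: "'a::comm_ring_1 set \<Rightarrow> bool" where
  "is_ideal I \<longleftrightarrow> 0 \<in> I \<and> (\<forall>a\<in>I. \<forall>b\<in>I. a + b \<in> I) \<and> (\<forall>a\<in>I. \<forall>d. d * a \<in> I)"

lemma is_idealD:
  assumes "is_ideal I"
  shows "0 \<in> I" "a \<in> I \<Longrightarrow> b \<in> I \<Longrightarrow> a + b \<in> I" "a \<in> I \<Longrightarrow> d * a \<in> I" "a \<in> I \<Longrightarrow> a * d \<in> I" "a \<in> I \<Longrightarrow> - a \<in> I"
    "a \<in> I \<Longrightarrow> b \<in> I \<Longrightarrow> a - b \<in> I"
proof -
  show m: "- a \<in> I" if "a \<in> I" for a
    using assms that unfolding is_ideal_def by (metis mult_minus1)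
  show "a - b \<in> I" if "a \<in> I" "b \<in> I"
    using assms that m[of b] unfolding is_ideal_def by (metis diff_conv_add_uminus)
qed (use assms in \<open>auto simp: is_ideal_def mult.commute\<close>)

lemma is_ideal_sum: "is_ideal I \<Longrightarrow> (\<And>i. i \<in> A \<Longrightarrow> f i \<in> I) \<Longrightarrow> (\<Sum>i\<in>A. f i) \<in> I"
  by (induction A rule: infinite_finite_induct) (auto simp: is_idealD)

lemma ideal_class_ring_iff: "ideal I (class_ring :: 'a::comm_ring_1 ring) \<longleftrightarrow> is_ideal I"
proof
  assume "ideal I (class_ring :: 'a ring)"
  then interpret ideal I "class_ring :: 'a ring" .
  show "is_ideal I"
    unfolding is_ideal_def using zero_closed a_closed I_l_closed by simp
next
  assume I: "is_ideal I"
  show "ideal I (class_ring :: 'a ring)"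
  proof (rule idealI)
    show "ring (class_ring :: 'a ring)" by (rule class_ring.ring_axioms)
    show "subgroup I (add_monoid (class_ring :: 'a ring))"
    proof
      fix x assume "x \<in> I"
      moreover have "inv\<^bsub>add_monoid (class_ring :: 'a ring)\<^esub> x = - x"
        using class_ring_simps(8)[where 'a = 'a] unfolding a_inv_def by (metis)
      ultimately show "inv\<^bsub>add_monoid (class_ring :: 'a ring)\<^esub> x \<in> I" using I by (simp add: is_idealD)
    qed (use I in \<open>auto simp: is_idealD\<close>)
  qed (use I in \<open>auto simp: is_idealD\<close>)
qed

text \<open>Zorn's lemma for the proper ideals containing \<open>x\<close>; the multiples of
  \<open>x\<close> form one of them because \<open>x\<close> is not a unit.\<close>

lemma nonunit_in_maximal:
  fixes x :: "'a::comm_ring_1"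
  assumes "\<not> x dvd 1"
  shows "\<exists>M. maximalideal M (class_ring :: 'a ring) \<and> x \<in> M"
proof -
  define \<A> where "\<A> = {I. is_ideal I \<and> 1 \<notin> I \<and> x \<in> I}"
  have "is_ideal (range ((*) x))"
    unfolding is_ideal_def
  proof (intro conjI ballI allI; clarsimp)
    show "0 \<in> range ((*) x)" by (rule image_eqI[of _ _ 0]) auto
    fix a b show "x * a + x * b \<in> range ((*) x)" by (rule image_eqI[of _ _ "a + b"]) (auto simp: distrib_left)
  next
    fix a d show "d * (x * a) \<in> range ((*) x)" by (rule image_eqI[of _ _ "d * a"]) (auto simp: ac_simps)
  qed
  moreover have "1 \<notin> range ((*) x)" using assms by (auto simp: dvd_def)
  moreover have "x \<in> range ((*) x)" by (rule image_eqI[of _ _ 1]) auto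
  ultimately have ne: "\<A> \<noteq> {}" by (auto simp: \<A>_def)
  have "\<exists>M\<in>\<A>. \<forall>X\<in>\<A>. M \<subseteq> X \<longrightarrow> X = M"
  proof (rule subset_Zorn_nonempty[OF ne])
    fix \<C> assume C: "\<C> \<noteq> {}" "subset.chain \<A> \<C>"
    hence sub: "\<C> \<subseteq> \<A>" and lin: "\<And>X Y. X \<in> \<C> \<Longrightarrow> Y \<in> \<C> \<Longrightarrow> X \<subseteq> Y \<or> Y \<subseteq> X"
      by (auto simp: subset_chain_def)
    have "is_ideal (\<Union>\<C>)"
      unfolding is_ideal_def
    proof (intro conjI ballI allI)
      show "0 \<in> \<Union>\<C>" using C(1) sub by (auto simp: \<A>_def is_ideal_def)
      fix a assume "a \<in> \<Union>\<C>"
      then obtain X where X: "X \<in> \<C>" "a \<in> X" by auto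
      hence iX: "is_ideal X" using sub by (auto simp: \<A>_def)
      show "d * a \<in> \<Union>\<C>" for d using X is_idealD(3)[OF iX] by auto
      fix b assume "b \<in> \<Union>\<C>"
      then obtain Y where Y: "Y \<in> \<C>" "b \<in> Y" by auto
      hence iY: "is_ideal Y" using sub by (auto simp: \<A>_def)
      show "a + b \<in> \<Union>\<C>" using lin[OF X(1) Y(1)] X Y is_idealD(2)[OF iX] is_idealD(2)[OF iY] by blast
    qed
    thus "\<Union>\<C> \<in> \<A>" using C(1) sub by (auto simp: \<A>_def)
  qed
  then obtain M where M: "is_ideal M" "1 \<notin> M" "x \<in> M" and max: "\<And>X. X \<in> \<A> \<Longrightarrow> M \<subseteq> X \<Longrightarrow> X = M"
    by (auto simp: \<A>_def)
  have "maximalideal M (class_ring :: 'a ring)"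
  proof (rule maximalidealI)
    show "ideal M (class_ring :: 'a ring)" using M by (simp add: ideal_class_ring_iff)
    show "carrier (class_ring :: 'a ring) \<noteq> M" using M by auto
    fix J assume J: "ideal J (class_ring :: 'a ring)" "M \<subseteq> J"
    hence iJ: "is_ideal J" by (simp add: ideal_class_ring_iff)
    show "J = M \<or> J = carrier (class_ring :: 'a ring)"
    proof (cases "1 \<in> J")
      case True
      hence "d \<in> J" for d using is_idealD(3)[OF iJ True, of d] by simp
      thus ?thesis by auto
    next
      case False
      hence "J \<in> \<A>" using iJ J(2) M(3) by (auto simp: \<A>_def)
      thus ?thesis using max J(2) by blast
    qed
  qed
  thus ?thesis using M by blast
qed

text \<open>Otherwise every f_i lies in the unique maximal ideal, and then so does 1.\<close>

lemma local_ring_sum_unit: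
  fixes f g :: "nat \<Rightarrow> 'a::comm_ring_1"
  assumes "local_ring TYPE('a)" "(\<Sum>i\<in>A. f i * g i) = 1"
  shows "\<exists>i\<in>A. f i dvd 1"
proof (rule ccontr)
  assume "\<not> (\<exists>i\<in>A. f i dvd 1)"
  hence nu: "\<And>i. i \<in> A \<Longrightarrow> \<not> f i dvd 1" by blast
  obtain M where M: "maximalideal M (class_ring :: 'a ring)" "\<And>M'. maximalideal M' (class_ring :: 'a ring) \<Longrightarrow> M' = M"
    using assms(1) unfolding local_ring_def by blast
  interpret maximalideal M "class_ring :: 'a ring" by fact
  have iM: "is_ideal M" using is_ideal by (simp add: ideal_class_ring_iff)
  have "f i \<in> M" if "i \<in> A" for i using nonunit_in_maximal[OF nu[OF that]] M(2) by blast
  hence "1 \<in> M" unfolding assms(2)[symmetric] by (intro is_ideal_sum[OF iM] is_idealD(4)[OF iM])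
  hence "M = UNIV" using is_idealD(3)[OF iM, of 1] by auto
  thus False using I_notcarr by simp
qed

section \<open>Lifts of products of Suslin matrices, and their commutators\<close>

context suslin_rank
begin

interpretation cl: clifford smr UNIV "zc r" "Suc r"
  using zc_clifford[OF r_ge_2] by simp

lemma idl_iff: "cl.idl I \<longleftrightarrow> is_ideal I"
  by (simp add: cl.idl_def is_ideal_def)

lemma extended_ideal_eq:
  assumes I: "is_ideal I"
  shows "extended_ideal I = poly_ideal I"
proof
  have "is_ideal (poly_ideal I)" using idl_poly_ideal[of I] I by (simp add: idl_iff)
  moreover have "(\<lambda>a. [:a:]) ` I \<subseteq> poly_ideal I"
    using is_idealD(1)[OF I] by (auto simp: poly_ideal_def coeff_pCons split: nat.splits)
  ultimately show "extended_ideal I \<subseteq> poly_ideal I"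
    unfolding extended_ideal_def by (intro ring.genideal_minimal[OF class_ring.ring_axioms]) (auto simp: ideal_class_ring_iff)
  have "ideal (extended_ideal I) (class_ring :: 'a poly ring)"
    unfolding extended_ideal_def by (rule ring.genideal_ideal[OF class_ring.ring_axioms]) simp
  hence E: "is_ideal (extended_ideal I)" by (simp add: ideal_class_ring_iff)
  have c: "[:a:] \<in> extended_ideal I" if "a \<in> I" for a
    using ring.genideal_self[OF class_ring.ring_axioms, of "(\<lambda>a. [:a:]) ` I"] that unfolding extended_ideal_def by auto
  have "p \<in> extended_ideal I" if "\<forall>i. coeff p i \<in> I" for p
    using that
  proof (induction p)
    case (pCons a p)
    have "a \<in> I" using pCons.prems[rule_format, of 0] by simp
    moreover have "\<forall>i. coeff p i \<in> I" using pCons.prems[rule_format, of "Suc i" for i] by simp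
    ultimately have "[:a:] + [:0, 1:] * p \<in> extended_ideal I"
      using pCons.IH c by (intro is_idealD(2,3)[OF E])
    thus ?case by simp
  qed (simp add: is_idealD(1)[OF E])
  thus "poly_ideal I \<subseteq> extended_ideal I" by (auto simp: poly_ideal_def)
qed

text \<open>The second argument is the inverse, carried along because conjugation needs it. The
  products u h_0 and h_0 u are the lifts of a Suslin matrix and of its inverse.\<close>

inductive spin :: "'b::comm_ring_1 rfm \<Rightarrow> 'b rfm \<Rightarrow> bool" where
  spin_one: "spin 1 1"
| spin_right: "unit_pair v w \<Longrightarrow> spin g g' \<Longrightarrow> spin ((Cl r v w * cl.h0) * g) (g' * (cl.h0 * Cl r v w))"
| spin_left: "unit_pair v w \<Longrightarrow> spin g g' \<Longrightarrow> spin ((cl.h0 * Cl r v w) * g) (g' * (Cl r v w * cl.h0))"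

lemma orth_generator:
  assumes "unit_pair v w"
  shows "cl.orth (Cl r v w * cl.h0) (cl.h0 * Cl r v w)" "cl.orth (cl.h0 * Cl r v w) (Cl r v w * cl.h0)"
proof -
  have "v \<in> carrier_vec (r + 1)" "w \<in> carrier_vec (r + 1)" using assms by (auto simp: unit_pair_def)
  note o = orth_unit_vector[OF Cl_in_Vec[OF this] unit_pair_Cl[OF assms]]
  show "cl.orth (Cl r v w * cl.h0) (cl.h0 * Cl r v w)" "cl.orth (cl.h0 * Cl r v w) (Cl r v w * cl.h0)"
    using cl.orth_mult[OF o orth_h0] cl.orth_mult[OF orth_h0 o] by auto
qed

lemma spin_orth: "spin g g' \<Longrightarrow> cl.orth g g'"
proof (induction rule: spin.induct)
  case spin_one
  show ?case by (simp add: cl.orth_def)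
qed (auto intro: cl.orth_mult orth_generator)

lemma spin_mult: "spin g g' \<Longrightarrow> spin h h' \<Longrightarrow> spin (g * h) (h' * g')"
proof (induction rule: spin.induct)
  case (spin_right v w g g')
  thus ?case using spin.spin_right[of v w "g * h" "h' * g'"] by (simp add: mult.assoc)
next
  case (spin_left v w g g')
  thus ?case using spin.spin_left[of v w "g * h" "h' * g'"] by (simp add: mult.assoc)
qed simp

text \<open>At X = 0 the generators come from vectors over the local ring itself, where v . w = 1
  forces an invertible entry of \<open>v\<close>, so \<open>unit_entry_E\<close> applies to each of
  them.\<close>

lemma spin_at_0_in_E:
  fixes g g' :: "'a::comm_ring_1 poly rfm"
  assumes loc: "local_ring TYPE('a)" and g: "spin g g'"
  shows "scale_var 0 g \<in> cl.E UNIV"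
proof -
  interpret ev: comm_ring_hom "\<lambda>p. poly p (0::'a)" by (rule comm_ring_hom_poly)
  interpret co: comm_ring_hom "\<lambda>a::'a. [:a:]" by (rule comm_ring_hom_const)
  have sv: "scale_var 0 A = map_rfm (\<lambda>a. [:a:]) (map_rfm (\<lambda>p. poly p 0) A)" for A :: "'a poly rfm"
    unfolding scale_var_def map_rfm_comp[OF comm_ring_hom_const comm_ring_hom_poly]
    by (rule arg_cong[of _ _ "\<lambda>f. map_rfm f A"]) (auto simp: pcompose_0' poly_0_coeff_0)
  have gen: "map_rfm (\<lambda>p. poly p 0) (Cl r v w * cl.h0) \<in> cl.E UNIV" "map_rfm (\<lambda>p. poly p 0) (cl.h0 * Cl r v w) \<in> cl.E UNIV"
    if vw: "unit_pair v w" for v w :: "'a poly vec"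
  proof -
    have c: "v \<in> carrier_vec (r + 1)" "w \<in> carrier_vec (r + 1)" "v \<bullet> w = 1" using vw by (auto simp: unit_pair_def)
    let ?v = "map_vec (\<lambda>p. poly p 0) v" and ?w = "map_vec (\<lambda>p. poly p 0) w"
    have s: "(\<Sum>i\<in>{0..<r + 1}. ?v $ i * ?w $ i) = 1"
    proof -
      have "(\<Sum>i\<in>{0..<r + 1}. ?v $ i * ?w $ i) = poly (v \<bullet> w) 0"
        using c(1,2) by (simp add: scalar_prod_def poly_sum del: sum.op_ivl_Suc)
      thus ?thesis by (simp add: c)
    qed
    have up: "unit_pair ?v ?w" unfolding unit_pair_def using c s by (simp add: scalar_prod_def)
    obtain j where j: "j \<in> {0..<r + 1}" "?v $ j dvd 1" using local_ring_sum_unit[OF loc s] by blast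
    then obtain t where "1 = ?v $ j * t" by (blast elim: dvdE)
    hence "j \<le> r" "?v $ j * t = 1" using j by (auto simp: less_Suc_eq_le)
    hence E: "Cl r ?v ?w * cl.h0 \<in> cl.E UNIV" using unit_entry_E[OF up] by blast
    have m: "map_rfm (\<lambda>p. poly p 0) (Cl r v w) = Cl r ?v ?w" by (rule ev.map_Cl[OF c(1,2)])
    show "map_rfm (\<lambda>p. poly p 0) (Cl r v w * cl.h0) \<in> cl.E UNIV"
      using E by (simp add: m map_rfm_h0[OF comm_ring_hom_poly])
    have "cl.h0 * (Cl r ?v ?w * cl.h0) * cl.h0 \<in> cl.E UNIV" by (rule cl.E_h0[OF E]) simp
    thus "map_rfm (\<lambda>p. poly p 0) (cl.h0 * Cl r v w) \<in> cl.E UNIV"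
      by (simp add: m map_rfm_h0[OF comm_ring_hom_poly] mult.assoc cl.h0_h0)
  qed
  have "map_rfm (\<lambda>p. poly p 0) g \<in> cl.E UNIV"
    using g
  proof (induction rule: spin.induct)
    case (spin_right v w g g')
    thus ?case using cl.E_mult[OF gen(1)[OF spin_right(1)]] by (simp only: ev.map_rfm_mult)
  next
    case (spin_left v w g g')
    thus ?case using cl.E_mult[OF gen(2)[OF spin_left(1)]] by (simp only: ev.map_rfm_mult)
  qed simp
  thus ?thesis unfolding sv by (rule map_rfm_E[OF comm_ring_hom_const])
qed

text \<open>[g, h'] is the conjugate by h' of the inverse of [g, h].\<close>

lemma comm_rel_inverse:
  assumes J: "cl.idl J" and h: "cl.orth h h'" and g: "cl.orth g g'" and c: "cl.comm_rel J g g' h h'"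
  shows "cl.comm_rel J g g' h' h"
proof -
  have inv: "h' * h = 1" "h * h' = 1" "g * g' = 1" "g' * g = 1" using h g by (auto simp: cl.orth_def)
  obtain X where X: "X \<in> cl.Erel J" "g * h * g' * h' * X = 1"
    using cl.Erel_inverse[OF c[unfolded cl.comm_rel_def[OF J]]] cl.idlD(6)[OF J] by blast
  have "X = (h * g * (h' * (g' * g) * h) * g' * h') * X" by (simp add: inv mult.assoc)
  also have "\<dots> = (h * g * h' * g') * (g * h * g' * h' * X)" by (simp only: mult.assoc)
  finally have "X = h * g * h' * g'" by (simp add: X)
  hence "h' * (h * g * h' * g') * h \<in> cl.Erel J" using cl.Erel_normal[OF J cl.orth_sym[OF h] X(1)] by simp
  moreover have "h' * (h * g * h' * g') * h = (h' * h) * g * h' * g' * h" by (simp only: mult.assoc)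
  ultimately show ?thesis by (simp add: cl.comm_rel_def[OF J] inv)
qed

lemma spin_commutator:
  fixes \<alpha> \<beta> :: "'a::comm_ring_1 poly rfm"
  assumes loc: "local_ring TYPE('a)" and I: "is_ideal I"
    and \<alpha>: "spin \<alpha> \<alpha>'" "tame I \<alpha> \<alpha>'" and \<beta>: "spin \<beta> \<beta>'"
    and c: "c * c - 1 \<in> poly_ideal I" "\<And>k. k \<in> cl.K \<Longrightarrow> \<beta> * zc r k * \<beta>' - smr c (zc r k) \<in> cl.Vec (poly_ideal I)"
  shows "\<alpha> * \<beta> * \<alpha>' * \<beta>' \<in> cl.Erel (poly_ideal I)"
proof -
  have I': "cl.idl I" using I by (simp add: idl_iff)
  note J = idl_poly_ideal[OF I']
  define \<delta> where "\<delta> = scale_var 0 \<alpha>' * \<alpha>"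
  define \<delta>' where "\<delta>' = \<alpha>' * scale_var 0 \<alpha>"
  note t0 = tame_orth[OF \<alpha>(2), of 0]
  note o\<alpha> = spin_orth[OF \<alpha>(1)] and o\<beta> = spin_orth[OF \<beta>]
  have o\<delta>: "cl.orth \<delta> \<delta>'" unfolding \<delta>_def \<delta>'_def by (rule cl.orth_mult[OF t0(2) o\<alpha>])
  have "cl.comm_rel (poly_ideal I) \<delta> \<delta>' \<beta> \<beta>'"
    using \<beta>
  proof (induction rule: spin.induct)
    case spin_one
    show ?case unfolding cl.comm_rel_def[OF J] using o\<delta> cl.Erel.one by (simp add: cl.orth_def)
  next
    case (spin_right v w g g')
    have "cl.comm_rel (poly_ideal I) \<delta> \<delta>' (Cl r v w * cl.h0) (cl.h0 * Cl r v w)"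
      unfolding \<delta>_def \<delta>'_def by (rule homotopy_commutes[OF I' \<alpha>(2) spin_right(1)])
    from cl.comm_rel_mult_right[OF J orth_generator(1)[OF spin_right(1)] this spin_right.IH o\<delta>] show ?case .
  next
    case (spin_left v w g g')
    have "cl.comm_rel (poly_ideal I) \<delta> \<delta>' (Cl r v w * cl.h0) (cl.h0 * Cl r v w)"
      unfolding \<delta>_def \<delta>'_def by (rule homotopy_commutes[OF I' \<alpha>(2) spin_left(1)])
    from comm_rel_inverse[OF J orth_generator(1)[OF spin_left(1)] o\<delta> this]
    have "cl.comm_rel (poly_ideal I) \<delta> \<delta>' (cl.h0 * Cl r v w) (Cl r v w * cl.h0)" .
    from cl.comm_rel_mult_right[OF J orth_generator(2)[OF spin_left(1)] this spin_left.IH o\<delta>] show ?case .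
  qed
  moreover have "cl.comm_rel (poly_ideal I) (scale_var 0 \<alpha>) (scale_var 0 \<alpha>') \<beta> \<beta>'"
  proof -
    \<comment> \<open>The roles are exchanged: \<beta> is the element acting by a scalar modulo the
      ideal, and \<alpha>(0) is the elementary one. The order is reversed afterwards by inversion
      and conjugation.\<close>
    have "cl.comm_rel (poly_ideal I) \<beta> \<beta>' (scale_var 0 \<alpha>) (scale_var 0 \<alpha>')"
      by (rule cl.Erel_commutator_E[OF J o\<beta> UNIV_I c spin_at_0_in_E[OF loc \<alpha>(1)] t0(1)])
    from comm_rel_inverse[OF J t0(1) o\<beta> this]
    have "\<beta> * scale_var 0 \<alpha>' * \<beta>' * scale_var 0 \<alpha> \<in> cl.Erel (poly_ideal I)" by (simp only: cl.comm_rel_def[OF J])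
    from cl.Erel_normal[OF J t0(1) this]
    have "scale_var 0 \<alpha> * (\<beta> * scale_var 0 \<alpha>' * \<beta>' * scale_var 0 \<alpha>) * scale_var 0 \<alpha>' \<in> cl.Erel (poly_ideal I)" .
    moreover have "scale_var 0 \<alpha> * (\<beta> * scale_var 0 \<alpha>' * \<beta>' * scale_var 0 \<alpha>) * scale_var 0 \<alpha>' =
        scale_var 0 \<alpha> * \<beta> * scale_var 0 \<alpha>' * \<beta>' * (scale_var 0 \<alpha> * scale_var 0 \<alpha>')"
      by (simp only: mult.assoc)
    ultimately show ?thesis using t0(1) by (simp add: cl.comm_rel_def[OF J] cl.orth_def)
  qed
  ultimately have "cl.comm_rel (poly_ideal I) (scale_var 0 \<alpha> * \<delta>) (\<delta>' * scale_var 0 \<alpha>') \<beta> \<beta>'"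
    by (intro cl.comm_rel_mult_left[OF J t0(1) _ _ o\<beta>])
  moreover have "scale_var 0 \<alpha> * \<delta> = (scale_var 0 \<alpha> * scale_var 0 \<alpha>') * \<alpha>" "\<delta>' * scale_var 0 \<alpha>' = \<alpha>' * (scale_var 0 \<alpha> * scale_var 0 \<alpha>')"
    by (simp_all only: \<delta>_def \<delta>'_def mult.assoc)
  ultimately show ?thesis using t0(1) by (simp add: cl.comm_rel_def[OF J] cl.orth_def)
qed

end

subsection \<open>Congruence of Suslin matrices\<close>

definition mcong :: "'b::comm_ring_1 set \<Rightarrow> 'b mat \<Rightarrow> 'b mat \<Rightarrow> bool" where
  "mcong J A B \<longleftrightarrow> dim_row A = dim_row B \<and> dim_col A = dim_col B \<and>
     (\<forall>i < dim_row B. \<forall>j < dim_col B. A $$ (i, j) - B $$ (i, j) \<in> J)"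

lemma mcong_refl: "is_ideal J \<Longrightarrow> mcong J A A"
  by (simp add: mcong_def is_idealD)

lemma mcong_sym: "is_ideal J \<Longrightarrow> mcong J A B \<Longrightarrow> mcong J B A"
  unfolding mcong_def using is_idealD(5)[of J "A $$ (i, j) - B $$ (i, j)" for i j] by auto

lemma mcong_trans:
  assumes J: "is_ideal J" and "mcong J A B" "mcong J B C"
  shows "mcong J A C"
proof -
  have "A $$ (i, j) - C $$ (i, j) \<in> J" if "i < dim_row C" "j < dim_col C" for i j
    using is_idealD(2)[OF J, of "A $$ (i, j) - B $$ (i, j)" "B $$ (i, j) - C $$ (i, j)"] assms that
    by (simp add: mcong_def)
  thus ?thesis using assms by (simp add: mcong_def)
qed

lemma mcong_mult:
  assumes J: "is_ideal J" and "mcong J A A'" "mcong J B B'" "dim_col A' = dim_row B'"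
  shows "mcong J (A * B) (A' * B')"
proof -
  have "(A * B) $$ (i, j) - (A' * B') $$ (i, j) \<in> J" if ij: "i < dim_row A'" "j < dim_col B'" for i j
  proof -
    have "(A * B) $$ (i, j) - (A' * B') $$ (i, j) =
        (\<Sum>k\<in>{0..<dim_row B'}. (A $$ (i, k) - A' $$ (i, k)) * B $$ (k, j) + A' $$ (i, k) * (B $$ (k, j) - B' $$ (k, j)))"
      using assms ij by (simp add: mcong_def scalar_prod_def algebra_simps flip: sum_subtractf)
    also have "\<dots> \<in> J"
      using assms ij by (intro is_ideal_sum[OF J] is_idealD(2)[OF J] is_idealD(3)[OF J] is_idealD(4)[OF J]) (auto simp: mcong_def)
    finally show ?thesis .
  qed
  thus ?thesis using assms by (simp add: mcong_def)
qed

lemma suslin_left_entry: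
  assumes "i \<le> m"
  shows "\<exists>p<2 ^ m. \<exists>q<2 ^ m. \<forall>v\<in>carrier_vec (m + 1). \<forall>w\<in>carrier_vec (m + 1). suslin m v w $$ (p, q) = (v $ i :: 'b::comm_ring_1)"
  using assms
proof (induction m arbitrary: i)
  case (Suc m)
  show ?case
  proof (cases i)
    case 0
    thus ?thesis by (auto simp: Let_def intro!: exI[of _ "0::nat"])
  next
    case (Suc i')
    then obtain p q where pq: "p < 2 ^ m" "q < 2 ^ m"
      "\<And>v w :: 'b vec. v \<in> carrier_vec (m + 1) \<Longrightarrow> w \<in> carrier_vec (m + 1) \<Longrightarrow> suslin m v w $$ (p, q) = v $ i'"
      using Suc.IH[of i'] Suc.prems by auto
    show ?thesis
      by (rule exI[of _ p], rule conjI, use pq(1) in simp, rule exI[of _ "2 ^ m + q"])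
        (use pq Suc Suc.prems in \<open>auto simp: Let_def vec_last_Suc\<close>)
  qed
qed auto

text \<open>A Suslin matrix of size 1 does not contain \<open>w\<close>, so the size is at least 2.
  The tail of \<open>w\<close> is read off from the lower left block, whose minus sign is the
  \<open>s\<close>.\<close>

lemma suslin_right_entry:
  assumes "i \<le> Suc m"
  shows "\<exists>p<2 ^ Suc m. \<exists>q<2 ^ Suc m. \<exists>s. s * s = 1 \<and>
    (\<forall>v\<in>carrier_vec (m + 2). \<forall>w\<in>carrier_vec (m + 2). suslin (Suc m) v w $$ (p, q) = s * (w $ i :: 'b::comm_ring_1))"
proof (cases i)
  case 0
  have "(2::nat) ^ m < 2 ^ Suc m" by simp
  thus ?thesis using 0 by (intro exI[of _ "2 ^ m"] conjI exI[of _ 1]) (auto simp: Let_def)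
next
  case (Suc i')
  then obtain p q where pq: "p < 2 ^ m" "q < 2 ^ m"
    "\<And>v w :: 'b vec. v \<in> carrier_vec (m + 1) \<Longrightarrow> w \<in> carrier_vec (m + 1) \<Longrightarrow> suslin m v w $$ (p, q) = v $ i'"
    using suslin_left_entry[of i' m, where 'b = 'b] assms by auto
  have "2 ^ m + q < 2 ^ Suc m" "p < 2 ^ Suc m" using pq by auto
  thus ?thesis using pq Suc assms
    by (intro exI[of _ "2 ^ m + q"] conjI exI[of _ p] exI[of _ "-1"]) (auto simp: Let_def vec_last_Suc)
qed

lemma suslin_cong_imp:
  assumes J: "is_ideal J" and c: "v \<in> carrier_vec (m + 2)" "w \<in> carrier_vec (m + 2)" "v' \<in> carrier_vec (m + 2)" "w' \<in> carrier_vec (m + 2)"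
    and S: "mcong J (suslin (Suc m) v w) (suslin (Suc m) v' w')" and i: "i \<le> Suc m"
  shows "v $ i - v' $ i \<in> J" "w $ i - w' $ i \<in> J"
proof -
  obtain p q where "p < 2 ^ Suc m" "q < 2 ^ Suc m"
    "\<And>v w :: 'a vec. v \<in> carrier_vec (m + 2) \<Longrightarrow> w \<in> carrier_vec (m + 2) \<Longrightarrow> suslin (Suc m) v w $$ (p, q) = v $ i"
    using suslin_left_entry[OF i, where 'b = 'a] by (auto simp del: suslin.simps)
  note pq = this(1,2) this(3)[OF c(1,2)] this(3)[OF c(3,4)]
  show "v $ i - v' $ i \<in> J" using S pq(1,2) unfolding mcong_def pq(3,4)[symmetric] suslin_dim by blast
  obtain p q s where pq: "p < 2 ^ Suc m" "q < 2 ^ Suc m" "s * s = 1"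
    "\<And>v w :: 'a vec. v \<in> carrier_vec (m + 2) \<Longrightarrow> w \<in> carrier_vec (m + 2) \<Longrightarrow> suslin (Suc m) v w $$ (p, q) = s * w $ i"
    using suslin_right_entry[OF i, where 'b = 'a] by blast
  have "s * w $ i - s * w' $ i \<in> J" using S pq(1,2) unfolding mcong_def pq(4)[OF c(1,2), symmetric] pq(4)[OF c(3,4), symmetric] suslin_dim by blast
  hence "s * (s * w $ i - s * w' $ i) \<in> J" by (rule is_idealD(3)[OF J])
  moreover have "s * (s * w $ i - s * w' $ i) = (s * s) * (w $ i - w' $ i)" by (simp add: algebra_simps)
  ultimately show "w $ i - w' $ i \<in> J" by (simp add: pq(3))
qed

lemma suslin_cong:
  assumes J: "is_ideal J" and c: "v \<in> carrier_vec (m + 1)" "w \<in> carrier_vec (m + 1)" "v' \<in> carrier_vec (m + 1)" "w' \<in> carrier_vec (m + 1)"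
    and "\<And>i. i \<le> m \<Longrightarrow> v $ i - v' $ i \<in> J" "\<And>i. i \<le> m \<Longrightarrow> w $ i - w' $ i \<in> J"
  shows "mcong J (suslin m v w) (suslin m v' w')"
  using assms(2-)
proof (induction m arbitrary: v w v' w')
  case (Suc m)
  have "mcong J (suslin m (vec_last v (Suc m)) (vec_last w (Suc m))) (suslin m (vec_last v' (Suc m)) (vec_last w' (Suc m)))"
    "mcong J (suslin m (vec_last w (Suc m)) (vec_last v (Suc m))) (suslin m (vec_last w' (Suc m)) (vec_last v' (Suc m)))"
    using Suc.prems by (auto intro!: Suc.IH simp: vec_last_Suc)
  moreover have "v $ 0 - v' $ 0 \<in> J" "w $ 0 - w' $ 0 \<in> J" using Suc.prems by auto
  moreover have "- a + b \<in> J" if "a - b \<in> J" for a b using is_idealD(5)[OF J that] by simp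
  ultimately show ?case by (auto simp: mcong_def Let_def is_idealD(1)[OF J])
qed (auto simp: mcong_def)

lemma mcong_four_block:
  assumes "mcong J (four_block_mat A B C D) (four_block_mat A' B' C' D')"
    "A \<in> carrier_mat n n" "B \<in> carrier_mat n n" "C \<in> carrier_mat n n" "D \<in> carrier_mat n n"
    "A' \<in> carrier_mat n n" "B' \<in> carrier_mat n n" "C' \<in> carrier_mat n n" "D' \<in> carrier_mat n n"
  shows "mcong J A A'" "mcong J B B'" "mcong J C C'" "mcong J D D'"
proof -
  have e: "four_block_mat A B C D $$ (i, j) - four_block_mat A' B' C' D' $$ (i, j) \<in> J" if "i < n + n" "j < n + n" for i j
    using assms that by (simp add: mcong_def)
  have "A $$ (i, j) - A' $$ (i, j) \<in> J" "B $$ (i, j) - B' $$ (i, j) \<in> J" "C $$ (i, j) - C' $$ (i, j) \<in> J"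
    "D $$ (i, j) - D' $$ (i, j) \<in> J" if "i < n" "j < n" for i j
    using e[of i j] e[of i "n + j"] e[of "n + i" j] e[of "n + i" "n + j"] that assms(2-) by simp_all
  thus "mcong J A A'" "mcong J B B'" "mcong J C C'" "mcong J D D'" using assms(2-) by (simp_all add: mcong_def)
qed

lemma scalar_four_block_mult:
  fixes A :: "'b::comm_ring_1 mat"
  assumes "A \<in> carrier_mat n n" "B \<in> carrier_mat n n" "C \<in> carrier_mat n n" "D \<in> carrier_mat n n"
  shows "four_block_mat (x \<cdot>\<^sub>m 1\<^sub>m n) A B (y \<cdot>\<^sub>m 1\<^sub>m n) * four_block_mat (a \<cdot>\<^sub>m 1\<^sub>m n) C D (b \<cdot>\<^sub>m 1\<^sub>m n) =
    four_block_mat ((x * a) \<cdot>\<^sub>m 1\<^sub>m n + A * D) (x \<cdot>\<^sub>m C + b \<cdot>\<^sub>m A) (a \<cdot>\<^sub>m B + y \<cdot>\<^sub>m D) (B * C + (y * b) \<cdot>\<^sub>m 1\<^sub>m n)"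
proof -
  have sI: "(x \<cdot>\<^sub>m 1\<^sub>m n) * M = x \<cdot>\<^sub>m M" "M * (x \<cdot>\<^sub>m 1\<^sub>m n) = x \<cdot>\<^sub>m M" if "M \<in> carrier_mat n n" for x and M :: "'b mat"
    using that by auto
  have "x \<cdot>\<^sub>m (a \<cdot>\<^sub>m 1\<^sub>m n) = (x * a) \<cdot>\<^sub>m (1\<^sub>m n :: 'b mat)" for x a by (intro eq_matI) (auto simp: mult.assoc)
  thus ?thesis using assms
    by (subst mult_four_block_mat[of _ n n _ n _ n _ _ n _ n]) (auto intro!: cong_four_block_mat simp: sI)
qed

declare suslin.simps(2) [simp del]

text \<open>Here \<open>(v, w) \<mapsto> (F v w, G v w)\<close> is induced by right multiplication with the Suslin matrix of \<open>(k, l)\<close>.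
  At \<open>(e\<^sub>0, 0)\<close> the lower left block of the product vanishes, which forces its upper right block, the Suslin
  matrix of the tails of \<open>k\<close> and \<open>l\<close>, to vanish too.\<close>

lemma suslin_multiplier:
  fixes k l :: "'b::comm_ring_1 vec"
  assumes J: "is_ideal J" and r: "r = Suc (Suc m)" and c: "k \<in> carrier_vec (r + 1)" "l \<in> carrier_vec (r + 1)" and kl: "k \<bullet> l = 1"
    and F: "\<And>v w. v \<in> carrier_vec (r + 1) \<Longrightarrow> w \<in> carrier_vec (r + 1) \<Longrightarrow>
      F v w \<in> carrier_vec (r + 1) \<and> G v w \<in> carrier_vec (r + 1) \<and> mcong J (suslin r (F v w) (G v w)) (suslin r v w * suslin r k l)"
  shows "k $ 0 * k $ 0 - 1 \<in> J"
    "\<And>v w i. v \<in> carrier_vec (r + 1) \<Longrightarrow> w \<in> carrier_vec (r + 1) \<Longrightarrow> i \<le> r \<Longrightarrow> F v w $ i - k $ 0 * v $ i \<in> J \<and> G v w $ i - k $ 0 * w $ i \<in> J"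
proof -
  define N :: nat where "N = 2 ^ Suc m"
  define t where "t = (\<lambda>v :: 'b vec. vec_last v (Suc (Suc m)))"
  let ?S = "suslin (Suc m)" and ?I = "1\<^sub>m N :: 'b mat" and ?a = "k $ 0" and ?b = "l $ 0"
  have tc [simp]: "t v \<in> carrier_vec (m + 2)" "t v \<in> carrier_vec (Suc m + 1)" "t v \<in> carrier_vec (Suc (Suc m))" for v by (simp_all add: t_def)
  have ti: "t v $ i = v $ Suc i" if "v \<in> carrier_vec (r + 1)" "i \<le> Suc m" for v i using that r by (simp add: t_def vec_last_Suc)
  have Sc [simp]: "?S v w \<in> carrier_mat N N" for v w :: "'b vec" unfolding N_def by (rule suslin_carrier)
  have Sd [simp]: "dim_row (?S v w) = N" "dim_col (?S v w) = N" for v w :: "'b vec" unfolding N_def by (rule suslin_dim)+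
  have S: "suslin r v w = four_block_mat (v $ 0 \<cdot>\<^sub>m ?I) (?S (t v) (t w)) (- (?S (t w) (t v))\<^sup>T) (w $ 0 \<cdot>\<^sub>m ?I)" for v w
    unfolding r suslin.simps(2)[of "Suc m"] by (simp only: Let_def t_def N_def)
  have zero: "?S (0\<^sub>v (m + 2)) (0\<^sub>v (m + 2)) = (0\<^sub>m N N :: 'b mat)" using suslin_zero[of "Suc m", where 'b = 'b] by (simp add: N_def)
  have sc: "mcong J (x \<cdot>\<^sub>m ?I) (y \<cdot>\<^sub>m ?I) \<Longrightarrow> x - y \<in> J" for x y
    by (drule mcong_def[THEN iffD1]) (auto simp: N_def dest!: spec[of _ 0])
  have vanish: "t v $ i \<in> J" "t w $ i \<in> J" if "mcong J (?S (t v) (t w)) (0\<^sub>m N N)" "i \<le> Suc m" for v w i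
    using suslin_cong_imp[OF J tc(1) tc(1) _ _ that(1)[folded zero] that(2)] that(2) by simp_all
  have "k $ Suc i \<in> J \<and> l $ Suc i \<in> J" if "i \<le> Suc m" for i
  proof -
    let ?e = "unit_vec (r + 1) 0 :: 'b vec" and ?o = "0\<^sub>v (r + 1) :: 'b vec"
    have e: "?e \<in> carrier_vec (r + 1)" "?o \<in> carrier_vec (r + 1)" by auto
    have e0: "?e $ 0 = 1" "?o $ 0 = 0" by auto
    have e_mult: "four_block_mat (1 \<cdot>\<^sub>m ?I) (0\<^sub>m N N) (- (0\<^sub>m N N)\<^sup>T) (0 \<cdot>\<^sub>m ?I) * four_block_mat (a \<cdot>\<^sub>m ?I) X (- Y\<^sup>T) (b \<cdot>\<^sub>m ?I) =
        four_block_mat (a \<cdot>\<^sub>m ?I) X (0\<^sub>m N N) (0\<^sub>m N N)"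
      if "X \<in> carrier_mat N N" "Y \<in> carrier_mat N N" for X Y a b
      using that by (subst scalar_four_block_mult) (auto intro!: cong_four_block_mat eq_matI)
    have te: "t ?e = 0\<^sub>v (m + 2)" "t ?o = 0\<^sub>v (m + 2)" using r by (auto simp: t_def vec_last_Suc)
    have "suslin r ?e ?o * suslin r k l = four_block_mat (?a \<cdot>\<^sub>m ?I) (?S (t k) (t l)) (0\<^sub>m N N) (0\<^sub>m N N)"
      unfolding S te zero e0 by (rule e_mult[OF Sc Sc])
    hence "mcong J (suslin r (F ?e ?o) (G ?e ?o)) (four_block_mat (?a \<cdot>\<^sub>m ?I) (?S (t k) (t l)) (0\<^sub>m N N) (0\<^sub>m N N))"
      using F[OF e] by simp
    note bl = mcong_four_block[OF this[unfolded S[of "F ?e ?o"]], of N]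
    have "mcong J (- (?S (t (G ?e ?o)) (t (F ?e ?o)))\<^sup>T) (0\<^sub>m N N)" by (rule bl) auto
    hence 0: "mcong J (?S (t (G ?e ?o)) (t (F ?e ?o))) (0\<^sub>m N N)"
      using is_idealD(5)[OF J] by (fastforce simp: mcong_def)
    note v = vanish[OF 0]
    have "mcong J (?S (t (F ?e ?o)) (t (G ?e ?o))) (?S (0\<^sub>v (m + 2)) (0\<^sub>v (m + 2)))"
      using v by (intro suslin_cong[OF J]) (auto)
    moreover have "mcong J (?S (t (F ?e ?o)) (t (G ?e ?o))) (?S (t k) (t l))" by (rule bl) auto
    ultimately have "mcong J (?S (t k) (t l)) (0\<^sub>m N N)" unfolding zero using mcong_trans[OF J] mcong_sym[OF J] by blast
    from vanish[OF this that] show ?thesis using ti c that by simp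
  qed
  hence k0: "mcong J (?S (t k) (t l)) (0\<^sub>m N N)" "mcong J (?S (t l) (t k)) (0\<^sub>m N N)"
    and kt: "\<And>i. i \<le> Suc m \<Longrightarrow> k $ Suc i \<in> J \<and> l $ Suc i \<in> J"
    unfolding zero[symmetric] using c ti by (auto intro!: suslin_cong[OF J])
  have "mcong J (suslin r k l) (four_block_mat (?a \<cdot>\<^sub>m ?I) (0\<^sub>m N N) (0\<^sub>m N N) (?b \<cdot>\<^sub>m ?I))"
    unfolding S using k0 is_idealD(1,5)[OF J] by (auto simp: mcong_def)
  hence F': "mcong J (suslin r (F v w) (G v w)) (four_block_mat ((?a * v $ 0) \<cdot>\<^sub>m ?I) (?b \<cdot>\<^sub>m ?S (t v) (t w))
      (- (?a \<cdot>\<^sub>m ?S (t w) (t v))\<^sup>T) ((?b * w $ 0) \<cdot>\<^sub>m ?I))" if vw: "v \<in> carrier_vec (r + 1)" "w \<in> carrier_vec (r + 1)" for v w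
  proof -
    let ?D = "four_block_mat (?a \<cdot>\<^sub>m ?I) (0\<^sub>m N N) (0\<^sub>m N N) (?b \<cdot>\<^sub>m ?I)"
    assume D: "mcong J (suslin r k l) ?D"
    have d_mult: "four_block_mat (x \<cdot>\<^sub>m ?I) X (- Y\<^sup>T) (y \<cdot>\<^sub>m ?I) * four_block_mat (a \<cdot>\<^sub>m ?I) (0\<^sub>m N N) (0\<^sub>m N N) (b \<cdot>\<^sub>m ?I) =
        four_block_mat ((a * x) \<cdot>\<^sub>m ?I) (b \<cdot>\<^sub>m X) (- (a \<cdot>\<^sub>m Y)\<^sup>T) ((b * y) \<cdot>\<^sub>m ?I)"
      if "X \<in> carrier_mat N N" "Y \<in> carrier_mat N N" for X Y a b x y
      using that by (subst scalar_four_block_mult) (auto intro!: cong_four_block_mat eq_matI simp: mult.commute)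
    have "mcong J (suslin r v w * suslin r k l) (suslin r v w * ?D)"
      using D by (intro mcong_mult[OF J mcong_refl[OF J]]) (auto simp: N_def r)
    moreover have "suslin r v w * ?D = four_block_mat ((?a * v $ 0) \<cdot>\<^sub>m ?I) (?b \<cdot>\<^sub>m ?S (t v) (t w))
      (- (?a \<cdot>\<^sub>m ?S (t w) (t v))\<^sup>T) ((?b * w $ 0) \<cdot>\<^sub>m ?I)"
      unfolding S by (rule d_mult[OF Sc Sc])
    moreover have "mcong J (suslin r (F v w) (G v w)) (suslin r v w * suslin r k l)" using F[OF vw] by blast
    ultimately show ?thesis using mcong_trans[OF J] by metis
  qed
  have res: "F v w $ 0 - ?a * v $ 0 \<in> J \<and> G v w $ 0 - ?b * w $ 0 \<in> J \<and>
      (\<forall>i\<le>Suc m. F v w $ Suc i - ?b * v $ Suc i \<in> J \<and> G v w $ Suc i - ?b * w $ Suc i \<in> J \<and>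
        F v w $ Suc i - ?a * v $ Suc i \<in> J \<and> G v w $ Suc i - ?a * w $ Suc i \<in> J)"
    if vw: "v \<in> carrier_vec (r + 1)" "w \<in> carrier_vec (r + 1)" for v w
  proof -
    have FG: "F v w \<in> carrier_vec (r + 1)" "G v w \<in> carrier_vec (r + 1)" using F[OF vw] by auto
    note bl = mcong_four_block[OF F'[OF vw, unfolded S[of "F v w"]], of N]
    have 1: "mcong J (F v w $ 0 \<cdot>\<^sub>m ?I) ((?a * v $ 0) \<cdot>\<^sub>m ?I)" "mcong J (G v w $ 0 \<cdot>\<^sub>m ?I) ((?b * w $ 0) \<cdot>\<^sub>m ?I)"
      by (rule bl; simp)+
    have 2: "mcong J (?S (t (F v w)) (t (G v w))) (?S (?b \<cdot>\<^sub>v t v) (?b \<cdot>\<^sub>v t w))"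
      unfolding suslin_smult[of "t v" "Suc m" "t w" ?b, OF tc(2) tc(2)] by (rule bl; simp)
    have "mcong J (- (?S (t (G v w)) (t (F v w)))\<^sup>T) (- (?S (?a \<cdot>\<^sub>v t w) (?a \<cdot>\<^sub>v t v))\<^sup>T)"
      unfolding suslin_smult[of "t w" "Suc m" "t v" ?a, OF tc(2) tc(2)] by (rule bl; simp)
    hence 3: "mcong J (?S (t (G v w)) (t (F v w))) (?S (?a \<cdot>\<^sub>v t w) (?a \<cdot>\<^sub>v t v))"
      using is_idealD(5)[OF J] by (fastforce simp: mcong_def)
    note e2 = suslin_cong_imp[OF J tc(1) tc(1) _ _ 2]
    note e3 = suslin_cong_imp[OF J tc(1) tc(1) _ _ 3]
    have "F v w $ Suc i - ?b * v $ Suc i \<in> J \<and> G v w $ Suc i - ?b * w $ Suc i \<in> J \<and>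
        F v w $ Suc i - ?a * v $ Suc i \<in> J \<and> G v w $ Suc i - ?a * w $ Suc i \<in> J" if i: "i \<le> Suc m" for i
    proof -
      have sm: "(x \<cdot>\<^sub>v t u) $ i = x * u $ Suc i" if "u \<in> carrier_vec (r + 1)" for x u
        using ti[OF that i] i index_smult_vec(1)[of i "t u" x] by (simp add: t_def)
      show ?thesis using e2[OF _ _ i] e3[OF _ _ i] by (simp add: ti[OF FG(1) i] ti[OF FG(2) i] sm[OF vw(1)] sm[OF vw(2)])
    qed
    thus ?thesis using sc[OF 1(1)] sc[OF 1(2)] by blast
  qed
  \<comment> \<open>The upper right block multiplies the tails by l_0 and the lower left block by
    k_0. Comparing both at the basis vector of index 1 gives k_0 = l_0 modulo
    \<open>J\<close>.\<close>
  have ab: "?a - ?b \<in> J"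
  proof -
    let ?e = "unit_vec (r + 1) 1 :: 'b vec" and ?o = "0\<^sub>v (r + 1) :: 'b vec"
    have e: "?e \<in> carrier_vec (r + 1)" "?o \<in> carrier_vec (r + 1)" by auto
    have "F ?e ?o $ 1 - ?b * ?e $ 1 \<in> J" "F ?e ?o $ 1 - ?a * ?e $ 1 \<in> J" using res[OF e] by auto
    from is_idealD(6)[OF J this] show ?thesis using r by simp
  qed
  \<comment> \<open>The tails of \<open>k\<close> and \<open>l\<close> vanish modulo
    \<open>J\<close>, so k . l = 1 reduces to k_0 l_0 = 1, which together with k_0 = l_0 makes the
    scalar square to 1.\<close>
  have "(\<Sum>i\<le>Suc m. k $ Suc i * l $ Suc i) \<in> J" using kt by (intro is_ideal_sum[OF J] is_idealD(3)[OF J]) auto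
  moreover have "k \<bullet> l = ?a * ?b + (\<Sum>i\<le>Suc m. k $ Suc i * l $ Suc i)"
  proof -
    have "k \<bullet> l = (\<Sum>i\<in>{0..<Suc (Suc (Suc m))}. k $ i * l $ i)" using c r by (simp add: scalar_prod_def del: sum.op_ivl_Suc)
    also have "\<dots> = ?a * ?b + (\<Sum>i\<in>{0..<Suc (Suc m)}. k $ Suc i * l $ Suc i)" by (simp add: sum.atLeast0_lessThan_Suc_shift del: sum.op_ivl_Suc)
    also have "{0..<Suc (Suc m)} = {..Suc m}" by auto
    finally show ?thesis .
  qed
  ultimately have "1 - ?a * ?b \<in> J" using kl by (metis add_diff_cancel_left')
  moreover have "?a * (?a - ?b) \<in> J" using ab by (rule is_idealD(3)[OF J])
  ultimately have "?a * (?a - ?b) - (1 - ?a * ?b) \<in> J" by (rule is_idealD(6)[OF J, rotated])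
  thus "?a * ?a - 1 \<in> J" by (simp add: algebra_simps)
  fix v w :: "'b vec" and i assume vw: "v \<in> carrier_vec (r + 1)" "w \<in> carrier_vec (r + 1)" and i: "i \<le> r"
  show "F v w $ i - ?a * v $ i \<in> J \<and> G v w $ i - ?a * w $ i \<in> J"
  proof (cases i)
    case 0
    have "(?a - ?b) * w $ 0 \<in> J" using ab by (rule is_idealD(4)[OF J])
    from is_idealD(6)[OF J _ this] have "G v w $ 0 - ?b * w $ 0 - (?a - ?b) * w $ 0 \<in> J" using res[OF vw] by blast
    thus ?thesis using 0 res[OF vw] by (simp add: algebra_simps)
  next
    case (Suc i')
    thus ?thesis using res[OF vw] i r by auto
  qed
qed

section \<open>From matrices congruent to 1 to their action on vectors\<close>

context suslin_rank
begin

interpretation cl: clifford smr UNIV "zc r" "Suc r"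
  using zc_clifford[OF r_ge_2] by simp

lemma Vec_eq_Cl:
  assumes "u \<in> cl.Vec UNIV"
  shows "\<exists>v\<in>carrier_vec (r + 1). \<exists>w\<in>carrier_vec (r + 1). u = Cl r v w"
proof -
  obtain a where "u = cl.vec a" using assms by (auto simp: cl.Vec_def)
  thus ?thesis using clifford_vec_eq[OF r_ge_2, of a] by (intro bexI) auto
qed

lemma bdiag_Cmat_bdiag:
  assumes "g \<in> carrier_mat (2 ^ r) (2 ^ r)" "h \<in> carrier_mat (2 ^ r) (2 ^ r)"
    "g' \<in> carrier_mat (2 ^ r) (2 ^ r)" "h' \<in> carrier_mat (2 ^ r) (2 ^ r)"
  shows "bdiag r g h * Cmat r v w * bdiag r g' h' =
    four_block_mat (0\<^sub>m (2 ^ r) (2 ^ r)) (g * suslin r v w * h') (h * sbar r v w * g') (0\<^sub>m (2 ^ r) (2 ^ r))"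
proof -
  have M: "bdiag r g h * Cmat r v w = four_block_mat (0\<^sub>m (2 ^ r) (2 ^ r)) (g * suslin r v w) (h * sbar r v w) (0\<^sub>m (2 ^ r) (2 ^ r))"
    unfolding bdiag_def Cmat_def using assms
    by (subst mult_four_block_mat[of _ "2 ^ r" "2 ^ r" _ "2 ^ r" _ "2 ^ r" _ _ "2 ^ r" _ "2 ^ r"]) (auto intro!: cong_four_block_mat)
  moreover have "g * suslin r v w \<in> carrier_mat (2 ^ r) (2 ^ r)" "h * sbar r v w \<in> carrier_mat (2 ^ r) (2 ^ r)"
    using assms by (auto intro!: mult_carrier_mat)
  ultimately show ?thesis unfolding bdiag_def using assms
    by (subst M[unfolded bdiag_def], subst mult_four_block_mat[of _ "2 ^ r" "2 ^ r" _ "2 ^ r" _ "2 ^ r" _ _ "2 ^ r" _ "2 ^ r"])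
      (auto intro!: cong_four_block_mat)
qed

text \<open>This is the upper right block of the conjugated vector; h' is the half-spin component of
  W' other than g', the same for all vectors.\<close>

lemma lft_conj_Cl:
  assumes "lft r g W" "lft r g' W'" "W * W' = 1" "W' * W = 1"
  shows "\<exists>h'\<in>carrier_mat (2 ^ r) (2 ^ r). \<forall>v w v' w'. W * Cl r v w * W' = Cl r v' w' \<longrightarrow> g * suslin r v w * h' = suslin r v' w'"
proof -
  obtain h h' where h: "h \<in> carrier_mat (2 ^ r) (2 ^ r)" "W = iota (2 * 2 ^ r) (bdiag r g h)"
    "h' \<in> carrier_mat (2 ^ r) (2 ^ r)" "W' = iota (2 * 2 ^ r) (bdiag r g' h')"
    using assms by (auto simp: lft_def)
  note g = lft_carrier[OF assms(1)] lft_carrier[OF assms(2)]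
  have "g * suslin r v w * h' = suslin r v' w'" if e: "W * Cl r v w * W' = Cl r v' w'" for v w v' w'
  proof -
    have pos: "0 < 2 * (2::nat) ^ r" by simp
    have b: "bdiag r g h \<in> carrier_mat (2 * 2 ^ r) (2 * 2 ^ r)" "bdiag r g' h' \<in> carrier_mat (2 * 2 ^ r) (2 * 2 ^ r)"
      using g h by (auto intro: bdiag_carrier)
    have bc: "bdiag r g h * Cmat r v w \<in> carrier_mat (2 * 2 ^ r) (2 * 2 ^ r)" using b by (rule_tac mult_carrier_mat) auto
    have "iota (2 * 2 ^ r) (bdiag r g h * Cmat r v w * bdiag r g' h') = iota (2 * 2 ^ r) (Cmat r v' w')"
      unfolding iota_mult[OF pos bc b(2)] iota_mult[OF pos b(1) Cmat_carrier] h(2,4)[symmetric] using e by (simp only: Cl_def)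
    hence M: "bdiag r g h * Cmat r v w * bdiag r g' h' = Cmat r v' w'"
      by (rule iota_inj[OF pos mult_carrier_mat[OF bc b(2)] Cmat_carrier])
    show ?thesis
    proof (rule eq_matI)
      fix i j assume "i < dim_row (suslin r v' w')" "j < dim_col (suslin r v' w')"
      hence ij: "i < 2 ^ r" "j < 2 ^ r" by auto
      have "(bdiag r g h * Cmat r v w * bdiag r g' h') $$ (i, 2 ^ r + j) = Cmat r v' w' $$ (i, 2 ^ r + j)" by (simp only: M)
      thus "(g * suslin r v w * h') $$ (i, j) = suslin r v' w' $$ (i, j)"
        unfolding bdiag_Cmat_bdiag[OF g(1) h(1) g(2) h(3)] unfolding Cmat_def using ij g h by simp
    qed (use g h in auto)
  qed
  thus ?thesis using h(3) by blast
qed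

text \<open>The congruence restricts only one half-spin component, so the action need not be trivial
  modulo \<open>J\<close>. Let (k, l) be the image of h_0, whose own Suslin matrix is 1. Then g h' =
  S(k, l), so the other component h' of the inverse is congruent to S(k, l), and modulo
  \<open>J\<close> conjugation is right multiplication of Suslin matrices by S(k, l). By
  \<open>suslin_multiplier\<close> this is scaling by c = k_0.\<close>

lemma congruent_acts_by_scalar:
  fixes J :: "'b::comm_ring_1 set"
  assumes J: "is_ideal J" and W: "cl.orth W W'" "lft r g W" "lft r g' W'"
    and g: "mcong J g (1\<^sub>m (2 ^ r))" "g' * g = 1\<^sub>m (2 ^ r)"
  shows "\<exists>c. c * c - 1 \<in> J \<and> (\<forall>k\<in>cl.K. W * zc r k * W' - smr c (zc r k) \<in> cl.Vec J)"
proof -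
  have inv: "W * W' = 1" "W' * W = 1" using W(1) by (auto simp: cl.orth_def)
  obtain h' where h': "h' \<in> carrier_mat (2 ^ r) (2 ^ r)"
    "\<And>v w v' w'. W * Cl r v w * W' = Cl r v' w' \<Longrightarrow> g * suslin r v w * h' = suslin r v' w'"
    using lft_conj_Cl[OF W(2,3) inv] by blast
  have "W * Cl r v w * W' \<in> cl.Vec UNIV" if "v \<in> carrier_vec (r + 1)" "w \<in> carrier_vec (r + 1)" for v w
    using W(1) by (intro cl.conj_Vec[OF _ cl.idl_D Cl_in_Vec[OF that]]) (simp add: cl.orth_def)
  hence "\<forall>v\<in>carrier_vec (r + 1). \<forall>w\<in>carrier_vec (r + 1). \<exists>p. fst p \<in> carrier_vec (r + 1) \<and> snd p \<in> carrier_vec (r + 1) \<and>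
      W * Cl r v w * W' = Cl r (fst p) (snd p)"
    using Vec_eq_Cl by (metis fst_conv snd_conv)
  then obtain P where P: "\<And>v w. v \<in> carrier_vec (r + 1) \<Longrightarrow> w \<in> carrier_vec (r + 1) \<Longrightarrow>
      fst (P v w) \<in> carrier_vec (r + 1) \<and> snd (P v w) \<in> carrier_vec (r + 1) \<and> W * Cl r v w * W' = Cl r (fst (P v w)) (snd (P v w))"
    by metis
  let ?e = "unit_vec (r + 1) 0 :: 'b vec"
  define k l where "k = fst (P ?e ?e)" and "l = snd (P ?e ?e)"
  have kl: "k \<in> carrier_vec (r + 1)" "l \<in> carrier_vec (r + 1)" "W * Cl r ?e ?e * W' = Cl r k l"
    using P[of ?e ?e] by (auto simp: k_def l_def)
  have gc: "g \<in> carrier_mat (2 ^ r) (2 ^ r)" by (rule lft_carrier[OF W(2)])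
  have g1: "mcong J (g * A) A" if "A \<in> carrier_mat (2 ^ r) (2 ^ r)" for A
    using mcong_mult[OF J g(1) mcong_refl[OF J], of A] that by simp
  have "suslin r k l = g * h'" using h'(2)[OF kl(3)] gc unfolding suslin_unit by simp
  hence h'k: "mcong J h' (suslin r k l)" using mcong_sym[OF J g1[OF h'(1)]] by simp
  have "Cl r k l * Cl r k l = W * (Cl r ?e ?e * (W' * W) * Cl r ?e ?e) * W'" unfolding kl(3)[symmetric] by (simp only: mult.assoc)
  also have "\<dots> = 1" by (simp add: inv Cl_square)
  finally have "smr (k \<bullet> l) 1 = (1 :: 'b rfm)" unfolding Cl_square[OF kl(1,2)] .
  hence "ent (smr (k \<bullet> l) 1) 0 0 = ent (1 :: 'b rfm) 0 0" by simp
  hence kl1: "k \<bullet> l = 1" by (simp add: ent_1)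
  have cong: "mcong J (suslin r (fst (P v w)) (snd (P v w))) (suslin r v w * suslin r k l)"
    if vw: "v \<in> carrier_vec (r + 1)" "w \<in> carrier_vec (r + 1)" for v w
  proof -
    have "suslin r (fst (P v w)) (snd (P v w)) = g * suslin r v w * h'" using h'(2) P[OF vw] by metis
    moreover have "mcong J (g * suslin r v w * h') (suslin r v w * suslin r k l)"
      by (rule mcong_mult[OF J g1[OF suslin_carrier] h'k]) simp
    ultimately show ?thesis by simp
  qed
  obtain m where m: "r = Suc (Suc m)" using r_ge_2 by (metis add_2_eq_Suc le_Suc_ex)
  note sm = suslin_multiplier[OF J m kl(1,2) kl1, of "\<lambda>v w. fst (P v w)" "\<lambda>v w. snd (P v w)"]
  have c1: "k $ 0 * k $ 0 - 1 \<in> J" using P cong by (intro sm) auto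
  have c2: "fst (P v w) $ i - k $ 0 * v $ i \<in> J \<and> snd (P v w) $ i - k $ 0 * w $ i \<in> J"
    if "v \<in> carrier_vec (r + 1)" "w \<in> carrier_vec (r + 1)" "i \<le> r" for v w i
    using P cong that by (intro sm(2)) auto
  have V: "W * Cl r v w * W' - smr (k $ 0) (Cl r v w) \<in> cl.Vec J"
    if vw: "v \<in> carrier_vec (r + 1)" "w \<in> carrier_vec (r + 1)" for v w
  proof -
    have p: "fst (P v w) \<in> carrier_vec (r + 1)" "snd (P v w) \<in> carrier_vec (r + 1)" using P[OF vw] by auto
    have "Cl r (fst (P v w) + (- k $ 0) \<cdot>\<^sub>v v) (snd (P v w) + (- k $ 0) \<cdot>\<^sub>v w) \<in> cl.Vec J"
      using c2[OF vw] vw p by (intro Cl_in_Vec_ideal) auto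
    moreover have "Cl r (fst (P v w) + (- k $ 0) \<cdot>\<^sub>v v) (snd (P v w) + (- k $ 0) \<cdot>\<^sub>v w) = W * Cl r v w * W' + smr (- k $ 0) (Cl r v w)"
      using P[OF vw] vw p by (subst Cl_add) (simp_all only: Cl_smult smult_carrier_vec)
    ultimately show ?thesis by simp
  qed
  have "W * zc r i * W' - smr (k $ 0) (zc r i) \<in> cl.Vec J" for i
    unfolding zc_def[of r i] by (cases "snd i") (simp_all only: if_True if_False; rule V; simp)+
  with c1 show ?thesis by blast
qed

text \<open>The coefficient of X^i in c^2 is 2 c_0 c_i plus products of coefficients of degree
  strictly between 0 and i. The latter lie in \<open>I\<close> by induction, and 2 and c_0 are
  invertible modulo \<open>I\<close>, since c_0^2 is congruent to 1.\<close>

lemma square_constant_mod: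
  fixes c :: "'a::comm_ring_1 poly"
  assumes I: "is_ideal I" and two: "(2::'a) dvd 1" and c: "c * c - 1 \<in> poly_ideal I" and i: "i \<noteq> 0"
  shows "coeff c i \<in> I"
  using i
proof (induction i rule: less_induct)
  case (less i)
  obtain d :: 'a where d: "2 * d = 1" using two by (metis dvd_def)
  have 0: "coeff c 0 * coeff c 0 - 1 \<in> I" using c by (auto simp: poly_ideal_def coeff_mult dest!: spec[of _ 0])
  obtain j where j: "i = Suc j" using less.prems by (cases i) auto
  define S where "S = (\<Sum>n<j. coeff c (Suc n) * coeff c (i - Suc n))"
  have "coeff (c * c - 1) i = (\<Sum>n\<le>i. coeff c n * coeff c (i - n))" using less.prems by (simp add: coeff_mult)
  also have "\<dots> = 2 * (coeff c 0 * coeff c i) + S"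
    unfolding S_def j sum.atMost_Suc by (subst sum.atMost_shift) (simp add: algebra_simps)
  finally have e: "coeff (c * c - 1) i - S = 2 * (coeff c 0 * coeff c i)" by simp
  have "S \<in> I" unfolding S_def using less.IH j by (intro is_ideal_sum[OF I] is_idealD(4)[OF I]) auto
  hence "coeff (c * c - 1) i - S \<in> I" using c by (intro is_idealD(6)[OF I]) (simp_all add: poly_ideal_def)
  hence "2 * (coeff c 0 * coeff c i) \<in> I" by (simp only: e)
  hence "d * coeff c 0 * (2 * (coeff c 0 * coeff c i)) \<in> I" by (rule is_idealD(3)[OF I])
  moreover have "d * coeff c 0 * (2 * (coeff c 0 * coeff c i)) = (2 * d) * (coeff c 0 * coeff c 0 * coeff c i)" by (simp add: ac_simps)
  ultimately have "coeff c 0 * coeff c 0 * coeff c i \<in> I" by (simp add: d)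
  moreover have "(coeff c 0 * coeff c 0 - 1) * coeff c i \<in> I" using 0 by (rule is_idealD(4)[OF I])
  ultimately have "coeff c 0 * coeff c 0 * coeff c i - (coeff c 0 * coeff c 0 - 1) * coeff c i \<in> I" by (rule is_idealD(6)[OF I])
  thus ?case by (simp add: algebra_simps)
qed

lemma scalar_action_tame:
  fixes c :: "'a::comm_ring_1 poly"
  assumes I: "is_ideal I" and two: "(2::'a) dvd 1" and W: "cl.orth W W'"
    and c: "c * c - 1 \<in> poly_ideal I" "\<And>k. k \<in> cl.K \<Longrightarrow> W * zc r k * W' - smr c (zc r k) \<in> cl.Vec (poly_ideal I)"
  shows "tame I W W'"
  unfolding tame_def
proof (intro conjI ballI W)
  fix k assume k: "k \<in> cl.K"
  obtain a where a: "W * zc r k * W' - smr c (zc r k) = cl.vec a" "\<forall>l\<in>cl.K. a l \<in> poly_ideal I"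
    using c(2)[OF k] by (auto simp: cl.Vec_def)
  define f where "f = (\<lambda>l. a l + c * (if l = k then 1 else 0))"
  have "W * zc r k * W' = cl.vec a + smr c (cl.vec (\<lambda>l. if l = k then 1 else 0))"
    using a(1) unfolding cl.z_eq_vec[OF k, symmetric] by (simp add: diff_eq_eq)
  also have "\<dots> = cl.vec f" by (simp only: cl.vec_sm cl.vec_add f_def)
  finally have "W * zc r k * W' = cl.vec f" .
  moreover have "coeff (f l) i \<in> I" if "l \<in> cl.K" "i \<noteq> 0" for l i
    using a(2) that square_constant_mod[OF I two c(1) that(2)] by (auto simp: f_def poly_ideal_def intro: is_idealD(2)[OF I])
  ultimately show "\<exists>f. W * zc r k * W' = cl.vec f \<and> (\<forall>l\<in>cl.K. \<forall>i. i \<noteq> 0 \<longrightarrow> coeff (f l) i \<in> I)" by blast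
qed

end

subsection \<open>The groups generated by Suslin matrices\<close>

lemma GL_group: "group (GL n)"
  unfolding GL_def by (rule monoid.units_group) (rule monoid.intro; auto simp: ring_mat_simps)

lemma GL_simps [simp]: "x \<otimes>\<^bsub>GL n\<^esub> y = x * y" "\<one>\<^bsub>GL n\<^esub> = 1\<^sub>m n"
  by (simp_all add: GL_def units_of_def ring_mat_simps)

lemma GL_I: "A \<in> carrier_mat n n \<Longrightarrow> B \<in> carrier_mat n n \<Longrightarrow> A * B = 1\<^sub>m n \<Longrightarrow> B * A = 1\<^sub>m n \<Longrightarrow> A \<in> carrier (GL n)"
  unfolding GL_def units_of_carrier Units_def ring_mat_simps by auto

lemma GL_carrier: "A \<in> carrier (GL n) \<Longrightarrow> A \<in> carrier_mat n n"
  unfolding GL_def units_of_carrier Units_def ring_mat_simps by auto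

lemma GL_inv:
  assumes "A \<in> carrier_mat n n" "B \<in> carrier_mat n n" "A * B = 1\<^sub>m n" "B * A = 1\<^sub>m n"
  shows "inv\<^bsub>GL n\<^esub> A = B"
  using group.inv_equality[OF GL_group, of n B A] GL_I[OF assms] GL_I[OF assms(2,1,4,3)] assms by simp

lemma (in group) conj_generate:
  assumes H: "H \<subseteq> carrier G" and c: "c \<in> carrier G" and conj: "\<And>h. h \<in> H \<Longrightarrow> c \<otimes> h \<otimes> inv c \<in> H" and x: "x \<in> generate G H"
  shows "c \<otimes> x \<otimes> inv c \<in> generate G H"
  using x
proof (induction x rule: generate.induct)
  case one
  thus ?case using c generate.one by (metis r_inv r_one)
next
  case (incl h)
  thus ?case using conj by (blast intro: generate.incl)
next
  case (inv h)
  hence h: "h \<in> carrier G" using H by auto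
  have "c \<otimes> inv h \<otimes> inv c = inv (c \<otimes> h \<otimes> inv c)" using h c by (simp add: inv_mult_group m_assoc)
  thus ?case using generate.inv[OF conj[OF inv]] by simp
next
  case (eng h1 h2)
  hence h: "h1 \<in> carrier G" "h2 \<in> carrier G" using generate_in_carrier[OF H] by auto
  hence "c \<otimes> (h1 \<otimes> h2) \<otimes> inv c = c \<otimes> h1 \<otimes> inv c \<otimes> (c \<otimes> h2 \<otimes> inv c)"
    using c by (simp add: m_assoc) (simp add: c flip: m_assoc)
  thus ?case using generate.eng[OF eng.IH] by simp
qed

lemma (in group) quotient_comm_group:
  assumes N: "N \<lhd> G" and comm: "\<And>x y. x \<in> carrier G \<Longrightarrow> y \<in> carrier G \<Longrightarrow> x \<otimes> y \<otimes> inv x \<otimes> inv y \<in> N"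
  shows "comm_group (G Mod N)"
proof (rule group.group_comm_groupI[OF normal.factorgroup_is_group[OF N]])
  interpret N: normal N G by fact
  fix H K assume "H \<in> carrier (G Mod N)" "K \<in> carrier (G Mod N)"
  then obtain x y where x: "x \<in> carrier G" "H = N #> x" and y: "y \<in> carrier G" "K = N #> y"
    by (auto simp: FactGroup_def RCOSETS_def)
  have "x \<otimes> y = x \<otimes> y \<otimes> inv x \<otimes> inv y \<otimes> (y \<otimes> x)" using x y by (simp add: m_assoc) (simp flip: m_assoc)
  hence "N #> (x \<otimes> y) = N #> (x \<otimes> y \<otimes> inv x \<otimes> inv y \<otimes> (y \<otimes> x))" by simp
  also have "\<dots> = (N #> (x \<otimes> y \<otimes> inv x \<otimes> inv y)) #> (y \<otimes> x)" using x y N.subset by (simp add: coset_mult_assoc)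
  also have "N #> (x \<otimes> y \<otimes> inv x \<otimes> inv y) = N" using x y comm by (intro N.rcos_const) auto
  finally show "H \<otimes>\<^bsub>G Mod N\<^esub> K = K \<otimes>\<^bsub>G Mod N\<^esub> H" using x y by (simp add: FactGroup_def N.rcos_sum)
qed

lemma lft_add: "lft r g W \<Longrightarrow> lft r g' W' \<Longrightarrow> lft r (g + g') (W + W')"
  unfolding lft_def
proof (elim conjE bexE, intro conjI)
  fix h h' assume *: "g \<in> carrier_mat (2 ^ r) (2 ^ r)" "g' \<in> carrier_mat (2 ^ r) (2 ^ r)"
    "h \<in> carrier_mat (2 ^ r) (2 ^ r)" "W = iota (2 * 2 ^ r) (bdiag r g h)"
    "h' \<in> carrier_mat (2 ^ r) (2 ^ r)" "W' = iota (2 * 2 ^ r) (bdiag r g' h')"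
  have "bdiag r g h + bdiag r g' h' = bdiag r (g + g') (h + h')"
    unfolding bdiag_def using * by (intro eq_matI) auto
  hence "W + W' = iota (2 * 2 ^ r) (bdiag r (g + g') (h + h'))"
    using iota_add[of "2 * 2 ^ r", OF _ bdiag_carrier[OF *(1,3)] bdiag_carrier[OF *(2,5)]] by (simp add: *(4,6))
  thus "\<exists>h\<in>carrier_mat (2 ^ r) (2 ^ r). W + W' = iota (2 * 2 ^ r) (bdiag r (g + g') h)"
    using *(3,5) by (intro bexI[of _ "h + h'"]) auto
qed auto

text \<open>As v_0 = w_0 = 0, the diagonal blocks of the Suslin matrix are identities, and each
  triangular part keeps one off-diagonal block. The matrices of (e_0, 0) and (0, e_0) are diagonal
  idempotents selecting these blocks; in the Clifford algebra the two parts belong to 1 + u e_0 and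
  1 + u f_0, where u is the vector of (v, w).\<close>

lemma triangular_suslin:
  fixes v w :: "'b::comm_ring_1 vec"
  assumes r: "r \<ge> 1" and v: "v \<in> carrier_vec (r + 1)" "v $ 0 = 0" and w: "w \<in> carrier_vec (r + 1)" "w $ 0 = 0"
  shows "mat_top (suslin r (unit_vec (r + 1) 0 + v) (unit_vec (r + 1) 0 + w)) =
      1\<^sub>m (2 ^ r) + suslin r v w * sbar r (unit_vec (r + 1) 0) (0\<^sub>v (r + 1))" (is ?top)
    "mat_bot (suslin r (unit_vec (r + 1) 0 + v) (unit_vec (r + 1) 0 + w)) =
      1\<^sub>m (2 ^ r) + suslin r v w * sbar r (0\<^sub>v (r + 1)) (unit_vec (r + 1) 0)" (is ?bot)
proof -
  obtain m where m: "r = Suc m" using r by (cases r) auto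
  define N :: nat where "N = 2 ^ m"
  define A where "A = suslin m (vec_last v (Suc m)) (vec_last w (Suc m))"
  define B where "B = - sbar m (vec_last v (Suc m)) (vec_last w (Suc m))"
  let ?I = "1\<^sub>m N :: 'b mat" and ?e = "unit_vec (r + 1) 0 :: 'b vec" and ?o = "0\<^sub>v (r + 1) :: 'b vec"
  have c: "A \<in> carrier_mat N N" "B \<in> carrier_mat N N" by (simp_all add: A_def B_def N_def)
  have S: "suslin r x y = four_block_mat (x $ 0 \<cdot>\<^sub>m ?I) (suslin m (vec_last x (Suc m)) (vec_last y (Suc m)))
      (- sbar m (vec_last x (Suc m)) (vec_last y (Suc m))) (y $ 0 \<cdot>\<^sub>m ?I)" for x y
    by (simp only: m suslin.simps(2) Let_def N_def)
  have l: "vec_last (?e + x) (Suc m) = vec_last x (Suc m)" if "x \<in> carrier_vec (r + 1)" for x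
    using that m by (intro eq_vecI) (auto simp: vec_last_Suc)
  have e: "vec_last ?e (Suc m) = 0\<^sub>v (m + 1)" "vec_last ?o (Suc m) = 0\<^sub>v (m + 1)"
    using m by (auto simp: vec_last_Suc)
  have zero: "suslin m (0\<^sub>v (m + 1)) (0\<^sub>v (m + 1)) = (0\<^sub>m N N :: 'b mat)" unfolding N_def by (rule suslin_zero)
  have ev: "(?e + v) $ 0 = 1" "(?e + w) $ 0 = 1" using v w by auto
  have e0: "?e $ 0 = 1" "?o $ 0 = 0" by auto
  have 1: "suslin r (?e + v) (?e + w) = four_block_mat (1 \<cdot>\<^sub>m ?I) A B (1 \<cdot>\<^sub>m ?I)"
    unfolding S l[OF v(1)] l[OF w(1)] ev A_def B_def ..
  have 2: "suslin r v w = four_block_mat (0 \<cdot>\<^sub>m ?I) A B (0 \<cdot>\<^sub>m ?I)"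
    unfolding S v(2) w(2) A_def B_def ..
  have "suslin r ?o ?e = four_block_mat (0 \<cdot>\<^sub>m ?I) (0\<^sub>m N N) (0\<^sub>m N N) (1 \<cdot>\<^sub>m ?I)"
    "suslin r ?e ?o = four_block_mat (1 \<cdot>\<^sub>m ?I) (0\<^sub>m N N) (0\<^sub>m N N) (0 \<cdot>\<^sub>m ?I)"
    unfolding S e zero e0 by (intro eq_matI; auto)+
  hence 3: "sbar r ?e ?o = four_block_mat (0 \<cdot>\<^sub>m ?I) (0\<^sub>m N N) (0\<^sub>m N N) (1 \<cdot>\<^sub>m ?I)"
    "sbar r ?o ?e = four_block_mat (1 \<cdot>\<^sub>m ?I) (0\<^sub>m N N) (0\<^sub>m N N) (0 \<cdot>\<^sub>m ?I)"
    by (auto intro!: eq_matI)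
  have N2: "2 ^ r = N + N" by (simp add: N_def m)
  have t: "suslin r v w * sbar r ?e ?o = four_block_mat (0\<^sub>m N N) A (0\<^sub>m N N) (0\<^sub>m N N)"
    unfolding 2 3 using c by (subst scalar_four_block_mult) (auto intro!: cong_four_block_mat)
  have b: "suslin r v w * sbar r ?o ?e = four_block_mat (0\<^sub>m N N) (0\<^sub>m N N) B (0\<^sub>m N N)"
    unfolding 2 3 using c by (subst scalar_four_block_mult) (auto intro!: cong_four_block_mat)
  show ?top unfolding 1 t N2 mat_top_def using c by (intro eq_matI) auto
  show ?bot unfolding 1 b N2 mat_bot_def using c by (intro eq_matI) auto
qed

lemma unipotent_mult:
  fixes p a b :: "'c::ring_1"
  assumes "p * p = 0" "br p a = 0"
  shows "(1 + p * a) * (1 + p * b) = 1 + p * (a + b)"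
proof -
  have "p * a * p = 0" using br_0_anti[OF assms(2)] assms(1) by (metis minus_mult_left mult.assoc mult_minus_right mult_zero_left neg_equal_0_iff_equal)
  hence "p * a * (p * b) = 0" by (metis mult.assoc mult_zero_left)
  thus ?thesis by (simp add: distrib_left distrib_right)
qed

text \<open>\<open>h\<close> anticommutes with \<open>p\<close> and \<open>q\<close> and so fixes
  their product. Conjugation by \<open>u\<close> negates \<open>p\<close> and sends \<open>q\<close>
  to u - q.\<close>

lemma conj_reflections:
  fixes u h p q :: "'c::ring_1"
  assumes "u * u = 1" "h * h = 1" "br u p = 0" "br h p = 0" "br h q = 0" "br u q = 1"
  shows "(u * h) * (1 + p * q) * (h * u) = 1 - p * (u - q)"
proof -
  have a: "u * p = - (p * u)" "h * p = - (p * h)" "h * q = - (q * h)" using assms br_0_anti by blast+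
  have "u * q * u = (u * q + q * u) * u - q * (u * u)" by (simp add: distrib_right mult.assoc)
  hence b: "u * q * u = u - q" using assms(1,6) by (simp add: br_def)
  have "h * p * q * h = - p * (h * q) * h" by (simp add: a(2) mult.assoc)
  also have "\<dots> = p * q * (h * h)" by (simp add: a(3) mult.assoc)
  finally have c: "h * p * q * h = p * q" by (simp add: assms(2))
  have "(u * h) * (1 + p * q) * (h * u) = u * (h * h) * u + u * (h * p * q * h) * u" by (simp add: distrib_left distrib_right mult.assoc)
  also have "\<dots> = 1 + (u * p) * q * u" by (simp only: c assms(1,2) mult_1_right) (simp only: mult.assoc)
  also have "\<dots> = 1 - p * (u * q * u)" by (simp add: a(1) mult.assoc)
  finally show ?thesis by (simp only: b)
qed

section \<open>Root elements as lifts of elements of the elementary group\<close>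

context suslin_rank
begin

interpretation cl: clifford smr UNIV "zc r" "Suc r"
  using zc_clifford[OF r_ge_2] by simp

abbreviation e0 :: "'b::comm_ring_1 vec" where
  "e0 \<equiv> unit_vec (r + 1) 0"

lemma h0_Cl: "cl.h0 = Cl r e0 e0"
proof -
  have "Cl r (e0 + 0\<^sub>v (r + 1)) (0\<^sub>v (r + 1) + e0) = Cl r e0 (0\<^sub>v (r + 1)) + Cl r (0\<^sub>v (r + 1)) (e0 :: 'a vec)"
    by (rule Cl_add) auto
  thus ?thesis by (simp add: cl.h0_def zc_def)
qed

lemma lft_suslin: "lft r (suslin r v w) (Cl r v w * cl.h0)" "lft r (sbar r v w) (cl.h0 * Cl r v w)"
  unfolding h0_Cl using lft_Cl[of r v w e0 e0] lft_Cl[of r e0 e0 w v] suslin_unit[of r, where 'b = 'a]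
  by (simp_all only: transpose_one right_mult_one_mat[OF suslin_carrier] left_mult_one_mat[OF transpose_carrier_mat[THEN iffD2, OF suslin_carrier]])

lemma suslin_GL:
  assumes "unit_pair v w"
  shows "suslin r v w \<in> carrier (GL (2 ^ r))" "inv\<^bsub>GL (2 ^ r)\<^esub> (suslin r v w) = sbar r v w"
proof -
  have "v \<in> carrier_vec (r + 1)" "w \<in> carrier_vec (r + 1)" "v \<bullet> w = 1" using assms by (auto simp: unit_pair_def)
  hence "suslin r v w * sbar r v w = 1\<^sub>m (2 ^ r)" "sbar r v w * suslin r v w = 1\<^sub>m (2 ^ r)"
    using suslin_sbar[of v r w] by (auto intro!: eq_matI)
  thus "suslin r v w \<in> carrier (GL (2 ^ r))" "inv\<^bsub>GL (2 ^ r)\<^esub> (suslin r v w) = sbar r v w"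
    by (intro GL_I[of _ _ "sbar r v w"] GL_inv; simp)+
qed

lemma SUm_generators: "{suslin r v w | v w. v \<in> carrier_vec (r + 1) \<and> w \<in> carrier_vec (r + 1) \<and> v \<bullet> w = 1} = {suslin r v w | v w. unit_pair v w}"
  by (auto simp: unit_pair_def)

lemma SUm_subgroup: "subgroup (SUm r) (GL (2 ^ r))"
  unfolding SUm_def SUm_generators by (rule group.generate_is_subgroup[OF GL_group]) (auto intro: suslin_GL)

lemma EUm_subset_SUm: "EUm r \<subseteq> SUm r"
  unfolding EUm_def SUm_def by (rule group.mono_generate[OF GL_group]) auto

lemma EUm_subgroup: "subgroup (EUm r) (GL (2 ^ r))"
  unfolding EUm_def by (rule group.generate_is_subgroup[OF GL_group]) (auto intro: suslin_GL simp: unit_pair_def)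

lemma SUm_lift:
  assumes "g \<in> SUm r"
  shows "\<exists>W W'. spin W W' \<and> lft r g W \<and> lft r (inv\<^bsub>GL (2 ^ r)\<^esub> g) W'"
  using assms unfolding SUm_def SUm_generators
proof (induction g rule: generate.induct)
  case one
  have "inv\<^bsub>GL (2 ^ r)\<^esub> (1\<^sub>m (2 ^ r)) = (1\<^sub>m (2 ^ r) :: 'a mat)" by (rule GL_inv) auto
  thus ?case using spin_one lft_1 by auto
next
  case (incl h)
  then obtain v w where vw: "unit_pair v w" "h = suslin r v w" by auto
  have "spin (Cl r v w * cl.h0) (cl.h0 * Cl r v w)" using spin_right[OF vw(1) spin_one] by simp
  thus ?case using lft_suslin(1)[of v w] lft_suslin(2)[of w v] suslin_GL[OF vw(1)] vw(2) by auto
next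
  case (inv h)
  then obtain v w where vw: "unit_pair v w" "h = suslin r v w" by auto
  have "spin (cl.h0 * Cl r v w) (Cl r v w * cl.h0)" using spin_left[OF vw(1) spin_one] by simp
  moreover have "inv\<^bsub>GL (2 ^ r)\<^esub> (inv\<^bsub>GL (2 ^ r)\<^esub> h) = h" using group.inv_inv[OF GL_group suslin_GL(1)[OF vw(1)]] by (simp only: vw(2))
  ultimately show ?case using lft_suslin(1)[of v w] lft_suslin(2)[of w v] suslin_GL[OF vw(1)] vw(2) by auto
next
  case (eng h1 h2)
  have sub: "{suslin r v w | v w. unit_pair v w} \<subseteq> carrier (GL (2 ^ r))" by (auto intro: suslin_GL)
  have h: "h1 \<in> carrier (GL (2 ^ r))" "h2 \<in> carrier (GL (2 ^ r))"
    using eng(1,2) group.generate_in_carrier[OF GL_group sub] by auto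
  have "inv\<^bsub>GL (2 ^ r)\<^esub> (h1 * h2) = inv\<^bsub>GL (2 ^ r)\<^esub> h2 * inv\<^bsub>GL (2 ^ r)\<^esub> h1"
    using group.inv_mult_group[OF GL_group h] by simp
  moreover obtain W1 W1' W2 W2' where "spin W1 W1'" "lft r h1 W1" "lft r (inv\<^bsub>GL (2 ^ r)\<^esub> h1) W1'"
    "spin W2 W2'" "lft r h2 W2" "lft r (inv\<^bsub>GL (2 ^ r)\<^esub> h2) W2'" using eng.IH by blast
  ultimately show ?case using spin_mult lft_mult by (metis GL_simps(1))
qed

definition in_EUm :: "'b::comm_ring_1 rfm \<Rightarrow> bool" where
  "in_EUm W \<longleftrightarrow> (\<exists>g\<in>EUm r. lft r g W)"

lemma in_EUm_mult: "in_EUm W \<Longrightarrow> in_EUm W' \<Longrightarrow> in_EUm (W * W')"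
  unfolding in_EUm_def using lft_mult subgroup.m_closed[OF EUm_subgroup] by (metis GL_simps(1))

lemma in_EUm_1: "in_EUm 1"
  unfolding in_EUm_def using lft_1 subgroup.one_closed[OF EUm_subgroup] by (metis GL_simps(2))

definition orbit :: "'b::comm_ring_1 vec \<Rightarrow> bool" where
  "orbit v \<longleftrightarrow> (\<exists>\<epsilon>\<in>elementary_group (r + 1). v = transpose_mat \<epsilon> *\<^sub>v e0)"

lemma in_EUm_suslin:
  assumes "unit_pair v w" "orbit v"
  shows "in_EUm (Cl r v w * cl.h0)" "in_EUm (cl.h0 * Cl r v w)"
proof -
  have "suslin r v w \<in> EUm r" unfolding EUm_def using assms by (intro generate.incl) (auto simp: unit_pair_def orbit_def)
  moreover from this have "sbar r v w \<in> EUm r" using subgroup.m_inv_closed[OF EUm_subgroup] suslin_GL(2)[OF assms(1)] by metis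
  ultimately show "in_EUm (Cl r v w * cl.h0)" "in_EUm (cl.h0 * Cl r v w)" using lft_suslin unfolding in_EUm_def by blast+
qed

lemma orbit_e0: "orbit e0"
proof -
  have "1\<^sub>m (r + 1) \<in> elementary_group (r + 1)" unfolding elementary_group_def using generate.one[of "GL (r + 1)"] by simp
  moreover have "e0 = transpose_mat (1\<^sub>m (r + 1)) *\<^sub>v (e0 :: 'a vec)" by simp
  ultimately show ?thesis unfolding orbit_def by blast
qed

lemma orbit_translate:
  assumes "1 \<le> i" "i \<le> r"
  shows "orbit (e0 + x \<cdot>\<^sub>v unit_vec (r + 1) i)"
proof -
  have "addrow_mat (r + 1) x 0 i \<in> elementary_group (r + 1)" unfolding elementary_group_def using assms
    by (intro generate.incl CollectI) (rule exI[of _ x], rule exI[of _ 0], rule exI[of _ i], simp)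
  moreover have "e0 + x \<cdot>\<^sub>v unit_vec (r + 1) i = transpose_mat (addrow_mat (r + 1) x 0 i) *\<^sub>v e0"
    using assms by (intro eq_vecI) auto
  ultimately show ?thesis unfolding orbit_def by blast
qed

lemma Cl_smult_unit:
  assumes "i \<le> r"
  shows "Cl r (x \<cdot>\<^sub>v unit_vec (r + 1) i) (0\<^sub>v (r + 1)) = smr x (zc r (i, True))"
    "Cl r (0\<^sub>v (r + 1)) (x \<cdot>\<^sub>v unit_vec (r + 1) i) = smr x (zc r (i, False))"
proof -
  have o: "0\<^sub>v (r + 1) = x \<cdot>\<^sub>v 0\<^sub>v (r + 1)" by auto
  show "Cl r (x \<cdot>\<^sub>v unit_vec (r + 1) i) (0\<^sub>v (r + 1)) = smr x (zc r (i, True))"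
    by (subst o, subst Cl_smult) (auto simp: zc_def)
  show "Cl r (0\<^sub>v (r + 1)) (x \<cdot>\<^sub>v unit_vec (r + 1) i) = smr x (zc r (i, False))"
    by (subst o, subst Cl_smult) (auto simp: zc_def)
qed

lemma Cl_translate:
  assumes "i \<le> r"
  shows "Cl r (e0 + x \<cdot>\<^sub>v unit_vec (r + 1) i) e0 = cl.h0 + smr x (zc r (i, True))"
    "Cl r e0 (e0 + x \<cdot>\<^sub>v unit_vec (r + 1) i) = cl.h0 + smr x (zc r (i, False))"
proof -
  have "Cl r (e0 + x \<cdot>\<^sub>v unit_vec (r + 1) i) (e0 + 0\<^sub>v (r + 1)) = Cl r e0 e0 + Cl r (x \<cdot>\<^sub>v unit_vec (r + 1) i) (0\<^sub>v (r + 1))"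
    "Cl r (e0 + 0\<^sub>v (r + 1)) (e0 + x \<cdot>\<^sub>v unit_vec (r + 1) i) = Cl r e0 e0 + Cl r (0\<^sub>v (r + 1)) (x \<cdot>\<^sub>v unit_vec (r + 1) i)"
    by (rule Cl_add; simp)+
  thus "Cl r (e0 + x \<cdot>\<^sub>v unit_vec (r + 1) i) e0 = cl.h0 + smr x (zc r (i, True))"
    "Cl r e0 (e0 + x \<cdot>\<^sub>v unit_vec (r + 1) i) = cl.h0 + smr x (zc r (i, False))"
    unfolding Cl_smult_unit[OF assms] h0_Cl by simp_all
qed

text \<open>The element is (h_0 + x z_k) h_0, and h_0 + x z_k is the vector belonging to
  \<open>E_vec\<close> or \<open>E_dual\<close>.\<close>

lemma in_EUm_root_h0:
  assumes k: "k \<in> cl.K" "fst k \<noteq> 0"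
  shows "in_EUm (1 + smr x (zc r k) * cl.h0)"
proof -
  obtain i b where ib: "k = (i, b)" by fastforce
  hence i: "1 \<le> i" "i \<le> r" using k by auto
  have u: "unit_pair (e0 + x \<cdot>\<^sub>v unit_vec (r + 1) i) e0" "unit_pair e0 (e0 + x \<cdot>\<^sub>v unit_vec (r + 1) i)"
    using i by (auto simp: unit_pair_def scalar_prod_add_distrib[of _ "r + 1"] add_scalar_prod_distrib[of _ "r + 1"])
  have "(cl.h0 + smr x (zc r k)) * cl.h0 = 1 + smr x (zc r k) * cl.h0" by (simp only: distrib_right cl.h0_h0)
  moreover have "in_EUm ((cl.h0 + smr x (zc r k)) * cl.h0)"
    using in_EUm_suslin(1)[OF u(1) orbit_translate[OF i]] in_EUm_suslin(1)[OF u(2) orbit_e0] unfolding ib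
    by (cases b) (simp_all only: Cl_translate[OF i(2)])
  ultimately show ?thesis by (simp only:)
qed

lemma br_h0: "k \<in> cl.K \<Longrightarrow> fst k \<noteq> 0 \<Longrightarrow> br cl.h0 (zc r k) = 0"
  by (auto simp: cl.h0_def cl.br_K dual_def)

text \<open>h_0 anticommutes with z_k and z_l, so p = y z_k h_0 and q = z_l h_0 satisfy p q = - y
  z_k z_l = - q p. The commutator of 1 + p and 1 + q therefore has parameter - 2 y, and the choice y
  = - x / 2 uses that 2 is invertible.\<close>

lemma in_EUm_root_nonzero:
  fixes x :: "'b::comm_ring_1"
  assumes two: "(2::'b) dvd 1" and k: "k \<in> cl.K" "fst k \<noteq> 0" and l: "l \<in> cl.K" "fst l \<noteq> 0" "fst k \<noteq> fst l"
  shows "in_EUm (1 + smr x (zc r k * zc r l))"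
proof -
  obtain d where d: "2 * d = (1 :: 'b)" using two by (metis dvd_def)
  define y where "y = - (d * x)"
  let ?p = "smr y (zc r k) * cl.h0" and ?q = "smr 1 (zc r l) * cl.h0"
  have h: "cl.h0 * zc r k = - (zc r k * cl.h0)" "cl.h0 * zc r l = - (zc r l * cl.h0)"
    using br_0_anti[OF br_h0] k l by blast+
  have hh: "zc r m * cl.h0 * (zc r n * cl.h0) = - (zc r m * zc r n)" if "n = k \<or> n = l" for m n
  proof -
    have "zc r m * cl.h0 * (zc r n * cl.h0) = zc r m * (cl.h0 * zc r n) * cl.h0" by (simp only: mult.assoc)
    also have "cl.h0 * zc r n = - (zc r n * cl.h0)" using h that by blast
    also have "zc r m * - (zc r n * cl.h0) * cl.h0 = - (zc r m * zc r n * (cl.h0 * cl.h0))" by (simp add: mult.assoc)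
    finally show ?thesis by (simp add: cl.h0_h0)
  qed
  have lk: "zc r l * zc r k = - (zc r k * zc r l)" using k l by (intro cl.z_anti) (auto simp: dual_def)
  have pq: "?p * ?p = 0" "?q * ?q = 0" "?p * ?q = - smr y (zc r k * zc r l)" "?q * ?p = smr y (zc r k * zc r l)"
    by (simp_all add: hh cl.zz_K k l lk)
  have nil: "p * q * p = 0" if "p * p = 0" "q * p = - (p * q)" for p q :: "'b rfm"
  proof -
    have "p * q * p = p * (q * p)" by (simp only: mult.assoc)
    also have "\<dots> = - (p * p * q)" unfolding that(2) by (simp add: mult.assoc)
    finally show ?thesis by (simp add: that(1))
  qed
  have "?q * ?p = - (?p * ?q)" "?p * ?q = - (?q * ?p)" unfolding pq(3,4) by simp_all
  hence "?p * ?q * ?p = 0" "?q * ?p * ?q = 0" using nil pq(1,2) by blast+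
  from cl.commutator_identity(1)[OF pq(1,2) this, of 1 1]
  have "(1 + ?p) * (1 + ?q) * (1 - ?p) * (1 - ?q) = 1 + (?p * ?q - ?q * ?p)" by simp
  also have "?p * ?q - ?q * ?p = smr (- (2 * y)) (zc r k * zc r l)" unfolding pq(3,4) mult_2 minus_add_distrib by (simp only: rfm.sm_add_left rfm.sm_minus_left diff_conv_add_uminus)
  also have "- (2 * y) = (2 * d) * x" by (simp add: y_def mult.assoc)
  also have "(2 * d) * x = x" by (simp only: d mult_1)
  finally have e: "(1 + ?p) * (1 + ?q) * (1 - ?p) * (1 - ?q) = 1 + smr x (zc r k * zc r l)" .
  have "1 - ?p = 1 + smr (- y) (zc r k) * cl.h0" "1 - ?q = (1 + smr (- 1) (zc r l) * cl.h0 :: 'b rfm)" by simp_all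
  note pq' = this
  have "in_EUm ((1 + ?p) * (1 + ?q) * (1 - ?p) * (1 - ?q))"
    unfolding pq' by (rule in_EUm_mult[OF in_EUm_mult[OF in_EUm_mult]]; rule in_EUm_root_h0; fact)
  thus ?thesis by (simp only: e)
qed

text \<open>For e_0, take the unit vector u = e_0 + e_j + f_j with j outside plane 0 and the plane
  of z_k. Conjugation by u h_0 carries 1 + p f_j to 1 - p (e_0 + e_j), and a factor 1 + p e_j
  removes e_j. Since e_0 + e_j is in the elementary orbit, u h_0 is a lift from the elementary
  group. For f_0 = h_0 - e_0 the element 1 + x z_k h_0 is used in addition.\<close>

lemma in_EUm_root_zero:
  fixes x :: "'b::comm_ring_1"
  assumes two: "(2::'b) dvd 1" and k: "k \<in> cl.K" "fst k \<noteq> 0"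
  shows "in_EUm (1 + smr x (zc r k * zc r (0, b)))"
proof -
  have top: "in_EUm (1 + smr y (zc r k * zc r (0, True)))" for y :: 'b
  proof -
    obtain j where j: "1 \<le> j" "j \<le> r" "fst k \<noteq> j" using r_ge_2 by (metis dual_order.trans le_refl one_le_numeral numeral_One numeral_eq_iff semiring_norm(85))
    let ?v = "e0 + 1 \<cdot>\<^sub>v unit_vec (r + 1) j" and ?w = "unit_vec (r + 1) j :: 'b vec"
    have up: "unit_pair ?v ?w" using j by (auto simp: unit_pair_def add_scalar_prod_distrib[of _ "r + 1"])
    define u where "u = Cl r ?v ?w"
    have c: "?v \<in> carrier_vec (r + 1)" "?w \<in> carrier_vec (r + 1)" by auto
    have ue: "u = zc r (0, True) + zc r (j, True) + zc r (j, False)"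
    proof -
      have "Cl r (?v + 0\<^sub>v (r + 1)) (0\<^sub>v (r + 1) + ?w) = Cl r ?v (0\<^sub>v (r + 1)) + Cl r (0\<^sub>v (r + 1)) ?w" by (rule Cl_add) auto
      moreover have "Cl r ?v (0\<^sub>v (r + 1) + 0\<^sub>v (r + 1)) = Cl r e0 (0\<^sub>v (r + 1)) + Cl r (1 \<cdot>\<^sub>v unit_vec (r + 1) j) (0\<^sub>v (r + 1))" by (rule Cl_add) auto
      ultimately show ?thesis by (simp add: u_def zc_def)
    qed
    let ?p = "smr (- y) (zc r k)" and ?q = "zc r (j, False)" and ?a = "zc r (j, True)" and ?e = "zc r (0, True)"
    have K: "(j, False) \<in> cl.K" "(j, True) \<in> cl.K" "(0, True) \<in> cl.K" using j by auto
    have b: "br ?p ?a = 0" "br ?p ?e = 0" "br u ?p = 0" "br cl.h0 ?p = 0" "br cl.h0 ?q = 0" "br u ?q = 1"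
      using k j by (auto simp: ue cl.br_K dual_def br_h0)
    have pp: "?p * ?p = 0" using k by (simp add: cl.zz_K)
    have uu: "u * u = 1" unfolding u_def by (rule unit_pair_Cl[OF up])
    from in_EUm_suslin[OF up orbit_translate[OF j(1,2)]] have uh: "in_EUm (u * cl.h0)" "in_EUm (cl.h0 * u)" by (simp_all only: u_def)
    have "in_EUm (1 + ?p * ?q)"
      using in_EUm_root_nonzero[OF two k K(1), of "- y"] j by simp
    from in_EUm_mult[OF in_EUm_mult[OF uh(1) this] uh(2)] have 1: "in_EUm (1 - ?p * (u - ?q))" using conj_reflections[OF uu cl.h0_h0 b(3,4,5,6)] by simp
    have "u - ?q = ?e + ?a" by (simp add: ue)
    moreover have "1 + ?p * (- (?e + ?a)) = 1 - ?p * (?e + ?a)" by (simp only: mult_minus_right diff_conv_add_uminus)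
    ultimately have "in_EUm (1 + ?p * (- (?e + ?a)))" using 1 by (simp only:)
    moreover have "in_EUm (1 + ?p * ?a)" using in_EUm_root_nonzero[OF two k K(2), of "- y"] j by simp
    ultimately have "in_EUm ((1 + ?p * (- (?e + ?a))) * (1 + ?p * ?a))" by (rule in_EUm_mult)
    moreover have "br ?p (- (?e + ?a)) = - (br ?p ?e + br ?p ?a)" by (simp only: br_def distrib_left distrib_right mult_minus_left mult_minus_right) simp
    hence "br ?p (- (?e + ?a)) = 0" by (simp only: b(1,2)) simp
    note unipotent_mult[OF pp this, of ?a]
    moreover have "- (?e + ?a) + ?a = (- ?e :: 'b rfm)" by simp
    ultimately have "in_EUm (1 + ?p * (- ?e))" by (simp only:)
    thus ?thesis by simp
  qed
  show ?thesis
  proof (cases b)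
    case False
    let ?p = "smr x (zc r k)"
    have "in_EUm (1 + ?p * (- zc r (0, True)))" using top[of "- x"] by simp
    hence "in_EUm ((1 + ?p * (- zc r (0, True))) * (1 + ?p * cl.h0))" using in_EUm_root_h0[OF k] by (rule in_EUm_mult)
    moreover have "?p * ?p = 0" "br ?p (- zc r (0, True)) = 0" using k by (auto simp: cl.zz_K br_def cl.z_anti dual_def)
    ultimately show ?thesis using unipotent_mult[of ?p "- zc r (0, True)" cl.h0] False by (simp add: cl.h0_def)
  qed (use top in simp)
qed

lemma in_EUm_root:
  fixes x :: "'b::comm_ring_1"
  assumes two: "(2::'b) dvd 1" and kl: "k \<in> cl.K" "l \<in> cl.K" "fst k \<noteq> fst l"
  shows "in_EUm (1 + smr x (zc r k * zc r l))"
proof (cases "fst l = 0")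
  case True
  thus ?thesis using in_EUm_root_zero[OF two kl(1), of x "snd l"] kl(3) by (metis prod.collapse)
next
  case l: False
  show ?thesis
  proof (cases "fst k = 0")
    case True
    have a: "zc r k * zc r l = - (zc r l * zc r k)" using kl by (intro cl.z_anti) (auto simp: dual_def)
    have "smr x (zc r k * zc r l) = smr (- x) (zc r l * zc r k)" unfolding a by simp
    thus ?thesis using in_EUm_root_zero[OF two kl(2) l, of "- x" "snd k"] True by (metis prod.collapse)
  qed (use in_EUm_root_nonzero[OF two kl(1) _ kl(2) l kl(3)] in blast)
qed

lemma E_in_EUm:
  fixes W :: "'b::comm_ring_1 rfm"
  assumes "(2::'b) dvd 1" "W \<in> cl.E UNIV"
  shows "in_EUm W"
  using assms(2) by (induction W rule: cl.E.induct) (auto intro: in_EUm_1 in_EUm_mult in_EUm_root[OF assms(1)])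

end

lemma mcong_mat_top: "is_ideal J \<Longrightarrow> mcong J A B \<Longrightarrow> mcong J (mat_top A) (mat_top B)"
  and mcong_mat_bot: "is_ideal J \<Longrightarrow> mcong J A B \<Longrightarrow> mcong J (mat_bot A) (mat_bot B)"
  by (auto simp: mcong_def mat_top_def mat_bot_def is_idealD(1))

lemma lft_inverse:
  assumes "lft r g W" "lft r g' W'" "W * W' = 1" "W' * W = 1"
  shows "inv\<^bsub>GL (2 ^ r)\<^esub> g = g'"
proof (rule GL_inv)
  show "g * g' = 1\<^sub>m (2 ^ r)" using lft_mult[OF assms(1,2)] lft_1 unfolding assms(3) by (rule lft_unique)
  show "g' * g = 1\<^sub>m (2 ^ r)" using lft_mult[OF assms(2,1)] lft_1 unfolding assms(4) by (rule lft_unique)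
qed (use assms lft_carrier in auto)

section \<open>The relative groups and their translation to the Clifford algebra\<close>

context suslin_rank
begin

interpretation cl: clifford smr UNIV "zc r" "Suc r"
  using zc_clifford[OF r_ge_2] by simp

interpretation GL: group "GL (2 ^ r) :: 'b::comm_ring_1 mat monoid"
  by (rule GL_group)

lemma generator_lft:
  assumes i: "1 \<le> i" "i \<le> r"
  shows "lft r (mat_top (E_vec r i x)) (1 + smr x (zc r (i, True) * zc r (0, True)))"
    "lft r (mat_bot (E_vec r i x)) (1 + smr x (zc r (i, True) * zc r (0, False)))"
    "lft r (mat_top (E_dual r i x)) (1 + smr x (zc r (i, False) * zc r (0, True)))"
    "lft r (mat_bot (E_dual r i x)) (1 + smr x (zc r (i, False) * zc r (0, False)))"
proof -
  let ?o = "0\<^sub>v (r + 1) :: 'a vec" and ?x = "x \<cdot>\<^sub>v unit_vec (r + 1) i"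
  have r: "1 \<le> r" using r_ge_2 by simp
  have c: "?x \<in> carrier_vec (r + 1)" "?x $ 0 = 0" "?o \<in> carrier_vec (r + 1)" "?o $ 0 = 0" using i by auto
  have o: "e0 + ?o = e0" by simp
  have E: "E_vec r i x = suslin r (e0 + ?x) (e0 + ?o)" "E_dual r i x = suslin r (e0 + ?o) (e0 + ?x)"
    by (simp_all only: E_vec_def E_dual_def o)
  have z: "Cl r e0 ?o = zc r (0, True)" "Cl r ?o e0 = zc r (0, False)" by (simp_all add: zc_def)
  note l = lft_add[OF lft_1 lft_Cl]
  show "lft r (mat_top (E_vec r i x)) (1 + smr x (zc r (i, True) * zc r (0, True)))"
    using l[of r ?x ?o ?o e0] unfolding E triangular_suslin[OF r c] z Cl_smult_unit[OF i(2)] rfm.sm_mult_left .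
  show "lft r (mat_bot (E_vec r i x)) (1 + smr x (zc r (i, True) * zc r (0, False)))"
    using l[of r ?x ?o e0 ?o] unfolding E triangular_suslin[OF r c] z Cl_smult_unit[OF i(2)] rfm.sm_mult_left .
  show "lft r (mat_top (E_dual r i x)) (1 + smr x (zc r (i, False) * zc r (0, True)))"
    using l[of r ?o ?x ?o e0] unfolding E triangular_suslin[OF r c(3,4,1,2)] z Cl_smult_unit[OF i(2)] rfm.sm_mult_left .
  show "lft r (mat_bot (E_dual r i x)) (1 + smr x (zc r (i, False) * zc r (0, False)))"
    using l[of r ?o ?x e0 ?o] unfolding E triangular_suslin[OF r c(3,4,1,2)] z Cl_smult_unit[OF i(2)] rfm.sm_mult_left .
qed

lemma elementary_generator_lft:
  assumes "g \<in> elementary_generators r J"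
  shows "\<exists>k\<in>cl.K. \<exists>l\<in>cl.K. fst k \<noteq> fst l \<and> (\<exists>x\<in>J. lft r g (1 + smr x (zc r k * zc r l)))"
proof -
  obtain i x where ix: "1 \<le> i" "i \<le> r" "x \<in> J" and
    g: "g \<in> {mat_top (E_vec r i x), mat_bot (E_vec r i x), mat_top (E_dual r i x), mat_bot (E_dual r i x)}"
    using assms by (auto simp: elementary_generators_def)
  obtain b c where "lft r g (1 + smr x (zc r (i, b) * zc r (0, c)))" using g generator_lft[OF ix(1,2), of x] by blast
  thus ?thesis using ix by (intro bexI[of _ "(i, b)"] bexI[of _ "(0, c)"]) auto
qed

lemma elementary_generator_exists:
  assumes i: "1 \<le> i" "i \<le> r" and x: "x \<in> J"
  shows "\<exists>g\<in>elementary_generators r J. lft r g (1 + smr x (zc r (i, b) * zc r (0, c)))"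
proof -
  have "{mat_top (E_vec r i x), mat_bot (E_vec r i x), mat_top (E_dual r i x), mat_bot (E_dual r i x)} \<subseteq> elementary_generators r J"
    unfolding elementary_generators_def using i x by (intro subsetI UN_I[of i] UN_I[of x]) auto
  moreover have "\<exists>g\<in>{mat_top (E_vec r i x), mat_bot (E_vec r i x), mat_top (E_dual r i x), mat_bot (E_dual r i x)}.
      lft r g (1 + smr x (zc r (i, b) * zc r (0, c)))"
    by (cases b; cases c) (simp_all add: generator_lft[OF i])
  ultimately show ?thesis by blast
qed

lemma elementary_generators_EUm:
  fixes J :: "'b::comm_ring_1 set"
  assumes "(2::'b) dvd 1"
  shows "elementary_generators r J \<subseteq> EUm r"
proof
  fix g assume "g \<in> elementary_generators r J"
  then obtain k l x where "k \<in> cl.K" "l \<in> cl.K" "fst k \<noteq> fst l" "lft r g (1 + smr x (zc r k * zc r l))"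
    using elementary_generator_lft by blast
  moreover from this obtain g' where "g' \<in> EUm r" "lft r g' (1 + smr x (zc r k * zc r l))"
    using in_EUm_root[OF assms] unfolding in_EUm_def by blast
  ultimately show "g \<in> EUm r" using lft_unique by metis
qed

definition rel_generators :: "'b::comm_ring_1 set \<Rightarrow> 'b mat set" where
  "rel_generators J = {\<gamma> * g * inv\<^bsub>GL (2 ^ r)\<^esub> \<gamma> | \<gamma> g. \<gamma> \<in> EUm r \<and> g \<in> elementary_generators r J}"

lemma EUm_rel_eq: "EUm_rel r J = generate (GL (2 ^ r)) (rel_generators J)"
  by (simp add: EUm_rel_def rel_generators_def)

lemma EUm_GL: "g \<in> EUm r \<Longrightarrow> g \<in> carrier (GL (2 ^ r))"
  using subgroup.subset[OF EUm_subgroup] by blast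

lemma rel_generators_EUm:
  fixes J :: "'b::comm_ring_1 set"
  assumes "(2::'b) dvd 1"
  shows "rel_generators J \<subseteq> EUm r"
proof
  fix h assume "h \<in> rel_generators J"
  then obtain \<gamma> g where g: "\<gamma> \<in> EUm r" "g \<in> EUm r" "h = \<gamma> * g * inv\<^bsub>GL (2 ^ r)\<^esub> \<gamma>"
    using elementary_generators_EUm[OF assms] unfolding rel_generators_def by blast
  have "\<gamma> \<otimes>\<^bsub>GL (2 ^ r)\<^esub> g \<otimes>\<^bsub>GL (2 ^ r)\<^esub> inv\<^bsub>GL (2 ^ r)\<^esub> \<gamma> \<in> EUm r"
    by (intro subgroup.m_closed[OF EUm_subgroup] subgroup.m_inv_closed[OF EUm_subgroup] g(1,2))
  thus "h \<in> EUm r" by (simp add: g(3))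
qed

lemma rel_generators_GL:
  fixes J :: "'b::comm_ring_1 set"
  assumes "(2::'b) dvd 1"
  shows "rel_generators J \<subseteq> carrier (GL (2 ^ r))"
  using rel_generators_EUm[OF assms] EUm_GL by blast

lemma EUm_rel_conj:
  fixes J :: "'b::comm_ring_1 set"
  assumes two: "(2::'b) dvd 1" and c: "c \<in> EUm r" and x: "x \<in> EUm_rel r J"
  shows "c * x * inv\<^bsub>GL (2 ^ r)\<^esub> c \<in> EUm_rel r J"
proof -
  have "c \<otimes>\<^bsub>GL (2 ^ r)\<^esub> h \<otimes>\<^bsub>GL (2 ^ r)\<^esub> inv\<^bsub>GL (2 ^ r)\<^esub> c \<in> rel_generators J" if h: "h \<in> rel_generators J" for h
  proof -
    obtain \<gamma> g where g: "\<gamma> \<in> EUm r" "g \<in> elementary_generators r J" "h = \<gamma> * g * inv\<^bsub>GL (2 ^ r)\<^esub> \<gamma>"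
      using h unfolding rel_generators_def by blast
    have "g \<in> EUm r" using g(2) elementary_generators_EUm[OF two] by blast
    note GL = EUm_GL[OF g(1)] EUm_GL[OF this] EUm_GL[OF c]
    have cg: "c \<otimes>\<^bsub>GL (2 ^ r)\<^esub> \<gamma> \<in> EUm r" by (rule subgroup.m_closed[OF EUm_subgroup c g(1)])
    have "c \<otimes>\<^bsub>GL (2 ^ r)\<^esub> (\<gamma> \<otimes>\<^bsub>GL (2 ^ r)\<^esub> g \<otimes>\<^bsub>GL (2 ^ r)\<^esub> inv\<^bsub>GL (2 ^ r)\<^esub> \<gamma>) \<otimes>\<^bsub>GL (2 ^ r)\<^esub> inv\<^bsub>GL (2 ^ r)\<^esub> c =
        c \<otimes>\<^bsub>GL (2 ^ r)\<^esub> \<gamma> \<otimes>\<^bsub>GL (2 ^ r)\<^esub> g \<otimes>\<^bsub>GL (2 ^ r)\<^esub> inv\<^bsub>GL (2 ^ r)\<^esub> (c \<otimes>\<^bsub>GL (2 ^ r)\<^esub> \<gamma>)"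
      using GL by (simp add: GL.m_assoc GL.inv_mult_group del: GL_simps)
    thus ?thesis using cg g(2) unfolding rel_generators_def g(3) by auto
  qed
  from GL.conj_generate[OF rel_generators_GL[OF two] EUm_GL[OF c] this x[unfolded EUm_rel_eq]]
  show ?thesis by (simp add: EUm_rel_eq)
qed

definition in_EUm_rel :: "'b::comm_ring_1 set \<Rightarrow> 'b rfm \<Rightarrow> bool" where
  "in_EUm_rel J W \<longleftrightarrow> (\<exists>g\<in>EUm_rel r J. lft r g W)"

lemma in_EUm_rel_1: "in_EUm_rel J 1"
  unfolding in_EUm_rel_def EUm_rel_eq using lft_1 generate.one[of "GL (2 ^ r)" "rel_generators J"] by auto

lemma in_EUm_rel_mult: "in_EUm_rel J W \<Longrightarrow> in_EUm_rel J W' \<Longrightarrow> in_EUm_rel J (W * W')"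
  unfolding in_EUm_rel_def EUm_rel_eq using lft_mult generate.eng[of _ "GL (2 ^ r)" "rel_generators J"] by (metis GL_simps(1))

lemma in_EUm_rel_conj:
  fixes J :: "'b::comm_ring_1 set"
  assumes two: "(2::'b) dvd 1" and V: "in_EUm V" "in_EUm V'" "V * V' = 1" "V' * V = 1" and W: "in_EUm_rel J W"
  shows "in_EUm_rel J (V * W * V')"
proof -
  obtain c c' where c: "c \<in> EUm r" "lft r c V" "lft r c' V'" using V by (auto simp: in_EUm_def)
  obtain g where g: "g \<in> EUm_rel r J" "lft r g W" using W by (auto simp: in_EUm_rel_def)
  have "c' = inv\<^bsub>GL (2 ^ r)\<^esub> c" using lft_inverse[OF c(2,3) V(3,4)] by simp
  hence "c * g * c' \<in> EUm_rel r J" using EUm_rel_conj[OF two c(1) g(1)] by simp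
  moreover have "lft r (c * g * c') (V * W * V')" using c g by (intro lft_mult)
  ultimately show ?thesis unfolding in_EUm_rel_def by blast
qed

lemma in_EUm_rel_root_zero:
  fixes J :: "'b::comm_ring_1 set"
  assumes two: "(2::'b) dvd 1" and k: "k \<in> cl.K" "fst k \<noteq> 0" and x: "x \<in> J"
  shows "in_EUm_rel J (1 + smr x (zc r k * zc r (0, c)))"
proof -
  obtain i b where ib: "k = (i, b)" by fastforce
  hence i: "1 \<le> i" "i \<le> r" using k by auto
  obtain g where g: "g \<in> elementary_generators r J" "lft r g (1 + smr x (zc r k * zc r (0, c)))"
    using elementary_generator_exists[OF i x] ib by blast
  have one: "(1\<^sub>m (2 ^ r) :: 'b mat) \<in> EUm r" using subgroup.one_closed[OF EUm_subgroup] by simp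
  have "inv\<^bsub>GL (2 ^ r)\<^esub> (1\<^sub>m (2 ^ r)) = (1\<^sub>m (2 ^ r) :: 'b mat)" by (rule GL_inv) auto
  hence "g = 1\<^sub>m (2 ^ r) * g * inv\<^bsub>GL (2 ^ r)\<^esub> (1\<^sub>m (2 ^ r))" using lft_carrier[OF g(2)] by simp
  hence "g \<in> rel_generators J" unfolding rel_generators_def using one g(1) by blast
  thus ?thesis unfolding in_EUm_rel_def EUm_rel_eq using g(2) by (blast intro: generate.incl)
qed

text \<open>The elementary generators give only root elements with an index in plane 0. For the
  others, 1 + p q with p = x z_k and q = z_l is the commutator of the relative element 1 + p e_0 and
  the elementary element 1 + f_0 q, hence a relative element times a conjugate of its
  inverse.\<close>

lemma in_EUm_rel_root:
  fixes J :: "'b::comm_ring_1 set"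
  assumes two: "(2::'b) dvd 1" and J: "is_ideal J" and kl: "k \<in> cl.K" "l \<in> cl.K" "fst k \<noteq> fst l" and x: "x \<in> J"
  shows "in_EUm_rel J (1 + smr x (zc r k * zc r l))"
proof -
  have m: "- x \<in> J" using x by (rule is_idealD(5)[OF J])
  have a: "zc r k * zc r l = (- (zc r l * zc r k) :: 'b rfm)" using kl by (intro cl.z_anti) (auto simp: dual_def)
  show ?thesis
  proof (cases "fst k = 0 \<or> fst l = 0")
    case True
    thus ?thesis
    proof
      assume "fst l = 0"
      thus ?thesis using in_EUm_rel_root_zero[OF two kl(1) _ x, of "snd l"] kl(3) by (metis prod.collapse)
    next
      assume k: "fst k = 0"
      have "smr x (zc r k * zc r l) = smr (- x) (zc r l * zc r k)" unfolding a by simp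
      thus ?thesis using in_EUm_rel_root_zero[OF two kl(2) _ m, of "snd k"] kl(3) k by (metis prod.collapse)
    qed
  next
    case False
    let ?p = "smr x (zc r k)" and ?q = "zc r l :: 'b rfm" and ?y = "zc r (0, True) :: 'b rfm" and ?y' = "zc r (0, False) :: 'b rfm"
    have sq: "?p * ?p = 0" "?q * ?q = 0" "?y * ?y = 0" "?y' * ?y' = 0"
      and br: "br ?p ?q = 0" "br ?p ?y = 0" "br ?p ?y' = 0" "br ?q ?y = 0" "br ?q ?y' = 0" "br ?y ?y' = 1"
      using kl False by (auto simp: cl.zz_K cl.br_K dual_def)
    note ap = anticommuting_products[OF sq br]
    have 1: "(1 + ?p * ?y) * (1 + ?y' * ?q) * (1 - ?p * ?y) * (1 - ?y' * ?q) = 1 + ?p * ?q"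
      using cl.commutator_identity(1)[OF ap(1-4), of 1 1] unfolding ap(5) by simp
    have E: "in_EUm (1 + ?y' * ?q)" "in_EUm (1 - ?y' * ?q)"
      using in_EUm_root[OF two, of "(0, False)" l 1] in_EUm_root[OF two, of "(0, False)" l "- 1"] kl False by auto
    have i: "(1 + ?y' * ?q) * (1 - ?y' * ?q) = 1" "(1 - ?y' * ?q) * (1 + ?y' * ?q) = 1"
      using ap(2) by (simp_all add: algebra_simps)
    have R: "in_EUm_rel J (1 + ?p * ?y)" "in_EUm_rel J (1 - ?p * ?y)"
      using in_EUm_rel_root_zero[OF two kl(1) _ x, of True] in_EUm_rel_root_zero[OF two kl(1) _ m, of True] False by auto
    have "in_EUm_rel J ((1 + ?p * ?y) * ((1 + ?y' * ?q) * (1 - ?p * ?y) * (1 - ?y' * ?q)))"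
      by (rule in_EUm_rel_mult[OF R(1) in_EUm_rel_conj[OF two E i R(2)]])
    also have "(1 + ?p * ?y) * ((1 + ?y' * ?q) * (1 - ?p * ?y) * (1 - ?y' * ?q)) = 1 + ?p * ?q"
      unfolding 1[symmetric] by (simp only: mult.assoc)
    finally show ?thesis by simp
  qed
qed

lemma Erel_in_EUm_rel:
  fixes J :: "'b::comm_ring_1 set"
  assumes two: "(2::'b) dvd 1" and J: "is_ideal J" and W: "W \<in> cl.Erel J"
  shows "in_EUm_rel J W"
  using W
proof (induction W rule: cl.Erel.induct)
  case (step \<gamma> \<gamma>' k l x h)
  show ?case
    by (intro in_EUm_rel_mult[OF in_EUm_rel_conj[OF two E_in_EUm[OF two step(1)] E_in_EUm[OF two step(2)] step(3,4)] step.IH]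
        in_EUm_rel_root[OF two J step(5-8)])
qed (rule in_EUm_rel_1)

text \<open>For the forward direction the conjugating matrices are lifted by
  \<open>SUm_lift\<close>, which places them merely in the Clifford group;
  \<open>Erel_conj_root\<close> is strong enough for that. In the other direction the lift
  determines the matrix by \<open>lft_unique\<close>.\<close>

lemma EUm_rel_iff:
  fixes J :: "'b::comm_ring_1 set"
  assumes two: "(2::'b) dvd 1" and J: "is_ideal J"
  shows "g \<in> EUm_rel r J \<longleftrightarrow> (\<exists>W\<in>cl.Erel J. lft r g W)"
proof
  assume "\<exists>W\<in>cl.Erel J. lft r g W"
  thus "g \<in> EUm_rel r J" using Erel_in_EUm_rel[OF two J] lft_unique unfolding in_EUm_rel_def by metis
next
  have J': "cl.idl J" using J by (simp add: idl_iff)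
  have gen: "\<exists>W\<in>cl.Erel J. lft r h W" if h: "h \<in> rel_generators J" for h
  proof -
    obtain \<gamma> g where g: "\<gamma> \<in> EUm r" "g \<in> elementary_generators r J" "h = \<gamma> * g * inv\<^bsub>GL (2 ^ r)\<^esub> \<gamma>"
      using h unfolding rel_generators_def by blast
    obtain W W' where W: "spin W W'" "lft r \<gamma> W" "lft r (inv\<^bsub>GL (2 ^ r)\<^esub> \<gamma>) W'"
      using SUm_lift g(1) EUm_subset_SUm by blast
    obtain k l x where k: "k \<in> cl.K" "l \<in> cl.K" "fst k \<noteq> fst l" "x \<in> J" "lft r g (1 + smr x (zc r k * zc r l))"
      using elementary_generator_lft[OF g(2)] by blast
    have "W * (1 + smr x (zc r k * zc r l)) * W' \<in> cl.Erel J" by (rule cl.Erel_conj_root[OF J' spin_orth[OF W(1)] k(1-4)])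
    moreover have "lft r h (W * (1 + smr x (zc r k * zc r l)) * W')" unfolding g(3) using W k by (intro lft_mult)
    ultimately show ?thesis by blast
  qed
  assume "g \<in> EUm_rel r J"
  thus "\<exists>W\<in>cl.Erel J. lft r g W"
    unfolding EUm_rel_eq
  proof (induction g rule: generate.induct)
    case one
    show ?case using lft_1 cl.Erel.one by auto
  next
    case (incl h)
    thus ?case by (rule gen)
  next
    case (inv h)
    obtain W where W: "W \<in> cl.Erel J" "lft r h W" using gen[OF inv] by blast
    obtain W' where W': "W' \<in> cl.Erel J" "W * W' = 1" "W' * W = 1" using cl.Erel_inverse[OF W(1)] is_idealD(5)[OF J] by blast
    obtain g' where "lft r g' W'" using Erel_in_EUm_rel[OF two J W'(1)] by (auto simp: in_EUm_rel_def)
    thus ?case using lft_inverse[OF W(2) _ W'(2,3)] W'(1) by metis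
  next
    case (eng h1 h2)
    thus ?case using cl.Erel_mult lft_mult by (metis GL_simps(1))
  qed
qed

lemma SUm_GL: "g \<in> SUm r \<Longrightarrow> g \<in> carrier (GL (2 ^ r))"
  using subgroup.subset[OF SUm_subgroup] by blast

lemma SUm_rel_eq: "SUm_rel r J = {A \<in> SUm r. mcong J A (1\<^sub>m (2 ^ r))}"
proof -
  have "A \<in> carrier_mat (2 ^ r) (2 ^ r)" if "A \<in> SUm r" for A :: "'a mat" using SUm_GL[OF that] by (rule GL_carrier)
  thus ?thesis unfolding SUm_rel_def mcong_def by fastforce
qed

lemma SUm_rel_subgroup:
  fixes J :: "'b::comm_ring_1 set"
  assumes J: "is_ideal J"
  shows "subgroup (SUm_rel r J) (GL (2 ^ r))"
proof (rule GL.subgroupI)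
  show "SUm_rel r J \<subseteq> carrier (GL (2 ^ r))" using SUm_GL by (auto simp: SUm_rel_eq)
  have "1\<^sub>m (2 ^ r) \<in> SUm_rel r J" using subgroup.one_closed[OF SUm_subgroup] mcong_refl[OF J] by (simp add: SUm_rel_eq)
  thus "SUm_rel r J \<noteq> {}" by blast
next
  fix a b assume "a \<in> SUm_rel r J" "b \<in> SUm_rel r J"
  hence ab: "a \<in> SUm r" "b \<in> SUm r" "mcong J a (1\<^sub>m (2 ^ r))" "mcong J b (1\<^sub>m (2 ^ r))" by (auto simp: SUm_rel_eq)
  have "mcong J (a * b) (1\<^sub>m (2 ^ r) * 1\<^sub>m (2 ^ r))" using ab by (intro mcong_mult[OF J]) auto
  moreover have "a * b \<in> SUm r" using subgroup.m_closed[OF SUm_subgroup ab(1,2)] by simp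
  ultimately show "a \<otimes>\<^bsub>GL (2 ^ r)\<^esub> b \<in> SUm_rel r J" by (simp add: SUm_rel_eq)
next
  fix a assume "a \<in> SUm_rel r J"
  hence a: "a \<in> SUm r" "mcong J a (1\<^sub>m (2 ^ r))" by (auto simp: SUm_rel_eq)
  let ?b = "inv\<^bsub>GL (2 ^ r)\<^esub> a"
  have b: "?b \<in> SUm r" by (rule subgroup.m_inv_closed[OF SUm_subgroup a(1)])
  hence bc: "?b \<in> carrier_mat (2 ^ r) (2 ^ r)" using SUm_GL GL_carrier by blast
  have "mcong J (?b * a) (?b * 1\<^sub>m (2 ^ r))" using bc by (intro mcong_mult[OF J mcong_refl[OF J] a(2)]) auto
  moreover have "?b * a = 1\<^sub>m (2 ^ r)" using GL.l_inv[OF SUm_GL[OF a(1)]] by simp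
  ultimately have "mcong J ?b (1\<^sub>m (2 ^ r))" using bc mcong_sym[OF J] by simp
  thus "?b \<in> SUm_rel r J" using b by (simp add: SUm_rel_eq)
qed

lemma elementary_generators_cong:
  fixes J :: "'b::comm_ring_1 set"
  assumes J: "is_ideal J" and g: "g \<in> elementary_generators r J"
  shows "mcong J g (1\<^sub>m (2 ^ r))"
proof -
  obtain i x where ix: "1 \<le> i" "i \<le> r" "x \<in> J" and
    g: "g \<in> {mat_top (E_vec r i x), mat_bot (E_vec r i x), mat_top (E_dual r i x), mat_bot (E_dual r i x)}"
    using g by (auto simp: elementary_generators_def)
  have x: "x * d \<in> J" for d using ix(3) by (rule is_idealD(4)[OF J])
  have "mcong J (E_vec r i x) (suslin r e0 e0)" "mcong J (E_dual r i x) (suslin r e0 e0)"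
    unfolding E_vec_def E_dual_def by (rule suslin_cong[OF J]; simp add: is_idealD(1)[OF J] x)+
  hence "mcong J (E_vec r i x) (1\<^sub>m (2 ^ r))" "mcong J (E_dual r i x) (1\<^sub>m (2 ^ r))" unfolding suslin_unit .
  moreover have "mat_top (1\<^sub>m (2 ^ r)) = (1\<^sub>m (2 ^ r) :: 'b mat)" "mat_bot (1\<^sub>m (2 ^ r)) = (1\<^sub>m (2 ^ r) :: 'b mat)"
    unfolding mat_top_def mat_bot_def by (auto intro!: eq_matI)
  ultimately show ?thesis using g mcong_mat_top[OF J] mcong_mat_bot[OF J] by (metis insertE empty_iff)
qed

lemma EUm_rel_subset:
  fixes J :: "'b::comm_ring_1 set"
  assumes two: "(2::'b) dvd 1" and J: "is_ideal J"
  shows "EUm_rel r J \<subseteq> SUm_rel r J"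
  unfolding EUm_rel_eq
proof (rule GL.generate_subgroup_incl[OF _ SUm_rel_subgroup[OF J]], rule subsetI)
  fix h assume h: "h \<in> rel_generators J"
  then obtain \<gamma> g where g: "\<gamma> \<in> EUm r" "g \<in> elementary_generators r J" "h = \<gamma> * g * inv\<^bsub>GL (2 ^ r)\<^esub> \<gamma>"
    unfolding rel_generators_def by blast
  have c: "\<gamma> \<in> carrier_mat (2 ^ r) (2 ^ r)" "inv\<^bsub>GL (2 ^ r)\<^esub> \<gamma> \<in> carrier_mat (2 ^ r) (2 ^ r)"
    using EUm_GL[OF g(1)] GL.inv_closed GL_carrier by blast+
  have "mcong J (\<gamma> * g) (\<gamma> * 1\<^sub>m (2 ^ r))"
    using c by (intro mcong_mult[OF J mcong_refl[OF J] elementary_generators_cong[OF J g(2)]]) auto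
  hence "mcong J (\<gamma> * g) \<gamma>" using c by simp
  hence "mcong J h (\<gamma> * inv\<^bsub>GL (2 ^ r)\<^esub> \<gamma>)"
    unfolding g(3) using c by (intro mcong_mult[OF J _ mcong_refl[OF J]]) auto
  moreover have "\<gamma> * inv\<^bsub>GL (2 ^ r)\<^esub> \<gamma> = 1\<^sub>m (2 ^ r)" using GL.r_inv[OF EUm_GL[OF g(1)]] by simp
  moreover have "h \<in> SUm r" using h rel_generators_EUm[OF two] EUm_subset_SUm by blast
  ultimately show "h \<in> SUm_rel r J" by (simp add: SUm_rel_eq)
qed

lemma EUm_rel_normal:
  fixes J :: "'b::comm_ring_1 set"
  assumes two: "(2::'b) dvd 1" and J: "is_ideal J"
  shows "EUm_rel r J \<lhd> (GL (2 ^ r))\<lparr>carrier := SUm_rel r J\<rparr>"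
proof -
  let ?G = "(GL (2 ^ r))\<lparr>carrier := SUm_rel r J\<rparr>"
  have J': "cl.idl J" using J by (simp add: idl_iff)
  interpret S: group ?G by (rule GL.subgroup_imp_group[OF SUm_rel_subgroup[OF J]])
  have "subgroup (EUm_rel r J) (GL (2 ^ r))"
    unfolding EUm_rel_eq by (rule GL.generate_is_subgroup[OF rel_generators_GL[OF two]])
  hence "subgroup (EUm_rel r J) ?G"
    using GL.subgroup_incl[OF _ SUm_rel_subgroup[OF J]] EUm_rel_subset[OF two J] by blast
  moreover have "a \<otimes>\<^bsub>?G\<^esub> h \<otimes>\<^bsub>?G\<^esub> inv\<^bsub>?G\<^esub> a \<in> EUm_rel r J" if a: "a \<in> carrier ?G" and h: "h \<in> EUm_rel r J" for a h
  proof -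
    have aS: "a \<in> SUm r" using a by (simp add: SUm_rel_eq)
    obtain W W' where W: "spin W W'" "lft r a W" "lft r (inv\<^bsub>GL (2 ^ r)\<^esub> a) W'" using SUm_lift[OF aS] by blast
    obtain V where V: "V \<in> cl.Erel J" "lft r h V" using h EUm_rel_iff[OF two J] by blast
    have "W * V * W' \<in> cl.Erel J" by (rule cl.Erel_normal[OF J' spin_orth[OF W(1)] V(1)])
    moreover have "lft r (a * h * inv\<^bsub>GL (2 ^ r)\<^esub> a) (W * V * W')" using W V by (intro lft_mult)
    ultimately have "a * h * inv\<^bsub>GL (2 ^ r)\<^esub> a \<in> EUm_rel r J" using EUm_rel_iff[OF two J] by blast
    thus ?thesis using GL.m_inv_consistent[OF SUm_rel_subgroup[OF J], of a] a by simp
  qed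
  ultimately show ?thesis unfolding S.normal_inv_iff by blast
qed

lemma SUm_rel_lift:
  assumes J: "is_ideal J" and a: "a \<in> SUm_rel r J"
  shows "\<exists>W W' c. spin W W' \<and> lft r a W \<and> lft r (inv\<^bsub>GL (2 ^ r)\<^esub> a) W' \<and> c * c - 1 \<in> J \<and>
    (\<forall>k\<in>cl.K. W * zc r k * W' - smr c (zc r k) \<in> cl.Vec J)"
proof -
  have aS: "a \<in> SUm r" "mcong J a (1\<^sub>m (2 ^ r))" using a by (simp_all add: SUm_rel_eq)
  obtain W W' where W: "spin W W'" "lft r a W" "lft r (inv\<^bsub>GL (2 ^ r)\<^esub> a) W'" using SUm_lift[OF aS(1)] by blast
  have "inv\<^bsub>GL (2 ^ r)\<^esub> a * a = 1\<^sub>m (2 ^ r)" using group.l_inv[OF GL_group SUm_GL[OF aS(1)]] by simp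
  from congruent_acts_by_scalar[OF J spin_orth[OF W(1)] W(2,3) aS(2) this] W show ?thesis by blast
qed

lemma SUm_rel_quotient_comm:
  fixes I :: "'a::comm_ring_1 set"
  assumes loc: "local_ring TYPE('a)" and two: "(2::'a) dvd 1" and I: "is_ideal I"
  shows "comm_group ((GL (2 ^ r))\<lparr>carrier := SUm_rel r (poly_ideal I)\<rparr> Mod EUm_rel r (poly_ideal I))"
proof -
  let ?J = "poly_ideal I"
  let ?G = "(GL (2 ^ r))\<lparr>carrier := SUm_rel r ?J\<rparr>"
  have J: "is_ideal ?J" using idl_poly_ideal[of I] I by (simp add: idl_iff)
  obtain d :: 'a where "1 = 2 * d" using two by (blast elim: dvdE)
  hence "(1 :: 'a poly) = 2 * [:d:]" by (simp add: one_pCons numeral_poly mult.commute)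
  hence two': "(2 :: 'a poly) dvd 1" by (rule dvdI)
  show ?thesis
  proof (rule group.quotient_comm_group[OF GL.subgroup_imp_group[OF SUm_rel_subgroup[OF J]] EUm_rel_normal[OF two' J]])
    fix a b assume ab: "a \<in> carrier ?G" "b \<in> carrier ?G"
    obtain A A' c where A: "spin A A'" "lft r a A" "lft r (inv\<^bsub>GL (2 ^ r)\<^esub> a) A'" "c * c - 1 \<in> ?J"
      "\<And>k. k \<in> cl.K \<Longrightarrow> A * zc r k * A' - smr c (zc r k) \<in> cl.Vec ?J"
      using SUm_rel_lift[OF J, of a] ab by auto
    obtain B B' c' where B: "spin B B'" "lft r b B" "lft r (inv\<^bsub>GL (2 ^ r)\<^esub> b) B'" "c' * c' - 1 \<in> ?J"
      "\<And>k. k \<in> cl.K \<Longrightarrow> B * zc r k * B' - smr c' (zc r k) \<in> cl.Vec ?J"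
      using SUm_rel_lift[OF J, of b] ab by auto
    have "A * B * A' * B' \<in> cl.Erel ?J"
      by (rule spin_commutator[OF loc I A(1) scalar_action_tame[OF I two spin_orth[OF A(1)] A(4,5)] B(1,4,5)])
    moreover have "lft r (a * b * inv\<^bsub>GL (2 ^ r)\<^esub> a * inv\<^bsub>GL (2 ^ r)\<^esub> b) (A * B * A' * B')"
      by (intro lft_mult A(2,3) B(2,3))
    ultimately have "a * b * inv\<^bsub>GL (2 ^ r)\<^esub> a * inv\<^bsub>GL (2 ^ r)\<^esub> b \<in> EUm_rel r ?J" using EUm_rel_iff[OF two' J] by blast
    thus "a \<otimes>\<^bsub>?G\<^esub> b \<otimes>\<^bsub>?G\<^esub> inv\<^bsub>?G\<^esub> a \<otimes>\<^bsub>?G\<^esub> inv\<^bsub>?G\<^esub> b \<in> EUm_rel r ?J"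
      using GL.m_inv_consistent[OF SUm_rel_subgroup[OF J]] ab by simp
  qed
qed

end

theorem theorem5p5:
  fixes I :: "'a::comm_ring_1 set" and r :: nat
  assumes "local_ring TYPE('a)"
    and "(2::'a) dvd 1"
    and "ideal I (class_ring :: 'a ring)"
    and "r \<ge> 2"
  shows "comm_group
    ((GL (2 ^ r))\<lparr>carrier := SUm_rel r (extended_ideal I)\<rparr> Mod EUm_rel r (extended_ideal I))"
proof -
  interpret suslin_rank r by unfold_locales (rule assms(4))
  have "is_ideal I" using assms(3) by (simp add: ideal_class_ring_iff)
  thus ?thesis using SUm_rel_quotient_comm[OF assms(1,2)] by (simp add: extended_ideal_eq)
qed

end
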